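(* Let $X$ be a Banach space and let $\Gamma:[0,1]\to cwk(X)$ be a variationally Henstock integrable multifunction. If $\mathcal{S}_{vH}(\Gamma)\neq\emptyset$ (this is fulfilled in case $X$ possesses the Radon–Nikodým property), then the following conditions are equivalent: (a) $\mathcal{S}_{vH}(\Gamma)\subset\mathcal{S}_{MS}(\Gamma)$; (b) $\mathcal{S}_{vH}(\Gamma)\subset\mathcal{S}_{P}(\Gamma)$; (c) $\mathcal{S}_{P}(\Gamma)\neq\emptyset$; (d) $\Gamma$ is Pettis integrable; (e) $\Gamma$ is McShane integrable.
   Context: $[0,1]$ carries Lebesgue measure $\lambda$; $\mathcal{L}$ is the family of Lebesgue measurable subsets, $\mathcal{I}$ the family of all closed subintervals of $[0,1]$, $|I|$ the length of $I$. $cwk(X)$ is the family of all non-empty convex weakly compact subsets of $X$, with Minkowski addition, multiplication by scalars, and the Hausdorff distance $d_H$. For $C\in cwk(X)$ and $x^*\in X^*$, $s(x^*,C)=\sup\{\langle x^*,x\rangle:x\in C\}$. A function $f:[0,1]\to X$ is a selection of $\Gamma$ if $f(t)\in\Gamma(t)$ for every $t$; it is scalarly measurable if $x^*f$ is measurable for every $x^*\in X^*$. A gauge is a function $\delta:[0,1]\to(0,\infty)$. A partition of $[0,1]$ is a finite collection $\{(I_1,t_1),\dots,(I_p,t_p)\}$ of non-overlapping closed subintervals with union $[0,1]$ and points $t_i\in[0,1]$; it is a Perron partition if $t_i\in I_i$ for all $i$; it is $\delta$-fine if $I_i\subset(t_i-\delta(t_i),t_i+\delta(t_i))$ for all $i$.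 $\Gamma:[0,1]\to cwk(X)$ is McShane integrable if there is a non-empty closed convex set $\Phi\subset X$ such that for every $\varepsilon>0$ there is a gauge $\delta$ with $d_H(\Phi,\sum_{i=1}^p\Gamma(t_i)|I_i|)<\varepsilon$ for every $\delta$-fine partition of $[0,1]$ (then automatically $\Phi\in cwk(X)$). $\Gamma$ is variationally Henstock integrable if there is a finitely additive $\Phi_\Gamma:\mathcal{I}\to cwk(X)$ such that for every $\varepsilon>0$ there is a gauge $\delta$ with $\sum_{j=1}^p d_H(\Phi_\Gamma(I_j),\Gamma(t_j)|I_j|)<\varepsilon$ for every $\delta$-fine Perron partition of $[0,1]$. For functions $f:[0,1]\to X$ the same definitions are used with $f$ identified with $t\mapsto\{f(t)\}$ and integrals/primitives taking values in $X$. $\Gamma$ is Pettis integrable (in $cwk(X)$) if $s(x^*,\Gamma(\cdot))$ is Lebesgue integrable for every $x^*\in X^*$ and for every $E\in\mathcal{L}$ there is $M_\Gamma(E)\in cwk(X)$ with $s(x^*,M_\Gamma(E))=\int_E s(x^*,\Gamma(t))\,dt$ for all $x^*\in X^*$. $\mathcal{S}_{vH}(\Gamma)$, $\mathcal{S}_{MS}(\Gamma)$, $\mathcal{S}_{P}(\Gamma)$ denote the families of all scalarly measurable selections of $\Gamma$ that are, respectively, variationally Henstock, McShane, Pettis integrable. *)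

theory Defs
  imports "HOL-Analysis.Analysis"
begin

section \<open>Weakly compact convex sets\<close>

text \<open>The dual of \<open>'a\<close> is the type \<open>'a \<Rightarrow>\<^sub>L real\<close> of bounded linear functionals.\<close>

definition weak_topology :: "'a::real_normed_vector topology" where
  "weak_topology =
     topology_generated_by {blinfun_apply f -` U | (f :: 'a \<Rightarrow>\<^sub>L real) U. open U}"

definition cwk :: "'a::real_normed_vector set set" where
  "cwk = {C. C \<noteq> {} \<and> convex C \<and> compactin weak_topology C}"

definition support_fun :: "('a::real_normed_vector \<Rightarrow>\<^sub>L real) \<Rightarrow> 'a set \<Rightarrow> real" where
  "support_fun x' C = (SUP x\<in>C. blinfun_apply x' x)"

text \<open>The Hausdorff distance is \<open>ennreal\<close>-valued, so that it is \<open>\<infinity>\<close> between a bounded and an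
  unbounded set. This matters in \<open>has_mcshane_integral\<close> below, where the integral is not assumed
  to be bounded. It is used for non-empty sets only.\<close>

definition hausdorff_distance :: "'a::metric_space set \<Rightarrow> 'a set \<Rightarrow> ennreal" where
  "hausdorff_distance A B =
     max (SUP a\<in>A. ennreal (infdist a B)) (SUP b\<in>B. ennreal (infdist b A))"

lemma hausdorff_distance_singletons: "hausdorff_distance {x} {y} = ennreal (dist x y)"
  by (simp add: hausdorff_distance_def dist_commute)


section \<open>Partitions of the unit interval\<close>

text \<open>The intervals may be degenerate; such intervals have length zero, and additivity forces an
  interval function to be \<open>{0}\<close> on them.\<close>

definition subintervals :: "real set set" where
  "subintervals = {{a..b} | a b. 0 \<le> a \<and> a \<le> b \<and> b \<le> 1}"

text \<open>Partitions as sets of pairs (tag, interval), as in \<open>tagged_division_of\<close>, but with tags that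
  need not belong to the respective interval.\<close>

definition free_partition :: "(real \<times> real set) set \<Rightarrow> bool" where
  "free_partition p \<longleftrightarrow>
     finite p \<and>
     (\<forall>(t, I) \<in> p. t \<in> {0..1} \<and> I \<in> subintervals) \<and>
     (\<forall>(t, I) \<in> p. \<forall>(u, J) \<in> p. (t, I) \<noteq> (u, J) \<longrightarrow> interior I \<inter> interior J = {}) \<and>
     (\<Union>(t, I) \<in> p. I) = {0..1}"

text \<open>Perron partitions are exactly the tagged divisions of the library.\<close>

lemma perron_partition_iff:
  "p tagged_division_of {0..1::real} \<longleftrightarrow> free_partition p \<and> (\<forall>(t, I) \<in> p. t \<in> I)"
proof -
  have "(t \<in> I \<and> I \<subseteq> {0..1} \<and> (\<exists>a b. I = cbox a b)) \<longleftrightarrow>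
      (t \<in> {0..1} \<and> I \<in> subintervals) \<and> t \<in> I" for t :: real and I
  proof
    assume I: "t \<in> I \<and> I \<subseteq> {0..1} \<and> (\<exists>a b. I = cbox a b)"
    then obtain a b where ab: "I = {a..b}"
      by (auto simp: cbox_interval)
    with I have "0 \<le> a" "a \<le> b" "b \<le> 1"
      by auto
    with I ab show "(t \<in> {0..1} \<and> I \<in> subintervals) \<and> t \<in> I"
      unfolding subintervals_def by blast
  next
    assume I: "(t \<in> {0..1} \<and> I \<in> subintervals) \<and> t \<in> I"
    then obtain a b where "I = cbox a b" "0 \<le> a" "b \<le> 1"
      by (auto simp: subintervals_def cbox_interval)
    with I show "t \<in> I \<and> I \<subseteq> {0..1} \<and> (\<exists>a b. I = cbox a b)"
      by auto
  qed
  then have "(\<forall>t I. (t, I) \<in> p \<longrightarrow> t \<in> I \<and> I \<subseteq> {0..1} \<and> (\<exists>a b. I = cbox a b)) \<longleftrightarrow>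
      (\<forall>(t, I) \<in> p. t \<in> {0..1} \<and> I \<in> subintervals) \<and> (\<forall>(t, I) \<in> p. t \<in> I)"
    by (simp only: split_beta Ball_def split_paired_All fst_conv snd_conv) iprover
  moreover have "(\<Union>(t, I) \<in> p. I) = \<Union>{K. \<exists>x. (x, K) \<in> p}"
    by auto
  moreover have "(\<forall>x1 K1 x2 K2. (x1, K1) \<in> p \<and> (x2, K2) \<in> p \<and> (x1, K1) \<noteq> (x2, K2) \<longrightarrow>
        interior K1 \<inter> interior K2 = {}) \<longleftrightarrow>
      (\<forall>(t, I) \<in> p. \<forall>(u, J) \<in> p. (t, I) \<noteq> (u, J) \<longrightarrow> interior I \<inter> interior J = {})"
    by (simp only: split_beta Ball_def split_paired_All fst_conv snd_conv) iprover
  ultimately show ?thesis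
    by (simp only: free_partition_def tagged_division_of) iprover
qed

definition gauge_fun :: "(real \<Rightarrow> real) \<Rightarrow> bool" where
  "gauge_fun \<delta> \<longleftrightarrow> (\<forall>t\<in>{0..1}. 0 < \<delta> t)"

definition delta_fine :: "(real \<Rightarrow> real) \<Rightarrow> (real \<times> real set) set \<Rightarrow> bool" where
  "delta_fine \<delta> p \<longleftrightarrow> (\<lambda>t. {t - \<delta> t <..< t + \<delta> t}) fine p"


section \<open>Integrals of multifunctions\<close>

text \<open>Sums of sets are Minkowski sums (\<open>HOL-Library.Set_Algebras\<close>).\<close>

definition has_mcshane_integral :: "(real \<Rightarrow> 'a::real_normed_vector set) \<Rightarrow> 'a set \<Rightarrow> bool" where
  "has_mcshane_integral \<Gamma> \<Phi> \<longleftrightarrow>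
     \<Phi> \<noteq> {} \<and> closed \<Phi> \<and> convex \<Phi> \<and>
     (\<forall>\<epsilon>>0. \<exists>\<delta>. gauge_fun \<delta> \<and>
        (\<forall>p. free_partition p \<and> delta_fine \<delta> p \<longrightarrow>
           hausdorff_distance \<Phi> (\<Sum>(t, I) \<in> p. (*\<^sub>R) (measure lborel I) ` \<Gamma> t) < ennreal \<epsilon>))"

definition mcshane_integrable :: "(real \<Rightarrow> 'a::real_normed_vector set) \<Rightarrow> bool" where
  "mcshane_integrable \<Gamma> \<longleftrightarrow> (\<exists>\<Phi>. has_mcshane_integral \<Gamma> \<Phi>)"

definition additive_interval_fun :: "(real set \<Rightarrow> 'a::real_normed_vector set) \<Rightarrow> bool" where
  "additive_interval_fun \<Phi> \<longleftrightarrow>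
     (\<forall>I\<in>subintervals. \<forall>J\<in>subintervals.
        interior I \<inter> interior J = {} \<and> I \<union> J \<in> subintervals \<longrightarrow> \<Phi> (I \<union> J) = \<Phi> I + \<Phi> J)"

definition has_vH_primitive ::
  "(real \<Rightarrow> 'a::real_normed_vector set) \<Rightarrow> (real set \<Rightarrow> 'a set) \<Rightarrow> bool" where
  "has_vH_primitive \<Gamma> \<Phi> \<longleftrightarrow>
     (\<forall>I\<in>subintervals. \<Phi> I \<in> cwk) \<and> additive_interval_fun \<Phi> \<and>
     (\<forall>\<epsilon>>0. \<exists>\<delta>. gauge_fun \<delta> \<and>
        (\<forall>p. p tagged_division_of {0..1} \<and> delta_fine \<delta> p \<longrightarrow>
           (\<Sum>(t, I) \<in> p. hausdorff_distance (\<Phi> I) ((*\<^sub>R) (measure lborel I) ` \<Gamma> t)) < ennreal \<epsilon>))"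

definition vH_integrable :: "(real \<Rightarrow> 'a::real_normed_vector set) \<Rightarrow> bool" where
  "vH_integrable \<Gamma> \<longleftrightarrow> (\<exists>\<Phi>. has_vH_primitive \<Gamma> \<Phi>)"

definition has_pettis_integral ::
  "(real \<Rightarrow> 'a::real_normed_vector set) \<Rightarrow> (real set \<Rightarrow> 'a set) \<Rightarrow> bool" where
  "has_pettis_integral \<Gamma> M \<longleftrightarrow>
     (\<forall>x'. integrable (lebesgue_on {0..1}) (\<lambda>t. support_fun x' (\<Gamma> t))) \<and>
     (\<forall>E. E \<in> sets lebesgue \<and> E \<subseteq> {0..1} \<longrightarrow>
        M E \<in> cwk \<and>
        (\<forall>x'. support_fun x' (M E) = (LINT t|lebesgue_on E. support_fun x' (\<Gamma> t))))"

definition pettis_integrable :: "(real \<Rightarrow> 'a::real_normed_vector set) \<Rightarrow> bool" where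
  "pettis_integrable \<Gamma> \<longleftrightarrow> (\<exists>M. has_pettis_integral \<Gamma> M)"


section \<open>Integrals of functions and selections\<close>

text \<open>A function \<open>f\<close> is identified with the multifunction \<open>\<lambda>t. {f t}\<close>; its integrals and primitives
  are required to be singletons.\<close>

definition mcshane_integrable_fun :: "(real \<Rightarrow> 'a::real_normed_vector) \<Rightarrow> bool" where
  "mcshane_integrable_fun f \<longleftrightarrow> (\<exists>x. has_mcshane_integral (\<lambda>t. {f t}) {x})"

definition vH_integrable_fun :: "(real \<Rightarrow> 'a::real_normed_vector) \<Rightarrow> bool" where
  "vH_integrable_fun f \<longleftrightarrow> (\<exists>F. has_vH_primitive (\<lambda>t. {f t}) (\<lambda>I. {F I}))"

definition pettis_integrable_fun :: "(real \<Rightarrow> 'a::real_normed_vector) \<Rightarrow> bool" where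
  "pettis_integrable_fun f \<longleftrightarrow> (\<exists>m. has_pettis_integral (\<lambda>t. {f t}) (\<lambda>E. {m E}))"

definition scalarly_measurable :: "(real \<Rightarrow> 'a::real_normed_vector) \<Rightarrow> bool" where
  "scalarly_measurable f \<longleftrightarrow>
     (\<forall>x' :: 'a \<Rightarrow>\<^sub>L real. (\<lambda>t. blinfun_apply x' (f t)) \<in> borel_measurable (lebesgue_on {0..1}))"

definition measurable_selections ::
  "(real \<Rightarrow> 'a::real_normed_vector set) \<Rightarrow> (real \<Rightarrow> 'a) set" where
  "measurable_selections \<Gamma> = {f. (\<forall>t\<in>{0..1}. f t \<in> \<Gamma> t) \<and> scalarly_measurable f}"

definition S_vH :: "(real \<Rightarrow> 'a::real_normed_vector set) \<Rightarrow> (real \<Rightarrow> 'a) set" where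
  "S_vH \<Gamma> = {f \<in> measurable_selections \<Gamma>. vH_integrable_fun f}"

definition S_MS :: "(real \<Rightarrow> 'a::real_normed_vector set) \<Rightarrow> (real \<Rightarrow> 'a) set" where
  "S_MS \<Gamma> = {f \<in> measurable_selections \<Gamma>. mcshane_integrable_fun f}"

definition S_P :: "(real \<Rightarrow> 'a::real_normed_vector set) \<Rightarrow> (real \<Rightarrow> 'a) set" where
  "S_P \<Gamma> = {f \<in> measurable_selections \<Gamma>. pettis_integrable_fun f}"


section \<open>The Radon--Nikodym property\<close>

text \<open>This repeats the library's \<open>has_bochner_integral\<close> without its restriction to second
  countable spaces. The approximation by simple functions makes \<open>f\<close> strongly measurable.\<close>

definition has_bochner_integral_gen ::
  "'m measure \<Rightarrow> ('m \<Rightarrow> 'a::real_normed_vector) \<Rightarrow> 'a \<Rightarrow> bool" where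
  "has_bochner_integral_gen M f x \<longleftrightarrow>
     f \<in> borel_measurable M \<and>
     (\<exists>s. (\<forall>i. Bochner_Integration.simple_bochner_integrable M (s i)) \<and>
          (\<lambda>i. \<integral>\<^sup>+ t. ennreal (norm (f t - s i t)) \<partial>M) \<longlonglongrightarrow> 0 \<and>
          (\<lambda>i. Bochner_Integration.simple_bochner_integral M (s i)) \<longlonglongrightarrow> x)"

definition vector_measure :: "'m measure \<Rightarrow> ('m set \<Rightarrow> 'a::real_normed_vector) \<Rightarrow> bool" where
  "vector_measure M \<nu> \<longleftrightarrow>
     (\<forall>A :: nat \<Rightarrow> 'm set. range A \<subseteq> sets M \<and> disjoint_family A \<longrightarrow>
        (\<lambda>n. \<nu> (A n)) sums \<nu> (\<Union>n. A n))"

definition finite_variation :: "'m measure \<Rightarrow> ('m set \<Rightarrow> 'a::real_normed_vector) \<Rightarrow> bool" where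
  "finite_variation M \<nu> \<longleftrightarrow>
     (\<exists>K. \<forall>P. finite P \<and> P \<subseteq> sets M \<and> disjoint P \<longrightarrow> (\<Sum>A\<in>P. norm (\<nu> A)) \<le> K)"

text \<open>Every vector measure of finite variation that is absolutely continuous with respect to a
  finite measure has a Bochner integrable density. HOL cannot quantify over the type carrying the
  measure space inside a definition, so the measure spaces range over all \<open>\<sigma>\<close>-algebras and finite
  measures on sets of reals (including Lebesgue measure on the unit interval).\<close>

definition radon_nikodym_property :: "'a::banach itself \<Rightarrow> bool" where
  "radon_nikodym_property _ \<longleftrightarrow>
     (\<forall>(M :: real measure) (\<nu> :: real set \<Rightarrow> 'a).
        finite_measure M \<and> vector_measure M \<nu> \<and> finite_variation M \<nu> \<and>
        (\<forall>A\<in>sets M. emeasure M A = 0 \<longrightarrow> \<nu> A = 0) \<longrightarrow>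
        (\<exists>g. \<forall>A\<in>sets M. has_bochner_integral_gen M (\<lambda>t. indicator A t *\<^sub>R g t) (\<nu> A)))"

end

theory Submission
  imports Defs
begin

text \<open>
  Every scalar statement is made uniform over the unit ball of the dual: by the Hahn--Banach theorem
  the Hausdorff distance of two sets in \<open>cwk\<close> is the supremum of the differences of their support
  functions.  A variationally Henstock and Pettis integrable multifunction is McShane integrable,
  because the unit interval splits into countably many measurable sets on each of which the support
  functions are, uniformly in the functional, nearly constant, while the Orlicz--Pettis theorem makes
  the support functions uniformly integrable.  Conversely, McShane integrability yields uniform
  integrability, and then a selection with representable integrals over intervals is Pettis
  integrable by a Dynkin system argument.  Given a Pettis integrable selection \<open>g\<close>, the functions
  \<open>support_fun f (\<Gamma> t) - f (g t)\<close> are non-negative, so their integrals over a measurable set are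
  dominated by the support function of a translate of the primitive; a sublinear functional so
  dominated is itself the support function of a set in \<open>cwk\<close>, hence \<open>\<Gamma>\<close> is Pettis integrable.

  Under the Radon--Nikodym property, a selection of the primitive is an additive interval function
  \<open>F\<close>, found by Tychonoff's theorem.  The unit interval is, up to a null set, the union of the sets
  of points at which \<open>F\<close> satisfies a Lipschitz estimate with constant \<open>n\<close>; there \<open>F\<close> agrees with a
  Lipschitz function, so it is differentiable almost everywhere, and its derivative, corrected on a
  null set, is the required selection.
\<close>

section \<open>Sublinear functionals\<close>

text \<open>Neither \<open>'a\<close> nor its dual need be separable, so estimates cannot be
  collected over a countable norming set of functionals. Two devices replace separability. First,
  vectors and sets are recovered from the dual: a linear functional on the dual that lies below the
  support function of a set in \<open>cwk\<close> is evaluation at a point of that set, so producing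
  a vector or a set amounts to proving a linear or sublinear inequality between scalar integrals.
  Second, the variational form of the integral bounds the errors of all functionals of norm at most
  1 by a single interval function, which is small compared with the length outside one null set.
  Dyadic difference quotients depend on \<open>t\<close> only through an integer index, whatever the
  functional, which settles measurability. The obstacle is conditional convergence: Henstock
  integrals need not be absolute, and Pettis or McShane integrability serves to exclude this
  uniformly in the functional. The equivalence of (a) and (b) comes from treating a selection
  \<open>g\<close> as the multifunction with values \<open>{g t}\<close>.\<close>

definition sublinear :: "('v::real_vector \<Rightarrow> real) \<Rightarrow> bool" where
  "sublinear p \<longleftrightarrow> (\<forall>x y. p (x + y) \<le> p x + p y) \<and> (\<forall>c x. 0 < c \<longrightarrow> p (c *\<^sub>R x) \<le> c * p x)"

lemma sublinearI:
  assumes "\<And>x y. p (x + y) \<le> p x + p y" "\<And>c x. 0 < c \<Longrightarrow> p (c *\<^sub>R x) \<le> c * p x"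
  shows "sublinear p"
  using assms by (simp add: sublinear_def)

lemma sublinear_add: "sublinear p \<Longrightarrow> p (x + y) \<le> p x + p y"
  by (simp add: sublinear_def)

text \<open>The inequality in the definition is used for \<open>c\<close> and for
  \<open>inverse c\<close>; the case \<open>c = 0\<close> needs \<open>p 0 = 0\<close>, which comes
  from \<open>p 0 = 2 * p 0\<close>.\<close>

lemma sublinear_scale:
  assumes "sublinear p" "0 \<le> c"
  shows "p (c *\<^sub>R x) = c * p x"
proof -
  have le: "p (c *\<^sub>R x) \<le> c * p x" if "0 < c" for c x
    using assms that by (simp add: sublinear_def)
  have eq: "p (c *\<^sub>R x) = c * p x" if "0 < c" for c x
  proof (rule antisym[OF le[OF that]])
    have "p (inverse c *\<^sub>R (c *\<^sub>R x)) \<le> inverse c * p (c *\<^sub>R x)"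
      using that by (intro le) simp
    with that show "c * p x \<le> p (c *\<^sub>R x)"
      by (simp add: field_simps)
  qed
  have "p 0 = 0"
    using eq[of 2 0] by simp
  with eq assms(2) show ?thesis
    by (cases "c = 0") auto
qed

lemma sublinear_zero: "sublinear p \<Longrightarrow> p 0 = 0"
  using sublinear_scale[of p 0 0] by simp

lemma sublinear_minus: "sublinear p \<Longrightarrow> - p (- x) \<le> p x"
  using sublinear_add[of p x "- x"] sublinear_zero[of p] by simp

lemma sublinear_norm: "sublinear norm"
  by (simp add: sublinear_def norm_triangle_ineq)

text \<open>The witness is the infimum of \<open>p (x + l *\<^sub>R z) - l * d\<close> over
  \<open>l \<ge> 0\<close> and \<open>z \<in> Z\<close>. Any sublinear minorant of \<open>p\<close>
  that is at most \<open>- d\<close> on \<open>- Z\<close> lies below it, so it is the largest one.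
  The assumption \<open>d \<le> p z\<close> keeps the infimum finite, and convexity of
  \<open>Z\<close> makes the vectors \<open>l *\<^sub>R z\<close> closed under addition.\<close>

lemma sublinear_descend:
  fixes p :: "'v::real_vector \<Rightarrow> real"
  assumes p: "sublinear p" and Z: "convex Z" "Z \<noteq> {}" and d: "\<And>z. z \<in> Z \<Longrightarrow> d \<le> p z"
  obtains q where "sublinear q" "\<And>x. q x \<le> p x" "\<And>z. z \<in> Z \<Longrightarrow> q (- z) \<le> - d"
proof -
  define A where "A = {0::real..} \<times> Z"
  define g where "g x lz = p (x + fst lz *\<^sub>R snd lz) - fst lz * d" for x lz
  define q where "q x = (INF lz\<in>A. g x lz)" for x
  have A: "A \<noteq> {}"
    using Z by (auto simp: A_def)
  have lower: "- p (- x) \<le> g x lz" if lzA: "lz \<in> A" for x lz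
  proof -
    obtain l z where lz: "lz = (l, z)" "0 \<le> l" "z \<in> Z"
      using lzA by (auto simp: A_def)
    have "l * d \<le> p (l *\<^sub>R z)"
      using d[OF lz(3)] lz(2) sublinear_scale[OF p lz(2)] by (simp add: mult_left_mono)
    also have "\<dots> \<le> p (x + l *\<^sub>R z) + p (- x)"
      using sublinear_add[OF p, of "x + l *\<^sub>R z" "- x"] by simp
    finally show ?thesis
      by (simp add: g_def lz)
  qed
  then have bdd: "bdd_below (g x ` A)" for x
    by (auto intro!: bdd_belowI2)
  have q_le: "q x \<le> g x lz" if "lz \<in> A" for x lz
    unfolding q_def by (rule cINF_lower[OF bdd that])
  have le_q: "b \<le> q x" if "\<And>lz. lz \<in> A \<Longrightarrow> b \<le> g x lz" for x b
    unfolding q_def using A that by (rule cINF_greatest)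
  show thesis
  proof
    show "sublinear q"
    proof (rule sublinearI)
      fix x y
      have "q (x + y) \<le> g x a + g y b" if abA: "a \<in> A" "b \<in> A" for a b
      proof -
        obtain l z m w where a: "a = (l, z)" "0 \<le> l" "z \<in> Z" and b: "b = (m, w)" "0 \<le> m" "w \<in> Z"
          using abA unfolding A_def by blast
        \<comment> \<open>The two multiples are merged into one multiple of a convex combination of
          \<open>z\<close> and \<open>w\<close>; if both weights vanish, any point of
          \<open>Z\<close> does.\<close>
        obtain v where v: "v \<in> Z" "(l + m) *\<^sub>R v = l *\<^sub>R z + m *\<^sub>R w"
        proof (cases "l + m = 0")
          case True
          with a b have "l = 0" "m = 0" by auto
          with that[of z] a show ?thesis by simp
        next
          case False
          have "(l / (l + m)) *\<^sub>R z + (m / (l + m)) *\<^sub>R w \<in> Z"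
            using a b False by (intro convexD[OF Z(1)]) (auto simp: add_divide_distrib[symmetric])
          moreover have "(l + m) *\<^sub>R ((l / (l + m)) *\<^sub>R z + (m / (l + m)) *\<^sub>R w) = l *\<^sub>R z + m *\<^sub>R w"
            using False by (simp add: scaleR_right_distrib)
          ultimately show ?thesis using that by blast
        qed
        have "q (x + y) \<le> g (x + y) (l + m, v)"
          using a b v by (intro q_le) (simp add: A_def)
        also have "\<dots> = p ((x + l *\<^sub>R z) + (y + m *\<^sub>R w)) - (l + m) * d"
          using v by (simp add: g_def algebra_simps)
        also have "\<dots> \<le> g x a + g y b"
          using sublinear_add[OF p, of "x + l *\<^sub>R z" "y + m *\<^sub>R w"] by (simp add: g_def a b algebra_simps)
        finally show ?thesis .
      qed
      then have "q (x + y) - g x a \<le> q y" if "a \<in> A" for a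
        using that by (intro le_q) (simp add: diff_le_eq add.commute)
      then have "q (x + y) - q y \<le> q x"
        by (intro le_q) (simp add: algebra_simps)
      then show "q (x + y) \<le> q x + q y" by simp
    next
      fix c :: real and x assume c: "0 < c"
      have "q (c *\<^sub>R x) / c \<le> g x a" if "a \<in> A" for a
      proof -
        have "q (c *\<^sub>R x) \<le> g (c *\<^sub>R x) (c * fst a, snd a)"
          using that c by (intro q_le) (auto simp: A_def)
        also have "\<dots> = p (c *\<^sub>R (x + fst a *\<^sub>R snd a)) - c * (fst a * d)"
          by (simp add: g_def scaleR_right_distrib)
        also have "\<dots> = c * g x a"
          using sublinear_scale[OF p, of c "x + fst a *\<^sub>R snd a"] c
          by (simp add: g_def right_diff_distrib del: scaleR_add_right)
        finally show ?thesis
          using c by (simp add: field_simps)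
      qed
      then have "q (c *\<^sub>R x) / c \<le> q x"
        by (rule le_q)
      with c show "q (c *\<^sub>R x) \<le> c * q x"
        by (simp add: field_simps)
    qed
    show "q x \<le> p x" for x
    proof -
      obtain z where "z \<in> Z" using Z by auto
      then show ?thesis
        using q_le[of "(0, z)" x] by (simp add: A_def g_def)
    qed
    show "q (- z) \<le> - d" if "z \<in> Z" for z
      using q_le[of "(1, z)" "- z"] that sublinear_zero[OF p] by (simp add: A_def g_def)
  qed
qed

text \<open>A minimal sublinear functional is linear, so no extension of functionals from subspaces
  is needed.\<close>

lemma sublinear_dominates_linear:
  fixes p :: "'v::real_vector \<Rightarrow> real"
  assumes "sublinear p"
  obtains f where "linear f" "\<And>x. f x \<le> p x"
proof -
  define A where "A = {q :: 'v \<Rightarrow> real. sublinear q \<and> q \<le> p}"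
  have "\<exists>m\<in>A. \<forall>a\<in>A. a \<le> m \<longrightarrow> a = m"
  proof (rule predicate_Zorn)
    show "partial_order_on A (relation_of (\<lambda>a b. b \<le> a) A)"
      by (auto simp: partial_order_on_def preorder_on_def refl_on_def trans_def antisym_def relation_of_def)
  next
    fix C assume C: "C \<in> Chains (relation_of (\<lambda>a b. b \<le> a) A)"
    show "\<exists>u\<in>A. \<forall>a\<in>C. u \<le> a"
    proof (cases "C = {}")
      case True
      then show ?thesis using assms by (auto simp: A_def)
    next
      case False
      have CA: "a \<in> A" if "a \<in> C" for a
        using C that by (auto simp: Chains_def relation_of_def)
      have tot: "a \<le> b \<or> b \<le> a" if "a \<in> C" "b \<in> C" for a b
        using C that by (auto simp: Chains_def relation_of_def)
      have sub: "sublinear a" "a x \<le> p x" if "a \<in> C" for a x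
        using CA[OF that] by (auto simp: A_def le_fun_def)
      define u where "u x = (INF a\<in>C. a x)" for x
      have "- p (- x) \<le> a x" if "a \<in> C" for a x
        using sublinear_minus[OF sub(1)[OF that], of x] sub(2)[OF that, of "- x"] by simp
      then have bdd: "bdd_below ((\<lambda>a. a x) ` C)" for x
        by (auto intro!: bdd_belowI2)
      have u_le: "u x \<le> a x" if "a \<in> C" for a x
        unfolding u_def by (rule cINF_lower[OF bdd that])
      have le_u: "b \<le> u x" if "\<And>a. a \<in> C \<Longrightarrow> b \<le> a x" for b x
        unfolding u_def using False that by (rule cINF_greatest)
      have "sublinear u"
      proof (rule sublinearI)
        fix x y
        have *: "u (x + y) \<le> a x + b y" if ab: "a \<in> C" "b \<in> C" for a b
        proof -
          \<comment> \<open>In a chain the smaller of \<open>a\<close> and \<open>b\<close> can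
            replace both, and it is itself subadditive.\<close>
          obtain m where m: "m \<in> C" "m \<le> a" "m \<le> b"
            using tot[OF ab] ab by auto
          have "u (x + y) \<le> m x + m y"
            using u_le[OF m(1)] sublinear_add[OF sub(1)[OF m(1)]] order_trans by blast
          also have "\<dots> \<le> a x + b y"
            using m by (simp add: le_fun_def add_mono)
          finally show ?thesis .
        qed
        have "u (x + y) - a x \<le> u y" if a: "a \<in> C" for a
        proof (rule le_u)
          show "u (x + y) - a x \<le> b y" if "b \<in> C" for b
            using *[OF a that] by simp
        qed
        then have "u (x + y) - u y \<le> u x"
          by (intro le_u) (simp add: algebra_simps)
        then show "u (x + y) \<le> u x + u y" by simp
      next
        fix c :: real and x assume c: "0 < c"
        have "u (c *\<^sub>R x) / c \<le> a x" if "a \<in> C" for a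
          using u_le[OF that, of "c *\<^sub>R x"] sublinear_scale[OF sub(1)[OF that], of c x] c
          by (simp add: field_simps)
        then have "u (c *\<^sub>R x) / c \<le> u x"
          by (rule le_u)
        with c show "u (c *\<^sub>R x) \<le> c * u x"
          by (simp add: field_simps)
      qed
      moreover have "u \<le> p"
      proof (rule le_funI)
        fix x
        obtain a where "a \<in> C" using False by blast
        then show "u x \<le> p x"
          using u_le[of a x] sub(2)[of a x] by simp
      qed
      ultimately show ?thesis
        using u_le by (auto simp: A_def le_fun_def)
    qed
  qed
  then obtain m where m: "sublinear m" "m \<le> p" and min: "\<And>a. sublinear a \<Longrightarrow> a \<le> p \<Longrightarrow> a \<le> m \<Longrightarrow> a = m"
    by (auto simp: A_def)
  \<comment> \<open>Descending along the single vector \<open>v\<close> with \<open>d = m v\<close>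
    cannot produce anything smaller than the minimal \<open>m\<close>, hence
    \<open>m (- v) \<le> - m v\<close>.\<close>
  have odd: "m (- v) = - m v" for v
  proof -
    obtain q where q: "sublinear q" "\<And>x. q x \<le> m x" "q (- v) \<le> - m v"
      using sublinear_descend[OF m(1), of "{v}" "m v"] by auto
    then have "q = m"
      using m(2) by (intro min) (auto simp: le_fun_def intro: order_trans)
    with q(3) sublinear_minus[OF m(1), of "- v"] show ?thesis by simp
  qed
  have "linear m"
  proof
    fix x y c
    have "m (- (x + y)) \<le> m (- x) + m (- y)"
      using sublinear_add[OF m(1), of "- x" "- y"] by simp
    then have "m x + m y \<le> m (x + y)"
      by (simp only: odd)
    with sublinear_add[OF m(1), of x y] show "m (x + y) = m x + m y"
      by simp
    show "m (c *\<^sub>R x) = c *\<^sub>R m x"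
    proof (cases "0 \<le> c")
      case True
      then show ?thesis using sublinear_scale[OF m(1)] by simp
    next
      case False
      then have "m ((- c) *\<^sub>R x) = (- c) * m x"
        by (intro sublinear_scale[OF m(1)]) simp
      then show ?thesis using odd[of "c *\<^sub>R x"] by simp
    qed
  qed
  with m(2) that show thesis
    by (auto simp: le_fun_def)
qed

text \<open>Any linear \<open>f\<close> below the descended functional \<open>q\<close> satisfies
  \<open>f z = - f (- z) \<ge> - q (- z) \<ge> d\<close>. This form of the Hahn-Banach theorem gives
  domination and separation at once.\<close>

lemma mazur_orlicz:
  fixes p :: "'v::real_vector \<Rightarrow> real"
  assumes "sublinear p" "convex Z" "Z \<noteq> {}" "\<And>z. z \<in> Z \<Longrightarrow> d \<le> p z"
  obtains f where "linear f" "\<And>x. f x \<le> p x" "\<And>z. z \<in> Z \<Longrightarrow> d \<le> f z"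
proof -
  obtain q where q: "sublinear q" "\<And>x. q x \<le> p x" "\<And>z. z \<in> Z \<Longrightarrow> q (- z) \<le> - d"
    using sublinear_descend[OF assms] by blast
  obtain f where f: "linear f" "\<And>x. f x \<le> q x"
    using sublinear_dominates_linear[OF q(1)] by blast
  have "d \<le> f z" if "z \<in> Z" for z
    using f(2)[of "- z"] q(3)[OF that] linear_neg[OF f(1), of z] by simp
  with f q(2) that show thesis
    by (meson order_trans)
qed

text \<open>Taking the norm as the sublinear functional makes the linear one bounded by 1:
  \<open>f \<le> norm\<close> at \<open>x\<close> and at \<open>- x\<close> bounds
  \<open>\<bar>f x\<bar>\<close>.\<close>

lemma separate_from_convex:
  fixes Z :: "'a::real_normed_vector set"
  assumes "convex Z" "Z \<noteq> {}" "\<And>z. z \<in> Z \<Longrightarrow> d \<le> norm z"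
  obtains x' :: "'a \<Rightarrow>\<^sub>L real" where "norm x' \<le> 1" "\<And>z. z \<in> Z \<Longrightarrow> d \<le> blinfun_apply x' z"
proof -
  obtain f :: "'a \<Rightarrow> real" where f: "linear f" "\<And>x. f x \<le> norm x" "\<And>z. z \<in> Z \<Longrightarrow> d \<le> f z"
    using mazur_orlicz[OF sublinear_norm assms] by blast
  have abs: "\<bar>f x\<bar> \<le> norm x" for x
    using f(2)[of x] f(2)[of "- x"] linear_neg[OF f(1), of x] by simp
  have bl: "bounded_linear f"
    using f(1) abs
    by (auto intro!: bounded_linear_intro[where K = 1] simp: linear_add linear_scale)
  show thesis
  proof
    show "norm (Blinfun f) \<le> 1"
      using abs by (intro norm_blinfun_bound) (auto simp: bounded_linear_Blinfun_apply[OF bl])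
    show "d \<le> blinfun_apply (Blinfun f) z" if "z \<in> Z" for z
      using f(3)[OF that] by (simp add: bounded_linear_Blinfun_apply[OF bl])
  qed
qed

lemma norming_functional:
  fixes x :: "'a::real_normed_vector"
  obtains x' :: "'a \<Rightarrow>\<^sub>L real" where "norm x' \<le> 1" "blinfun_apply x' x = norm x"
proof -
  obtain x' :: "'a \<Rightarrow>\<^sub>L real" where "norm x' \<le> 1" "norm x \<le> blinfun_apply x' x"
    using separate_from_convex[of "{x}" "norm x"] by auto
  moreover have "blinfun_apply x' x \<le> norm x' * norm x"
    using norm_blinfun[of x' x] by simp
  ultimately show thesis
    using that[of x'] mult_right_mono[of "norm x'" 1 "norm x"] by simp
qed

lemma norm_le_dualI:
  fixes x :: "'a::real_normed_vector"
  assumes "\<And>x' :: 'a \<Rightarrow>\<^sub>L real. norm x' \<le> 1 \<Longrightarrow> blinfun_apply x' x \<le> c"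
  shows "norm x \<le> c"
  using norming_functional[of x] assms by metis

lemma dual_eqI:
  fixes x y :: "'a::real_normed_vector"
  assumes "\<And>x' :: 'a \<Rightarrow>\<^sub>L real. blinfun_apply x' x = blinfun_apply x' y"
  shows "x = y"
  using norm_le_dualI[of "x - y" 0] assms by (simp add: blinfun.diff_right)

lemma blinfun_apply_le:
  fixes x' :: "'a::real_normed_vector \<Rightarrow>\<^sub>L real"
  shows "\<bar>blinfun_apply x' x\<bar> \<le> norm x' * norm x"
  using norm_blinfun[of x' x] by simp

lemma blinfun_apply_le_unit:
  fixes x' :: "'a::real_normed_vector \<Rightarrow>\<^sub>L real"
  assumes "norm x' \<le> 1"
  shows "\<bar>blinfun_apply x' x\<bar> \<le> norm x"
  using blinfun_apply_le[of x' x] mult_right_mono[OF assms, of "norm x"] by simp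

section \<open>Weakly compact convex sets\<close>

lemma topspace_weak_topology [simp]: "topspace weak_topology = UNIV"
proof -
  have "UNIV = blinfun_apply (0 :: 'a \<Rightarrow>\<^sub>L real) -` UNIV" by simp
  then show ?thesis
    unfolding weak_topology_def topology_generated_by_topspace by blast
qed

lemma continuous_map_weak_functional [continuous_intros]:
  "continuous_map weak_topology euclideanreal (blinfun_apply f)"
proof -
  have "openin weak_topology (blinfun_apply f -` U)" if "open U" for U
    unfolding weak_topology_def using that by (intro topology_generated_by_Basis) blast
  then have "openin weak_topology {x. blinfun_apply f x \<in> U}" if "open U" for U
    using that by (simp add: vimage_def)
  then have "blinfun_apply f ` topspace weak_topology \<subseteq> topspace euclideanreal \<and>
      (\<forall>U. openin euclideanreal U \<longrightarrow> openin weak_topology {x \<in> topspace weak_topology. blinfun_apply f x \<in> U})"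
    by simp
  then show ?thesis
    unfolding continuous_map .
qed

lemma continuous_map_into_weak:
  assumes "\<And>f. continuous_map X euclideanreal (\<lambda>x. blinfun_apply f (g x))"
  shows "continuous_map X weak_topology g"
  unfolding weak_topology_def
proof (rule continuous_on_generated_topo)
  fix U assume "U \<in> {blinfun_apply f -` U |(f :: 'a \<Rightarrow>\<^sub>L real) U. open U}"
  then obtain f :: "'a \<Rightarrow>\<^sub>L real" and V where U: "U = blinfun_apply f -` V" "open V"
    by blast
  have "openin X {x \<in> topspace X. f (g x) \<in> V}"
    using openin_continuous_map_preimage[OF assms] U(2) by simp
  also have "{x \<in> topspace X. f (g x) \<in> V} = g -` U \<inter> topspace X"
    using U by auto
  finally show "openin X (g -` U \<inter> topspace X)" .
next
  have "UNIV = blinfun_apply (0 :: 'a \<Rightarrow>\<^sub>L real) -` UNIV" by simp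
  then show "g ` topspace X \<subseteq> \<Union> {blinfun_apply f -` U |(f :: 'a \<Rightarrow>\<^sub>L real) U. open U}"
    by blast
qed

lemma cwkD:
  assumes "C \<in> cwk"
  shows "C \<noteq> {}" "convex C" "compactin weak_topology C"
  using assms by (auto simp: cwk_def)

lemma cwk_functional_compact:
  fixes f :: "'a::real_normed_vector \<Rightarrow>\<^sub>L real"
  assumes "K \<in> cwk" shows "compact (f ` K)"
  using image_compactin[OF cwkD(3)[OF assms] continuous_map_weak_functional[of f]] by simp

lemma cwk_bdd_above: "K \<in> cwk \<Longrightarrow> bdd_above (blinfun_apply (f :: 'a::real_normed_vector \<Rightarrow>\<^sub>L real) ` K)"
  by (simp add: bounded_imp_bdd_above compact_imp_bounded cwk_functional_compact)

lemma le_support_fun: "K \<in> cwk \<Longrightarrow> x \<in> K \<Longrightarrow> blinfun_apply f x \<le> support_fun f K"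
  unfolding support_fun_def by (intro cSUP_upper cwk_bdd_above)

lemma support_fun_le:
  "K \<noteq> {} \<Longrightarrow> (\<And>x. x \<in> K \<Longrightarrow> blinfun_apply f x \<le> c) \<Longrightarrow> support_fun f K \<le> c"
  unfolding support_fun_def by (rule cSUP_least)

lemma support_fun_attained:
  assumes "K \<in> cwk"
  obtains x where "x \<in> K" "support_fun f K = blinfun_apply f x"
proof -
  obtain m where m: "m \<in> blinfun_apply f ` K" "\<And>y. y \<in> blinfun_apply f ` K \<Longrightarrow> y \<le> m"
    using compact_attains_sup[OF cwk_functional_compact[OF assms]] cwkD(1)[OF assms] by blast
  then obtain x where x: "x \<in> K" "m = f x" by auto
  have "support_fun f K = f x"
    using m x cwkD(1)[OF assms] by (intro antisym support_fun_le le_support_fun[OF assms]) auto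
  with x that show thesis by blast
qed

lemma support_fun_singleton [simp]: "support_fun f {x} = blinfun_apply f x"
  by (simp add: support_fun_def)

lemma sublinear_support_fun:
  assumes "K \<in> cwk" shows "sublinear (\<lambda>f. support_fun f K)"
proof (rule sublinearI)
  show "support_fun (f + g) K \<le> support_fun f K + support_fun g K" for f g
    using cwkD(1)[OF assms]
    by (intro support_fun_le) (auto simp: blinfun.add_left intro!: add_mono le_support_fun[OF assms])
  show "support_fun (c *\<^sub>R f) K \<le> c * support_fun f K" if "0 < c" for c f
    using cwkD(1)[OF assms] that
    by (intro support_fun_le) (auto simp: blinfun.scaleR_left intro!: le_support_fun[OF assms])
qed

lemma singleton_in_cwk [simp]: "{x} \<in> cwk"
  by (simp add: cwk_def)

text \<open>Minimizing the sum of the squared differences over the compact set replaces the separation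
  of a point from a compact convex set in a space of varying finite dimension.\<close>

lemma finite_functional_represented:
  fixes K :: "'a::real_normed_vector set" and \<xi> :: "('a \<Rightarrow>\<^sub>L real) \<Rightarrow> real"
  assumes K: "K \<in> cwk" and \<xi>: "linear \<xi>" "\<And>f. \<xi> f \<le> support_fun f K" and A: "finite A"
  obtains x where "x \<in> K" "\<And>f. f \<in> A \<Longrightarrow> \<xi> f = blinfun_apply f x"
proof -
  define \<phi> where "\<phi> x = (\<Sum>f\<in>A. (\<xi> f - blinfun_apply f x)^2)" for x
  have "continuous_map weak_topology euclideanreal \<phi>"
    unfolding \<phi>_def using A
    by (intro continuous_map_sum continuous_map_real_pow continuous_map_diff
          continuous_map_weak_functional continuous_map_canonical_const) auto
  then have "compact (\<phi> ` K)"
    using image_compactin[OF cwkD(3)[OF K], of euclideanreal \<phi>] by simp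
  then obtain x where x: "x \<in> K" and min: "\<And>y. y \<in> K \<Longrightarrow> \<phi> x \<le> \<phi> y"
    using compact_attains_inf[of "\<phi> ` K"] cwkD(1)[OF K] by auto
  define a where "a f = \<xi> f - blinfun_apply f x" for f
  have le: "(\<Sum>f\<in>A. a f * blinfun_apply f (y - x)) \<le> 0" if y: "y \<in> K" for y
  proof -
    define s where "s = (\<Sum>f\<in>A. a f * blinfun_apply f (y - x))"
    define q where "q = (\<Sum>f\<in>A. (blinfun_apply f (y - x))^2)"
    \<comment> \<open>First order condition at the minimizer: along the segment towards
      \<open>y\<close>, \<open>\<phi>\<close> equals \<open>\<phi> x - 2 * t * s + t^2 * q\<close>.
      After division by \<open>t\<close>, the limit \<open>t \<rightarrow> 0\<close> gives
      \<open>s \<le> 0\<close>.\<close>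
    have ineq: "2 * s \<le> t * q" if t: "0 < t" "t \<le> 1" for t
    proof -
      have "(1 - t) *\<^sub>R x + t *\<^sub>R y \<in> K"
        using t x y by (intro convexD[OF cwkD(2)[OF K]]) auto
      then have "\<phi> x \<le> \<phi> (x + (t *\<^sub>R y - t *\<^sub>R x))"
        using min by (simp add: algebra_simps)
      also have "\<dots> = (\<Sum>f\<in>A. (a f - t * blinfun_apply f (y - x))^2)"
        by (simp add: \<phi>_def a_def blinfun.add_right blinfun.scaleR_right blinfun.diff_right right_diff_distrib diff_diff_eq)
      also have "\<dots> = \<phi> x - 2 * t * s + t^2 * q"
        by (simp add: \<phi>_def a_def[symmetric] s_def q_def power2_diff sum.distrib sum_subtractf
              sum_distrib_left power_mult_distrib mult.assoc mult.left_commute)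
      finally have "t * (2 * s) \<le> t * (t * q)"
        by (simp add: power2_eq_square algebra_simps)
      with t(1) show ?thesis by (simp only: mult_le_cancel_left_pos)
    qed
    have "((\<lambda>t. t * q) \<longlongrightarrow> 0 * q) (at_right 0)"
      by (intro tendsto_intros)
    moreover have "\<forall>\<^sub>F t in at_right 0. 2 * s \<le> t * q"
      unfolding eventually_at_right[OF zero_less_one] using ineq by (intro exI[of _ 1]) auto
    ultimately have "2 * s \<le> 0 * q"
      by (rule tendsto_lowerbound) simp
    then show ?thesis by (simp add: s_def)
  qed
  \<comment> \<open>The residuals \<open>a f\<close> serve as coefficients: by the first order
    condition \<open>x\<close> maximizes \<open>f0\<close> on \<open>K\<close>, and comparing
    \<open>\<xi> f0\<close> with this maximum bounds the sum of the squared residuals by 0.\<close>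
  define f0 where "f0 = (\<Sum>f\<in>A. a f *\<^sub>R f)"
  have f0: "blinfun_apply f0 y = (\<Sum>f\<in>A. a f * blinfun_apply f y)" for y
    by (simp add: f0_def blinfun.sum_left blinfun.scaleR_left)
  have "\<xi> f0 \<le> support_fun f0 K" by (rule \<xi>)
  also have "\<dots> \<le> blinfun_apply f0 x"
  proof (rule support_fun_le[OF cwkD(1)[OF K]])
    show "blinfun_apply f0 y \<le> blinfun_apply f0 x" if "y \<in> K" for y
      using le[OF that] by (simp add: f0 blinfun.diff_right right_diff_distrib sum_subtractf)
  qed
  finally have "(\<Sum>f\<in>A. a f * \<xi> f) \<le> (\<Sum>f\<in>A. a f * blinfun_apply f x)"
    by (simp add: f0) (simp add: f0_def linear_sum[OF \<xi>(1)] linear_scale[OF \<xi>(1)])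
  moreover have "(\<Sum>f\<in>A. (a f)^2) = (\<Sum>f\<in>A. a f * \<xi> f) - (\<Sum>f\<in>A. a f * blinfun_apply f x)"
    unfolding sum_subtractf[symmetric]
    by (rule sum.cong) (auto simp: a_def power2_eq_square algebra_simps)
  ultimately have "(\<Sum>f\<in>A. (a f)^2) \<le> 0"
    by simp
  then have "(\<Sum>f\<in>A. (a f)^2) = 0"
    by (intro antisym sum_nonneg) auto
  then have "a f = 0" if "f \<in> A" for f
    using that A by (simp add: sum_nonneg_eq_0_iff)
  with x that show thesis
    by (auto simp: a_def)
qed

text \<open>The weakly closed sets on which \<open>\<xi> f\<close> is attained have the finite
  intersection property inside \<open>K\<close>, so weak compactness yields one point for all
  \<open>f\<close>. Domination alone makes \<open>\<xi>\<close> an evaluation; this is how vector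
  integrals are obtained below.\<close>

lemma functional_represented:
  fixes K :: "'a::real_normed_vector set" and \<xi> :: "('a \<Rightarrow>\<^sub>L real) \<Rightarrow> real"
  assumes K: "K \<in> cwk" and \<xi>: "linear \<xi>" "\<And>f. \<xi> f \<le> support_fun f K"
  shows "\<exists>x\<in>K. \<forall>f. \<xi> f = blinfun_apply f x"
proof -
  define D where "D f = {x. blinfun_apply f x = \<xi> f}" for f
  have "closedin weak_topology (D f)" for f
    using closedin_continuous_map_preimage[OF continuous_map_weak_functional, of "{\<xi> f}" f]
    by (simp add: D_def)
  moreover have "K \<inter> \<Inter> F \<noteq> {}" if F: "finite F" "F \<subseteq> range D" for F
  proof -
    obtain A where A: "finite A" "F = D ` A"
      using finite_subset_image[OF F] by blast
    obtain x where "x \<in> K" "\<And>f. f \<in> A \<Longrightarrow> \<xi> f = blinfun_apply f x"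
      using finite_functional_represented[OF K \<xi> A(1)] by blast
    then have "x \<in> K \<inter> \<Inter> F"
      unfolding A(2) D_def by auto
    then show ?thesis by blast
  qed
  ultimately have "K \<inter> \<Inter> (range D) \<noteq> {}"
    using cwkD(3)[OF K] by (auto simp: compactin_fip)
  then obtain x where "x \<in> K" "\<forall>f. blinfun_apply f x = \<xi> f"
    by (auto simp: D_def)
  then show ?thesis by (metis (full_types))
qed

text \<open>Evaluation at \<open>x\<close> is a dominated linear functional, hence evaluation at
  some \<open>y \<in> K\<close>, and functionals separate points. A set in \<open>cwk\<close> is
  thus determined by its support function.\<close>

lemma mem_cwkI:
  fixes K :: "'a::real_normed_vector set"
  assumes "K \<in> cwk" "\<And>f. blinfun_apply f x \<le> support_fun f K"
  shows "x \<in> K"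
proof -
  have lin: "linear (\<lambda>f. blinfun_apply f x)"
    by (intro linearI) (auto simp: blinfun.add_left blinfun.scaleR_left)
  obtain y where y: "y \<in> K" "\<And>f :: 'a \<Rightarrow>\<^sub>L real. blinfun_apply f x = blinfun_apply f y"
    using functional_represented[OF assms(1) lin assms(2)] by blast
  from dual_eqI[OF y(2)] y(1) show ?thesis by simp
qed

text \<open>\<open>C\<close> consists of the points whose evaluation lies below \<open>p\<close>.
  For each \<open>f\<close> there is a linear functional below \<open>p\<close> touching it at
  \<open>f\<close>; being dominated by the support function of \<open>K\<close> it is a point of
  \<open>C\<close>, so \<open>p f\<close> is attained on \<open>C\<close>.\<close>

lemma cwk_dominated:
  fixes p :: "('a::real_normed_vector \<Rightarrow>\<^sub>L real) \<Rightarrow> real"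
  assumes K: "K \<in> cwk" and p: "sublinear p" "\<And>f. p f \<le> support_fun f K"
  obtains C where "C \<in> cwk" "\<And>f. support_fun f C = p f"
proof -
  define C where "C = {x. \<forall>f. blinfun_apply f x \<le> p f}"
  have ex: "\<exists>x\<in>C. p f \<le> blinfun_apply f x" for f
  proof -
    obtain \<xi> where \<xi>: "linear \<xi>" "\<And>g. \<xi> g \<le> p g" "p f \<le> \<xi> f"
      using mazur_orlicz[OF p(1), of "{f}" "p f"] by auto
    have "\<xi> g \<le> support_fun g K" for g
      using \<xi>(2) p(2) by (rule order_trans)
    from functional_represented[OF K \<xi>(1) this]
    obtain x where "x \<in> K" "\<And>g. \<xi> g = blinfun_apply g x"
      by auto
    with \<xi> show ?thesis by (auto simp: C_def)
  qed
  have "C \<subseteq> K"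
  proof
    fix x assume "x \<in> C"
    then have "blinfun_apply f x \<le> support_fun f K" for f
      using order_trans[OF _ p(2)] by (simp add: C_def)
    then show "x \<in> K" by (rule mem_cwkI[OF K])
  qed
  moreover have "closedin weak_topology C"
  proof -
    have "closedin weak_topology {x. blinfun_apply f x \<le> p f}" for f
      using closedin_continuous_map_preimage[OF continuous_map_weak_functional, of "{..p f}" f]
      by simp
    moreover have "C = (\<Inter>f. {x. blinfun_apply f x \<le> p f})"
      by (auto simp: C_def)
    ultimately show ?thesis
      using closedin_Inter[of "range (\<lambda>f. {x. blinfun_apply f x \<le> p f})" weak_topology] by blast
  qed
  ultimately have "compactin weak_topology C"
    using closed_compactin cwkD(3)[OF K] by blast
  moreover have "convex C"
  proof -
    have "convex {x. blinfun_apply f x \<le> p f}" for f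
      using convex_linear_vimage[of f "{..p f}"]
      by (simp add: vimage_def blinfun.bounded_linear_right bounded_linear.linear)
    moreover have "C = (\<Inter>f. {x. blinfun_apply f x \<le> p f})"
      by (auto simp: C_def)
    ultimately show ?thesis by (auto intro: convex_INT)
  qed
  ultimately have "C \<in> cwk"
    using ex by (auto simp: cwk_def)
  moreover have "support_fun f C = p f" for f
  proof (rule antisym)
    show "support_fun f C \<le> p f"
      using ex by (intro support_fun_le) (auto simp: C_def)
    show "p f \<le> support_fun f C"
      using ex[of f] le_support_fun[OF \<open>C \<in> cwk\<close>, of _ f] order_trans by blast
  qed
  ultimately show thesis using that by blast
qed

lemma cwk_translation:
  assumes "K \<in> cwk"
  shows "(+) a ` K \<in> cwk" "support_fun f ((+) a ` K) = blinfun_apply f a + support_fun f K"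
proof -
  have "continuous_map weak_topology weak_topology ((+) a)"
    by (intro continuous_map_into_weak)
      (simp add: blinfun.add_right continuous_map_add continuous_map_weak_functional)
  then show *: "(+) a ` K \<in> cwk"
    using assms by (auto simp: cwk_def image_compactin intro: convex_translation)
  show "support_fun f ((+) a ` K) = blinfun_apply f a + support_fun f K"
  proof (rule antisym)
    show "support_fun f ((+) a ` K) \<le> blinfun_apply f a + support_fun f K"
      using cwkD(1)[OF assms]
      by (intro support_fun_le) (auto simp: blinfun.add_right le_support_fun[OF assms])
    have "support_fun f K \<le> support_fun f ((+) a ` K) - blinfun_apply f a"
    proof (rule support_fun_le[OF cwkD(1)[OF assms]])
      fix x assume "x \<in> K"
      then have "blinfun_apply f (a + x) \<le> support_fun f ((+) a ` K)"
        by (intro le_support_fun[OF *]) auto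
      then show "blinfun_apply f x \<le> support_fun f ((+) a ` K) - blinfun_apply f a"
        by (simp add: blinfun.add_right)
    qed
    then show "blinfun_apply f a + support_fun f K \<le> support_fun f ((+) a ` K)" by simp
  qed
qed

text \<open>Uniform boundedness principle: weak compactness makes \<open>K\<close> bounded in every
  functional, and Baire's theorem is applied in the dual, which is complete whether or not
  \<open>'a\<close> is.\<close>

lemma cwk_bounded:
  fixes K :: "'a::real_normed_vector set"
  assumes "K \<in> cwk" shows "bounded K"
proof -
  define F where "F n = {f :: 'a \<Rightarrow>\<^sub>L real. \<forall>x\<in>K. \<bar>blinfun_apply f x\<bar> \<le> real n}" for n
  have cl: "closed (F n)" for n
  proof -
    have "F n = (\<Inter>x\<in>K. {f. \<bar>blinfun_apply f x\<bar> \<le> real n})"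
      by (auto simp: F_def)
    moreover have "closed {f :: 'a \<Rightarrow>\<^sub>L real. \<bar>blinfun_apply f x\<bar> \<le> real n}" for x
      by (intro closed_Collect_le continuous_intros)
    ultimately show ?thesis by (simp add: closed_INT)
  qed
  have "\<exists>n. f \<in> F n" for f
  proof -
    have "bounded (blinfun_apply f ` K)"
      using cwk_functional_compact[OF assms] compact_imp_bounded by blast
    then obtain b where b: "\<And>x. x \<in> K \<Longrightarrow> \<bar>blinfun_apply f x\<bar> \<le> b"
      by (auto simp: bounded_iff)
    have "f \<in> F (nat \<lceil>b\<rceil>)"
      unfolding F_def using b real_nat_ceiling_ge[of b] order_trans by blast
    then show ?thesis ..
  qed
  then have un: "(\<Union>n. F n) = UNIV" by blast
  have "\<exists>n. interior (F n) \<noteq> {}"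
  proof (rule ccontr)
    assume "\<not> (\<exists>n. interior (F n) \<noteq> {})"
    then have dense: "closure (- F n) = UNIV" for n
      by (simp add: closure_complement)
    have "euclidean closure_of (\<Inter> (range (\<lambda>n. - F n))) = topspace euclidean"
      using cl dense
      by (intro Baire_category) (auto simp: completely_metrizable_space_euclidean open_Compl)
    moreover have "\<Inter> (range (\<lambda>n. - F n)) = {}"
      using un by blast
    ultimately show False by simp
  qed
  then obtain n f0 where "f0 \<in> interior (F n)" by blast
  then obtain e where e: "0 < e" "cball f0 e \<subseteq> F n"
    by (auto simp: mem_interior_cball)
  have "norm x \<le> 2 * real n / e" if x: "x \<in> K" for x
  proof (rule norm_le_dualI)
    fix f :: "'a \<Rightarrow>\<^sub>L real" assume f: "norm f \<le> 1"
    \<comment> \<open>Both \<open>f0\<close> and \<open>f0 + e *\<^sub>R f\<close> are bounded by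
      \<open>n\<close> on \<open>K\<close>, so their difference bounds \<open>e * f x\<close> by
      \<open>2 * n\<close>.\<close>
    have "f0 + e *\<^sub>R f \<in> F n" "f0 \<in> F n"
      using e f by (auto intro!: subsetD[OF e(2)] simp: dist_norm)
    then have "\<bar>blinfun_apply f0 x + e * blinfun_apply f x\<bar> \<le> real n" "\<bar>blinfun_apply f0 x\<bar> \<le> real n"
      using x by (auto simp: F_def blinfun.add_left blinfun.scaleR_left)
    then have "e * blinfun_apply f x \<le> 2 * real n" by linarith
    with e show "blinfun_apply f x \<le> 2 * real n / e" by (simp add: field_simps)
  qed
  then show ?thesis by (auto simp: bounded_iff)
qed

lemma cwk_closed:
  fixes K :: "'a::real_normed_vector set"
  assumes "K \<in> cwk" shows "closed K"
proof -
  have "closed {x. blinfun_apply f x \<le> support_fun f K}" for f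
    by (intro closed_Collect_le continuous_intros)
  then have "closed (\<Inter>f. {x. blinfun_apply f x \<le> support_fun f K})"
    by (intro closed_INT) auto
  also have "(\<Inter>f. {x. blinfun_apply f x \<le> support_fun f K}) = K"
    using mem_cwkI[OF assms] le_support_fun[OF assms] by blast
  finally show ?thesis .
qed

section \<open>Hausdorff distance and support functions\<close>

lemma hausdorff_distance_commute: "hausdorff_distance A B = hausdorff_distance B A"
  by (simp add: hausdorff_distance_def max.commute)

lemma bdd_above_functional:
  fixes f :: "'a::real_normed_vector \<Rightarrow>\<^sub>L real"
  shows "bounded A \<Longrightarrow> bdd_above (blinfun_apply f ` A)"
  by (simp add: bounded_imp_bdd_above bounded_linear_image blinfun.bounded_linear_right)

lemma support_fun_upper:
  "bdd_above (blinfun_apply f ` A) \<Longrightarrow> x \<in> A \<Longrightarrow> blinfun_apply f x \<le> support_fun f A"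
  unfolding support_fun_def by (rule cSUP_upper)

lemma hausdorff_distance_lessD:
  assumes "hausdorff_distance A B < ennreal r" "a \<in> A" "B \<noteq> {}"
  obtains b where "b \<in> B" "dist a b < r"
proof -
  have "ennreal (infdist a B) \<le> hausdorff_distance A B"
    unfolding hausdorff_distance_def using assms(2) by (intro max.coboundedI1 SUP_upper)
  then have "infdist a B < r"
    using assms(1) infdist_nonneg[of a B] by (metis ennreal_less_iff le_less_trans)
  then show thesis
    using that assms(3) by (auto simp: infdist_notempty cInf_less_iff)
qed

lemma support_fun_le_hausdorff:
  fixes f :: "'a::real_normed_vector \<Rightarrow>\<^sub>L real"
  assumes "hausdorff_distance A B < ennreal r" "A \<noteq> {}" "B \<noteq> {}" "bdd_above (blinfun_apply f ` B)"
  shows "support_fun f A \<le> support_fun f B + norm f * r"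
proof (rule support_fun_le[OF assms(2)])
  fix a assume "a \<in> A"
  then obtain b where b: "b \<in> B" "dist a b < r"
    using hausdorff_distance_lessD assms(1,3) by metis
  have "blinfun_apply f (a - b) \<le> norm f * norm (a - b)"
    using blinfun_apply_le[of f "a - b"] by simp
  also have "\<dots> \<le> norm f * r"
    using b(2) by (intro mult_left_mono) (auto simp: dist_norm)
  finally show "blinfun_apply f a \<le> support_fun f B + norm f * r"
    using support_fun_upper[OF assms(4) b(1)] by (simp add: blinfun.diff_right)
qed

lemma support_fun_diff_le_hausdorff:
  fixes f :: "'a::real_normed_vector \<Rightarrow>\<^sub>L real"
  assumes "hausdorff_distance A B < ennreal r" "A \<noteq> {}" "B \<noteq> {}"
    and "bdd_above (blinfun_apply f ` A)" "bdd_above (blinfun_apply f ` B)"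
  shows "\<bar>support_fun f A - support_fun f B\<bar> \<le> norm f * r"
  using support_fun_le_hausdorff[OF assms(1-3,5)]
    support_fun_le_hausdorff[OF assms(1)[unfolded hausdorff_distance_commute[of A]] assms(3,2,4)]
  by linarith

text \<open>Non-strict version, obtained by enlarging \<open>r\<close> by \<open>d\<close> with
  \<open>norm f * d \<le> e\<close>. It is applied with \<open>r\<close> equal to the distance
  itself.\<close>

lemma support_fun_diff_le_hausdorff':
  fixes f :: "'a::real_normed_vector \<Rightarrow>\<^sub>L real"
  assumes "hausdorff_distance A B \<le> ennreal r" "0 \<le> r" "A \<noteq> {}" "B \<noteq> {}"
    and "bdd_above (blinfun_apply f ` A)" "bdd_above (blinfun_apply f ` B)"
  shows "\<bar>support_fun f A - support_fun f B\<bar> \<le> norm f * r"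
proof (rule field_le_epsilon)
  fix e :: real assume e: "0 < e"
  define d where "d = e / (norm f + 1)"
  have d: "0 < d" "norm f * d \<le> e"
    using e by (auto simp: d_def field_simps add_pos_nonneg)
  have "hausdorff_distance A B < ennreal (r + d)"
    using assms(1,2) d by (auto intro!: le_less_trans[OF assms(1)] simp: ennreal_less_iff)
  from support_fun_diff_le_hausdorff[OF this assms(3-6)] d(2)
  show "\<bar>support_fun f A - support_fun f B\<bar> \<le> norm f * r + e"
    by (simp add: distrib_left)
qed

text \<open>All elements of the convex set \<open>a - B\<close> have norm at least
  \<open>infdist a B\<close>. A separating functional \<open>f\<close> of norm at most 1 gives
  \<open>infdist a B \<le> f a - support_fun f B\<close>, and \<open>f a\<close> is at most
  \<open>support_fun f A\<close>.\<close>

lemma infdist_le_support_fun: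
  fixes A B :: "'a::real_normed_vector set"
  assumes "convex B" "B \<noteq> {}" "bounded A" "a \<in> A"
    and "\<And>f. norm f \<le> 1 \<Longrightarrow> support_fun f A \<le> support_fun f B + r"
  shows "infdist a B \<le> r"
proof -
  have "convex ((\<lambda>b. a - b) ` B)"
    using convex_translation[OF convex_negations[OF assms(1)], of a]
    by (simp add: image_image)
  moreover have "infdist a B \<le> norm z" if "z \<in> (\<lambda>b. a - b) ` B" for z
    using that infdist_le[of _ B a] by (auto simp: dist_norm)
  ultimately obtain f :: "'a \<Rightarrow>\<^sub>L real" where f: "norm f \<le> 1"
    "\<And>z. z \<in> (\<lambda>b. a - b) ` B \<Longrightarrow> infdist a B \<le> blinfun_apply f z"
    using separate_from_convex[of "(\<lambda>b. a - b) ` B" "infdist a B"] assms(2) by blast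
  have "support_fun f B \<le> blinfun_apply f a - infdist a B"
  proof (rule support_fun_le[OF assms(2)])
    show "blinfun_apply f b \<le> blinfun_apply f a - infdist a B" if "b \<in> B" for b
      using f(2)[of "a - b"] that by (simp add: blinfun.diff_right)
  qed
  moreover have "blinfun_apply f a \<le> support_fun f A"
    by (rule support_fun_upper[OF bdd_above_functional[OF assms(3)] assms(4)])
  ultimately show ?thesis
    using assms(5)[OF f(1)] by linarith
qed

lemma hausdorff_distance_le:
  fixes A B :: "'a::real_normed_vector set"
  assumes "convex A" "A \<noteq> {}" "bounded A" "convex B" "B \<noteq> {}" "bounded B"
    and "\<And>f. norm f \<le> 1 \<Longrightarrow> \<bar>support_fun f A - support_fun f B\<bar> \<le> r"
  shows "hausdorff_distance A B \<le> ennreal r"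
proof -
  have "support_fun f A \<le> support_fun f B + r" "support_fun f B \<le> support_fun f A + r"
    if "norm f \<le> 1" for f
    using assms(7)[OF that] by linarith+
  with assms show ?thesis
    unfolding hausdorff_distance_def
    by (intro max.boundedI SUP_least ennreal_leI) (auto intro: infdist_le_support_fun)
qed

lemma hausdorff_distance_finite:
  fixes A B :: "'a::real_normed_vector set"
  assumes "bounded A" "A \<noteq> {}" "bounded B" "B \<noteq> {}"
  shows "hausdorff_distance A B < \<infinity>"
proof -
  obtain c where c: "\<And>x. x \<in> A \<union> B \<Longrightarrow> norm x \<le> c"
    using assms(1,3) by (metis bounded_Un bounded_iff)
  have *: "infdist x C \<le> 2 * c" if xC: "x \<in> A \<union> B" "C \<noteq> {}" "C \<subseteq> A \<union> B" for x C
  proof -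
    obtain y where "y \<in> C" using xC(2) by blast
    then have "infdist x C \<le> dist x y" by (rule infdist_le)
    also have "\<dots> \<le> norm x + norm y" by (simp add: dist_norm norm_triangle_ineq4)
    also have "\<dots> \<le> 2 * c" using c[of x] c[of y] xC \<open>y \<in> C\<close> by auto
    finally show ?thesis .
  qed
  have "hausdorff_distance A B \<le> ennreal (2 * c)"
    unfolding hausdorff_distance_def using assms
    by (intro max.boundedI SUP_least ennreal_leI *) auto
  also have "\<dots> < \<infinity>" by simp
  finally show ?thesis .
qed

section \<open>Support functions of scaled sets and Minkowski sums\<close>

lemma support_fun_scaleR:
  fixes f :: "'a::real_normed_vector \<Rightarrow>\<^sub>L real"
  assumes "A \<noteq> {}" "bounded A" "0 \<le> c"
  shows "support_fun f ((*\<^sub>R) c ` A) = c * support_fun f A"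
proof (cases "c = 0")
  case True
  with assms(1) have "(*\<^sub>R) c ` A = {0}" by auto
  with True show ?thesis by simp
next
  case False
  with assms(3) have c: "0 < c" by simp
  have bdd: "bdd_above (blinfun_apply f ` (*\<^sub>R) c ` A)"
    using assms(2) by (intro bdd_above_functional bounded_scaling)
  show ?thesis
  proof (rule antisym)
    show "support_fun f ((*\<^sub>R) c ` A) \<le> c * support_fun f A"
      using assms c
      by (intro support_fun_le) (auto simp: blinfun.scaleR_right support_fun_upper bdd_above_functional)
    have "support_fun f A \<le> support_fun f ((*\<^sub>R) c ` A) / c"
    proof (rule support_fun_le[OF assms(1)])
      fix x assume "x \<in> A"
      then have "blinfun_apply f (c *\<^sub>R x) \<le> support_fun f ((*\<^sub>R) c ` A)"
        by (intro support_fun_upper[OF bdd]) auto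
      with c show "blinfun_apply f x \<le> support_fun f ((*\<^sub>R) c ` A) / c"
        by (simp add: blinfun.scaleR_right field_simps)
    qed
    with c show "c * support_fun f A \<le> support_fun f ((*\<^sub>R) c ` A)"
      by (simp add: field_simps)
  qed
qed

lemma bounded_set_plus:
  fixes A B :: "'a::real_normed_vector set"
  assumes "bounded A" "bounded B" shows "bounded (A + B)"
  using bounded_plus[OF assms] by (simp add: set_plus_image)

lemma support_fun_plus:
  fixes f :: "'a::real_normed_vector \<Rightarrow>\<^sub>L real"
  assumes "A \<noteq> {}" "bounded A" "B \<noteq> {}" "bounded B"
  shows "support_fun f (A + B) = support_fun f A + support_fun f B"
proof (rule antisym)
  have ne: "A + B \<noteq> {}"
    using assms by (auto simp: set_plus_def)
  show "support_fun f (A + B) \<le> support_fun f A + support_fun f B"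
    using assms ne
    by (intro support_fun_le)
      (auto simp: set_plus_def blinfun.add_right intro!: add_mono support_fun_upper bdd_above_functional)
  have bdd: "bdd_above (blinfun_apply f ` (A + B))"
    using assms by (intro bdd_above_functional bounded_set_plus)
  have "support_fun f A \<le> support_fun f (A + B) - blinfun_apply f b" if "b \<in> B" for b
  proof (rule support_fun_le[OF assms(1)])
    fix a assume "a \<in> A"
    with that have "blinfun_apply f (a + b) \<le> support_fun f (A + B)"
      by (intro support_fun_upper[OF bdd]) (auto intro: set_plus_intro)
    then show "blinfun_apply f a \<le> support_fun f (A + B) - blinfun_apply f b"
      by (simp add: blinfun.add_right)
  qed
  then have "blinfun_apply f b \<le> support_fun f (A + B) - support_fun f A" if "b \<in> B" for b
    using that by fastforce
  from support_fun_le[OF assms(3) this]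
  show "support_fun f A + support_fun f B \<le> support_fun f (A + B)"
    by simp
qed

text \<open>Non-emptiness, boundedness and convexity are what \<open>hausdorff_distance_le\<close>
  asks of a Riemann sum of sets; the last conjunct reduces it to scalar Riemann sums.\<close>

lemma set_sum_convex_bounded:
  fixes A :: "'i \<Rightarrow> 'a::real_normed_vector set"
  assumes "finite P" "\<And>i. i \<in> P \<Longrightarrow> A i \<noteq> {} \<and> bounded (A i) \<and> convex (A i)"
  shows "(\<Sum>i\<in>P. A i) \<noteq> {} \<and> bounded (\<Sum>i\<in>P. A i) \<and> convex (\<Sum>i\<in>P. A i) \<and>
    (\<forall>f. support_fun f (\<Sum>i\<in>P. A i) = (\<Sum>i\<in>P. support_fun f (A i)))"
  using assms
proof (induction P rule: finite_induct)
  case empty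
  then show ?case by (simp add: set_zero)
next
  case (insert i P)
  then have IH: "sum A P \<noteq> {}" "bounded (sum A P)" "convex (sum A P)"
    "\<And>f. support_fun f (sum A P) = (\<Sum>i\<in>P. support_fun f (A i))"
    by auto
  have Ai: "A i \<noteq> {}" "bounded (A i)" "convex (A i)"
    using insert.prems by auto
  have "A i + sum A P \<noteq> {}"
    using IH(1) Ai(1) by (auto simp: set_plus_def)
  with insert.hyps IH Ai show ?case
    by (simp add: bounded_set_plus convex_set_plus support_fun_plus)
qed

section \<open>Interval functions with small Henstock sums\<close>

text \<open>Outside the unit interval \<open>\<delta>\<close> may fail to be positive, so it is
  replaced by 1 there before passing to a gauge on the whole line.\<close>

lemma gauge_of_gauge_fun:
  assumes "gauge_fun \<delta>"
  obtains \<gamma> where "gauge \<gamma>" "\<And>t. t \<in> {0..1} \<Longrightarrow> \<gamma> t = {t - \<delta> t <..< t + \<delta> t}"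
proof
  let ?\<delta> = "\<lambda>t. if t \<in> {0..1} then \<delta> t else 1"
  show "gauge (\<lambda>t. {t - ?\<delta> t <..< t + ?\<delta> t})"
    using assms by (auto simp: gauge_def gauge_fun_def)
  show "{t - ?\<delta> t <..< t + ?\<delta> t} = {t - \<delta> t <..< t + \<delta> t}" if "t \<in> {0..1}" for t
    using that by simp
qed

lemma gauge_fun_of_gauge:
  assumes "gauge \<gamma>"
  obtains \<delta> where "gauge_fun \<delta>" "\<And>t. {t - \<delta> t <..< t + \<delta> t} \<subseteq> \<gamma> t"
proof -
  have "\<exists>d>0. {t - d <..< t + d} \<subseteq> \<gamma> t" for t :: real
  proof -
    have "open (\<gamma> t)" "t \<in> \<gamma> t"
      using assms by (auto simp: gauge_def)
    then obtain d where "0 < d" "ball t d \<subseteq> \<gamma> t"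
      by (meson open_contains_ball)
    then show ?thesis by (auto simp: ball_eq_greaterThanLessThan)
  qed
  then obtain \<delta> where "\<And>t. 0 < \<delta> t \<and> {t - \<delta> t <..< t + \<delta> t} \<subseteq> \<gamma> t"
    by metis
  then show thesis by (intro that[of \<delta>]) (auto simp: gauge_fun_def)
qed

lemma gauge_fun_min: "gauge_fun \<delta> \<Longrightarrow> gauge_fun \<delta>' \<Longrightarrow> gauge_fun (\<lambda>t. min (\<delta> t) (\<delta>' t))"
  by (simp add: gauge_fun_def)

lemma delta_fine_mono:
  assumes "delta_fine \<delta> p" "\<And>t I. (t, I) \<in> p \<Longrightarrow> \<delta> t \<le> \<delta>' t"
  shows "delta_fine \<delta>' p"
  unfolding delta_fine_def
proof (rule fineI)
  fix t I assume tI: "(t, I) \<in> p"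
  then have "I \<subseteq> {t - \<delta> t <..< t + \<delta> t}"
    using assms(1) by (auto simp: delta_fine_def fine_def)
  with assms(2)[OF tI] show "I \<subseteq> {t - \<delta>' t <..< t + \<delta>' t}"
    by fastforce
qed

lemma subintervalsI: "0 \<le> a \<Longrightarrow> a \<le> b \<Longrightarrow> b \<le> 1 \<Longrightarrow> {a..b} \<in> subintervals"
  by (auto simp: subintervals_def)

lemma tagged_partial_division_subintervals:
  assumes "p tagged_partial_division_of {0..1::real}" "(t, I) \<in> p"
  obtains a b where "I = {a..b}" "0 \<le> a" "a \<le> t" "t \<le> b" "b \<le> 1"
proof -
  note d = tagged_partial_division_ofD[OF assms(1)]
  obtain a b where I: "I = {a..b}"
    using d(4)[OF assms(2)] by (auto simp: cbox_interval)
  with d(2,3)[OF assms(2)] have "a \<le> t" "t \<le> b" "{a..b} \<subseteq> {0..1}" by auto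
  then have "0 \<le> a" "b \<le> 1" by auto
  with I \<open>a \<le> t\<close> \<open>t \<le> b\<close> that show thesis by blast
qed

text \<open>The variational condition speaks of full divisions only. Since its summands are
  non-negative, extending a fine partial division to a fine division transfers it to partial
  ones.\<close>

lemma fine_partial_division_extend:
  assumes \<delta>: "gauge_fun \<delta>" and p: "p tagged_partial_division_of {0..1}" "delta_fine \<delta> p"
  obtains q where "q tagged_division_of {0..1}" "delta_fine \<delta> q" "p \<subseteq> q"
proof -
  note pd = tagged_partial_division_ofD[OF p(1)]
  obtain \<gamma> where \<gamma>: "gauge \<gamma>" "\<And>t. t \<in> {0..1} \<Longrightarrow> \<gamma> t = {t - \<delta> t <..< t + \<delta> t}"
    using gauge_of_gauge_fun[OF \<delta>] by metis
  have "\<Union> (snd ` p) \<subseteq> cbox 0 (1::real)"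
    using pd(3) by fastforce
  then obtain d where d: "snd ` p \<subseteq> d" "d division_of cbox 0 (1::real)"
    using partial_division_extend_interval[OF partial_division_of_tagged_division[OF p(1)]] by metis
  note dd = division_ofD[OF d(2)]
  \<comment> \<open>The left endpoint is a provisional tag for the added intervals; those that are
    not fine are subdivided and retagged afterwards.\<close>
  define P where "P = p \<union> (\<lambda>K. (Inf K, K)) ` (d - snd ` p)"
  have Kd: "K \<in> d" if "(x, K) \<in> P" for x K
    using that d(1) by (force simp: P_def)
  have fresh: "(x, K) \<in> p" if "(x, K) \<in> P" "K \<in> snd ` p" for x K
    using that by (auto simp: P_def)
  have new: "x = Inf K" if "(x, K) \<in> P" "K \<notin> snd ` p" for x K
    using that by (force simp: P_def)
  have P: "P tagged_division_of {0..1}"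
  proof (rule tagged_division_ofI)
    show "finite P"
      using pd(1) dd(1) by (simp add: P_def)
    show "x \<in> K" if xK: "(x, K) \<in> P" for x K
    proof (cases "K \<in> snd ` p")
      case True
      then show ?thesis using fresh[OF xK] pd(2) by blast
    next
      case False
      then have "x = Inf K" using new xK by blast
      moreover obtain a b where "K = {a..b}" "K \<noteq> {}"
        using dd(3,4)[OF Kd[OF xK]] by (auto simp: cbox_interval)
      ultimately show ?thesis by simp
    qed
    show "K \<subseteq> {0..1}" "\<exists>a b. K = cbox a b" if "(x, K) \<in> P" for x K
      using dd(2,4)[OF Kd[OF that]] by auto
    show "interior K1 \<inter> interior K2 = {}"
      if "(x1, K1) \<in> P" "(x2, K2) \<in> P" "(x1, K1) \<noteq> (x2, K2)" for x1 K1 x2 K2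
    proof (cases "K1 = K2")
      case True
      show ?thesis
      proof (cases "K1 \<in> snd ` p")
        case True
        with that \<open>K1 = K2\<close> fresh pd(5) show ?thesis by metis
      next
        case False
        with that \<open>K1 = K2\<close> new show ?thesis by metis
      qed
    next
      case False
      then show ?thesis using dd(5) Kd that by metis
    qed
    have "{K. \<exists>x. (x, K) \<in> P} = d"
    proof
      show "{K. \<exists>x. (x, K) \<in> P} \<subseteq> d" using Kd by blast
      show "d \<subseteq> {K. \<exists>x. (x, K) \<in> P}"
      proof
        fix K assume "K \<in> d"
        then show "K \<in> {K. \<exists>x. (x, K) \<in> P}"
          by (cases "K \<in> snd ` p") (force simp: P_def)+
      qed
    qed
    then show "\<Union> {K. \<exists>x. (x, K) \<in> P} = {0..1}"
      using dd(6) by simp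
  qed
  \<comment> \<open>The refinement keeps every pair that is already fine, in particular all of
    \<open>p\<close>.\<close>
  then obtain q where q: "q tagged_division_of cbox 0 1" "\<gamma> fine q"
    "\<forall>(x, K)\<in>P. K \<subseteq> \<gamma> x \<longrightarrow> (x, K) \<in> q"
    using tagged_division_finer[of P 0 1 \<gamma>] \<gamma>(1) by auto
  have "delta_fine \<delta> q"
    unfolding delta_fine_def
  proof (rule fineI)
    fix x K assume xK: "(x, K) \<in> q"
    then have "x \<in> {0..1}" using q(1) by (auto dest: tag_in_interval)
    with xK q(2) \<gamma>(2) show "K \<subseteq> {x - \<delta> x <..< x + \<delta> x}"
      by (metis fineD)
  qed
  moreover have "p \<subseteq> q"
  proof
    fix y assume "y \<in> p"
    obtain x K where y: "y = (x, K)" by (cases y)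
    then have xK: "(x, K) \<in> p" using \<open>y \<in> p\<close> by simp
    then have "x \<in> {0..1}" using pd(2,3) by blast
    with xK p(2) \<gamma>(2) have "K \<subseteq> \<gamma> x"
      unfolding delta_fine_def by (metis fineD)
    with q(3) xK y show "y \<in> q" by (auto simp: P_def)
  qed
  ultimately show thesis using that q(1) by auto
qed

text \<open>An interval function of Henstock variation zero. The instances are the error of a
  variational Henstock primitive and the Saks-Henstock error of an integrable real function.\<close>

definition henstock_null :: "(real \<Rightarrow> real set \<Rightarrow> real) \<Rightarrow> bool" where
  "henstock_null e \<longleftrightarrow> (\<forall>\<epsilon>>0. \<exists>\<delta>. gauge_fun \<delta> \<and>
     (\<forall>p. p tagged_partial_division_of {0..1} \<and> delta_fine \<delta> p \<longrightarrow> (\<Sum>(t, I)\<in>p. e t I) < \<epsilon>))"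

text \<open>The short intervals on which \<open>e\<close> exceeds \<open>\<eta>\<close> times the
  length form a Vitali cover of the exceptional set. Finitely many disjoint ones form a fine partial
  division, so their total length is at most the sum of \<open>e\<close> divided by
  \<open>\<eta>\<close>.\<close>

lemma henstock_null_negligible:
  assumes e: "henstock_null e" and nonneg: "\<And>t I. 0 \<le> e t I" and \<eta>: "0 < \<eta>"
  shows "negligible {t \<in> {0..1}. \<forall>r>0. \<exists>a b. 0 \<le> a \<and> a \<le> t \<and> t \<le> b \<and> b \<le> 1 \<and> a < b \<and> b - a < r \<and>
    \<eta> * (b - a) < e t {a..b}}" (is "negligible ?B")
  unfolding negligible_outer_le
proof (intro allI impI)
  fix \<epsilon> :: real assume \<epsilon>: "0 < \<epsilon>"
  with \<eta> have "0 < \<epsilon> * \<eta>" by simp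
  with e obtain \<delta> where \<delta>: "gauge_fun \<delta>"
    "\<And>p. p tagged_partial_division_of {0..1} \<Longrightarrow> delta_fine \<delta> p \<Longrightarrow> (\<Sum>(t, I)\<in>p. e t I) < \<epsilon> * \<eta>"
    unfolding henstock_null_def by blast
  \<comment> \<open>Index set of the cover: tag and endpoints. Fineness is built in, so that finite
    subfamilies of disjoint members are admissible for \<open>\<delta>\<close>.\<close>
  define K where "K = {(t, a, b). 0 \<le> a \<and> a \<le> t \<and> t \<le> b \<and> b \<le> 1 \<and> a < b \<and>
    {a..b} \<subseteq> {t - \<delta> t <..< t + \<delta> t} \<and> \<eta> * (b - a) < e t {a..b}}"
  define c :: "real \<times> real \<times> real \<Rightarrow> real" where "c i = (fst (snd i) + snd (snd i)) / 2" for i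
  define r :: "real \<times> real \<times> real \<Rightarrow> real" where "r i = (snd (snd i) - fst (snd i)) / 2" for i
  have cb: "cball (c (t, a, b)) (r (t, a, b)) = {a..b}" for t a b
    by (simp add: c_def r_def cball_eq_atLeastAtMost field_simps)
  have S: "\<exists>i. i \<in> K \<and> x \<in> cball (c i) (r i) \<and> r i < d" if x: "x \<in> ?B" and d: "0 < d" for x d
  proof -
    have "0 < min d (\<delta> x)"
      using \<delta>(1) x d by (auto simp: gauge_fun_def)
    then obtain a b where ab: "0 \<le> a" "a \<le> x" "x \<le> b" "b \<le> 1" "a < b" "b - a < min d (\<delta> x)"
      "\<eta> * (b - a) < e x {a..b}"
      using x by blast
    then have "(x, a, b) \<in> K" by (auto simp: K_def)
    moreover have "x \<in> cball (c (x, a, b)) (r (x, a, b))"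
      unfolding cb using ab by simp
    moreover have "r (x, a, b) < d"
      using ab by (simp add: r_def)
    ultimately show ?thesis by blast
  qed
  have rpos: "0 < r i" if "i \<in> K" for i
    using that by (auto simp: K_def r_def)
  obtain C where C: "countable C" "C \<subseteq> K"
    "pairwise (\<lambda>i j. disjnt (cball (c i) (r i)) (cball (c j) (r j))) C"
    "negligible (?B - (\<Union>i\<in>C. cball (c i) (r i)))"
    by (rule Vitali_covering_theorem_cballs[OF rpos S])
  define U where "U = (\<Union>i\<in>C. cball (c i) (r i))"
  have bound: "measure lebesgue (\<Union>i\<in>F. cball (c i) (r i)) \<le> \<epsilon>" if F: "F \<subseteq> C" "finite F" for F
  proof -
    define p where "p = (\<lambda>(t, a, b). (t, {a..b})) ` F"
    have FK: "0 \<le> a" "a \<le> t" "t \<le> b" "b \<le> 1" "a < b" "{a..b} \<subseteq> {t - \<delta> t <..< t + \<delta> t}"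
      "\<eta> * (b - a) < e t {a..b}" if "(t, a, b) \<in> F" for t a b
      using that F(1) C(2) by (auto simp: K_def)
    have inj: "inj_on (\<lambda>(t, a, b). (t, {a..b})) F"
      by (auto simp: inj_on_def Icc_eq_Icc dest!: FK(5))
    have "p tagged_partial_division_of {0..1}"
      unfolding tagged_partial_division_of_def
    proof (intro conjI allI impI)
      show "finite p" using F by (simp add: p_def)
    next
      fix x K assume "(x, K) \<in> p"
      then obtain a b where ab: "(x, a, b) \<in> F" "K = {a..b}" by (auto simp: p_def)
      show "x \<in> K" "K \<subseteq> {0..1}"
        using ab FK[OF ab(1)] by auto
      show "\<exists>a b. K = cbox a b"
        using ab by (auto simp: cbox_interval)
    next
      fix x1 K1 x2 K2
      assume "(x1, K1) \<in> p \<and> (x2, K2) \<in> p \<and> (x1, K1) \<noteq> (x2, K2)"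
      then obtain a b u v where *: "(x1, a, b) \<in> F" "K1 = {a..b}" "(x2, u, v) \<in> F" "K2 = {u..v}"
        "(x1, a, b) \<noteq> (x2, u, v)" by (auto simp: p_def)
      then have "disjnt {a..b} {u..v}"
        using pairwiseD[OF C(3), of "(x1, a, b)" "(x2, u, v)"] F(1) by (auto simp: cb)
      then show "interior K1 \<inter> interior K2 = {}"
        using * interior_subset[of K1] interior_subset[of K2] by (auto simp: disjnt_def)
    qed
    moreover have "delta_fine \<delta> p"
      using FK(6) by (auto simp: delta_fine_def fine_def p_def)
    ultimately have sm: "(\<Sum>(t, I)\<in>p. e t I) < \<epsilon> * \<eta>"
      by (rule \<delta>(2))
    have "measure lebesgue (\<Union>i\<in>F. cball (c i) (r i)) \<le> (\<Sum>i\<in>F. measure lebesgue (cball (c i) (r i)))"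
      using F(2) by (intro measure_UNION_le) auto
    also have "\<dots> \<le> (\<Sum>(t, a, b)\<in>F. e t {a..b} / \<eta>)"
    proof (rule sum_mono)
      fix i assume i: "i \<in> F"
      obtain t a b where tab: "i = (t, a, b)" by (cases i)
      from FK(5,7)[of t a b] i tab \<eta>
      show "measure lebesgue (cball (c i) (r i)) \<le> (case i of (t, a, b) \<Rightarrow> e t {a..b} / \<eta>)"
        by (simp add: cb field_simps)
    qed
    also have "\<dots> = (\<Sum>(t, I)\<in>p. e t I) / \<eta>"
      unfolding p_def sum.reindex[OF inj] by (simp add: sum_divide_distrib case_prod_beta')
    also have "\<dots> \<le> \<epsilon>"
      using sm \<eta> by (simp add: field_simps)
    finally show ?thesis .
  qed
  have U: "U \<in> lmeasurable" "measure lebesgue U \<le> \<epsilon>"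
    unfolding U_def
    by (rule fmeasurable_UN_bound[OF C(1) _ bound] measure_UN_bound[OF C(1) _ bound]; simp)+
  have N: "?B - U \<in> lmeasurable" "measure lebesgue (?B - U) = 0"
    using C(4) unfolding U_def by (auto simp: negligible_imp_measurable negligible_imp_measure0)
  show "\<exists>T. ?B \<subseteq> T \<and> T \<in> lmeasurable \<and> measure lebesgue T \<le> \<epsilon>"
  proof (intro exI conjI)
    show "?B \<subseteq> U \<union> (?B - U)" by blast
    show "U \<union> (?B - U) \<in> lmeasurable"
      using U N by (intro fmeasurable.Un)
    show "measure lebesgue (U \<union> (?B - U)) \<le> \<epsilon>"
      using measure_Un_le[of U lebesgue "?B - U"] U N by (auto dest: fmeasurableD)
  qed
qed

text \<open>The null set is the union over \<open>\<eta> = 1 / Suc n\<close>, so it does not depend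
  on \<open>\<eta>\<close>. With \<open>vh_error\<close> for \<open>e\<close> it does not depend on
  the functional either, which yields differentiation of all support functions at once, uniformly on
  the unit ball.\<close>

lemma henstock_null_derivative_zero:
  assumes e: "henstock_null e" and nonneg: "\<And>t I. 0 \<le> e t I"
  obtains N where "negligible N"
    "\<And>t \<eta>. t \<in> {0..1} \<Longrightarrow> t \<notin> N \<Longrightarrow> 0 < \<eta> \<Longrightarrow>
       \<exists>r>0. \<forall>a b. 0 \<le> a \<and> a \<le> t \<and> t \<le> b \<and> b \<le> 1 \<and> a < b \<and> b - a < r \<longrightarrow> e t {a..b} \<le> \<eta> * (b - a)"
proof
  let ?B = "\<lambda>\<eta>. {t \<in> {0..1}. \<forall>r>0. \<exists>a b. 0 \<le> a \<and> a \<le> t \<and> t \<le> b \<and> b \<le> 1 \<and> a < b \<and> b - a < r \<and>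
    \<eta> * (b - a) < e t {a..b}}"
  show "negligible (\<Union>n. ?B (1 / real (Suc n)))"
    by (intro negligible_Union_nat henstock_null_negligible assms) simp
  fix t \<eta> :: real assume t: "t \<in> {0..1}" "t \<notin> (\<Union>n. ?B (1 / real (Suc n)))" and \<eta>: "0 < \<eta>"
  obtain n where n: "1 / real (Suc n) < \<eta>"
    using \<eta> nat_approx_posE by blast
  have "t \<notin> ?B (1 / real (Suc n))"
    using t(2) by blast
  then obtain r where r: "0 < r" "\<And>a b. 0 \<le> a \<and> a \<le> t \<and> t \<le> b \<and> b \<le> 1 \<and> a < b \<and> b - a < r \<Longrightarrow>
      \<not> 1 / real (Suc n) * (b - a) < e t {a..b}"
    using t(1) by blast
  show "\<exists>r>0. \<forall>a b. 0 \<le> a \<and> a \<le> t \<and> t \<le> b \<and> b \<le> 1 \<and> a < b \<and> b - a < r \<longrightarrow> e t {a..b} \<le> \<eta> * (b - a)"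
  proof (intro exI conjI allI impI)
    show "0 < r" by fact
    fix a b assume ab: "0 \<le> a \<and> a \<le> t \<and> t \<le> b \<and> b \<le> 1 \<and> a < b \<and> b - a < r"
    then have "e t {a..b} \<le> 1 / real (Suc n) * (b - a)"
      using r(2) by (simp add: not_less)
    also have "\<dots> \<le> \<eta> * (b - a)"
      using n ab by (intro mult_right_mono) auto
    finally show "e t {a..b} \<le> \<eta> * (b - a)" .
  qed
qed

text \<open>Increments of \<open>H\<close> telescope over a tagged division, so the error of a
  Riemann sum is at most \<open>C\<close> times a small sum of \<open>e\<close>.\<close>

lemma henstock_null_has_integral:
  fixes h H :: "real \<Rightarrow> real"
  assumes e: "henstock_null e" and nonneg: "\<And>t I. 0 \<le> e t I" and ab: "0 \<le> a" "a \<le> b" "b \<le> 1"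
    and C: "0 \<le> C" "\<And>t u v. 0 \<le> u \<Longrightarrow> u \<le> t \<Longrightarrow> t \<le> v \<Longrightarrow> v \<le> 1 \<Longrightarrow> \<bar>(v - u) * h t - (H v - H u)\<bar> \<le> C * e t {u..v}"
  shows "(h has_integral H b - H a) {a..b}"
  unfolding has_integral_real
proof (intro allI impI)
  fix \<epsilon> :: real assume \<epsilon>: "0 < \<epsilon>"
  define \<epsilon>' where "\<epsilon>' = \<epsilon> / (C + 1)"
  have \<epsilon>': "0 < \<epsilon>'" "C * \<epsilon>' < \<epsilon>"
    using \<epsilon> C(1) by (auto simp: \<epsilon>'_def field_simps)
  from e \<epsilon>'(1) obtain \<delta> where \<delta>: "gauge_fun \<delta>"
    "\<And>p. p tagged_partial_division_of {0..1} \<Longrightarrow> delta_fine \<delta> p \<Longrightarrow> (\<Sum>(t, I)\<in>p. e t I) < \<epsilon>'"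
    unfolding henstock_null_def by blast
  obtain \<gamma> where \<gamma>: "gauge \<gamma>" "\<And>t. t \<in> {0..1} \<Longrightarrow> \<gamma> t = {t - \<delta> t <..< t + \<delta> t}"
    using gauge_of_gauge_fun[OF \<delta>(1)] by metis
  show "\<exists>\<gamma>. gauge \<gamma> \<and> (\<forall>p. p tagged_division_of {a..b} \<and> \<gamma> fine p \<longrightarrow>
      norm ((\<Sum>(x, k)\<in>p. measure lborel k *\<^sub>R h x) - (H b - H a)) < \<epsilon>)"
  proof (intro exI conjI allI impI)
    show "gauge \<gamma>" by fact
    fix p assume p: "p tagged_division_of {a..b} \<and> \<gamma> fine p"
    have part: "p tagged_partial_division_of {0..1}"
      using p ab unfolding tagged_division_of_def tagged_partial_division_of_def
      by (meson atLeastatMost_subset_iff order_trans)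
    have tags: "t \<in> {0..1}" if "(t, I) \<in> p" for t I
      using tagged_partial_division_ofD(2,3)[OF part that] by blast
    have "delta_fine \<delta> p"
      unfolding delta_fine_def
    proof (rule fineI)
      show "I \<subseteq> {t - \<delta> t <..< t + \<delta> t}" if "(t, I) \<in> p" for t I
        using p that \<gamma>(2)[OF tags[OF that]] fineD by metis
    qed
    with part have sm: "(\<Sum>(t, I)\<in>p. e t I) < \<epsilon>'"
      by (rule \<delta>(2))
    have "(\<Sum>(x, k)\<in>p. measure lborel k *\<^sub>R h x) - (H b - H a) =
        (\<Sum>(x, k)\<in>p. measure lborel k *\<^sub>R h x - (H (Sup k) - H (Inf k)))"
      using additive_tagged_division_1[OF ab(2), of p H] p
      by (simp add: sum_subtractf case_prod_beta')
    also have "norm \<dots> \<le> (\<Sum>(x, k)\<in>p. C * e x k)"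
    proof (rule sum_norm_le)
      fix xk assume "xk \<in> p"
      then obtain x k where xk: "xk = (x, k)" "(x, k) \<in> p" by (cases xk) auto
      obtain u v where "k = {u..v}" "0 \<le> u" "u \<le> x" "x \<le> v" "v \<le> 1"
        using tagged_partial_division_subintervals[OF part xk(2)] .
      with C(2)[of u x v] show "norm (case xk of (x, k) \<Rightarrow> measure lborel k *\<^sub>R h x - (H (Sup k) - H (Inf k)))
          \<le> (case xk of (x, k) \<Rightarrow> C * e x k)"
        by (simp add: xk(1))
    qed
    also have "\<dots> = C * (\<Sum>(x, k)\<in>p. e x k)"
      by (simp add: sum_distrib_left case_prod_beta')
    also have "\<dots> \<le> C * \<epsilon>'"
      using sm C(1) by (intro mult_left_mono) auto
    also have "\<dots> < \<epsilon>" by (rule \<epsilon>'(2))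
    finally show "norm ((\<Sum>(x, k)\<in>p. measure lborel k *\<^sub>R h x) - (H b - H a)) < \<epsilon>" .
  qed
qed

text \<open>This is the Saks-Henstock lemma. Together with
  \<open>henstock_null_derivative_zero\<close> it gives Lebesgue's differentiation theorem for
  indefinite integrals.\<close>

lemma henstock_null_integrable:
  fixes h :: "real \<Rightarrow> real"
  assumes "h integrable_on {0..1}"
  shows "henstock_null (\<lambda>t I. \<bar>measure lborel I * h t - integral I h\<bar>)"
  unfolding henstock_null_def
proof (intro allI impI)
  fix \<epsilon> :: real assume "0 < \<epsilon>"
  have "h integrable_on cbox 0 1"
    using assms by simp
  then obtain \<gamma> where \<gamma>: "gauge \<gamma>" "\<And>p. p tagged_partial_division_of cbox 0 1 \<Longrightarrow> \<gamma> fine p \<Longrightarrow>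
      (\<Sum>(x, k)\<in>p. norm (measure lborel k *\<^sub>R h x - integral k h)) < \<epsilon>"
    by (rule Henstock_lemma[OF _ \<open>0 < \<epsilon>\<close>]) (rule that, assumption, blast)
  obtain \<delta> where \<delta>: "gauge_fun \<delta>" "\<And>t. {t - \<delta> t <..< t + \<delta> t} \<subseteq> \<gamma> t"
    using gauge_fun_of_gauge[OF \<gamma>(1)] by metis
  have "\<gamma> fine p" if "delta_fine \<delta> p" for p
    using that \<delta>(2) unfolding delta_fine_def fine_def by fast
  with \<delta>(1) \<gamma>(2) show "\<exists>\<delta>. gauge_fun \<delta> \<and> (\<forall>p. p tagged_partial_division_of {0..1} \<and> delta_fine \<delta> p \<longrightarrow>
      (\<Sum>(t, I)\<in>p. \<bar>measure lborel I * h t - integral I h\<bar>) < \<epsilon>)"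
    by (intro exI[of _ \<delta>]) (auto simp del: content_real_if)
qed

section \<open>Variational Henstock primitives\<close>

text \<open>Between bounded non-empty sets the distance is finite, so passing to \<open>real\<close>
  loses nothing there; see \<open>vh_error_eq\<close>.\<close>

definition vh_error :: "(real \<Rightarrow> 'a::real_normed_vector set) \<Rightarrow> (real set \<Rightarrow> 'a set) \<Rightarrow> real \<Rightarrow> real set \<Rightarrow> real"
  where "vh_error \<Gamma> \<Phi> t I = enn2real (hausdorff_distance (\<Phi> I) ((*\<^sub>R) (measure lborel I) ` \<Gamma> t))"

lemma vh_error_nonneg: "0 \<le> vh_error \<Gamma> \<Phi> t I"
  by (simp add: vh_error_def)

lemma cwk_scaleR: 
  assumes "C \<in> cwk"
  shows "(*\<^sub>R) c ` C \<noteq> {}" "bounded ((*\<^sub>R) c ` C)" "convex ((*\<^sub>R) c ` C)"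
  using assms by (auto simp: bounded_scaling cwk_bounded cwkD convex_scaling)

lemma vh_error_eq:
  assumes "\<Phi> I \<in> cwk" "\<Gamma> t \<in> cwk"
  shows "hausdorff_distance (\<Phi> I) ((*\<^sub>R) (measure lborel I) ` \<Gamma> t) = ennreal (vh_error \<Gamma> \<Phi> t I)"
  using hausdorff_distance_finite[of "\<Phi> I" "(*\<^sub>R) (measure lborel I) ` \<Gamma> t"] assms
  by (simp add: vh_error_def cwk_bounded cwk_scaleR cwkD)

context
  fixes \<Gamma> :: "real \<Rightarrow> 'a::real_normed_vector set" and \<Phi>
  assumes cwk: "\<And>t. t \<in> {0..1} \<Longrightarrow> \<Gamma> t \<in> cwk" and prim: "has_vH_primitive \<Gamma> \<Phi>"
begin

lemma vh_primitive_cwk: "I \<in> subintervals \<Longrightarrow> \<Phi> I \<in> cwk"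
  using prim by (simp add: has_vH_primitive_def)

lemma henstock_null_vh_error: "henstock_null (vh_error \<Gamma> \<Phi>)"
  unfolding henstock_null_def
proof (intro allI impI)
  fix \<epsilon> :: real assume "0 < \<epsilon>"
  then obtain \<delta> where \<delta>: "gauge_fun \<delta>" "\<And>p. p tagged_division_of {0..1} \<Longrightarrow> delta_fine \<delta> p \<Longrightarrow>
      (\<Sum>(t, I)\<in>p. hausdorff_distance (\<Phi> I) ((*\<^sub>R) (measure lborel I) ` \<Gamma> t)) < ennreal \<epsilon>"
    using prim unfolding has_vH_primitive_def by blast
  show "\<exists>\<delta>. gauge_fun \<delta> \<and> (\<forall>p. p tagged_partial_division_of {0..1} \<and> delta_fine \<delta> p \<longrightarrow>
      (\<Sum>(t, I)\<in>p. vh_error \<Gamma> \<Phi> t I) < \<epsilon>)"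
  proof (intro exI conjI allI impI)
    show "gauge_fun \<delta>" by fact
    fix p assume "p tagged_partial_division_of {0..1} \<and> delta_fine \<delta> p"
    then obtain q where q: "q tagged_division_of {0..1}" "delta_fine \<delta> q" "p \<subseteq> q"
      using fine_partial_division_extend[OF \<delta>(1)] by metis
    have qpart: "q tagged_partial_division_of {0..1}"
      using q(1) by (simp add: tagged_division_of_def)
    have "(\<Sum>(t, I)\<in>q. hausdorff_distance (\<Phi> I) ((*\<^sub>R) (measure lborel I) ` \<Gamma> t)) =
        (\<Sum>(t, I)\<in>q. ennreal (vh_error \<Gamma> \<Phi> t I))"
    proof (rule sum.cong[OF refl])
      fix y assume "y \<in> q"
      then obtain t I where y: "y = (t, I)" "(t, I) \<in> q" by (cases y) auto
      obtain a b where "I = {a..b}" "0 \<le> a" "a \<le> t" "t \<le> b" "b \<le> 1"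
        using tagged_partial_division_subintervals[OF qpart y(2)] .
      then show "(case y of (t, I) \<Rightarrow> hausdorff_distance (\<Phi> I) ((*\<^sub>R) (measure lborel I) ` \<Gamma> t)) =
          (case y of (t, I) \<Rightarrow> ennreal (vh_error \<Gamma> \<Phi> t I))"
        using vh_error_eq[of \<Phi> I \<Gamma> t] vh_primitive_cwk[OF subintervalsI, of a b] cwk[of t]
        by (simp add: y(1) del: content_real_if)
    qed
    also have "\<dots> = ennreal (\<Sum>(t, I)\<in>q. vh_error \<Gamma> \<Phi> t I)"
      by (simp add: case_prod_beta' vh_error_nonneg sum_ennreal)
    finally have "(\<Sum>(t, I)\<in>q. vh_error \<Gamma> \<Phi> t I) < \<epsilon>"
      using \<delta>(2)[OF q(1,2)] by (simp add: ennreal_less_iff sum_nonneg vh_error_nonneg case_prod_beta')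
    moreover have "(\<Sum>(t, I)\<in>p. vh_error \<Gamma> \<Phi> t I) \<le> (\<Sum>(t, I)\<in>q. vh_error \<Gamma> \<Phi> t I)"
      using q by (intro sum_mono2) (auto simp: vh_error_nonneg)
    ultimately show "(\<Sum>(t, I)\<in>p. vh_error \<Gamma> \<Phi> t I) < \<epsilon>" by simp
  qed
qed

text \<open>Additivity of the primitive together with additivity of support functions under
  Minkowski sums turns every interval value into an increment of the point function
  \<open>t \<mapsto> support_fun f (\<Phi> {0..t})\<close>.\<close>

lemma support_fun_primitive_diff:
  assumes "0 \<le> a" "a \<le> b" "b \<le> 1"
  shows "support_fun f (\<Phi> {a..b}) = support_fun f (\<Phi> {0..b}) - support_fun f (\<Phi> {0..a})"
proof -
  have I: "{0..a} \<in> subintervals" "{a..b} \<in> subintervals" "{0..a} \<union> {a..b} = {0..b}" "{0..b} \<in> subintervals"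
    using assms by (auto intro!: subintervalsI)
  have "interior {0..a} \<inter> interior {a..b} = {}"
    by (auto simp: interior_atLeastAtMost_real)
  then have "\<Phi> ({0..a} \<union> {a..b}) = \<Phi> {0..a} + \<Phi> {a..b}"
    using prim I unfolding has_vH_primitive_def additive_interval_fun_def by metis
  then have "\<Phi> {0..b} = \<Phi> {0..a} + \<Phi> {a..b}"
    by (simp only: I(3))
  then show ?thesis
    using support_fun_plus[of "\<Phi> {0..a}" "\<Phi> {a..b}" f] I vh_primitive_cwk
    by (simp add: cwkD(1) cwk_bounded)
qed

lemma support_fun_vh_error:
  assumes "0 \<le> a" "a \<le> b" "b \<le> 1" "t \<in> {0..1}"
  shows "\<bar>(b - a) * support_fun f (\<Gamma> t) - support_fun f (\<Phi> {a..b})\<bar> \<le> norm f * vh_error \<Gamma> \<Phi> t {a..b}"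
proof -
  have c: "\<Phi> {a..b} \<in> cwk" "\<Gamma> t \<in> cwk"
    using assms by (auto intro!: vh_primitive_cwk subintervalsI cwk)
  note c' = cwk_scaleR[OF c(2), of "measure lborel {a..b}"]
  have "\<bar>support_fun f (\<Phi> {a..b}) - support_fun f ((*\<^sub>R) (measure lborel {a..b}) ` \<Gamma> t)\<bar>
      \<le> norm f * vh_error \<Gamma> \<Phi> t {a..b}"
    using c c' by (intro support_fun_diff_le_hausdorff')
      (auto simp: vh_error_eq vh_error_nonneg cwk_bdd_above bdd_above_functional cwkD(1)
        simp del: content_real_if)
  moreover have "support_fun f ((*\<^sub>R) (measure lborel {a..b}) ` \<Gamma> t) = (b - a) * support_fun f (\<Gamma> t)"
    using c assms by (subst support_fun_scaleR) (auto simp: cwkD(1) cwk_bounded)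
  ultimately show ?thesis by (simp add: abs_minus_commute)
qed

lemma support_fun_has_integral:
  assumes "0 \<le> a" "a \<le> b" "b \<le> 1"
  shows "((\<lambda>t. support_fun f (\<Gamma> t)) has_integral support_fun f (\<Phi> {a..b})) {a..b}"
  unfolding support_fun_primitive_diff[OF assms]
proof (rule henstock_null_has_integral[OF henstock_null_vh_error vh_error_nonneg assms norm_ge_zero])
  fix t u v :: real assume "0 \<le> u" "u \<le> t" "t \<le> v" "v \<le> 1"
  then show "\<bar>(v - u) * support_fun f (\<Gamma> t) - (support_fun f (\<Phi> {0..v}) - support_fun f (\<Phi> {0..u}))\<bar>
      \<le> norm f * vh_error \<Gamma> \<Phi> t {u..v}"
    using support_fun_vh_error[of u v t f] support_fun_primitive_diff[of u v f] by simp
qed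

end

section \<open>Weakly subseries convergent series\<close>

text \<open>If the diagonal does not tend to 0, indices \<open>\<kappa> n\<close> are chosen such
  that row \<open>\<kappa> (Suc n)\<close> has mass below \<open>\<epsilon> / 4\<close> on the
  columns up to \<open>\<kappa> n\<close> and again on those from
  \<open>\<kappa> (Suc (Suc n))\<close> on. Summing this row over the chosen columns leaves its
  diagonal entry up to \<open>\<epsilon> / 2\<close>, against the assumption on subsums.\<close>

lemma gliding_hump:
  fixes a :: "nat \<Rightarrow> nat \<Rightarrow> real"
  assumes rows: "\<And>i. summable (\<lambda>j. \<bar>a i j\<bar>)"
    and sums: "\<And>S. (\<lambda>i. \<Sum>j. if j \<in> S then a i j else 0) \<longlonglongrightarrow> 0"
  shows "(\<lambda>i. a i i) \<longlonglongrightarrow> 0"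
proof (rule ccontr)
  assume "\<not> (\<lambda>i. a i i) \<longlonglongrightarrow> 0"
  then obtain \<epsilon> where \<epsilon>: "0 < \<epsilon>" "\<And>n. \<exists>i\<ge>n. \<epsilon> \<le> \<bar>a i i\<bar>"
    unfolding LIMSEQ_iff by (auto simp: not_less)
  have cols: "(\<lambda>i. \<bar>a i j\<bar>) \<longlonglongrightarrow> 0" for j
  proof -
    have "(\<Sum>j'. if j' \<in> {j} then a i j' else 0) = a i j" for i
      using sums_unique[OF sums_single[of j "a i"]] by simp
    with sums[of "{j}"] show ?thesis
      by (simp add: tendsto_rabs_zero)
  qed
  \<comment> \<open>The head is small for large \<open>k'\<close> because the columns tend to 0, the
    tail because row \<open>k\<close> is summable, and large diagonal entries occur arbitrarily
    late.\<close>
  have step: "\<exists>k'>k. \<epsilon> \<le> \<bar>a k' k'\<bar> \<and> (\<Sum>j\<le>k. \<bar>a k' j\<bar>) < \<epsilon> / 4 \<and> (\<Sum>j. \<bar>a k (j + k')\<bar>) < \<epsilon> / 4" for k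
  proof -
    have "(\<lambda>i. \<Sum>j\<le>k. \<bar>a i j\<bar>) \<longlonglongrightarrow> (\<Sum>j\<le>k. 0)"
      by (intro tendsto_sum cols)
    then have 1: "\<forall>\<^sub>F i in sequentially. (\<Sum>j\<le>k. \<bar>a i j\<bar>) < \<epsilon> / 4"
      by (rule order_tendstoD(2)) (use \<epsilon> in simp)
    have 2: "\<forall>\<^sub>F i in sequentially. (\<Sum>j. \<bar>a k (j + i)\<bar>) < \<epsilon> / 4"
      by (rule order_tendstoD(2)[OF suminf_exist_split2[OF rows]]) (use \<epsilon> in simp)
    obtain n where n: "\<And>i. n \<le> i \<Longrightarrow> (\<Sum>j\<le>k. \<bar>a i j\<bar>) < \<epsilon> / 4 \<and> (\<Sum>j. \<bar>a k (j + i)\<bar>) < \<epsilon> / 4"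
      using eventually_conj[OF 1 2] by (auto simp: eventually_sequentially)
    obtain i where "max n (Suc k) \<le> i" "\<epsilon> \<le> \<bar>a i i\<bar>"
      using \<epsilon>(2) by blast
    with n[of i] show ?thesis
      by (intro exI[of _ i]) auto
  qed
  obtain k0 where k0: "\<epsilon> \<le> \<bar>a k0 k0\<bar>"
    using \<epsilon>(2) by blast
  obtain \<kappa> where \<kappa>: "\<And>n. \<epsilon> \<le> \<bar>a (\<kappa> n) (\<kappa> n)\<bar>" "\<And>n. \<kappa> n < \<kappa> (Suc n)"
    "\<And>n. (\<Sum>j\<le>\<kappa> n. \<bar>a (\<kappa> (Suc n)) j\<bar>) < \<epsilon> / 4" "\<And>n. (\<Sum>j. \<bar>a (\<kappa> n) (j + \<kappa> (Suc n))\<bar>) < \<epsilon> / 4"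
    using dependent_nat_choice[of "\<lambda>_ k. \<epsilon> \<le> \<bar>a k k\<bar>"
      "\<lambda>_ k k'. k < k' \<and> (\<Sum>j\<le>k. \<bar>a k' j\<bar>) < \<epsilon> / 4 \<and> (\<Sum>j. \<bar>a k (j + k')\<bar>) < \<epsilon> / 4"] k0 step
    by metis
  have mono: "strict_mono \<kappa>"
    using \<kappa>(2) by (simp add: strict_mono_Suc_iff)
  define S where "S = range \<kappa>"
  have big: "\<epsilon> / 2 \<le> \<bar>\<Sum>j. if j \<in> S then a (\<kappa> (Suc n)) j else 0\<bar>" for n
  proof -
    define m where "m = \<kappa> (Suc n)"
    define p where "p = \<kappa> n"
    define q where "q = \<kappa> (Suc (Suc n))"
    have gap: "j \<le> p \<or> q \<le> j" if j: "j \<in> S" "j \<noteq> m" for j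
    proof -
      obtain i where i: "j = \<kappa> i" using j(1) by (auto simp: S_def)
      then have "i \<noteq> Suc n" using j(2) by (auto simp: m_def)
      then have "i \<le> n \<or> Suc (Suc n) \<le> i" by linarith
      then show ?thesis
        using strict_mono_less_eq[OF mono] by (auto simp: i p_def q_def)
    qed
    have row: "summable (\<lambda>j. \<bar>a m j\<bar>)" by (rule rows)
    have row': "summable (\<lambda>j. a m j)" using row by (rule summable_rabs_cancel)
    have T: "summable (\<lambda>j. if j \<in> X then a m j else 0)" for X
      by (rule summable_comparison_test'[OF row, of 0]) auto
    have T': "summable (\<lambda>j. if j \<in> X then \<bar>a m j\<bar> else 0)" for X
      by (rule summable_comparison_test'[OF row, of 0]) auto
    have "(\<Sum>j. if j \<in> S then a m j else 0) = (\<Sum>j. (if j \<in> {m} then a m j else 0) + (if j \<in> S - {m} then a m j else 0))"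
      by (intro suminf_cong) (auto simp: S_def m_def)
    also have "\<dots> = (\<Sum>j. if j \<in> {m} then a m j else 0) + (\<Sum>j. if j \<in> S - {m} then a m j else 0)"
      by (rule suminf_add[symmetric, OF T T])
    also have "(\<Sum>j. if j \<in> {m} then a m j else 0) = a m m"
      using sums_unique[OF sums_single[of m "a m"]] by simp
    finally have split: "(\<Sum>j. if j \<in> S then a m j else 0) = a m m + (\<Sum>j. if j \<in> S - {m} then a m j else 0)" .
    have "\<bar>\<Sum>j. if j \<in> S - {m} then a m j else 0\<bar> \<le> (\<Sum>j. \<bar>if j \<in> S - {m} then a m j else 0\<bar>)"
      by (rule summable_rabs) (rule summable_comparison_test'[OF row, of 0], auto)
    also have "\<dots> \<le> (\<Sum>j. (if j \<in> {..p} then \<bar>a m j\<bar> else 0) + (if j \<in> {q..} then \<bar>a m j\<bar> else 0))"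
      using gap by (intro suminf_le summable_add T' summable_comparison_test'[OF row, of 0]) auto
    also have "\<dots> = (\<Sum>j. if j \<in> {..p} then \<bar>a m j\<bar> else 0) + (\<Sum>j. if j \<in> {q..} then \<bar>a m j\<bar> else 0)"
      by (rule suminf_add[symmetric, OF T' T'])
    also have "(\<Sum>j. if j \<in> {..p} then \<bar>a m j\<bar> else 0) = (\<Sum>j\<le>p. \<bar>a m j\<bar>)"
      by (subst suminf_finite[of "{..p}"]) auto
    also have "(\<Sum>j. if j \<in> {q..} then \<bar>a m j\<bar> else 0) = (\<Sum>j. \<bar>a m (j + q)\<bar>)"
      by (subst suminf_split_initial_segment[OF T', of _ q]) simp
    also have "(\<Sum>j\<le>p. \<bar>a m j\<bar>) + (\<Sum>j. \<bar>a m (j + q)\<bar>) < \<epsilon> / 2"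
      using \<kappa>(3)[of n] \<kappa>(4)[of "Suc n"] by (simp add: m_def p_def q_def)
    finally show ?thesis
      using split \<kappa>(1)[of "Suc n"] unfolding m_def by linarith
  qed
  have "(\<lambda>n. \<bar>\<Sum>j. if j \<in> S then a (\<kappa> (Suc n)) j else 0\<bar>) \<longlonglongrightarrow> 0"
    using LIMSEQ_subseq_LIMSEQ[OF sums[of S], of "\<kappa> \<circ> Suc"] mono
    by (intro tendsto_rabs_zero) (simp add: o_def strict_mono_def)
  then have "\<forall>\<^sub>F n in sequentially. \<bar>\<Sum>j. if j \<in> S then a (\<kappa> (Suc n)) j else 0\<bar> < \<epsilon> / 2"
    by (rule order_tendstoD(2)) (use \<epsilon> in simp)
  then show False
    using big by (auto simp: eventually_sequentially not_less[symmetric])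
qed

text \<open>A point outside has positive distance to \<open>C\<close>. The separating functional is
  bounded above on a subspace, hence zero on it, but not at \<open>y\<close>.\<close>

lemma mem_closed_subspaceI:
  fixes C :: "'a::real_normed_vector set"
  assumes C: "subspace C" "closed C"
    and f: "\<And>f :: 'a \<Rightarrow>\<^sub>L real. (\<And>c. c \<in> C \<Longrightarrow> blinfun_apply f c = 0) \<Longrightarrow> blinfun_apply f y = 0"
  shows "y \<in> C"
proof (rule ccontr)
  assume y: "y \<notin> C"
  have ne: "C \<noteq> {}" using subspace_0[OF C(1)] by blast
  define d where "d = infdist y C"
  have d: "0 < d"
    using y C(2) ne in_closed_iff_infdist_zero[of C y] infdist_nonneg[of y C] by (simp add: d_def less_le)
  have "convex ((\<lambda>c. y - c) ` C)"
    using convex_translation[OF convex_negations[OF subspace_imp_convex[OF C(1)]], of y]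
    by (simp add: image_image)
  moreover have "d \<le> norm z" if "z \<in> (\<lambda>c. y - c) ` C" for z
    using that infdist_le[of _ C y] by (auto simp: dist_norm d_def)
  ultimately obtain g :: "'a \<Rightarrow>\<^sub>L real" where g: "\<And>z. z \<in> (\<lambda>c. y - c) ` C \<Longrightarrow> d \<le> blinfun_apply g z"
    using separate_from_convex[of "(\<lambda>c. y - c) ` C" d] ne by blast
  have le: "blinfun_apply g c \<le> blinfun_apply g y - d" if "c \<in> C" for c
    using g[of "y - c"] that by (simp add: blinfun.diff_right)
  have "blinfun_apply g c = 0" if "c \<in> C" for c
  proof (rule ccontr)
    assume nz: "blinfun_apply g c \<noteq> 0"
    \<comment> \<open>The multiple \<open>t *\<^sub>R c\<close> has value \<open>g y + 1\<close>,
      above the bound valid on \<open>C\<close>.\<close>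
    define t where "t = (blinfun_apply g y + 1) / blinfun_apply g c"
    have "blinfun_apply g (t *\<^sub>R c) \<le> blinfun_apply g y - d"
      using that C(1) by (intro le subspace_scale)
    with nz d show False by (simp add: t_def blinfun.scaleR_right)
  qed
  then have "blinfun_apply g y = 0" by (rule f)
  with le[OF subspace_0[OF C(1)]] d show False by simp
qed

text \<open>The values lie in a countable product of compact intervals, which is compact and
  metrizable, hence sequentially compact.\<close>

lemma pointwise_convergent_subseq:
  fixes g :: "nat \<Rightarrow> nat \<Rightarrow> real"
  assumes "\<And>n j. \<bar>g n j\<bar> \<le> b j"
  obtains r where "strict_mono r" "\<And>j. convergent (\<lambda>n. g (r n) j)"
proof -
  have "compactin (product_topology (\<lambda>i::nat. euclideanreal) UNIV) (PiE UNIV (\<lambda>j. {- b j..b j}))"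
    by (subst compactin_PiE) auto
  then have "compact (PiE UNIV (\<lambda>j. {- b j..b j}))"
    by (simp add: euclidean_product_topology)
  then have "seq_compact (PiE UNIV (\<lambda>j. {- b j..b j}))"
    by (rule compact_imp_seq_compact)
  moreover have "g n \<in> PiE UNIV (\<lambda>j. {- b j..b j})" for n
    using assms[of n] by (auto simp: abs_le_iff minus_le_iff)
  ultimately obtain l r where r: "strict_mono r" "(g \<circ> r) \<longlonglongrightarrow> l"
    unfolding seq_compact_def by blast
  have "(\<lambda>n. g (r n) j) \<longlonglongrightarrow> l j" for j
    using continuous_on_tendsto_compose[OF continuous_on_product_coordinates[of j] r(2)] by (simp add: o_def)
  with r(1) that show thesis by (auto simp: convergent_def)
qed

lemma summable_abs_of_subseries:
  fixes f :: "nat \<Rightarrow> real"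
  assumes "\<And>S. summable (\<lambda>k. if k \<in> S then f k else 0)"
  shows "summable (\<lambda>k. \<bar>f k\<bar>)"
proof -
  have "(\<lambda>k. \<bar>f k\<bar>) = (\<lambda>k. (if k \<in> {k. 0 \<le> f k} then f k else 0) - (if k \<in> {k. f k < 0} then f k else 0))"
    by auto
  with summable_diff[OF assms[of "{k. 0 \<le> f k}"] assms[of "{k. f k < 0}"]] show ?thesis
    by metis
qed

text \<open>Suppose infinitely many terms have norm at least \<open>\<epsilon>\<close>. A
  subsequence \<open>w\<close> of their norming functionals converges at every term of the series,
  hence at every weak subsum. Differences of consecutive functionals therefore tend to 0 on all
  subsums, and \<open>gliding_hump\<close> forces the diagonal values to 0, although they stay above
  \<open>\<epsilon> / 2\<close>.\<close>

lemma orlicz_pettis: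
  fixes x :: "nat \<Rightarrow> 'a::real_normed_vector"
  assumes sub: "\<And>S. \<exists>y. \<forall>f :: 'a \<Rightarrow>\<^sub>L real. (\<lambda>k. if k \<in> S then blinfun_apply f (x k) else 0) sums blinfun_apply f y"
  shows "x \<longlonglongrightarrow> 0"
proof (rule ccontr)
  assume "\<not> x \<longlonglongrightarrow> 0"
  then obtain \<epsilon> where \<epsilon>: "0 < \<epsilon>" "\<And>n. \<exists>i\<ge>n. \<epsilon> \<le> norm (x i)"
    unfolding LIMSEQ_iff by (auto simp: not_less)
  have abs: "summable (\<lambda>k. \<bar>blinfun_apply f (x k)\<bar>)" for f :: "'a \<Rightarrow>\<^sub>L real"
  proof (rule summable_abs_of_subseries)
    fix S
    obtain y where "\<forall>f :: 'a \<Rightarrow>\<^sub>L real. (\<lambda>k. if k \<in> S then blinfun_apply f (x k) else 0) sums blinfun_apply f y"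
      using sub[of S] by blast
    then have "(\<lambda>k. if k \<in> S then blinfun_apply f (x k) else 0) sums blinfun_apply f y" ..
    then show "summable (\<lambda>k. if k \<in> S then blinfun_apply f (x k) else 0)"
      by (rule sums_summable)
  qed
  have "\<exists>s :: nat \<Rightarrow> nat. strict_mono s \<and> (\<forall>n. \<epsilon> \<le> norm (x (s n)))"
  proof -
    have "\<exists>f. \<forall>n. \<epsilon> \<le> norm (x (f n)) \<and> f n < f (Suc n)"
    proof (rule dependent_nat_choice)
      show "\<exists>i. \<epsilon> \<le> norm (x i)" using \<epsilon>(2) by blast
      show "\<exists>y. \<epsilon> \<le> norm (x y) \<and> i < y" for i
        using \<epsilon>(2)[of "Suc i"] by (auto simp: Suc_le_eq)
    qed
    then show ?thesis unfolding strict_mono_Suc_iff by blast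
  qed
  then obtain s :: "nat \<Rightarrow> nat" where s: "strict_mono s" "\<And>n. \<epsilon> \<le> norm (x (s n))" by blast
  have "\<forall>n. \<exists>f :: 'a \<Rightarrow>\<^sub>L real. norm f \<le> 1 \<and> blinfun_apply f (x (s n)) = norm (x (s n))"
    by (metis norming_functional)
  from choice[OF this] obtain u :: "nat \<Rightarrow> 'a \<Rightarrow>\<^sub>L real" where u: "\<And>n. norm (u n) \<le> 1"
    "\<And>n. blinfun_apply (u n) (x (s n)) = norm (x (s n))"
    by blast
  obtain r where r: "strict_mono r" "\<And>j. convergent (\<lambda>n. blinfun_apply (u (r n)) (x j))"
    using pointwise_convergent_subseq[of "\<lambda>n j. blinfun_apply (u n) (x j)" "\<lambda>j. norm (x j)"]
      blinfun_apply_le_unit[OF u(1)] by blast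
  define w where "w n = u (r n)" for n
  have w: "norm (w n) \<le> 1" for n by (simp add: w_def u)
  \<comment> \<open>The closed subspace of convergence of \<open>w\<close>: closedness comes from
    the uniform bound on the norms.\<close>
  define C where "C = {v. Cauchy (\<lambda>n. blinfun_apply (w n) v)}"
  have "subspace C"
    unfolding C_def subspace_def Cauchy_convergent_iff
    by (auto simp: blinfun.add_right blinfun.scaleR_right convergent_const
        intro: convergent_add convergent_mult)
  moreover have "closed C"
    unfolding closed_sequential_limits
  proof (intro allI impI)
    fix v l assume vl: "(\<forall>n. v n \<in> C) \<and> v \<longlonglongrightarrow> l"
    show "l \<in> C"
      unfolding C_def
    proof (simp, rule metric_CauchyI)
      fix e :: real assume e: "0 < e"
      then obtain i where i: "norm (v i - l) < e / 3"
        using vl LIMSEQ_D[of v l "e / 3"] by auto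
      have "Cauchy (\<lambda>n. blinfun_apply (w n) (v i))"
        using vl by (auto simp: C_def)
      then obtain M where M: "\<And>m n. M \<le> m \<Longrightarrow> M \<le> n \<Longrightarrow>
          dist (blinfun_apply (w m) (v i)) (blinfun_apply (w n) (v i)) < e / 3"
        using metric_CauchyD[of _ "e / 3"] e by (metis divide_pos_pos zero_less_numeral)
      have near: "\<bar>blinfun_apply (w n) (v i) - blinfun_apply (w n) l\<bar> < e / 3" for n
        using blinfun_apply_le_unit[OF w, of n "v i - l"] i by (simp add: blinfun.diff_right)
      show "\<exists>M. \<forall>m\<ge>M. \<forall>n\<ge>M. dist (blinfun_apply (w m) l) (blinfun_apply (w n) l) < e"
      proof (intro exI[of _ M] allI impI)
        fix m n assume "M \<le> m" "M \<le> n"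
        then show "dist (blinfun_apply (w m) l) (blinfun_apply (w n) l) < e"
          using M[of m n] near[of m] near[of n] unfolding dist_real_def by linarith
      qed
    qed
  qed
  ultimately have C: "subspace C" "closed C" .
  have Cx: "x j \<in> C" for j
    using r(2)[of j] by (simp add: C_def w_def Cauchy_convergent_iff)
  have small: "(\<lambda>n. blinfun_apply f (x n)) \<longlonglongrightarrow> 0" for f :: "'a \<Rightarrow>\<^sub>L real"
    using summable_LIMSEQ_zero[OF abs[of f]] by (simp add: tendsto_rabs_zero_iff)
  have sr: "strict_mono (\<lambda>n. s (r n))"
    using s(1) r(1) by (simp add: strict_mono_def)
  \<comment> \<open>Weak convergence of the terms to 0 permits the next index to be chosen where the
    current functional is already below \<open>\<epsilon> / 2\<close>.\<close>
  have "\<exists>\<kappa>. \<forall>n. True \<and> (\<kappa> n < \<kappa> (Suc n) \<and> \<bar>blinfun_apply (w (\<kappa> n)) (x (s (r (\<kappa> (Suc n)))))\<bar> < \<epsilon> / 2)"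
  proof (rule dependent_nat_choice)
    show "\<exists>k::nat. True" by blast
    fix k :: nat
    have "(\<lambda>n. \<bar>blinfun_apply (w k) (x (s (r n)))\<bar>) \<longlonglongrightarrow> 0"
      using LIMSEQ_subseq_LIMSEQ[OF small[of "w k"] sr] by (simp add: o_def tendsto_rabs_zero)
    then have "\<forall>\<^sub>F n in sequentially. \<bar>blinfun_apply (w k) (x (s (r n)))\<bar> < \<epsilon> / 2"
      by (rule order_tendstoD(2)) (use \<epsilon> in simp)
    then obtain N where "\<forall>n\<ge>N. \<bar>blinfun_apply (w k) (x (s (r n)))\<bar> < \<epsilon> / 2"
      by (auto simp: eventually_sequentially)
    then show "\<exists>y. True \<and> k < y \<and> \<bar>blinfun_apply (w k) (x (s (r y)))\<bar> < \<epsilon> / 2"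
      by (intro exI[of _ "max N (Suc k)"]) auto
  qed
  then obtain \<kappa> where \<kappa>: "\<And>n. \<kappa> n < \<kappa> (Suc n)"
    "\<And>n. \<bar>blinfun_apply (w (\<kappa> n)) (x (s (r (\<kappa> (Suc n)))))\<bar> < \<epsilon> / 2"
    by blast
  have \<kappa>mono: "strict_mono \<kappa>" using \<kappa>(1) by (simp add: strict_mono_Suc_iff)
  \<comment> \<open>The shift by one pairs \<open>v i\<close> with the term normed by
    \<open>w (\<kappa> (Suc i))\<close> and nearly annihilated by
    \<open>w (\<kappa> i)\<close>.\<close>
  define \<sigma> where "\<sigma> j = s (r (\<kappa> (Suc j)))" for j
  have \<sigma>: "strict_mono \<sigma>"
    using sr \<kappa>mono by (simp add: \<sigma>_def strict_mono_def)
  define v where "v i = w (\<kappa> (Suc i)) - w (\<kappa> i)" for i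
  define a where "a i j = blinfun_apply (v i) (x (\<sigma> j))" for i j
  have "(\<lambda>i. a i i) \<longlonglongrightarrow> 0"
  proof (rule gliding_hump[of a])
    show "summable (\<lambda>j. \<bar>a i j\<bar>)" for i
      using summable_reindex[OF abs[of "v i"] strict_mono_imp_inj_on[OF \<sigma>]]
      by (simp add: a_def o_def)
  next
    fix S :: "nat set"
    obtain y where y: "\<And>f :: 'a \<Rightarrow>\<^sub>L real. (\<lambda>k. if k \<in> \<sigma> ` S then blinfun_apply f (x k) else 0) sums blinfun_apply f y"
      using sub[of "\<sigma> ` S"] by blast
    \<comment> \<open>A functional vanishing on \<open>C\<close> vanishes at all terms, hence at
      their weak sum \<open>y\<close>.\<close>
    have "y \<in> C"
    proof (rule mem_closed_subspaceI[OF C])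
      fix f :: "'a \<Rightarrow>\<^sub>L real" assume "\<And>c. c \<in> C \<Longrightarrow> blinfun_apply f c = 0"
      then have "(\<lambda>k. if k \<in> \<sigma> ` S then blinfun_apply f (x k) else 0) = (\<lambda>k. 0)"
        using Cx by auto
      then show "blinfun_apply f y = 0"
        using y[of f] by (simp add: sums_unique2[OF _ sums_zero])
    qed
    then obtain L where L: "(\<lambda>n. blinfun_apply (w n) y) \<longlonglongrightarrow> L"
      by (auto simp: C_def Cauchy_convergent_iff convergent_def)
    have eq: "(\<Sum>j. if j \<in> S then a i j else 0) = blinfun_apply (v i) y" for i
    proof -
      have "(\<lambda>j. if \<sigma> j \<in> \<sigma> ` S then blinfun_apply (v i) (x (\<sigma> j)) else 0) sums blinfun_apply (v i) y"
        by (subst sums_mono_reindex[OF \<sigma>]) (auto intro: y)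
      moreover have "\<sigma> j \<in> \<sigma> ` S \<longleftrightarrow> j \<in> S" for j
        using strict_mono_eq[OF \<sigma>] by auto
      ultimately show ?thesis
        unfolding a_def by (simp add: sums_iff)
    qed
    have "(\<lambda>i. blinfun_apply (w (\<kappa> (Suc i))) y - blinfun_apply (w (\<kappa> i)) y) \<longlonglongrightarrow> L - L"
      using LIMSEQ_subseq_LIMSEQ[OF L \<kappa>mono] LIMSEQ_subseq_LIMSEQ[OF L, of "\<lambda>i. \<kappa> (Suc i)"] \<kappa>mono
      by (intro tendsto_diff) (auto simp: o_def strict_mono_def)
    then show "(\<lambda>i. \<Sum>j. if j \<in> S then a i j else 0) \<longlonglongrightarrow> 0"
      by (simp add: eq v_def blinfun.diff_left)
  qed
  then have "\<forall>\<^sub>F i in sequentially. a i i < \<epsilon> / 2"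
    by (rule order_tendstoD(2)) (use \<epsilon> in simp)
  moreover have "\<epsilon> / 2 \<le> a i i" for i
  proof -
    have "blinfun_apply (w (\<kappa> (Suc i))) (x (\<sigma> i)) = norm (x (\<sigma> i))"
      by (simp add: w_def \<sigma>_def u)
    moreover have "\<epsilon> \<le> norm (x (\<sigma> i))" by (simp add: \<sigma>_def s)
    moreover have "\<bar>blinfun_apply (w (\<kappa> i)) (x (\<sigma> i))\<bar> < \<epsilon> / 2"
      using \<kappa>(2)[of i] by (simp add: \<sigma>_def)
    ultimately show ?thesis
      by (simp add: a_def v_def blinfun.diff_left)
  qed
  ultimately show False
    by (auto simp: eventually_sequentially not_less[symmetric])
qed

section \<open>Uniform integrability of Pettis integrable multifunctions\<close>

lemma set_integral_abs_subset_le: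
  fixes g :: "'b \<Rightarrow> real"
  assumes "set_integrable M B g" "A \<in> sets M" "A \<subseteq> B"
  shows "\<bar>LINT t:A|M. g t\<bar> \<le> (LINT t:A|M. \<bar>g t\<bar>)" "(LINT t:A|M. \<bar>g t\<bar>) \<le> (LINT t:B|M. \<bar>g t\<bar>)"
proof -
  have A: "set_integrable M A g"
    using set_integrable_subset[OF assms] .
  then show "\<bar>LINT t:A|M. g t\<bar> \<le> (LINT t:A|M. \<bar>g t\<bar>)"
    using set_integral_norm_bound[OF A] by simp
  have "set_integrable M A (\<lambda>t. \<bar>g t\<bar>)" "set_integrable M B (\<lambda>t. \<bar>g t\<bar>)"
    using A assms(1) by (auto intro: set_integrable_abs)
  then show "(LINT t:A|M. \<bar>g t\<bar>) \<le> (LINT t:B|M. \<bar>g t\<bar>)"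
    unfolding set_lebesgue_integral_def set_integrable_def
    using assms(3) by (intro integral_mono) (auto simp: indicator_def)
qed

lemma set_integral_sums_subfamily:
  fixes g :: "'b \<Rightarrow> real" and A :: "nat \<Rightarrow> 'b set"
  assumes A: "\<And>i. A i \<in> sets M" "disjoint_family A" "\<And>i. A i \<subseteq> B" and g: "set_integrable M B g"
  shows "(\<lambda>i. if i \<in> S then LINT t:A i|M. g t else 0) sums (LINT t:(\<Union>i\<in>S. A i)|M. g t)"
proof -
  define A' where "A' i = (if i \<in> S then A i else {})" for i
  have meas: "A' i \<in> sets M" for i
    using A(1) by (simp add: A'_def)
  have disj: "A' i \<inter> A' j = {}" if "i \<noteq> j" for i j
    using A(2) that by (auto simp: A'_def disjoint_family_on_def)
  have un: "(\<Union>i. A' i) = (\<Union>i\<in>S. A i)"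
    by (auto simp: A'_def split: if_splits)
  have "(\<Union>i. A' i) \<in> sets M" using meas by blast
  moreover have sub: "(\<Union>i. A' i) \<subseteq> B" using A(3) by (auto simp: A'_def split: if_splits)
  ultimately have int: "set_integrable M (\<Union>i. A' i) g"
    using g set_integrable_subset by blast
  have "incseq (\<lambda>n. \<Union>i<n. A' i)"
    by (force simp: incseq_def)
  then have "(\<lambda>n. LINT t:(\<Union>i<n. A' i)|M. g t) \<longlonglongrightarrow> (LINT t:(\<Union>n. \<Union>i<n. A' i)|M. g t)"
  proof (rule set_integral_cont_up[rotated])
    have "(\<Union>n. \<Union>i<n. A' i) = (\<Union>i. A' i)" by blast
    with int show "set_integrable M (\<Union>n. \<Union>i<n. A' i) g" by simp
  qed (use meas in blast)
  moreover have "(\<Union>n. \<Union>i<n. A' i) = (\<Union>i\<in>S. A i)" using un by blast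
  moreover have "(LINT t:(\<Union>i<n. A' i)|M. g t) = (\<Sum>i<n. LINT t:A' i|M. g t)" for n
  proof (rule set_integral_finite_Union)
    show "disjoint_family_on A' {..<n}"
      using disj by (auto simp: disjoint_family_on_def)
    show "set_integrable M (A' i) g" for i
      using int meas[of i] set_integrable_subset by blast
  qed (use meas in auto)
  moreover have "(LINT t:A' i|M. g t) = (if i \<in> S then LINT t:A i|M. g t else 0)" for i
    by (simp add: A'_def set_lebesgue_integral_def)
  ultimately show ?thesis
    by (simp add: sums_def)
qed

lemma pettis_integral_set_integral:
  assumes "has_pettis_integral \<Gamma> M"
  shows "set_integrable lebesgue {0..1} (\<lambda>t. support_fun f (\<Gamma> t))"
    and "E \<in> sets lebesgue \<Longrightarrow> E \<subseteq> {0..1} \<Longrightarrow> M E \<in> cwk"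
    and "E \<in> sets lebesgue \<Longrightarrow> E \<subseteq> {0..1} \<Longrightarrow> support_fun f (M E) = (LINT t:E|lebesgue. support_fun f (\<Gamma> t))"
  using assms unfolding has_pettis_integral_def
  by (auto simp: integrable_restrict_space set_integrable_def integral_restrict_space set_lebesgue_integral_def)

text \<open>The level function \<open>c\<close> has natural number values; it will be the label of a
  countable decomposition. If the tails were not uniformly small, disjoint sets and unit functionals
  with large integrals could be chosen, and then vectors in the corresponding values of
  \<open>M\<close> that stay large. Their subseries converge weakly because sums over a subfamily
  are dominated by the value of \<open>M\<close> at the union, which contradicts
  \<open>orlicz_pettis\<close>.\<close>

lemma pettis_uniformly_integrable:
  fixes \<Gamma> :: "real \<Rightarrow> 'a::real_normed_vector set"
  assumes cwk: "\<And>t. t \<in> {0..1} \<Longrightarrow> \<Gamma> t \<in> cwk" and M: "has_pettis_integral \<Gamma> M"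
    and c: "\<And>n::nat. {t \<in> {0..1}. n \<le> c t} \<in> sets lebesgue" and \<epsilon>: "0 < \<epsilon>"
  obtains k where "\<And>f. norm f \<le> 1 \<Longrightarrow> (LINT t:{t \<in> {0..1}. k \<le> c t}|lebesgue. \<bar>support_fun f (\<Gamma> t)\<bar>) \<le> \<epsilon>"
proof (rule ccontr)
  define L where "L k = {t \<in> {0..1}. k \<le> c t}" for k
  define h where "h f t = support_fun f (\<Gamma> t)" for f t
  note [measurable] = c[folded L_def]
  have int: "set_integrable lebesgue {0..1} (h f)" for f
    unfolding h_def by (rule pettis_integral_set_integral(1)[OF M])
  have int': "set_integrable lebesgue E (h f)" if "E \<in> sets lebesgue" "E \<subseteq> {0..1}" for f E
    using set_integrable_subset[OF int that] .
  assume neg: "\<not> thesis"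
  have "\<exists>f. norm f \<le> 1 \<and> \<epsilon> < (LINT t:L k|lebesgue. \<bar>h f t\<bar>)" for k
    using neg that[of k] unfolding L_def h_def by (meson not_le)
  have step: "\<exists>f k'. k < k' \<and> norm f \<le> 1 \<and> \<epsilon> < (LINT t:L k - L k'|lebesgue. \<bar>h f t\<bar>)" for k
  proof -
    obtain f where f: "norm f \<le> 1" "\<epsilon> < (LINT t:L k|lebesgue. \<bar>h f t\<bar>)"
      using \<open>\<And>k. \<exists>f. norm f \<le> 1 \<and> \<epsilon> < (LINT t:L k|lebesgue. \<bar>h f t\<bar>)\<close> by blast
    have "incseq (\<lambda>n. L k - L n)"
      by (auto simp: incseq_def L_def)
    moreover have un: "(\<Union>n. L k - L n) = L k"
    proof
      show "L k \<subseteq> (\<Union>n. L k - L n)"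
      proof
        fix t assume "t \<in> L k"
        then have "t \<in> L k - L (Suc (c t))" by (simp add: L_def)
        then show "t \<in> (\<Union>n. L k - L n)" by blast
      qed
    qed blast
    moreover have "set_integrable lebesgue (\<Union>n. L k - L n) (\<lambda>t. \<bar>h f t\<bar>)"
      unfolding un using c[of k] by (intro set_integrable_abs int') (auto simp: L_def)
    ultimately have "(\<lambda>n. LINT t:L k - L n|lebesgue. \<bar>h f t\<bar>) \<longlonglongrightarrow> (LINT t:L k|lebesgue. \<bar>h f t\<bar>)"
      using set_integral_cont_up[of "\<lambda>n. L k - L n" lebesgue "\<lambda>t. \<bar>h f t\<bar>"] by simp
    then have "\<forall>\<^sub>F n in sequentially. \<epsilon> < (LINT t:L k - L n|lebesgue. \<bar>h f t\<bar>)"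
      using f(2) by (rule order_tendstoD(1))
    then obtain N where "\<forall>n\<ge>N. \<epsilon> < (LINT t:L k - L n|lebesgue. \<bar>h f t\<bar>)"
      by (auto simp: eventually_sequentially)
    then have "\<epsilon> < (LINT t:L k - L (max N (Suc k))|lebesgue. \<bar>h f t\<bar>)" by simp
    with f(1) show ?thesis
      by (intro exI[of _ f] exI[of _ "max N (Suc k)"]) auto
  qed
  then obtain F K where FK: "\<And>k. k < K k" "\<And>k. norm (F k) \<le> 1" "\<And>k. \<epsilon> < (LINT t:L k - L (K k)|lebesgue. \<bar>h (F k) t\<bar>)"
    by metis
  define \<kappa> where "\<kappa> n = (K ^^ n) 0" for n
  have \<kappa>: "\<kappa> (Suc n) = K (\<kappa> n)" for n by (simp add: \<kappa>_def)
  have \<kappa>mono: "mono \<kappa>"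
    using FK(1) by (simp add: mono_iff_le_Suc \<kappa> less_imp_le)
  define D where "D n = L (\<kappa> n) - L (\<kappa> (Suc n))" for n
  define g where "g n = F (\<kappa> n)" for n
  have D_sets [measurable]: "D n \<in> sets lebesgue" for n by (simp add: D_def)
  have D01: "D n \<subseteq> {0..1}" for n by (auto simp: D_def L_def)
  have D_disj: "disjoint_family D"
  proof -
    have "D m \<inter> D n = {}" if "m < n" for m n
    proof -
      have "\<kappa> (Suc m) \<le> \<kappa> n" using \<kappa>mono that by (simp add: monoD)
      then show ?thesis by (auto simp: D_def L_def)
    qed
    then show ?thesis
      unfolding disjoint_family_on_def by (metis Int_commute linorder_neqE_nat)
  qed
  have g: "norm (g n) \<le> 1" "\<epsilon> < (LINT t:D n|lebesgue. \<bar>h (g n) t\<bar>)" for n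
    using FK(2,3) by (auto simp: g_def D_def \<kappa>)
  \<comment> \<open>The integral of the absolute value splits by sign, and one of the two parts
    carries more than half of it.\<close>
  have "\<exists>A. A \<in> sets lebesgue \<and> A \<subseteq> D n \<and> \<epsilon> / 2 < \<bar>LINT t:A|lebesgue. h (g n) t\<bar>" for n
  proof -
    have hm: "(\<lambda>t. indicator (D n) t * h (g n) t) \<in> borel_measurable lebesgue"
      using int'[OF D_sets[of n] D01[of n], of "g n"]
      unfolding set_integrable_def real_scaleR_def by (rule borel_measurable_integrable)
    define P where "P = D n \<inter> {t. 0 < indicator (D n) t * h (g n) t}"
    define Q where "Q = D n \<inter> {t. indicator (D n) t * h (g n) t \<le> 0}"
    have "{t \<in> space lebesgue. 0 < indicator (D n) t * h (g n) t} \<in> sets lebesgue"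
      "{t \<in> space lebesgue. indicator (D n) t * h (g n) t \<le> 0} \<in> sets lebesgue"
      using hm by measurable
    then have PQ: "P \<in> sets lebesgue" "Q \<in> sets lebesgue"
      unfolding P_def Q_def using D_sets[of n] by auto
    have "P \<subseteq> {0..1}" "Q \<subseteq> {0..1}"
      using D01[of n] by (auto simp: P_def Q_def)
    then have intP: "set_integrable lebesgue P (h (g n))" "set_integrable lebesgue Q (h (g n))"
      using int'[OF PQ(1)] int'[OF PQ(2)] by auto
    have "P \<union> Q = D n" "P \<inter> Q = {}" by (auto simp: P_def Q_def)
    then have "(LINT t:D n|lebesgue. \<bar>h (g n) t\<bar>) = (LINT t:P|lebesgue. \<bar>h (g n) t\<bar>) + (LINT t:Q|lebesgue. \<bar>h (g n) t\<bar>)"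
      using set_integral_Un[of P Q lebesgue "\<lambda>t. \<bar>h (g n) t\<bar>"] intP by (simp add: set_integrable_abs)
    also have "(LINT t:P|lebesgue. \<bar>h (g n) t\<bar>) = (LINT t:P|lebesgue. h (g n) t)"
      by (intro set_lebesgue_integral_cong PQ) (auto simp: P_def)
    also have "(LINT t:Q|lebesgue. \<bar>h (g n) t\<bar>) = (LINT t:Q|lebesgue. - h (g n) t)"
      by (intro set_lebesgue_integral_cong PQ) (auto simp: Q_def)
    also have "\<dots> = - (LINT t:Q|lebesgue. h (g n) t)"
      by (rule set_integral_uminus[OF intP(2)])
    finally have "\<epsilon> < (LINT t:P|lebesgue. h (g n) t) - (LINT t:Q|lebesgue. h (g n) t)"
      using g(2)[of n] by simp
    then have "\<epsilon> / 2 < \<bar>LINT t:P|lebesgue. h (g n) t\<bar> \<or> \<epsilon> / 2 < \<bar>LINT t:Q|lebesgue. h (g n) t\<bar>"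
      by linarith
    moreover have "P \<subseteq> D n" "Q \<subseteq> D n" by (auto simp: P_def Q_def)
    ultimately show ?thesis using PQ by blast
  qed
  then obtain A where A: "\<And>n. A n \<in> sets lebesgue" "\<And>n. A n \<subseteq> D n" "\<And>n. \<epsilon> / 2 < \<bar>LINT t:A n|lebesgue. h (g n) t\<bar>"
    by metis
  have A01: "A n \<subseteq> {0..1}" for n using A(2) D01 by blast
  have A_disj: "disjoint_family A"
    using D_disj A(2) unfolding disjoint_family_on_def by blast
  have supp: "support_fun f (M E) = (LINT t:E|lebesgue. h f t)" "M E \<in> cwk" if "E \<in> sets lebesgue" "E \<subseteq> {0..1}" for f E
    unfolding h_def using pettis_integral_set_integral(2,3)[OF M that] by auto
  have "\<exists>x. x \<in> M (A n) \<and> \<epsilon> / 2 < \<bar>blinfun_apply (g n) x\<bar>" for n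
  proof -
    have c: "M (A n) \<in> cwk" and s: "support_fun (g n) (M (A n)) = (LINT t:A n|lebesgue. h (g n) t)"
      using supp A A01 by auto
    obtain x where "x \<in> M (A n)" "support_fun (g n) (M (A n)) = blinfun_apply (g n) x"
      using support_fun_attained[OF c] by metis
    with A(3)[of n] s show ?thesis by auto
  qed
  then obtain x where x: "\<And>n. x n \<in> M (A n)" "\<And>n. \<epsilon> / 2 < \<bar>blinfun_apply (g n) (x n)\<bar>"
    by metis
  have big: "\<epsilon> / 2 < norm (x n)" for n
    using blinfun_apply_le_unit[OF g(1), of n "x n"] x(2)[of n] by linarith
  have le: "blinfun_apply f (x n) \<le> (LINT t:A n|lebesgue. h f t)" for f n
    using le_support_fun[OF supp(2) x(1), of n f] supp(1)[of "A n" f] A A01 by simp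
  have "x \<longlonglongrightarrow> 0"
  proof (rule orlicz_pettis)
    fix S :: "nat set"
    define E where "E = (\<Union>i\<in>S. A i)"
    have E: "E \<in> sets lebesgue" "E \<subseteq> {0..1}"
      using A(1) A01 by (auto simp: E_def)
    have sumsA: "(\<lambda>i. if i \<in> T then LINT t:A i|lebesgue. h f t else 0) sums (LINT t:(\<Union>i\<in>T. A i)|lebesgue. h f t)" for T f
      by (rule set_integral_sums_subfamily[OF A(1) A_disj A01 int])
    have absA: "summable (\<lambda>i. \<bar>LINT t:A i|lebesgue. h f t\<bar>)" for f
      using sumsA by (intro summable_abs_of_subseries) (rule sums_summable)
    \<comment> \<open>Domination by the integrals of the support functions of \<open>f\<close> and
      of \<open>- f\<close> bounds the value on both sides.\<close>
    have absx: "summable (\<lambda>i. \<bar>blinfun_apply f (x i)\<bar>)" for f :: "'a \<Rightarrow>\<^sub>L real"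
    proof (rule summable_comparison_test'[where N = 0])
      show "summable (\<lambda>i. \<bar>LINT t:A i|lebesgue. h f t\<bar> + \<bar>LINT t:A i|lebesgue. h (- f) t\<bar>)"
        by (intro summable_add absA)
      show "norm \<bar>blinfun_apply f (x n)\<bar> \<le> \<bar>LINT t:A n|lebesgue. h f t\<bar> + \<bar>LINT t:A n|lebesgue. h (- f) t\<bar>" for n
        using le[of f n] le[of "- f" n] by (simp add: blinfun.minus_left)
    qed
    have sm: "summable (\<lambda>i. if i \<in> S then blinfun_apply f (x i) else 0)" for f :: "'a \<Rightarrow>\<^sub>L real"
      by (rule summable_comparison_test'[OF absx[of f], of 0]) auto
    \<comment> \<open>The formal subsum is linear in \<open>f\<close> and lies below the support
      function of \<open>M E\<close>, so it is evaluation at a vector, the weak sum of the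
      subseries.\<close>
    define \<xi> where "\<xi> f = (\<Sum>i. if i \<in> S then blinfun_apply f (x i) else 0)" for f :: "'a \<Rightarrow>\<^sub>L real"
    have "linear \<xi>"
    proof
      show "\<xi> (f + f') = \<xi> f + \<xi> f'" for f f'
        unfolding \<xi>_def by (subst suminf_add[OF sm sm]) (auto intro!: suminf_cong simp: blinfun.add_left)
      show "\<xi> (b *\<^sub>R f) = b *\<^sub>R \<xi> f" for b f
        unfolding \<xi>_def real_scaleR_def
        by (subst suminf_mult[OF sm, symmetric]) (auto intro!: suminf_cong simp: blinfun.scaleR_left)
    qed
    moreover have "\<xi> f \<le> support_fun f (M E)" for f
    proof -
      have "\<xi> f \<le> (\<Sum>i. if i \<in> S then LINT t:A i|lebesgue. h f t else 0)"
        unfolding \<xi>_def using le sm sums_summable[OF sumsA[of S f]]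
        by (intro suminf_le) auto
      also have "\<dots> = (LINT t:E|lebesgue. h f t)"
        unfolding E_def by (rule sums_unique[OF sumsA, symmetric])
      finally show ?thesis by (simp add: supp(1)[OF E])
    qed
    ultimately obtain y where "\<And>f. \<xi> f = blinfun_apply f y"
      using functional_represented[OF supp(2)[OF E]] by blast
    moreover have "(\<lambda>i. if i \<in> S then blinfun_apply f (x i) else 0) sums \<xi> f" for f
      unfolding \<xi>_def using sm by (rule summable_sums)
    ultimately show "\<exists>y. \<forall>f :: 'a \<Rightarrow>\<^sub>L real. (\<lambda>k. if k \<in> S then blinfun_apply f (x k) else 0) sums blinfun_apply f y"
      by metis
  qed
  then have "\<forall>\<^sub>F n in sequentially. norm (x n) < \<epsilon> / 2"
    using \<epsilon> by (intro order_tendstoD(2)[OF tendsto_norm_zero]) auto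
  then obtain n where "norm (x n) < \<epsilon> / 2"
    by (auto simp: eventually_sequentially)
  with big[of n] show False by simp
qed

lemma has_integral_gauge_fun:
  fixes h :: "real \<Rightarrow> real"
  assumes "(h has_integral y) {0..1}" "0 < \<epsilon>"
  shows "\<exists>\<delta>. gauge_fun \<delta> \<and> (\<forall>p. p tagged_division_of {0..1} \<longrightarrow> delta_fine \<delta> p \<longrightarrow>
    \<bar>(\<Sum>(t, I)\<in>p. measure lborel I * h t) - y\<bar> < \<epsilon>)"
proof -
  obtain \<gamma> where \<gamma>: "gauge \<gamma>" and *: "\<forall>p. p tagged_division_of {0..1} \<and> \<gamma> fine p \<longrightarrow>
      norm ((\<Sum>(t, I)\<in>p. measure lborel I *\<^sub>R h t) - y) < \<epsilon>"
    using assms(1)[unfolded has_integral_real, rule_format, OF assms(2)] by blast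
  obtain \<delta> where \<delta>: "gauge_fun \<delta>" "\<And>t. {t - \<delta> t <..< t + \<delta> t} \<subseteq> \<gamma> t"
    using gauge_fun_of_gauge[OF \<gamma>] by metis
  have "\<gamma> fine p" if "delta_fine \<delta> p" for p
    using that \<delta>(2) unfolding delta_fine_def fine_def by fast
  with * have "\<bar>(\<Sum>(t, I)\<in>p. measure lborel I * h t) - y\<bar> < \<epsilon>"
    if "p tagged_division_of {0..1}" "delta_fine \<delta> p" for p
    using that by simp
  with \<delta>(1) show ?thesis by blast
qed

section \<open>McShane sums of countably decomposed functions\<close>

lemma free_partition_subinterval:
  assumes "free_partition p" "(t, I) \<in> p"
  obtains a b where "I = {a..b}" "0 \<le> a" "a \<le> b" "b \<le> 1" "t \<in> {0..1}"
  using assms unfolding free_partition_def subintervals_def by fast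

lemma free_partition_memD:
  assumes "free_partition p" "y \<in> p"
  shows "fst y \<in> {0..1}" "snd y \<in> subintervals"
proof -
  have "\<forall>(t, I) \<in> p. t \<in> {0..1} \<and> I \<in> subintervals"
    using assms(1) unfolding free_partition_def by blast
  with assms(2) show "fst y \<in> {0..1}" "snd y \<in> subintervals"
    by auto
qed

lemma negligible_interval_Int:
  assumes "I \<in> subintervals" "J \<in> subintervals" "interior I \<inter> interior J = {}"
  shows "negligible (I \<inter> J)"
proof -
  have "convex (I \<inter> J)"
    using assms by (auto simp: subintervals_def intro: convex_Int)
  then show ?thesis
    using assms(3) by (simp add: negligible_convex_interior)
qed

lemma measure_lborel_subinterval: "I \<in> subintervals \<Longrightarrow> measure lborel I = measure lebesgue I"
  by (auto simp: subintervals_def)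

lemma sum_length_free_partition:
  assumes p: "free_partition p" and q: "q \<subseteq> p"
  shows "(\<Sum>(t, I)\<in>q. measure lborel I) = measure lebesgue (\<Union>y\<in>q. snd y)"
proof -
  have fin: "finite q"
    using p q finite_subset unfolding free_partition_def by blast
  have sub: "snd y \<in> subintervals" if "y \<in> q" for y
    using p q that unfolding free_partition_def by (cases y) auto
  have dis: "interior (snd y) \<inter> interior (snd z) = {}" if "y \<in> q" "z \<in> q" "y \<noteq> z" for y z
  proof -
    have "(fst y, snd y) \<in> p" "(fst z, snd z) \<in> p" "(fst y, snd y) \<noteq> (fst z, snd z)"
      using q that by auto
    then show ?thesis
      using p unfolding free_partition_def by blast
  qed
  have "measure lebesgue (\<Union> (snd ` q)) = (\<Sum>y\<in>q. measure lebesgue (snd y))"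
  proof (rule measure_negligible_finite_Union_image[OF fin])
    show "snd y \<in> lmeasurable" if "y \<in> q" for y
      using sub[OF that] by (auto simp: subintervals_def)
    show "pairwise (\<lambda>y z. negligible (snd y \<inter> snd z)) q"
      unfolding pairwise_def by (intro ballI impI negligible_interval_Int sub dis)
  qed
  also have "\<dots> = (\<Sum>(t, I)\<in>q. measure lborel I)"
    by (rule sum.cong) (use sub in \<open>auto simp: measure_lborel_subinterval case_prod_beta'\<close>)
  finally show ?thesis by simp
qed

text \<open>On the piece with label \<open>n\<close> each \<open>h x\<close> is within
  \<open>r n\<close> of the constant \<open>V x n\<close>. The gauge confines intervals tagged in a
  piece to an open set of slightly larger measure, so their total length \<open>a n\<close> is close
  to \<open>m n\<close> wherever the tags sit in the intervals. The gauge depends on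
  \<open>r\<close> and \<open>R\<close> only, hence is common to all
  \<open>x \<in> B\<close>.\<close>

lemma countable_decomposition_mcshane:
  fixes h :: "'i \<Rightarrow> real \<Rightarrow> real" and c :: "real \<Rightarrow> nat" and V :: "'i \<Rightarrow> nat \<Rightarrow> real"
  defines "m \<equiv> \<lambda>n. measure lebesgue {t \<in> {0..1}. c t = n}"
  assumes E: "\<And>n. {t \<in> {0..1}. c t = n} \<in> sets lebesgue" and \<epsilon>: "0 < \<epsilon>"
    and r: "\<And>n. 0 \<le> r n" "\<And>F. finite F \<Longrightarrow> (\<Sum>n\<in>F. r n * m n) \<le> \<epsilon>"
    and h: "\<And>x t. x \<in> B \<Longrightarrow> t \<in> {0..1} \<Longrightarrow> \<bar>h x t - V x (c t)\<bar> \<le> r (c t)"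
    and V: "\<And>x n. x \<in> B \<Longrightarrow> \<bar>V x n\<bar> \<le> R n"
    and tail: "\<And>x F. x \<in> B \<Longrightarrow> finite F \<Longrightarrow> F \<subseteq> {n0..} \<Longrightarrow> (\<Sum>n\<in>F. \<bar>V x n\<bar> * m n) \<le> 2 * \<epsilon>"
  obtains \<delta> where "gauge_fun \<delta>" "\<And>p x. free_partition p \<Longrightarrow> delta_fine \<delta> p \<Longrightarrow> x \<in> B \<Longrightarrow>
    \<bar>(\<Sum>(t, I)\<in>p. measure lborel I * h x t) - (\<Sum>n<n0. m n * V x n)\<bar> \<le> 6 * \<epsilon>"
proof -
  define S0 where "S0 = (\<Sum>n<n0. \<bar>R n\<bar>)"
  have S0: "0 \<le> S0" by (simp add: S0_def sum_nonneg)
  \<comment> \<open>The admissible excess of measure: its products with \<open>r n\<close>,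
    \<open>\<bar>R n\<bar>\<close> and \<open>S0\<close> are each at most
    \<open>\<epsilon> / 2^(Suc n)\<close>, hence sum to at most \<open>\<epsilon>\<close>.\<close>
  define \<theta> where "\<theta> n = \<epsilon> * (1/2)^(Suc n) / ((r n + \<bar>R n\<bar> + 1) * (1 + S0))" for n
  have \<theta>: "0 < \<theta> n" "\<theta> n * r n \<le> \<epsilon> * (1/2)^(Suc n)" "\<theta> n * \<bar>R n\<bar> \<le> \<epsilon> * (1/2)^(Suc n)"
    "\<theta> n * S0 \<le> \<epsilon> * (1/2)^(Suc n)" for n
  proof -
    have D: "1 \<le> r n + \<bar>R n\<bar> + 1" "r n \<le> r n + \<bar>R n\<bar> + 1" "\<bar>R n\<bar> \<le> r n + \<bar>R n\<bar> + 1" "1 \<le> 1 + S0" "S0 \<le> 1 + S0"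
      using r(1)[of n] S0 by auto
    have pos: "0 < (r n + \<bar>R n\<bar> + 1) * (1 + S0)"
      using D by (intro mult_pos_pos) auto
    then show "0 < \<theta> n" using \<epsilon> by (simp add: \<theta>_def)
    have *: "\<theta> n * a \<le> \<epsilon> * (1/2)^(Suc n)" if "a \<le> (r n + \<bar>R n\<bar> + 1) * (1 + S0)" for a
    proof -
      have "\<theta> n * a \<le> \<theta> n * ((r n + \<bar>R n\<bar> + 1) * (1 + S0))"
        using that \<open>0 < \<theta> n\<close> by (intro mult_left_mono) auto
      also have "\<dots> = \<epsilon> * (1/2)^(Suc n)"
        using pos unfolding \<theta>_def by (metis less_irrefl nonzero_divide_eq_eq)
      finally show ?thesis .
    qed
    have "r n * 1 \<le> (r n + \<bar>R n\<bar> + 1) * (1 + S0)" "\<bar>R n\<bar> * 1 \<le> (r n + \<bar>R n\<bar> + 1) * (1 + S0)"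
      "1 * S0 \<le> (r n + \<bar>R n\<bar> + 1) * (1 + S0)"
      using D r(1)[of n] S0 by (intro mult_mono; simp)+
    then show "\<theta> n * r n \<le> \<epsilon> * (1/2)^(Suc n)" "\<theta> n * \<bar>R n\<bar> \<le> \<epsilon> * (1/2)^(Suc n)" "\<theta> n * S0 \<le> \<epsilon> * (1/2)^(Suc n)"
      using * by auto
  qed
  have half: "(\<Sum>n\<in>F. \<epsilon> * (1/2)^(Suc n)) \<le> \<epsilon>" if "finite F" for F
  proof -
    have "(\<Sum>n\<in>F. (1/2::real)^(Suc n)) \<le> (\<Sum>n. (1/2)^(Suc n))"
      using power_half_series that by (intro sum_le_suminf) (auto simp: sums_iff)
    also have "\<dots> = 1" using power_half_series by (simp add: sums_iff)
    finally have "\<epsilon> * (\<Sum>n\<in>F. (1/2::real)^(Suc n)) \<le> \<epsilon> * 1"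
      using \<epsilon> by (intro mult_left_mono) auto
    then show ?thesis by (simp only: sum_distrib_left mult_1_right)
  qed
  define E' where "E' n = {t \<in> {0..1}. c t = n}" for n
  have E': "E' n \<in> lmeasurable" for n
    unfolding E'_def using E by (intro bounded_set_imp_lmeasurable) (auto intro: bounded_subset[of "{0..1}"])
  have "\<exists>G. open G \<and> E' n \<subseteq> G \<and> G - E' n \<in> lmeasurable \<and> measure lebesgue (G - E' n) < \<theta> n" for n
  proof -
    obtain G where G: "open G" "E' n \<subseteq> G" "G - E' n \<in> lmeasurable" "emeasure lebesgue (G - E' n) < ennreal (\<theta> n)"
      using sets_lebesgue_outer_open[of "E' n" "\<theta> n"] E' \<theta>(1) by (auto dest: fmeasurableD)
    then have "measure lebesgue (G - E' n) < \<theta> n"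
      using \<theta>(1)[of n] by (simp add: emeasure_eq_measure2 ennreal_less_iff)
    with G show ?thesis by blast
  qed
  then obtain G where G: "\<And>n. open (G n)" "\<And>n. E' n \<subseteq> G n" "\<And>n. G n - E' n \<in> lmeasurable"
    "\<And>n. measure lebesgue (G n - E' n) < \<theta> n" by metis
  have "\<exists>d>0. t \<in> {0..1} \<longrightarrow> {t - d <..< t + d} \<subseteq> G (c t)" for t
  proof (cases "t \<in> {0..1}")
    case True
    then have "t \<in> G (c t)" using G(2)[of "c t"] by (auto simp: E'_def)
    then obtain d where "0 < d" "ball t d \<subseteq> G (c t)"
      using G(1) by (meson open_contains_ball)
    then show ?thesis by (auto simp: ball_eq_greaterThanLessThan)
  qed (auto intro: exI[of _ 1])
  then obtain \<delta> where \<delta>: "\<And>t. 0 < \<delta> t" "\<And>t. t \<in> {0..1} \<Longrightarrow> {t - \<delta> t <..< t + \<delta> t} \<subseteq> G (c t)"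
    by metis
  show thesis
  proof
    show "gauge_fun \<delta>" using \<delta>(1) by (simp add: gauge_fun_def)
    fix p x assume p: "free_partition p" "delta_fine \<delta> p" and x: "x \<in> B"
    have finp: "finite p" using p(1) by (simp add: free_partition_def)
    define P where "P n = {y \<in> p. c (fst y) = n}" for n
    define a where "a n = (\<Sum>(t, I)\<in>P n. measure lborel I)" for n
    have Pp: "P n \<subseteq> p" for n by (auto simp: P_def)
    have a0: "0 \<le> a n" for n by (auto simp: a_def intro!: sum_nonneg)
    have a_le: "a n \<le> m n + \<theta> n" for n
    proof -
      have sub: "(\<Union>y\<in>P n. snd y) \<subseteq> E' n \<union> (G n - E' n)"
      proof
        fix s assume "s \<in> (\<Union>y\<in>P n. snd y)"
        then obtain t I where tI: "(t, I) \<in> p" "c t = n" "s \<in> I" by (auto simp: P_def)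
        then have "t \<in> {0..1}" using p(1) by (auto elim: free_partition_subinterval)
        moreover have "I \<subseteq> {t - \<delta> t <..< t + \<delta> t}"
          using p(2) tI(1) unfolding delta_fine_def by (metis fineD)
        ultimately show "s \<in> E' n \<union> (G n - E' n)"
          using \<delta>(2)[of t] tI by blast
      qed
      have "snd y \<in> sets lebesgue" if "y \<in> P n" for y
        using free_partition_memD(2)[OF p(1), of y] that by (auto simp: P_def subintervals_def)
      then have meas: "(\<Union>y\<in>P n. snd y) \<in> sets lebesgue"
        using finp by (intro sets.finite_UN) (auto simp: P_def)
      have "a n = measure lebesgue (\<Union>y\<in>P n. snd y)"
        unfolding a_def by (rule sum_length_free_partition[OF p(1) Pp])
      also have "\<dots> \<le> measure lebesgue (E' n \<union> (G n - E' n))"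
        using sub meas E' G(3) by (intro measure_mono_fmeasurable fmeasurable.Un) auto
      also have "\<dots> \<le> measure lebesgue (E' n) + measure lebesgue (G n - E' n)"
        using E' G(3) by (intro measure_Un_le) (auto dest: fmeasurableD)
      also have "\<dots> \<le> m n + \<theta> n"
        using G(4)[of n] by (simp add: m_def E'_def)
      finally show ?thesis .
    qed
    \<comment> \<open>All labels that occur among the tags, and in addition the first
      \<open>n0\<close>, some of which may be carried by no tag.\<close>
    define N where "N = (\<lambda>y. c (fst y)) ` p \<union> {..<n0}"
    have finN: "finite N" using finp by (simp add: N_def)
    have group: "(\<Sum>n\<in>N. \<Sum>y\<in>P n. g y) = sum g p" for g :: "real \<times> real set \<Rightarrow> real"
      unfolding P_def using finp finN by (intro sum.group) (auto simp: N_def)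
    have suma: "(\<Sum>n\<in>N. a n) = 1"
    proof -
      have "(\<Sum>n\<in>N. a n) = (\<Sum>(t, I)\<in>p. measure lborel I)"
        unfolding a_def by (rule group)
      also have "\<dots> = measure lebesgue (\<Union>y\<in>p. snd y)"
        by (rule sum_length_free_partition[OF p(1)]) simp
      also have "(\<Union>y\<in>p. snd y) = {0..1}"
        using p(1) by (simp add: free_partition_def case_prod_beta')
      finally show ?thesis by simp
    qed
    have summ: "(\<Sum>n\<in>N. m n) \<le> 1"
    proof -
      have "(\<Sum>n\<in>N. m n) = measure lebesgue (\<Union> (E' ` N))"
        unfolding m_def E'_def[symmetric] using finN E'
        by (intro measure_negligible_finite_Union_image[symmetric])
          (auto simp: pairwise_def E'_def intro!: negligible_subset[OF negligible_empty])
      also have "\<dots> \<le> measure lebesgue {0..1::real}"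
        using E' finN by (intro measure_mono_fmeasurable) (auto simp: E'_def[abs_def] dest: fmeasurableD intro!: sets.finite_UN E)
      finally show ?thesis by simp
    qed
    define \<Theta> where "\<Theta> = (\<Sum>n\<in>N. \<theta> n)"
    \<comment> \<open>The gauge bounds \<open>a n\<close> only from above. The lower bound holds
      because the \<open>a n\<close> sum to 1 while the \<open>m n\<close> sum to at most 1: length
      missing on one piece is excess on the others.\<close>
    have dev: "\<bar>a n - m n\<bar> \<le> \<Theta>" if n: "n \<in> N" for n
    proof -
      have "\<theta> n \<le> \<Theta>"
        unfolding \<Theta>_def using n finN \<theta>(1) by (intro member_le_sum) (auto intro: less_imp_le)
      moreover have "m n - a n \<le> \<Theta>"
      proof -
        have "m n - a n \<le> (\<Sum>k\<in>N - {n}. a k) - (\<Sum>k\<in>N - {n}. m k)"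
          using suma summ by (simp add: sum.remove[OF finN n])
        also have "\<dots> = (\<Sum>k\<in>N - {n}. a k - m k)" by (simp add: sum_subtractf)
        also have "\<dots> \<le> (\<Sum>k\<in>N - {n}. \<theta> k)"
          using a_le by (intro sum_mono) (simp add: algebra_simps)
        also have "\<dots> \<le> \<Theta>"
          unfolding \<Theta>_def using finN \<theta>(1) by (intro sum_mono2) (auto intro: less_imp_le)
        finally show ?thesis .
      qed
      ultimately show ?thesis using a_le[of n] by linarith
    qed
    have \<Theta>S0: "\<Theta> * S0 \<le> \<epsilon>"
    proof -
      have "\<Theta> * S0 = (\<Sum>n\<in>N. \<theta> n * S0)" by (simp add: \<Theta>_def sum_distrib_right)
      also have "\<dots> \<le> (\<Sum>n\<in>N. \<epsilon> * (1/2)^(Suc n))" by (intro sum_mono \<theta>)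
      finally show ?thesis using half[OF finN] by linarith
    qed
    have 1: "\<bar>(\<Sum>(t, I)\<in>p. measure lborel I * h x t) - (\<Sum>n\<in>N. a n * V x n)\<bar> \<le> 2 * \<epsilon>"
    proof -
      have "(\<Sum>n\<in>N. a n * V x n) = (\<Sum>n\<in>N. \<Sum>y\<in>P n. measure lborel (snd y) * V x (c (fst y)))"
        by (auto simp: a_def sum_distrib_right case_prod_beta' P_def intro!: sum.cong)
      also have "\<dots> = (\<Sum>y\<in>p. measure lborel (snd y) * V x (c (fst y)))" by (rule group)
      finally have "\<bar>(\<Sum>(t, I)\<in>p. measure lborel I * h x t) - (\<Sum>n\<in>N. a n * V x n)\<bar> =
          \<bar>\<Sum>y\<in>p. measure lborel (snd y) * (h x (fst y) - V x (c (fst y)))\<bar>"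
        by (simp add: case_prod_beta' sum_subtractf[symmetric] right_diff_distrib)
      also have "\<dots> \<le> (\<Sum>y\<in>p. measure lborel (snd y) * r (c (fst y)))"
      proof (rule sum_norm_le[where 'a = real, simplified])
        fix y assume "y \<in> p"
        then have "fst y \<in> {0..1}" by (rule free_partition_memD(1)[OF p(1)])
        then show "\<bar>measure lborel (snd y) * (h x (fst y) - V x (c (fst y)))\<bar> \<le> measure lborel (snd y) * r (c (fst y))"
          using h[OF x] by (simp add: abs_mult mult_left_mono)
      qed
      also have "\<dots> = (\<Sum>n\<in>N. \<Sum>y\<in>P n. measure lborel (snd y) * r (c (fst y)))" by (rule group[symmetric])
      also have "\<dots> = (\<Sum>n\<in>N. a n * r n)"
        by (auto simp: a_def sum_distrib_right case_prod_beta' P_def intro!: sum.cong)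
      also have "\<dots> \<le> (\<Sum>n\<in>N. r n * m n + \<epsilon> * (1/2)^(Suc n))"
      proof (rule sum_mono)
        fix n
        have "a n * r n \<le> (m n + \<theta> n) * r n" using a_le r(1) by (intro mult_right_mono)
        then show "a n * r n \<le> r n * m n + \<epsilon> * (1/2)^(Suc n)"
          using \<theta>(2)[of n] by (simp add: algebra_simps)
      qed
      also have "\<dots> \<le> 2 * \<epsilon>"
        using r(2)[OF finN] half[OF finN] by (simp add: sum.distrib)
      finally show ?thesis .
    qed
    \<comment> \<open>Labels from \<open>n0\<close> on contribute \<open>2 * \<epsilon>\<close> by
      \<open>tail\<close> and \<open>\<epsilon>\<close> from the excess of length, the first
      \<open>n0\<close> labels another \<open>\<epsilon>\<close>; with the
      \<open>2 * \<epsilon>\<close> of the previous estimate this makes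
      \<open>6 * \<epsilon>\<close>.\<close>
    have 2: "\<bar>(\<Sum>n\<in>N. a n * V x n) - (\<Sum>n<n0. m n * V x n)\<bar> \<le> 4 * \<epsilon>"
    proof -
      define T where "T = N - {..<n0}"
      have finT: "finite T" "T \<subseteq> {n0..}" using finN by (auto simp: T_def)
      have "(\<Sum>n\<in>N. a n * V x n) = (\<Sum>n\<in>T. a n * V x n) + (\<Sum>n<n0. a n * V x n)"
        unfolding T_def using finN by (intro sum.subset_diff) (auto simp: N_def)
      then have "\<bar>(\<Sum>n\<in>N. a n * V x n) - (\<Sum>n<n0. m n * V x n)\<bar> \<le>
          \<bar>\<Sum>n\<in>T. a n * V x n\<bar> + \<bar>\<Sum>n<n0. (a n - m n) * V x n\<bar>"
        by (simp add: left_diff_distrib sum_subtractf)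
      also have "\<bar>\<Sum>n<n0. (a n - m n) * V x n\<bar> \<le> (\<Sum>n<n0. \<Theta> * \<bar>R n\<bar>)"
      proof (rule sum_norm_le[where 'a = real, simplified])
        fix n assume "n \<in> {..<n0}"
        then have "n \<in> N" by (simp add: N_def)
        have "\<bar>V x n\<bar> \<le> \<bar>R n\<bar>" using V[OF x, of n] by linarith
        then show "\<bar>(a n - m n) * V x n\<bar> \<le> \<Theta> * \<bar>R n\<bar>"
          unfolding abs_mult using dev[OF \<open>n \<in> N\<close>] by (intro mult_mono) auto
      qed
      also have "(\<Sum>n<n0. \<Theta> * \<bar>R n\<bar>) = \<Theta> * S0" by (simp add: S0_def sum_distrib_left)
      also have "\<bar>\<Sum>n\<in>T. a n * V x n\<bar> \<le> (\<Sum>n\<in>T. \<bar>V x n\<bar> * m n + \<epsilon> * (1/2)^(Suc n))"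
      proof (rule sum_norm_le[where 'a = real, simplified])
        fix n
        have "\<bar>V x n\<bar> \<le> \<bar>R n\<bar>" using V[OF x, of n] by linarith
        then have "\<theta> n * \<bar>V x n\<bar> \<le> \<theta> n * \<bar>R n\<bar>"
          using \<theta>(1)[of n] by (intro mult_left_mono) auto
        moreover have "a n * \<bar>V x n\<bar> \<le> (m n + \<theta> n) * \<bar>V x n\<bar>"
          using a_le by (intro mult_right_mono) auto
        ultimately show "\<bar>a n * V x n\<bar> \<le> \<bar>V x n\<bar> * m n + \<epsilon> * (1/2)^(Suc n)"
          using \<theta>(3)[of n] a0[of n] by (simp add: abs_mult algebra_simps)
      qed
      also have "\<dots> \<le> 3 * \<epsilon>"
        using tail[OF x finT] half[OF finT(1)] by (simp add: sum.distrib)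
      finally show ?thesis using \<Theta>S0 by linarith
    qed
    from 1 2 show "\<bar>(\<Sum>(t, I)\<in>p. measure lborel I * h x t) - (\<Sum>n<n0. m n * V x n)\<bar> \<le> 6 * \<epsilon>"
      by linarith
  qed
qed

lemma free_partition_of_division:
  "p tagged_division_of {0..1} \<Longrightarrow> free_partition p"
  using perron_partition_iff by blast

lemma gauge_exists_fine_division:
  assumes "gauge_fun \<delta>"
  obtains p where "p tagged_division_of {0..1}" "delta_fine \<delta> p"
proof -
  have "{} tagged_partial_division_of {0..1::real}" "delta_fine \<delta> {}"
    by (auto simp: tagged_partial_division_of_def delta_fine_def fine_def)
  with fine_partial_division_extend[OF assms] that show thesis by metis
qed

section \<open>Variational Henstock and Pettis integrability imply McShane integrability\<close>

lemma borel_dyadic_index [measurable]: "(\<lambda>t::real. nat \<lfloor>2^n * t\<rfloor>) \<in> borel \<rightarrow>\<^sub>M count_space UNIV"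
  by measurable

lemma set_sum_cwk:
  fixes \<Gamma> :: "real \<Rightarrow> 'a::real_normed_vector set"
  assumes cwk: "\<And>t. t \<in> {0..1} \<Longrightarrow> \<Gamma> t \<in> cwk" and p: "free_partition p"
  defines "S \<equiv> (\<Sum>(t, I)\<in>p. (*\<^sub>R) (measure lborel I) ` \<Gamma> t)"
  shows "S \<noteq> {}" "bounded S" "convex S"
    "support_fun f S = (\<Sum>(t, I)\<in>p. measure lborel I * support_fun f (\<Gamma> t))"
proof -
  have fin: "finite p" using p by (simp add: free_partition_def)
  have \<Gamma>p: "\<Gamma> (fst y) \<in> cwk" if "y \<in> p" for y
    using p that by (intro cwk free_partition_memD(1))
  have S: "S = (\<Sum>y\<in>p. (*\<^sub>R) (measure lborel (snd y)) ` \<Gamma> (fst y))"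
    by (simp add: S_def case_prod_beta')
  have "(*\<^sub>R) (measure lborel (snd y)) ` \<Gamma> (fst y) \<noteq> {} \<and>
      bounded ((*\<^sub>R) (measure lborel (snd y)) ` \<Gamma> (fst y)) \<and>
      convex ((*\<^sub>R) (measure lborel (snd y)) ` \<Gamma> (fst y))" if "y \<in> p" for y
    using cwk_scaleR[OF \<Gamma>p[OF that]] by blast
  then have *: "S \<noteq> {} \<and> bounded S \<and> convex S \<and>
    (\<forall>f. support_fun f S = (\<Sum>y\<in>p. support_fun f ((*\<^sub>R) (measure lborel (snd y)) ` \<Gamma> (fst y))))"
    unfolding S by (rule set_sum_convex_bounded[OF fin])
  then show "S \<noteq> {}" "bounded S" "convex S" by blast+
  have "support_fun f S = (\<Sum>y\<in>p. support_fun f ((*\<^sub>R) (measure lborel (snd y)) ` \<Gamma> (fst y)))"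
    using * by blast
  also have "\<dots> = (\<Sum>(t, I)\<in>p. measure lborel I * support_fun f (\<Gamma> t))"
    using \<Gamma>p by (intro sum.cong) (auto simp: support_fun_scaleR cwkD cwk_bounded)
  finally show "support_fun f S = (\<Sum>(t, I)\<in>p. measure lborel I * support_fun f (\<Gamma> t))" .
qed

context
  fixes \<Gamma> :: "real \<Rightarrow> 'a::real_normed_vector set" and \<Phi> M
  assumes cwk: "\<And>t. t \<in> {0..1} \<Longrightarrow> \<Gamma> t \<in> cwk" and prim: "has_vH_primitive \<Gamma> \<Phi>"
    and pettis: "has_pettis_integral \<Gamma> M"
begin

text \<open>Off a null set the dyadic difference quotients of the primitive converge to the support
  functions of \<open>\<Gamma> t\<close>, uniformly on the unit ball. Points are sorted by the first
  level from which the quotients move by at most \<open>\<epsilon>\<close> and by their dyadic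
  interval of that level, on which the quotient is constant. On the null set only the size of
  \<open>\<Gamma> t\<close> matters.\<close>

lemma vh_pettis_decomposition:
  assumes \<epsilon>: "0 < \<epsilon>"
  obtains c :: "real \<Rightarrow> nat" and V :: "('a \<Rightarrow>\<^sub>L real) \<Rightarrow> nat \<Rightarrow> real" and r R where
    "\<And>n. {t \<in> {0..1}. c t = n} \<in> sets lebesgue" "\<And>n::nat. 0 \<le> r n"
    "\<And>F. finite F \<Longrightarrow> (\<Sum>n\<in>F. r n * measure lebesgue {t \<in> {0..1}. c t = n}) \<le> \<epsilon>"
    "\<And>f t. norm f \<le> 1 \<Longrightarrow> t \<in> {0..1} \<Longrightarrow> \<bar>support_fun f (\<Gamma> t) - V f (c t)\<bar> \<le> r (c t)"
    "\<And>f n. norm f \<le> 1 \<Longrightarrow> \<bar>V f n\<bar> \<le> R n"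
proof -
  obtain N where N: "negligible N" "\<And>t \<eta>. t \<in> {0..1} \<Longrightarrow> t \<notin> N \<Longrightarrow> 0 < \<eta> \<Longrightarrow>
      \<exists>r>0. \<forall>a b. 0 \<le> a \<and> a \<le> t \<and> t \<le> b \<and> b \<le> 1 \<and> a < b \<and> b - a < r \<longrightarrow> vh_error \<Gamma> \<Phi> t {a..b} \<le> \<eta> * (b - a)"
    using henstock_null_derivative_zero[OF henstock_null_vh_error[OF cwk prim] vh_error_nonneg] by blast
  \<comment> \<open>At \<open>t = 1\<close> the index \<open>\<lfloor>2^n * t\<rfloor>\<close> is
    \<open>2^n\<close>, which is no dyadic interval of the unit interval.\<close>
  define N' where "N' = N \<union> {1}"
  have N': "negligible N'" using N(1) by (simp add: N'_def)
  define J where "J n k = {real k / 2^n..(real k + 1) / 2^n}" for n k :: nat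
  define Q where "Q f n k = 2^n * support_fun f (\<Phi> (J n k))" for f :: "'a \<Rightarrow>\<^sub>L real" and n k
  define q where "q f n t = Q f n (nat \<lfloor>2^n * t\<rfloor>)" for f n and t :: real
  have J: "0 \<le> real k / 2^n" "real k / 2^n < (real k + 1) / 2^n" "(real k + 1) / 2^n \<le> 1"
    if "k < 2^n" for k n :: nat
  proof -
    have "real k + 1 \<le> 2^n" using that by (metis Suc_leI add.commute of_nat_Suc of_nat_le_iff of_nat_numeral of_nat_power)
    then show "(real k + 1) / 2^n \<le> 1" by simp
  qed (auto simp: divide_strict_right_mono)
  have idx: "nat \<lfloor>2^n * t\<rfloor> < 2^n" "real (nat \<lfloor>2^n * t\<rfloor>) / 2^n \<le> t" "t \<le> (real (nat \<lfloor>2^n * t\<rfloor>) + 1) / 2^n"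
    if "0 \<le> t" "t < 1" for t :: real and n
  proof -
    have "2^n * t < 2^n" using that by simp
    then have "\<lfloor>2^n * t\<rfloor> < 2^n" by (simp add: floor_less_iff)
    then show "nat \<lfloor>2^n * t\<rfloor> < 2^n" by (simp add: nat_less_iff that)
    have "real (nat \<lfloor>2^n * t\<rfloor>) = of_int \<lfloor>2^n * t\<rfloor>" using that by simp
    then show "real (nat \<lfloor>2^n * t\<rfloor>) / 2^n \<le> t" "t \<le> (real (nat \<lfloor>2^n * t\<rfloor>) + 1) / 2^n"
      by (auto simp: divide_le_eq le_divide_eq mult.commute of_int_floor_le less_imp_le)
  qed
  have conv: "\<exists>n0. \<forall>n\<ge>n0. \<forall>f. norm f \<le> 1 \<longrightarrow> \<bar>q f n t - support_fun f (\<Gamma> t)\<bar> \<le> \<eta>"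
    if t: "t \<in> {0..1}" "t \<notin> N'" and \<eta>: "0 < \<eta>" for t \<eta>
  proof -
    have t1: "0 \<le> t" "t < 1" using t by (auto simp: N'_def)
    obtain s where s: "0 < s" "\<And>a b. 0 \<le> a \<Longrightarrow> a \<le> t \<Longrightarrow> t \<le> b \<Longrightarrow> b \<le> 1 \<Longrightarrow> a < b \<Longrightarrow> b - a < s \<Longrightarrow>
        vh_error \<Gamma> \<Phi> t {a..b} \<le> \<eta> * (b - a)"
      using N(2)[of t \<eta>] t \<eta> by (auto simp: N'_def)
    obtain n0 where n0: "(1/2)^n0 < s" using real_arch_pow_inv[OF s(1), of "1/2"] by auto
    show ?thesis
    proof (intro exI[of _ n0] allI impI)
      fix n and f :: "'a \<Rightarrow>\<^sub>L real" assume n: "n0 \<le> n" and f: "norm f \<le> 1"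
      define k where "k = nat \<lfloor>2^n * t\<rfloor>"
      define a where "a = real k / 2^n"
      define b where "b = (real k + 1) / 2^n"
      have ab: "0 \<le> a" "a < b" "b \<le> 1" "a \<le> t" "t \<le> b"
        using J[OF idx(1)[OF t1, of n]] idx(2,3)[OF t1, of n] by (auto simp: a_def b_def k_def)
      have len: "b - a = 1 / 2^n" by (simp add: a_def b_def diff_divide_distrib[symmetric])
      have "(1/2::real)^n \<le> (1/2)^n0" using n by (intro power_decreasing) auto
      then have "b - a < s" using n0 by (simp add: len power_one_over)
      then have e: "vh_error \<Gamma> \<Phi> t {a..b} \<le> \<eta> * (b - a)"
        using ab by (intro s(2)) auto
      have "\<bar>(b - a) * support_fun f (\<Gamma> t) - support_fun f (\<Phi> {a..b})\<bar> \<le> norm f * vh_error \<Gamma> \<Phi> t {a..b}"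
        using ab t by (intro support_fun_vh_error[OF cwk prim]) auto
      also have "\<dots> \<le> 1 * vh_error \<Gamma> \<Phi> t {a..b}"
        using f by (intro mult_right_mono) (auto simp: vh_error_nonneg)
      finally have "\<bar>(b - a) * support_fun f (\<Gamma> t) - support_fun f (\<Phi> {a..b})\<bar> \<le> \<eta> * (b - a)"
        using e by simp
      moreover have "support_fun f (\<Phi> {a..b}) = (b - a) * q f n t"
        unfolding len by (simp add: q_def Q_def J_def a_def b_def k_def)
      ultimately have "(b - a) * \<bar>support_fun f (\<Gamma> t) - q f n t\<bar> \<le> (b - a) * \<eta>"
        using ab by (simp add: right_diff_distrib[symmetric] abs_mult mult.commute)
      then show "\<bar>q f n t - support_fun f (\<Gamma> t)\<bar> \<le> \<eta>"
        using ab by (simp add: mult_le_cancel_left_pos abs_minus_commute)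
    qed
  qed
  \<comment> \<open>Stability is phrased through the quotients alone, without
    \<open>\<Gamma> t\<close>, so that its measurability can be checked on dyadic indices.\<close>
  define P where "P n t \<longleftrightarrow> (\<forall>m\<ge>n. \<forall>f. norm f \<le> 1 \<longrightarrow> \<bar>q f m t - q f n t\<bar> \<le> \<epsilon>)" for n t
  have P_ex: "\<exists>n. P n t" if t: "t \<in> {0..1}" "t \<notin> N'" for t
  proof -
    obtain n0 where n0: "\<And>n f. n0 \<le> n \<Longrightarrow> norm f \<le> 1 \<Longrightarrow> \<bar>q f n t - support_fun f (\<Gamma> t)\<bar> \<le> \<epsilon> / 2"
      using conv[OF t, of "\<epsilon> / 2"] \<epsilon> by auto
    have "P n0 t"
      unfolding P_def
    proof (intro allI impI)
      fix m and f :: "'a \<Rightarrow>\<^sub>L real" assume "n0 \<le> m" "norm f \<le> 1"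
      then show "\<bar>q f m t - q f n0 t\<bar> \<le> \<epsilon>"
        using n0[of m f] n0[of n0 f] by linarith
    qed
    then show ?thesis ..
  qed
  have P_close: "\<bar>support_fun f (\<Gamma> t) - q f n t\<bar> \<le> \<epsilon>"
    if t: "t \<in> {0..1}" "t \<notin> N'" and P: "P n t" and f: "norm f \<le> 1" for t n f
  proof (rule field_le_epsilon)
    fix \<eta> :: real assume "0 < \<eta>"
    then obtain n0 where n0: "\<And>m. n0 \<le> m \<Longrightarrow> \<bar>q f m t - support_fun f (\<Gamma> t)\<bar> \<le> \<eta>"
      using conv[OF t, of \<eta>] f by auto
    show "\<bar>support_fun f (\<Gamma> t) - q f n t\<bar> \<le> \<epsilon> + \<eta>"
      using n0[of "max n0 n"] P f unfolding P_def by (smt (verit) max.cobounded1 max.cobounded2)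
  qed
  have P_meas: "{t. P n t} \<in> sets borel" for n
  proof -
    \<comment> \<open>The quantifier over uncountably many functionals is absorbed into a relation
      between integer indices, so the set is a countable union of intersections of index
      sets.\<close>
    define W where "W m i j \<longleftrightarrow> (\<forall>f. norm f \<le> 1 \<longrightarrow> \<bar>Q f m i - Q f n j\<bar> \<le> \<epsilon>)" for m i j
    have "{t::real. W m (nat \<lfloor>2^m * t\<rfloor>) (nat \<lfloor>2^n * t\<rfloor>)} \<in> sets borel" for m
    proof -
      have "{t::real. W m (nat \<lfloor>2^m * t\<rfloor>) (nat \<lfloor>2^n * t\<rfloor>)} =
          (\<Union>y\<in>{(i, j). W m i j}. {t::real. nat \<lfloor>2^m * t\<rfloor> = fst y} \<inter> {t. nat \<lfloor>2^n * t\<rfloor> = snd y})"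
        by auto
      also have "\<dots> \<in> sets borel"
      proof (rule sets.countable_UN')
        have "{t::real. nat \<lfloor>2^m * t\<rfloor> = i} \<in> sets borel" for m i
          using measurable_sets[OF borel_dyadic_index[of m], of "{i}"] by (simp add: vimage_def)
        then show "(\<lambda>y. {t::real. nat \<lfloor>2^m * t\<rfloor> = fst y} \<inter> {t. nat \<lfloor>2^n * t\<rfloor> = snd y}) ` {(i, j). W m i j} \<subseteq> sets borel"
          by auto
      qed auto
      finally show ?thesis .
    qed
    moreover have "{t. P n t} = (\<Inter>m\<in>{n..}. {t. W m (nat \<lfloor>2^m * t\<rfloor>) (nat \<lfloor>2^n * t\<rfloor>)})"
      by (auto simp: P_def W_def q_def)
    ultimately show ?thesis by (auto intro!: sets.countable_INT'')
  qed
  define \<nu> where "\<nu> t = (LEAST n. P n t)" for t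
  have \<nu>_meas [measurable]: "\<nu> \<in> borel \<rightarrow>\<^sub>M count_space UNIV"
    unfolding \<nu>_def using P_meas by (intro measurable_Least) (simp add: pred_def)
  have \<nu>P: "P (\<nu> t) t" if "t \<in> {0..1}" "t \<notin> N'" for t
    unfolding \<nu>_def using P_ex[OF that] by (rule LeastI_ex)
  \<comment> \<open>Odd labels encode level and dyadic index; even labels are kept for the null
    set.\<close>
  define cD where "cD t = Suc (2 * prod_encode (\<nu> t, nat \<lfloor>2^(\<nu> t) * t\<rfloor>))" for t
  have cD_meas: "cD \<in> borel \<rightarrow>\<^sub>M count_space UNIV"
    unfolding cD_def by (rule measurable_compose_countable[OF _ \<nu>_meas]) measurable
  define K where "K t = (SOME k::nat. \<forall>f. norm f \<le> 1 \<longrightarrow> \<bar>support_fun f (\<Gamma> t)\<bar> \<le> real k)" for t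
  have K: "\<bar>support_fun f (\<Gamma> t)\<bar> \<le> real (K t)" if t: "t \<in> {0..1}" and f: "norm f \<le> 1" for t f
  proof -
    obtain b where b: "\<And>x. x \<in> \<Gamma> t \<Longrightarrow> norm x \<le> b"
      using cwk_bounded[OF cwk[OF t]] by (auto simp: bounded_iff)
    have "\<forall>f. norm f \<le> 1 \<longrightarrow> \<bar>support_fun f (\<Gamma> t)\<bar> \<le> real (nat \<lceil>b\<rceil>)"
    proof (intro allI impI)
      fix f :: "'a \<Rightarrow>\<^sub>L real" assume f: "norm f \<le> 1"
      obtain x where x: "x \<in> \<Gamma> t" "support_fun f (\<Gamma> t) = blinfun_apply f x"
        using support_fun_attained[OF cwk[OF t]] by metis
      have "\<bar>support_fun f (\<Gamma> t)\<bar> \<le> b"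
        using blinfun_apply_le_unit[OF f, of x] b[OF x(1)] x(2) by simp
      then show "\<bar>support_fun f (\<Gamma> t)\<bar> \<le> real (nat \<lceil>b\<rceil>)"
        using real_nat_ceiling_ge[of b] by linarith
    qed
    then have "\<forall>f. norm f \<le> 1 \<longrightarrow> \<bar>support_fun f (\<Gamma> t)\<bar> \<le> real (K t)"
      unfolding K_def by (rule someI)
    with f show ?thesis by blast
  qed
  \<comment> \<open>On the null set the label \<open>2 * K t\<close> records a bound for the values
    at \<open>t\<close>. There \<open>V\<close> is 0 and \<open>r\<close> is the label itself, which
    costs nothing since these pieces have measure zero.\<close>
  define c where "c t = (if t \<in> N' then 2 * K t else cD t)" for t
  define r where "r n = (if odd n then \<epsilon> else real n)" for n :: nat
  \<comment> \<open>The guard \<open>j < 2^i\<close> excludes codes whose interval leaves the unit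
    interval; this makes \<open>V\<close> bounded on the unit ball for every label.\<close>
  define V where "V f n = (if odd n then (case prod_decode (n div 2) of (i, j) \<Rightarrow> if j < 2^i then Q f i j else 0) else 0)"
    for f :: "'a \<Rightarrow>\<^sub>L real" and n :: nat
  define E where "E n = {t \<in> {0..1}. c t = n}" for n
  have E_meas: "E n \<in> sets lebesgue" for n
  proof -
    have "{t. cD t = n} \<in> sets borel"
      using measurable_sets[OF cD_meas, of "{n}"] by (simp add: vimage_def)
    then have "{t. cD t = n} \<in> sets lebesgue" by simp
    moreover have "N' \<in> sets lebesgue"
      using N' by (simp add: negligible_imp_sets)
    ultimately have "{0..1} \<inter> {t. cD t = n} - N' \<in> sets lebesgue"
      by (intro sets.Diff sets.Int) simp_all
    moreover have "E n \<inter> N' \<in> sets lebesgue"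
      by (rule negligible_imp_sets[OF negligible_subset[OF N']]) blast
    ultimately have "({0..1} \<inter> {t. cD t = n} - N') \<union> (E n \<inter> N') \<in> sets lebesgue"
      by (rule sets.Un)
    also have "({0..1} \<inter> {t. cD t = n} - N') \<union> (E n \<inter> N') = E n"
      by (auto simp: E_def c_def)
    finally show ?thesis .
  qed
  have E_fm: "E n \<in> lmeasurable" for n
    using E_meas by (intro bounded_set_imp_lmeasurable) (auto simp: E_def intro: bounded_subset[of "{0..1}"])
  have rE: "r n * measure lebesgue (E n) \<le> \<epsilon> * measure lebesgue (E n)" for n
  proof (cases "odd n")
    case False
    then have "E n \<subseteq> N'" by (auto simp: E_def c_def cD_def)
    then have "measure lebesgue (E n) = 0"
      using N' negligible_subset negligible_imp_measure0 by blast
    then show ?thesis by simp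
  qed (simp add: r_def)
  have sum1: "(\<Sum>n\<in>F. r n * measure lebesgue (E n)) \<le> \<epsilon>" if F: "finite F" for F
  proof -
    have "(\<Sum>n\<in>F. measure lebesgue (E n)) = measure lebesgue (\<Union> (E ` F))"
      using F E_fm by (intro measure_negligible_finite_Union_image[symmetric])
        (auto simp: pairwise_def E_def intro!: negligible_subset[OF negligible_empty])
    also have "\<dots> \<le> measure lebesgue {0..1::real}"
      using F E_meas by (intro measure_mono_fmeasurable sets.finite_UN) (auto simp: E_def)
    finally have "\<epsilon> * (\<Sum>n\<in>F. measure lebesgue (E n)) \<le> \<epsilon> * 1"
      using \<epsilon> by (intro mult_left_mono) auto
    moreover have "(\<Sum>n\<in>F. r n * measure lebesgue (E n)) \<le> (\<Sum>n\<in>F. \<epsilon> * measure lebesgue (E n))"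
      by (intro sum_mono rE)
    ultimately show ?thesis by (simp add: sum_distrib_left)
  qed
  have close: "\<bar>support_fun f (\<Gamma> t) - V f (c t)\<bar> \<le> r (c t)" if f: "norm f \<le> 1" and t: "t \<in> {0..1}" for f t
  proof (cases "t \<in> N'")
    case True
    then show ?thesis
      using K[OF t f] by (simp add: c_def V_def r_def)
  next
    case False
    then have "0 \<le> t" "t < 1" using t by (auto simp: N'_def)
    then have "V f (c t) = q f (\<nu> t) t"
      using False idx(1)[of t "\<nu> t"] by (simp add: c_def cD_def V_def q_def)
    then show ?thesis
      using P_close[OF t False \<nu>P[OF t False] f] False by (simp add: c_def cD_def r_def)
  qed
  have "\<exists>b. \<forall>f. norm f \<le> 1 \<longrightarrow> \<bar>V f n\<bar> \<le> b" for n
  proof -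
    obtain i j where ij: "prod_decode (n div 2) = (i, j)" by (cases "prod_decode (n div 2)")
    show ?thesis
    proof (cases "odd n \<and> j < 2^i")
      case True
      then have Jc: "\<Phi> (J i j) \<in> cwk"
        unfolding J_def using J[of j i] by (intro vh_primitive_cwk[OF cwk prim] subintervalsI) auto
      then obtain b where b: "\<And>x. x \<in> \<Phi> (J i j) \<Longrightarrow> norm x \<le> b"
        using cwk_bounded[OF Jc] by (auto simp: bounded_iff)
      have "\<bar>V f n\<bar> \<le> 2^i * b" if f: "norm f \<le> 1" for f
      proof -
        obtain x where x: "x \<in> \<Phi> (J i j)" "support_fun f (\<Phi> (J i j)) = blinfun_apply f x"
          using support_fun_attained[OF Jc] by metis
        have "\<bar>support_fun f (\<Phi> (J i j))\<bar> \<le> b"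
          using blinfun_apply_le_unit[OF f, of x] b[OF x(1)] x(2) by simp
        then show ?thesis
          using True by (simp add: V_def ij Q_def abs_mult mult_left_mono)
      qed
      then show ?thesis by blast
    next
      case False
      then show ?thesis by (intro exI[of _ 0]) (auto simp: V_def ij)
    qed
  qed
  then obtain R where R: "\<And>f n. norm f \<le> 1 \<Longrightarrow> \<bar>V f n\<bar> \<le> R n"
    by metis
  show thesis
  proof (rule that[where c = c and V = V and r = r and R = R])
    show "{t \<in> {0..1}. c t = n} \<in> sets lebesgue" for n
      using E_meas[of n] by (simp only: E_def)
    show "0 \<le> r n" for n using \<epsilon> by (simp add: r_def)
    show "(\<Sum>n\<in>F. r n * measure lebesgue {t \<in> {0..1}. c t = n}) \<le> \<epsilon>" if "finite F" for F
      using sum1[OF that] by (simp only: E_def)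
  qed (use close R in auto)
qed

text \<open>Uniform integrability with respect to the labels supplies \<open>n0\<close>, and the
  decomposition lemma one gauge for all functionals. The resulting finite sum \<open>A f\<close> is
  then compared with the Henstock integral on a Perron partition, which is also a free
  partition.\<close>

lemma vh_pettis_uniform_mcshane:
  assumes \<epsilon>: "0 < \<epsilon>"
  obtains \<delta> where "gauge_fun \<delta>" "\<And>p f. free_partition p \<Longrightarrow> delta_fine \<delta> p \<Longrightarrow> norm f \<le> 1 \<Longrightarrow>
    \<bar>(\<Sum>(t, I)\<in>p. measure lborel I * support_fun f (\<Gamma> t)) - support_fun f (\<Phi> {0..1})\<bar> \<le> \<epsilon>"
proof -
  \<comment> \<open>\<open>6 * \<eta>\<close> for the distance of a McShane sum from
    \<open>A f\<close>, and \<open>7 * \<eta>\<close> for that of \<open>A f\<close> from the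
    integral.\<close>
  define \<eta> where "\<eta> = \<epsilon> / 13"
  have \<eta>: "0 < \<eta>" using \<epsilon> by (simp add: \<eta>_def)
  obtain c :: "real \<Rightarrow> nat" and V :: "('a \<Rightarrow>\<^sub>L real) \<Rightarrow> nat \<Rightarrow> real" and r R where
    c: "\<And>n. {t \<in> {0..1}. c t = n} \<in> sets lebesgue" and r: "\<And>n::nat. 0 \<le> r n"
    "\<And>F. finite F \<Longrightarrow> (\<Sum>n\<in>F. r n * measure lebesgue {t \<in> {0..1}. c t = n}) \<le> \<eta>"
    and V: "\<And>f t. norm f \<le> 1 \<Longrightarrow> t \<in> {0..1} \<Longrightarrow> \<bar>support_fun f (\<Gamma> t) - V f (c t)\<bar> \<le> r (c t)"
    "\<And>f n. norm f \<le> 1 \<Longrightarrow> \<bar>V f n\<bar> \<le> R n"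
    by (rule vh_pettis_decomposition[OF \<eta>]) (rule that; assumption)
  define E where "E n = {t \<in> {0..1}. c t = n}" for n
  have E: "E n \<in> sets lebesgue" "E n \<subseteq> {0..1}" for n
    using c[of n] by (auto simp: E_def)
  have E_fm: "E n \<in> lmeasurable" for n
    using E[of n] bounded_subset[of "{0..1}" "E n"] by (intro bounded_set_imp_lmeasurable) auto
  have cge: "{t \<in> {0..1}. n \<le> c t} = (\<Union>k\<in>{n..}. E k)" for n
    by (auto simp: E_def)
  have cge_sets: "{t \<in> {0..1}. n \<le> c t} \<in> sets lebesgue" for n
    unfolding cge using E(1) by (intro sets.countable_UN') auto
  obtain n0 where n0: "\<And>f. norm f \<le> 1 \<Longrightarrow> (LINT t:{t \<in> {0..1}. n0 \<le> c t}|lebesgue. \<bar>support_fun f (\<Gamma> t)\<bar>) \<le> \<eta>"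
    using pettis_uniformly_integrable[OF cwk pettis cge_sets \<eta>] by metis
  have int: "set_integrable lebesgue A (\<lambda>t. support_fun f (\<Gamma> t))" if "A \<in> sets lebesgue" "A \<subseteq> {0..1}" for A f
    using set_integrable_subset[OF pettis_integral_set_integral(1)[OF pettis] that] .
  \<comment> \<open>On the piece \<open>E n\<close>, \<open>\<bar>V f n\<bar>\<close> is at most
    \<open>\<bar>support_fun f (\<Gamma> t)\<bar> + r n\<close>; integrating gives one
    \<open>\<eta>\<close> from the choice of \<open>n0\<close> and one from
    \<open>r\<close>.\<close>
  have tail: "(\<Sum>n\<in>F. \<bar>V f n\<bar> * measure lebesgue {t \<in> {0..1}. c t = n}) \<le> 2 * \<eta>"
    if f: "norm f \<le> 1" and F: "finite F" "F \<subseteq> {n0..}" for f F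
  proof -
    have intabs: "set_integrable lebesgue (E n) (\<lambda>t. \<bar>support_fun f (\<Gamma> t)\<bar>)" for n
      by (intro set_integrable_abs int E)
    have const: "set_integrable lebesgue (E n) (\<lambda>t. b)" "(LINT t:E n|lebesgue. b) = b * measure lebesgue (E n)" for n and b :: real
      using E_fm[of n] E(1)[of n] by (auto simp: set_integrable_def set_lebesgue_integral_def fmeasurable_def)
    have "(\<Sum>n\<in>F. \<bar>V f n\<bar> * measure lebesgue (E n)) = (\<Sum>n\<in>F. LINT t:E n|lebesgue. \<bar>V f n\<bar>)"
      by (simp add: const)
    also have "\<dots> \<le> (\<Sum>n\<in>F. LINT t:E n|lebesgue. \<bar>support_fun f (\<Gamma> t)\<bar> + r n)"
    proof (intro sum_mono set_integral_mono const set_integral_add intabs)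
      fix n t assume "t \<in> E n"
      then show "\<bar>V f n\<bar> \<le> \<bar>support_fun f (\<Gamma> t)\<bar> + r n"
        using V(1)[OF f, of t] by (auto simp: E_def)
    qed
    also have "\<dots> = (\<Sum>n\<in>F. (LINT t:E n|lebesgue. \<bar>support_fun f (\<Gamma> t)\<bar>) + r n * measure lebesgue (E n))"
      by (simp add: set_integral_add intabs const)
    also have "\<dots> = (LINT t:(\<Union>n\<in>F. E n)|lebesgue. \<bar>support_fun f (\<Gamma> t)\<bar>) + (\<Sum>n\<in>F. r n * measure lebesgue (E n))"
      unfolding sum.distrib using F(1) E intabs
      by (subst set_integral_finite_Union) (auto simp: disjoint_family_on_def E_def)
    also have "(LINT t:(\<Union>n\<in>F. E n)|lebesgue. \<bar>support_fun f (\<Gamma> t)\<bar>) \<le> (LINT t:{t \<in> {0..1}. n0 \<le> c t}|lebesgue. \<bar>support_fun f (\<Gamma> t)\<bar>)"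
    proof (rule set_integral_abs_subset_le(2))
      show "set_integrable lebesgue {t \<in> {0..1}. n0 \<le> c t} (\<lambda>t. support_fun f (\<Gamma> t))"
        by (rule int[OF cge_sets]) auto
      show "(\<Union>n\<in>F. E n) \<in> sets lebesgue" using F(1) E(1) by (intro sets.finite_UN) auto
      show "(\<Union>n\<in>F. E n) \<subseteq> {t \<in> {0..1}. n0 \<le> c t}" using F(2) unfolding cge by blast
    qed
    finally show ?thesis
      using n0[OF f] r(2)[OF F(1)] by (simp add: E_def)
  qed
  define A where "A f = (\<Sum>n<n0. measure lebesgue {t \<in> {0..1}. c t = n} * V f n)" for f
  have "\<exists>\<delta>. gauge_fun \<delta> \<and> (\<forall>p f. free_partition p \<longrightarrow> delta_fine \<delta> p \<longrightarrow> norm f \<le> 1 \<longrightarrow>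
      \<bar>(\<Sum>(t, I)\<in>p. measure lborel I * support_fun f (\<Gamma> t)) - A f\<bar> \<le> 6 * \<eta>)"
  proof (rule countable_decomposition_mcshane[OF c \<eta> r, of "{f. norm f \<le> 1}" "\<lambda>f t. support_fun f (\<Gamma> t)" V R n0])
    fix f t assume "f \<in> {f :: 'a \<Rightarrow>\<^sub>L real. norm f \<le> 1}" "t \<in> {0..1::real}"
    then show "\<bar>support_fun f (\<Gamma> t) - V f (c t)\<bar> \<le> r (c t)"
      by (intro V(1)) simp
  next
    fix f n assume "f \<in> {f :: 'a \<Rightarrow>\<^sub>L real. norm f \<le> 1}"
    then show "\<bar>V f n\<bar> \<le> R n" by (intro V(2)) simp
  next
    fix f F assume "f \<in> {f :: 'a \<Rightarrow>\<^sub>L real. norm f \<le> 1}" "finite F" "F \<subseteq> {n0..}"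
    then show "(\<Sum>n\<in>F. \<bar>V f n\<bar> * measure lebesgue {t \<in> {0..1}. c t = n}) \<le> 2 * \<eta>"
      by (intro tail) simp
  next
    fix \<delta> assume \<delta>: "gauge_fun \<delta>" "\<And>p f. free_partition p \<Longrightarrow> delta_fine \<delta> p \<Longrightarrow> f \<in> {f. norm f \<le> 1} \<Longrightarrow>
      \<bar>(\<Sum>(t, I)\<in>p. measure lborel I * support_fun f (\<Gamma> t)) -
        (\<Sum>n<n0. measure lebesgue {t \<in> {0..1}. c t = n} * V f n)\<bar> \<le> 6 * \<eta>"
    show ?thesis
      unfolding A_def
    proof (intro exI conjI allI impI)
      fix p and f :: "'a \<Rightarrow>\<^sub>L real" assume "free_partition p" "delta_fine \<delta> p" "norm f \<le> 1"
      then show "\<bar>(\<Sum>(t, I)\<in>p. measure lborel I * support_fun f (\<Gamma> t)) -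
          (\<Sum>n<n0. measure lebesgue {t \<in> {0..1}. c t = n} * V f n)\<bar> \<le> 6 * \<eta>"
        by (intro \<delta>(2)) simp_all
    qed (rule \<delta>(1))
  qed
  then obtain \<delta> where \<delta>: "gauge_fun \<delta>" "\<And>p f. free_partition p \<Longrightarrow> delta_fine \<delta> p \<Longrightarrow> norm f \<le> 1 \<Longrightarrow>
      \<bar>(\<Sum>(t, I)\<in>p. measure lborel I * support_fun f (\<Gamma> t)) - A f\<bar> \<le> 6 * \<eta>"
    by blast
  show thesis
  proof
    show "gauge_fun \<delta>" by fact
    fix p and f :: "'a \<Rightarrow>\<^sub>L real" assume p: "free_partition p" "delta_fine \<delta> p" and f: "norm f \<le> 1"
    have "\<bar>support_fun f (\<Phi> {0..1}) - A f\<bar> \<le> 7 * \<eta>"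
    proof -
      \<comment> \<open>The gauge \<open>\<delta>'\<close> obtained from this depends on
        \<open>f\<close>. This is harmless, since it only serves to estimate the number
        \<open>A f\<close>.\<close>
      have "((\<lambda>t. support_fun f (\<Gamma> t)) has_integral support_fun f (\<Phi> {0..1})) {0..1}"
        by (rule support_fun_has_integral[OF cwk prim]) auto
      from has_integral_gauge_fun[OF this \<eta>]
      obtain \<delta>' where \<delta>': "gauge_fun \<delta>'" and int: "\<And>q. q tagged_division_of {0..1} \<Longrightarrow> delta_fine \<delta>' q \<Longrightarrow>
          \<bar>(\<Sum>(t, I)\<in>q. measure lborel I * support_fun f (\<Gamma> t)) - support_fun f (\<Phi> {0..1})\<bar> < \<eta>"
        by blast
      obtain q where q: "q tagged_division_of {0..1}" "delta_fine (\<lambda>t. min (\<delta> t) (\<delta>' t)) q"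
        using gauge_exists_fine_division[OF gauge_fun_min[OF \<delta>(1) \<delta>']] by metis
      have q1: "delta_fine \<delta> q" "delta_fine \<delta>' q"
        by (rule delta_fine_mono[OF q(2)]; simp)+
      have "\<bar>(\<Sum>(t, I)\<in>q. measure lborel I * support_fun f (\<Gamma> t)) - support_fun f (\<Phi> {0..1})\<bar> < \<eta>"
        by (rule int[OF q(1) q1(2)])
      moreover have "\<bar>(\<Sum>(t, I)\<in>q. measure lborel I * support_fun f (\<Gamma> t)) - A f\<bar> \<le> 6 * \<eta>"
        using \<delta>(2)[OF free_partition_of_division[OF q(1)] q1(1) f] .
      ultimately show ?thesis by linarith
    qed
    moreover have "\<bar>(\<Sum>(t, I)\<in>p. measure lborel I * support_fun f (\<Gamma> t)) - A f\<bar> \<le> 6 * \<eta>"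
      by (rule \<delta>(2)[OF p f])
    ultimately show "\<bar>(\<Sum>(t, I)\<in>p. measure lborel I * support_fun f (\<Gamma> t)) - support_fun f (\<Phi> {0..1})\<bar> \<le> \<epsilon>"
      unfolding \<eta>_def by linarith
  qed
qed

lemma vh_pettis_imp_mcshane: "has_mcshane_integral \<Gamma> (\<Phi> {0..1})"
  unfolding has_mcshane_integral_def
proof (intro conjI allI impI)
  have \<Phi>: "\<Phi> {0..1} \<in> cwk"
    by (intro vh_primitive_cwk[OF cwk prim] subintervalsI) auto
  then show "\<Phi> {0..1} \<noteq> {}" "closed (\<Phi> {0..1})" "convex (\<Phi> {0..1})"
    by (auto simp: cwkD cwk_closed)
  fix \<epsilon> :: real assume \<epsilon>: "0 < \<epsilon>"
  then have "0 < \<epsilon> / 2" by simp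
  then obtain \<delta> where \<delta>: "gauge_fun \<delta>" "\<And>p f. free_partition p \<Longrightarrow> delta_fine \<delta> p \<Longrightarrow> norm f \<le> 1 \<Longrightarrow>
    \<bar>(\<Sum>(t, I)\<in>p. measure lborel I * support_fun f (\<Gamma> t)) - support_fun f (\<Phi> {0..1})\<bar> \<le> \<epsilon> / 2"
    using vh_pettis_uniform_mcshane by metis
  show "\<exists>\<delta>. gauge_fun \<delta> \<and> (\<forall>p. free_partition p \<and> delta_fine \<delta> p \<longrightarrow>
      hausdorff_distance (\<Phi> {0..1}) (\<Sum>(t, I)\<in>p. (*\<^sub>R) (measure lborel I) ` \<Gamma> t) < ennreal \<epsilon>)"
  proof (intro exI conjI allI impI)
    show "gauge_fun \<delta>" by fact
    fix p assume p: "free_partition p \<and> delta_fine \<delta> p"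
    have "hausdorff_distance (\<Phi> {0..1}) (\<Sum>(t, I)\<in>p. (*\<^sub>R) (measure lborel I) ` \<Gamma> t) \<le> ennreal (\<epsilon> / 2)"
      using set_sum_cwk[of \<Gamma> p] cwk \<Phi> \<delta>(2) p
      by (intro hausdorff_distance_le) (auto simp: cwkD cwk_bounded abs_minus_commute)
    also have "\<dots> < ennreal \<epsilon>" using \<epsilon> by (simp add: ennreal_less_iff)
    finally show "hausdorff_distance (\<Phi> {0..1}) (\<Sum>(t, I)\<in>p. (*\<^sub>R) (measure lborel I) ` \<Gamma> t) < ennreal \<epsilon>" .
  qed
qed

end

section \<open>McShane integrability implies uniform integrability\<close>

text \<open>Local version of \<open>free_partition\<close>: tags may lie outside \<open>K\<close>,
  as happens when a partition of the unit interval is cut down to \<open>K\<close>.\<close>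

definition free_partition_on :: "real set \<Rightarrow> (real \<times> real set) set \<Rightarrow> bool" where
  "free_partition_on K Q \<longleftrightarrow> finite Q \<and> (\<forall>y\<in>Q. fst y \<in> {0..1} \<and> snd y \<in> subintervals \<and> snd y \<subseteq> K) \<and>
     (\<forall>y\<in>Q. \<forall>z\<in>Q. y \<noteq> z \<longrightarrow> interior (snd y) \<inter> interior (snd z) = {}) \<and> (\<Union>y\<in>Q. snd y) = K"

lemma free_partition_onD:
  assumes "free_partition_on K Q"
  shows "finite Q" "(\<Union>y\<in>Q. snd y) = K"
    "\<And>y. y \<in> Q \<Longrightarrow> fst y \<in> {0..1}" "\<And>y. y \<in> Q \<Longrightarrow> snd y \<in> subintervals" "\<And>y. y \<in> Q \<Longrightarrow> snd y \<subseteq> K"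
    "\<And>y z. y \<in> Q \<Longrightarrow> z \<in> Q \<Longrightarrow> y \<noteq> z \<Longrightarrow> interior (snd y) \<inter> interior (snd z) = {}"
proof -
  show "finite Q"
    using assms unfolding free_partition_on_def by (elim conjE)
  show "(\<Union>y\<in>Q. snd y) = K"
    using assms unfolding free_partition_on_def by (elim conjE)
  have 1: "\<forall>y\<in>Q. fst y \<in> {0..1} \<and> snd y \<in> subintervals \<and> snd y \<subseteq> K"
    using assms unfolding free_partition_on_def by (elim conjE)
  have 2: "\<forall>y\<in>Q. \<forall>z\<in>Q. y \<noteq> z \<longrightarrow> interior (snd y) \<inter> interior (snd z) = {}"
    using assms unfolding free_partition_on_def by (elim conjE)
  show "fst y \<in> {0..1}" "snd y \<in> subintervals" "snd y \<subseteq> K" if "y \<in> Q" for y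
    using 1 that by blast+
  show "interior (snd y) \<inter> interior (snd z) = {}" if "y \<in> Q" "z \<in> Q" "y \<noteq> z" for y z
    using 2 that by blast
qed

lemma length_zero_if_interior_empty:
  assumes "I \<in> subintervals" "interior I = {}" shows "measure lborel I = 0"
proof -
  obtain a b where I: "I = {a..b}" "a \<le> b" using assms(1) by (auto simp: subintervals_def)
  then have "{a<..<b} = {}" using assms(2) by (simp add: interior_atLeastAtMost_real)
  with I show ?thesis by auto
qed

text \<open>Partitions are sets of pairs, so a pair occurring over two members of \<open>d\<close>
  is counted once in the union. Its interval then has empty interior and length zero, and the sums
  agree.\<close>

lemma free_partition_concat:
  assumes d: "d division_of {0..1::real}" and Q: "\<And>K. K \<in> d \<Longrightarrow> free_partition_on K (Q K)"
  shows "free_partition (\<Union>K\<in>d. Q K)"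
    and "(\<Sum>(t, I)\<in>(\<Union>K\<in>d. Q K). measure lborel I * g t) = (\<Sum>K\<in>d. \<Sum>(t, I)\<in>Q K. measure lborel I * g t)"
proof -
  note dd = division_ofD[OF d]
  have mem: "fst y \<in> {0..1}" "snd y \<in> subintervals" "snd y \<subseteq> K" if "K \<in> d" "y \<in> Q K" for K y
    by (rule free_partition_onD(3-5)[OF Q[OF that(1)] that(2)])+
  have finQ: "finite (Q K)" "(\<Union>y\<in>Q K. snd y) = K" if "K \<in> d" for K
    by (rule free_partition_onD(1,2)[OF Q[OF that]])+
  have disj: "interior (snd y) \<inter> interior (snd z) = {}"
    if "K \<in> d" "y \<in> Q K" "L \<in> d" "z \<in> Q L" "K \<noteq> L \<or> y \<noteq> z" for K L y z
  proof (cases "K = L")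
    case True
    show ?thesis
      by (rule free_partition_onD(6)[OF Q[OF that(1)]]) (use that \<open>K = L\<close> in auto)
  next
    case False
    then have "interior K \<inter> interior L = {}" by (rule dd(5)[OF that(1,3)])
    then show ?thesis
      using interior_mono[OF mem(3)[OF that(1,2)]] interior_mono[OF mem(3)[OF that(3,4)]] by blast
  qed
  show "free_partition (\<Union>K\<in>d. Q K)"
    unfolding free_partition_def
  proof (intro conjI)
    show "finite (\<Union>K\<in>d. Q K)"
      using dd(1) finQ by blast
    show "\<forall>(t, I)\<in>\<Union>K\<in>d. Q K. t \<in> {0..1} \<and> I \<in> subintervals"
    proof (clarify)
      fix t I K assume "K \<in> d" "(t, I) \<in> Q K"
      then show "t \<in> {0..1} \<and> I \<in> subintervals" using mem(1,2)[of K "(t, I)"] by simp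
    qed
    show "\<forall>(t, I)\<in>\<Union>K\<in>d. Q K. \<forall>(u, J)\<in>\<Union>K\<in>d. Q K. (t, I) \<noteq> (u, J) \<longrightarrow> interior I \<inter> interior J = {}"
    proof -
      have "\<forall>y\<in>\<Union>K\<in>d. Q K. \<forall>z\<in>\<Union>K\<in>d. Q K. y \<noteq> z \<longrightarrow> interior (snd y) \<inter> interior (snd z) = {}"
        using disj by blast
      then show ?thesis by (simp add: case_prod_beta' prod_eq_iff)
    qed
    have "(\<Union>(t, I)\<in>\<Union>K\<in>d. Q K. I) = (\<Union>K\<in>d. \<Union>y\<in>Q K. snd y)" by (auto simp: case_prod_beta')
    also have "\<dots> = \<Union> d" using finQ(2) by auto
    finally show "(\<Union>(t, I)\<in>\<Union>K\<in>d. Q K. I) = {0..1}" by (simp add: dd(6))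
  qed
  have un: "(\<Union>K\<in>d. Q K) = snd ` (Sigma d Q)" by force
  have fin: "finite (Sigma d Q)"
    using dd(1) finQ(1) by (intro finite_SigmaI)
  have "(\<Sum>(t, I)\<in>(\<Union>K\<in>d. Q K). measure lborel I * g t) = (\<Sum>x\<in>Sigma d Q. (case snd x of (t, I) \<Rightarrow> measure lborel I * g t))"
    unfolding un
  proof (subst sum.reindex_nontrivial[OF fin])
    \<comment> \<open>The collision: the same tagged interval over two different members of
      \<open>d\<close>.\<close>
    fix x y assume xy: "x \<in> Sigma d Q" "y \<in> Sigma d Q" "x \<noteq> y" "snd x = snd y"
    then have ne: "fst x \<noteq> fst y" by (auto simp: prod_eq_iff)
    have x: "fst x \<in> d" "snd x \<in> Q (fst x)" and y: "fst y \<in> d" "snd y \<in> Q (fst y)"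
      using xy by auto
    have "interior (snd (snd x)) = {}"
      using disj[OF x y] ne xy(4) by simp
    then have "measure lborel (snd (snd x)) = 0"
      using mem(2)[OF x] by (intro length_zero_if_interior_empty)
    then show "(case snd x of (t, I) \<Rightarrow> measure lborel I * g t) = 0"
      by (simp add: case_prod_beta')
  qed (simp add: o_def)
  also have "\<dots> = (\<Sum>K\<in>d. \<Sum>(t, I)\<in>Q K. measure lborel I * g t)"
    using dd(1) finQ(1) by (subst sum.Sigma) (auto simp: case_prod_beta')
  finally show "(\<Sum>(t, I)\<in>(\<Union>K\<in>d. Q K). measure lborel I * g t) = (\<Sum>K\<in>d. \<Sum>(t, I)\<in>Q K. measure lborel I * g t)" .
qed

text \<open>Empty traces are discarded because the empty set is not a subinterval. Two pairs can
  have the same trace only if it is degenerate, so no length is lost by collecting traces into a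
  set.\<close>

lemma free_partition_restrict:
  assumes P: "P tagged_division_of {0..1::real}" and K: "K \<in> subintervals"
  defines "Q \<equiv> (\<lambda>(t, J). (t, K \<inter> J)) ` {y \<in> P. K \<inter> snd y \<noteq> {}}"
  shows "free_partition_on K Q"
    and "(\<Sum>(t, I)\<in>Q. measure lborel I * g t) = (\<Sum>(t, J)\<in>P. measure lborel (K \<inter> J) * g t)"
proof -
  note PD = tagged_division_ofD[OF P]
  obtain a b where ab: "K = {a..b}" "0 \<le> a" "a \<le> b" "b \<le> 1"
    using K by (auto simp: subintervals_def)
  have sub: "K \<inter> J \<in> subintervals" if tJ: "(t, J) \<in> P" "K \<inter> J \<noteq> {}" for t J
  proof -
    obtain u v where J: "J = {u..v}" using PD(4)[OF tJ(1)] by (auto simp: cbox_interval)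
    then have KJ: "K \<inter> J = {max a u..min b v}" by (auto simp: ab(1))
    with tJ(2) have "max a u \<le> min b v" by auto
    then show ?thesis unfolding KJ using ab by (intro subintervalsI) auto
  qed
  have tag: "t \<in> {0..1}" if "(t, J) \<in> P" for t J
    using PD(2,3)[OF that] by blast
  have disj: "interior (K \<inter> J) \<inter> interior (K \<inter> J') = {}"
    if "(t, J) \<in> P" "(u, J') \<in> P" "(t, J) \<noteq> (u, J')" for t u J J'
    using PD(5)[OF that] by (auto simp: interior_Int)
  show "free_partition_on K Q"
    unfolding free_partition_on_def
  proof (intro conjI ballI impI)
    show "finite Q" using PD(1) by (simp add: Q_def)
    fix y assume "y \<in> Q"
    then obtain w where w: "w \<in> {y \<in> P. K \<inter> snd y \<noteq> {}}" "y = (case w of (t, J) \<Rightarrow> (t, K \<inter> J))"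
      unfolding Q_def by blast
    obtain t J where "w = (t, J)" by (cases w)
    with w have y: "y = (t, K \<inter> J)" "(t, J) \<in> P" "K \<inter> J \<noteq> {}" by auto
    show "fst y \<in> {0..1}" "snd y \<in> subintervals" "snd y \<subseteq> K"
      using y sub[OF y(2,3)] tag[OF y(2)] by auto
    fix z assume "z \<in> Q" "y \<noteq> z"
    then obtain u J' where z: "z = (u, K \<inter> J')" "(u, J') \<in> P" by (auto simp: Q_def)
    show "interior (snd y) \<inter> interior (snd z) = {}"
      using disj[OF y(2) z(2)] \<open>y \<noteq> z\<close> y(1) z(1) by auto
  next
    have "(\<Union>y\<in>Q. snd y) = K \<inter> (\<Union>{J. \<exists>t. (t, J) \<in> P})"
      by (force simp: Q_def)
    also have "\<dots> = K" using PD(6) ab by auto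
    finally show "(\<Union>y\<in>Q. snd y) = K" .
  qed
  have "(\<Sum>(t, I)\<in>Q. measure lborel I * g t) = (\<Sum>(t, J)\<in>{y \<in> P. K \<inter> snd y \<noteq> {}}. measure lborel (K \<inter> J) * g t)"
    unfolding Q_def
  proof (subst sum.reindex_nontrivial)
    show "finite {y \<in> P. K \<inter> snd y \<noteq> {}}" using PD(1) by simp
    fix x y assume x: "x \<in> {y \<in> P. K \<inter> snd y \<noteq> {}}" and y: "y \<in> {y \<in> P. K \<inter> snd y \<noteq> {}}"
      and ne: "x \<noteq> y" and eq: "(case x of (t, J) \<Rightarrow> (t, K \<inter> J)) = (case y of (t, J) \<Rightarrow> (t, K \<inter> J))"
    obtain t J where xt: "x = (t, J)" by (cases x)
    obtain u J' where yu: "y = (u, J')" by (cases y)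
    have "K \<inter> J = K \<inter> J'" using eq by (simp add: xt yu)
    moreover have "interior (K \<inter> J) \<inter> interior (K \<inter> J') = {}"
      using x y ne by (intro disj[of t J u J']) (simp_all add: xt yu)
    ultimately have "interior (K \<inter> J) = {}" by (simp only: Int_absorb)
    then have "measure lborel (K \<inter> J) = 0"
      using sub[of t J] x by (intro length_zero_if_interior_empty) (auto simp: xt)
    then show "(case (case x of (t, J) \<Rightarrow> (t, K \<inter> J)) of (t, I) \<Rightarrow> measure lborel I * g t) = 0"
      by (simp add: xt)
  qed (auto simp: case_prod_beta' intro!: sum.cong)
  also have "\<dots> = (\<Sum>(t, J)\<in>P. measure lborel (K \<inter> J) * g t)"
    using PD(1) by (intro sum.mono_neutral_left) auto
  finally show "(\<Sum>(t, I)\<in>Q. measure lborel I * g t) = (\<Sum>(t, J)\<in>P. measure lborel (K \<inter> J) * g t)" .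
qed

lemma division_subinterval:
  assumes "d division_of {0..1::real}" "K \<in> d" shows "K \<in> subintervals"
proof -
  obtain a b where K: "K = {a..b}" using division_ofD(4)[OF assms] by (auto simp: cbox_interval)
  with division_ofD(2,3)[OF assms] show ?thesis by (auto intro!: subintervalsI simp: K)
qed

text \<open>Two fine free partitions agreeing outside the chosen subfamily are compared: one carries the
  tags of the fixed partition \<open>P\<close>, the other those of fine Perron partitions.\<close>

lemma mcshane_subfamily_bound:
  fixes h :: "real \<Rightarrow> real"
  assumes \<delta>: "gauge_fun \<delta>" and mc: "\<And>p. free_partition p \<Longrightarrow> delta_fine \<delta> p \<Longrightarrow>
      \<bar>(\<Sum>(t, I)\<in>p. measure lborel I * h t) - y\<bar> \<le> \<epsilon>"
    and h: "\<And>a b. 0 \<le> a \<Longrightarrow> a \<le> b \<Longrightarrow> b \<le> 1 \<Longrightarrow> h integrable_on {a..b}"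
    and P: "P tagged_division_of {0..1}" "delta_fine \<delta> P"
    and d: "d division_of {0..1}" and D: "D \<subseteq> d" and \<eta>: "0 < \<eta>"
  shows "\<bar>\<Sum>K\<in>D. integral K h - (\<Sum>(t, J)\<in>P. measure lborel (K \<inter> J) * h t)\<bar> \<le> 2 * \<epsilon> + \<eta>"
proof -
  note dd = division_ofD[OF d]
  \<comment> \<open>Each member of \<open>d\<close> receives the share \<open>\<eta> / N\<close>;
    the summand 1 keeps \<open>N\<close> positive.\<close>
  define N where "N = real (card d) + 1"
  have N: "0 < N" by (simp add: N_def)
  define R where "R K = (\<lambda>(t, J). (t, K \<inter> J)) ` {y \<in> P. K \<inter> snd y \<noteq> {}}" for K
  have R: "free_partition_on K (R K)" "(\<Sum>(t, I)\<in>R K. measure lborel I * h t) = (\<Sum>(t, J)\<in>P. measure lborel (K \<inter> J) * h t)"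
    if "K \<in> d" for K
    unfolding R_def using free_partition_restrict[OF P(1) division_subinterval[OF d that]] by auto
  have R_fine: "delta_fine \<delta> (R K)" for K
    using P(2) unfolding delta_fine_def fine_def R_def by fastforce
  have "\<exists>q. free_partition_on K q \<and> delta_fine \<delta> q \<and> \<bar>(\<Sum>(t, I)\<in>q. measure lborel I * h t) - integral K h\<bar> \<le> \<eta> / N"
    if K: "K \<in> d" for K
  proof -
    obtain a b where ab: "K = {a..b}" "0 \<le> a" "a \<le> b" "b \<le> 1"
      using division_subinterval[OF d K] by (auto simp: subintervals_def)
    have hint: "(h has_integral integral K h) {a..b}"
      using h[OF ab(2-4)] ab(1) by (simp add: integrable_integral)
    have "0 < \<eta> / N" using \<eta> N by simp
    then obtain \<gamma> where \<gamma>: "gauge \<gamma>" and *: "\<forall>p. p tagged_division_of {a..b} \<and> \<gamma> fine p \<longrightarrow>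
        norm ((\<Sum>(t, I)\<in>p. measure lborel I *\<^sub>R h t) - integral K h) < \<eta> / N"
      using hint[unfolded has_integral_real, rule_format, of "\<eta> / N"] by blast
    obtain \<gamma>' where \<gamma>': "gauge \<gamma>'" "\<And>t. t \<in> {0..1} \<Longrightarrow> \<gamma>' t = {t - \<delta> t <..< t + \<delta> t}"
      using gauge_of_gauge_fun[OF \<delta>] by metis
    obtain q where q: "q tagged_division_of {a..b}" "(\<lambda>t. \<gamma> t \<inter> \<gamma>' t) fine q"
      using fine_division_exists_real[OF gauge_Int[OF \<gamma> \<gamma>'(1)]] by metis
    note qd = tagged_division_ofD[OF q(1)]
    have tag: "t \<in> {0..1}" if "(t, I) \<in> q" for t I
      using qd(2,3)[OF that] ab by auto
    have "delta_fine \<delta> q"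
      unfolding delta_fine_def
    proof (rule fineI)
      fix t I assume "(t, I) \<in> q"
      with q(2) have "I \<subseteq> \<gamma>' t" by (auto dest: fineD)
      with \<gamma>'(2)[OF tag[OF \<open>(t, I) \<in> q\<close>]] show "I \<subseteq> {t - \<delta> t <..< t + \<delta> t}" by simp
    qed
    moreover have "free_partition_on K q"
      unfolding free_partition_on_def
    proof (intro conjI ballI impI)
      show "finite q" by (rule qd(1))
      fix y assume "y \<in> q"
      then have y: "(fst y, snd y) \<in> q" by simp
      show "fst y \<in> {0..1}" by (rule tag[OF y])
      show "snd y \<subseteq> K" using qd(3)[OF y] ab(1) by simp
      obtain u v where uv: "snd y = {u..v}" using qd(4)[OF y] by (auto simp: cbox_interval)
      then show "snd y \<in> subintervals"
        using qd(2,3)[OF y] ab by (auto intro!: subintervalsI)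
      fix z assume "z \<in> q" "y \<noteq> z"
      then show "interior (snd y) \<inter> interior (snd z) = {}"
        using qd(5)[OF y, of "fst z" "snd z"] by (auto simp: prod_eq_iff)
    next
      show "(\<Union>y\<in>q. snd y) = K" using qd(6) ab(1) by force
    qed
    moreover have "\<gamma> fine q" using q(2) by (auto simp: fine_def)
    with * q(1) have "\<bar>(\<Sum>(t, I)\<in>q. measure lborel I * h t) - integral K h\<bar> \<le> \<eta> / N"
      by (auto intro: less_imp_le)
    ultimately show ?thesis by blast
  qed
  then obtain q where q: "\<And>K. K \<in> d \<Longrightarrow> free_partition_on K (q K)" "\<And>K. K \<in> d \<Longrightarrow> delta_fine \<delta> (q K)"
    "\<And>K. K \<in> d \<Longrightarrow> \<bar>(\<Sum>(t, I)\<in>q K. measure lborel I * h t) - integral K h\<bar> \<le> \<eta> / N"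
    by metis
  have est: "\<bar>(\<Sum>K\<in>d. \<Sum>(t, I)\<in>Q K. measure lborel I * h t) - y\<bar> \<le> \<epsilon>"
    if Q: "\<And>K. K \<in> d \<Longrightarrow> free_partition_on K (Q K)" "\<And>K. K \<in> d \<Longrightarrow> delta_fine \<delta> (Q K)" for Q
  proof -
    have "delta_fine \<delta> (\<Union>K\<in>d. Q K)"
      using Q(2) unfolding delta_fine_def fine_def by blast
    with free_partition_concat(1)[of d Q, OF d Q(1)] mc have
      "\<bar>(\<Sum>(t, I)\<in>(\<Union>K\<in>d. Q K). measure lborel I * h t) - y\<bar> \<le> \<epsilon>" by blast
    then show ?thesis by (simp only: free_partition_concat(2)[of d Q h, OF d Q(1)])
  qed
  define S where "S Q K = (\<Sum>(t, I)\<in>Q K. measure lborel I * h t)" for Q :: "real set \<Rightarrow> (real \<times> real set) set" and K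
  \<comment> \<open>The concatenations of \<open>q'\<close> and of \<open>R\<close> differ only over
    \<open>D\<close>; both are fine, so each sum is within \<open>\<epsilon>\<close> of
    \<open>y\<close>.\<close>
  define q' where "q' K = (if K \<in> D then q K else R K)" for K
  have "\<bar>(\<Sum>K\<in>d. S R K) - y\<bar> \<le> \<epsilon>"
    unfolding S_def using R(1) R_fine by (intro est) auto
  moreover have "\<bar>(\<Sum>K\<in>d. S q' K) - y\<bar> \<le> \<epsilon>"
    unfolding S_def using R(1) R_fine q by (intro est) (auto simp: q'_def)
  ultimately have "\<bar>\<Sum>K\<in>d. S q' K - S R K\<bar> \<le> 2 * \<epsilon>"
    by (simp add: sum_subtractf)
  also have "(\<Sum>K\<in>d. S q' K - S R K) = (\<Sum>K\<in>D. S q K - S R K)"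
    using dd(1) D by (intro sum.mono_neutral_cong_right) (auto simp: q'_def S_def)
  finally have 1: "\<bar>\<Sum>K\<in>D. S q K - S R K\<bar> \<le> 2 * \<epsilon>" .
  have finD: "finite D" using dd(1) D finite_subset by blast
  have "\<bar>\<Sum>K\<in>D. integral K h - S q K\<bar> \<le> (\<Sum>K\<in>D. \<eta> / N)"
    using q(3) D by (intro sum_norm_le[where 'a = real, simplified]) (auto simp: S_def abs_minus_commute)
  also have "\<dots> = real (card D) * (\<eta> / N)" by simp
  also have "\<dots> \<le> N * (\<eta> / N)"
    using card_mono[OF dd(1) D] \<eta> N by (intro mult_right_mono) (auto simp: N_def)
  also have "\<dots> = \<eta>" using N by simp
  finally have 2: "\<bar>\<Sum>K\<in>D. integral K h - S q K\<bar> \<le> \<eta>" .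
  have "(\<Sum>K\<in>D. integral K h - (\<Sum>(t, J)\<in>P. measure lborel (K \<inter> J) * h t)) = (\<Sum>K\<in>D. integral K h - S R K)"
    using D R(2) by (intro sum.cong) (auto simp: S_def)
  also have "\<dots> = (\<Sum>K\<in>D. integral K h - S q K) + (\<Sum>K\<in>D. S q K - S R K)"
    by (simp add: sum.distrib[symmetric])
  finally show ?thesis using 1 2 by linarith
qed

text \<open>On a division fine for both gauges, \<open>\<bar>u t\<bar>\<close> times the length is
  at most the Saks-Henstock error plus \<open>\<bar>integral I u\<bar>\<close>. The errors sum to
  little and the integrals to at most \<open>B\<close>.\<close>

lemma integral_abs_le_variation:
  fixes u :: "real \<Rightarrow> real"
  assumes u: "u absolutely_integrable_on {0..1}"
    and B: "\<And>d. d division_of {0..1} \<Longrightarrow> (\<Sum>K\<in>d. \<bar>integral K u\<bar>) \<le> B"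
  shows "integral {0..1} (\<lambda>t. \<bar>u t\<bar>) \<le> B"
proof (rule field_le_epsilon)
  fix \<eta> :: real assume "0 < \<eta>"
  then have \<eta>: "0 < \<eta> / 2" by simp
  have "u integrable_on {0..1}" "(\<lambda>t. \<bar>u t\<bar>) integrable_on {0..1}"
    using u by (auto simp: absolutely_integrable_on_def)
  then have abs: "((\<lambda>t. \<bar>u t\<bar>) has_integral integral {0..1} (\<lambda>t. \<bar>u t\<bar>)) {0..1}"
    and null: "henstock_null (\<lambda>t I. \<bar>measure lborel I * u t - integral I u\<bar>)"
    by (auto intro: integrable_integral henstock_null_integrable)
  obtain \<delta>1 where \<delta>1: "gauge_fun \<delta>1" "\<And>p. p tagged_partial_division_of {0..1} \<Longrightarrow> delta_fine \<delta>1 p \<Longrightarrow>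
      (\<Sum>(t, I)\<in>p. \<bar>measure lborel I * u t - integral I u\<bar>) < \<eta> / 2"
    using null \<eta> unfolding henstock_null_def by blast
  obtain \<delta>2 where \<delta>2: "gauge_fun \<delta>2" "\<And>p. p tagged_division_of {0..1} \<Longrightarrow> delta_fine \<delta>2 p \<Longrightarrow>
      \<bar>(\<Sum>(t, I)\<in>p. measure lborel I * \<bar>u t\<bar>) - integral {0..1} (\<lambda>t. \<bar>u t\<bar>)\<bar> < \<eta> / 2"
    using has_integral_gauge_fun[OF abs \<eta>] by blast
  obtain p where p: "p tagged_division_of {0..1}" "delta_fine (\<lambda>t. min (\<delta>1 t) (\<delta>2 t)) p"
    using gauge_exists_fine_division[OF gauge_fun_min[OF \<delta>1(1) \<delta>2(1)]] by metis
  have p1: "delta_fine \<delta>1 p" and p2: "delta_fine \<delta>2 p"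
    by (rule delta_fine_mono[OF p(2)]; simp)+
  have "(\<Sum>(t, I)\<in>p. measure lborel I * \<bar>u t\<bar>) \<le> (\<Sum>(t, I)\<in>p. \<bar>measure lborel I * u t - integral I u\<bar> + \<bar>integral I u\<bar>)"
  proof (rule sum_mono, clarify)
    fix t :: real and I :: "real set"
    have "measure lborel I * \<bar>u t\<bar> = \<bar>measure lborel I * u t\<bar>" by (simp add: abs_mult)
    then show "measure lborel I * \<bar>u t\<bar> \<le> \<bar>measure lborel I * u t - integral I u\<bar> + \<bar>integral I u\<bar>"
      by linarith
  qed
  also have "\<dots> = (\<Sum>(t, I)\<in>p. \<bar>measure lborel I * u t - integral I u\<bar>) + (\<Sum>(t, I)\<in>p. \<bar>integral I u\<bar>)"
    by (simp add: case_prod_beta' sum.distrib)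
  also have "(\<Sum>(t, I)\<in>p. \<bar>integral I u\<bar>) = (\<Sum>I\<in>snd ` p. \<bar>integral I u\<bar>)"
  proof (rule sum.over_tagged_division_lemma[OF p(1)])
    fix a b :: real assume "box a b = {}"
    then have "measure lborel (cbox a b) = 0" by (simp only: content_eq_0_interior interior_cbox)
    then show "\<bar>integral (cbox a b) u\<bar> = 0" by (simp only: integral_null abs_zero)
  qed
  also have "\<dots> \<le> B" by (rule B[OF division_of_tagged_division[OF p(1)]])
  finally show "integral {0..1} (\<lambda>t. \<bar>u t\<bar>) \<le> B + \<eta>"
    using \<delta>1(2)[OF _ p1] \<delta>2(2)[OF p(1) p2] p(1) unfolding tagged_division_of_def by linarith
qed

text \<open>\<open>\<sigma>\<close> is the step function with the values of \<open>h\<close> at the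
  tags of \<open>P\<close>. By the subfamily bound, \<open>h - \<sigma>\<close> has a primitive of
  variation at most \<open>6 * \<epsilon>\<close>, hence an absolute integral of at most that size,
  while \<open>\<sigma>\<close> is bounded. The bound involves \<open>h\<close> only through
  finitely many values, which makes it uniform over families.\<close>

lemma mcshane_real_absolutely_integrable:
  fixes h :: "real \<Rightarrow> real"
  assumes \<delta>: "gauge_fun \<delta>" and \<epsilon>: "0 < \<epsilon>" and mc: "\<And>p. free_partition p \<Longrightarrow> delta_fine \<delta> p \<Longrightarrow>
      \<bar>(\<Sum>(t, I)\<in>p. measure lborel I * h t) - y\<bar> \<le> \<epsilon>"
    and h: "\<And>a b. 0 \<le> a \<Longrightarrow> a \<le> b \<Longrightarrow> b \<le> 1 \<Longrightarrow> h integrable_on {a..b}"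
    and P: "P tagged_division_of {0..1}" "delta_fine \<delta> P"
  shows "h absolutely_integrable_on {0..1}"
    and "E \<in> sets lebesgue \<Longrightarrow> E \<subseteq> {0..1} \<Longrightarrow>
      (LINT t:E|lebesgue. \<bar>h t\<bar>) \<le> 6 * \<epsilon> + (\<Sum>(t, J)\<in>P. \<bar>h t\<bar>) * measure lebesgue E"
proof -
  note PD = tagged_division_ofD[OF P(1)]
  define \<sigma> where "\<sigma> s = (\<Sum>(t, J)\<in>P. indicator J s * h t)" for s
  define T where "T K = integral K h - (\<Sum>(t, J)\<in>P. measure lborel (K \<inter> J) * h t)" for K
  have T: "(\<Sum>K\<in>d. \<bar>T K\<bar>) \<le> 6 * \<epsilon>" if d: "d division_of {0..1}" for d
  proof -
    define D1 where "D1 = {K \<in> d. 0 \<le> T K}"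
    define D2 where "D2 = {K \<in> d. T K < 0}"
    have fin: "finite d" using division_ofD(1)[OF d] .
    \<comment> \<open>The slack in \<open>mcshane_subfamily_bound\<close> is taken to be
      \<open>\<epsilon>\<close>, so each subfamily contributes at most
      \<open>3 * \<epsilon>\<close>; separating the two signs of \<open>T\<close> doubles
      this.\<close>
    have "(\<Sum>K\<in>D. T K) \<le> 3 * \<epsilon>" "- (\<Sum>K\<in>D. T K) \<le> 3 * \<epsilon>" if "D \<subseteq> d" for D
      using mcshane_subfamily_bound[OF \<delta> mc h P d that \<epsilon>] unfolding T_def by auto
    note bnd = this
    have "d = D1 \<union> D2" "D1 \<inter> D2 = {}" by (auto simp: D1_def D2_def)
    then have "(\<Sum>K\<in>d. \<bar>T K\<bar>) = (\<Sum>K\<in>D1. \<bar>T K\<bar>) + (\<Sum>K\<in>D2. \<bar>T K\<bar>)"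
      using fin by (metis finite_Un sum.union_disjoint)
    also have "(\<Sum>K\<in>D1. \<bar>T K\<bar>) = (\<Sum>K\<in>D1. T K)" by (intro sum.cong) (auto simp: D1_def)
    also have "(\<Sum>K\<in>D2. \<bar>T K\<bar>) = - (\<Sum>K\<in>D2. T K)"
      unfolding sum_negf[symmetric] by (intro sum.cong) (auto simp: D2_def)
    finally show ?thesis using bnd(1)[of D1] bnd(2)[of D2] by (auto simp: D1_def D2_def)
  qed
  have \<sigma>_int: "(\<sigma> has_integral (\<Sum>(t, J)\<in>P. measure lborel (K \<inter> J) * h t)) K" if K: "K \<in> subintervals" for K
  proof -
    obtain a b where ab: "K = {a..b}" using K by (auto simp: subintervals_def)
    have "((\<lambda>s. case y of (t, J) \<Rightarrow> indicator J s * h t) has_integral (case y of (t, J) \<Rightarrow> measure lborel (K \<inter> J) * h t)) K"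
      if yP: "y \<in> P" for y
    proof -
      obtain t J where y: "y = (t, J)" "(t, J) \<in> P" using yP by (cases y) auto
      obtain u v where J: "J = {u..v}" using PD(4)[OF y(2)] by (auto simp: cbox_interval)
      have KJ: "K \<inter> J = {max a u..min b v}" by (auto simp: ab J)
      have "J \<inter> K = {max a u..min b v}" by (auto simp: ab J)
      then have "((\<lambda>s. h t) has_integral measure lborel (J \<inter> K) *\<^sub>R h t) (J \<inter> K)"
        by (simp only: has_integral_const_real)
      then have "((\<lambda>s. if s \<in> J then h t else 0) has_integral measure lborel (J \<inter> K) *\<^sub>R h t) K"
        by (simp only: has_integral_restrict_Int)
      moreover have "(\<lambda>s. if s \<in> J then h t else 0) = (\<lambda>s. indicator J s * h t)"
        by (auto simp: indicator_def)
      ultimately show ?thesis by (simp add: y(1) Int_commute)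
    qed
    then show ?thesis
      unfolding \<sigma>_def[abs_def] by (rule has_integral_sum[OF PD(1)])
  qed
  \<comment> \<open>A sum instead of a maximum, so that it also bounds \<open>\<sigma>\<close> at
    common endpoints, where several indicators are 1.\<close>
  define C where "C = (\<Sum>(t, J)\<in>P. \<bar>h t\<bar>)"
  have C: "0 \<le> C" by (auto simp: C_def intro!: sum_nonneg)
  have \<sigma>C: "\<bar>\<sigma> s\<bar> \<le> C" for s
    unfolding \<sigma>_def C_def
    by (rule sum_norm_le[where 'a = real, simplified]) (auto simp: abs_mult indicator_def)
  have "\<sigma> integrable_on {0..1}"
    using \<sigma>_int[OF subintervalsI[of 0 1]] unfolding integrable_on_def by auto
  then have \<sigma>_abs: "\<sigma> absolutely_integrable_on {0..1}"
    by (rule absolutely_integrable_integrable_bound[where g = "\<lambda>_. C", rotated]) (use \<sigma>C in auto)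
  define u where "u s = h s - \<sigma> s" for s
  have uK: "integral K u = T K" if K: "K \<in> subintervals" for K
  proof -
    obtain a b where ab: "K = {a..b}" "0 \<le> a" "a \<le> b" "b \<le> 1" using K by (auto simp: subintervals_def)
    have "(h has_integral integral K h) K"
      using h[OF ab(2-4)] by (simp add: ab(1) integrable_integral)
    from has_integral_diff[OF this \<sigma>_int[OF K]] show ?thesis
      unfolding u_def[abs_def] T_def by (rule integral_unique)
  qed
  have var: "(\<Sum>K\<in>d. \<bar>integral K u\<bar>) \<le> 6 * \<epsilon>" if "d division_of {0..1}" for d
  proof -
    have "(\<Sum>K\<in>d. \<bar>integral K u\<bar>) = (\<Sum>K\<in>d. \<bar>T K\<bar>)"
      using uK division_subinterval[OF that] by (intro sum.cong) auto
    with T[OF that] show ?thesis by simp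
  qed
  have u_int: "u integrable_on {0..1}"
    unfolding u_def using h[of 0 1] \<open>\<sigma> integrable_on {0..1}\<close> by (intro integrable_diff) auto
  have u_abs: "u absolutely_integrable_on {0..1}"
    using bounded_variation_absolutely_integrable_interval[of u 0 1 "6 * \<epsilon>"] u_int var by simp
  have "(\<lambda>s. u s + \<sigma> s) absolutely_integrable_on {0..1}"
    using u_abs \<sigma>_abs by (rule set_integral_add(1))
  then show h_abs: "h absolutely_integrable_on {0..1}" by (simp add: u_def)
  assume E: "E \<in> sets lebesgue" "E \<subseteq> {0..1}"
  have restr: "set_integrable lebesgue E g" if "g absolutely_integrable_on {0..1}" for g :: "real \<Rightarrow> real"
    using set_integrable_subset[OF that E] .
  have Efm: "E \<in> lmeasurable"
    using E bounded_subset[of "{0..1}" E] by (intro bounded_set_imp_lmeasurable) auto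
  have const: "set_integrable lebesgue E (\<lambda>t. C)" "(LINT t:E|lebesgue. C) = C * measure lebesgue E"
    using Efm E(1) by (auto simp: set_integrable_def set_lebesgue_integral_def fmeasurable_def)
  have "(LINT t:E|lebesgue. \<bar>h t\<bar>) \<le> (LINT t:E|lebesgue. \<bar>u t\<bar> + C)"
  proof (rule set_integral_mono)
    show "set_integrable lebesgue E (\<lambda>t. \<bar>h t\<bar>)" by (intro set_integrable_abs restr h_abs)
    show "set_integrable lebesgue E (\<lambda>t. \<bar>u t\<bar> + C)" by (intro set_integral_add set_integrable_abs restr u_abs const)
    show "\<bar>h t\<bar> \<le> \<bar>u t\<bar> + C" for t using \<sigma>C[of t] by (auto simp: u_def)
  qed
  also have "\<dots> = (LINT t:E|lebesgue. \<bar>u t\<bar>) + C * measure lebesgue E"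
    by (simp add: set_integral_add set_integrable_abs restr u_abs const)
  also have "(LINT t:E|lebesgue. \<bar>u t\<bar>) \<le> (LINT t:{0..1}|lebesgue. \<bar>u t\<bar>)"
    by (rule set_integral_abs_subset_le(2)[OF u_abs E])
  also have "\<dots> = integral {0..1} (\<lambda>t. \<bar>u t\<bar>)"
    using u_abs by (intro set_lebesgue_integral_eq_integral set_integrable_abs)
  also have "\<dots> \<le> 6 * \<epsilon>" by (rule integral_abs_le_variation[OF u_abs var])
  finally show "(LINT t:E|lebesgue. \<bar>h t\<bar>) \<le> 6 * \<epsilon> + (\<Sum>(t, J)\<in>P. \<bar>h t\<bar>) * measure lebesgue E"
    by (simp add: C_def)
qed

context
  fixes \<Gamma> :: "real \<Rightarrow> 'a::real_normed_vector set" and \<Phi>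
  assumes cwk: "\<And>t. t \<in> {0..1} \<Longrightarrow> \<Gamma> t \<in> cwk" and prim: "has_vH_primitive \<Gamma> \<Phi>"
    and mcs: "mcshane_integrable \<Gamma>"
begin

text \<open>Support functions are 1-Lipschitz in the Hausdorff distance for functionals of norm at
  most 1, so the gauge of the McShane integral serves them all; \<open>y f\<close> is the support
  function of the integral.\<close>

lemma mcshane_support_fun_uniform:
  assumes \<epsilon>: "0 < \<epsilon>"
  obtains \<delta> y where "gauge_fun \<delta>" "\<And>p f. free_partition p \<Longrightarrow> delta_fine \<delta> p \<Longrightarrow> norm f \<le> 1 \<Longrightarrow>
    \<bar>(\<Sum>(t, I)\<in>p. measure lborel I * support_fun f (\<Gamma> t)) - y f\<bar> \<le> \<epsilon>"
proof -
  obtain \<Psi> where \<Psi>: "has_mcshane_integral \<Gamma> \<Psi>"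
    using mcs by (auto simp: mcshane_integrable_def)
  then have ne: "\<Psi> \<noteq> {}" by (simp add: has_mcshane_integral_def)
  define S where "S p = (\<Sum>(t, I)\<in>p. (*\<^sub>R) (measure lborel I) ` \<Gamma> t)" for p :: "(real \<times> real set) set"
  have ex: "\<exists>\<delta>. gauge_fun \<delta> \<and> (\<forall>p. free_partition p \<and> delta_fine \<delta> p \<longrightarrow> hausdorff_distance \<Psi> (S p) < ennreal e)"
    if "0 < e" for e :: real
    using \<Psi> that unfolding has_mcshane_integral_def S_def by blast
  \<comment> \<open>The integral is assumed only non-empty, closed and convex. It is bounded because
    it lies within distance 1 of some Riemann sum.\<close>
  have bounded: "bounded \<Psi>"
  proof -
    obtain \<delta> where \<delta>: "gauge_fun \<delta>" "\<forall>p. free_partition p \<and> delta_fine \<delta> p \<longrightarrow> hausdorff_distance \<Psi> (S p) < ennreal 1"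
      using ex[of 1] by auto
    obtain p where p: "p tagged_division_of {0..1}" "delta_fine \<delta> p"
      using gauge_exists_fine_division[OF \<delta>(1)] by metis
    have fp: "free_partition p" by (rule free_partition_of_division[OF p(1)])
    have hd: "hausdorff_distance \<Psi> (S p) < ennreal 1" using \<delta>(2) fp p(2) by blast
    have S: "S p \<noteq> {}" "bounded (S p)" unfolding S_def by (rule set_sum_cwk; use cwk fp in blast)+
    then obtain c where c: "\<And>x. x \<in> S p \<Longrightarrow> norm x \<le> c" by (auto simp: bounded_iff)
    have "norm x \<le> c + 1" if x: "x \<in> \<Psi>" for x
    proof -
      obtain b where "b \<in> S p" "dist x b < 1"
        using hausdorff_distance_lessD[OF hd x S(1)] by metis
      then show ?thesis
        using c[of b] norm_triangle_ineq2[of x b] by (simp add: dist_norm)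
    qed
    then show ?thesis by (auto simp: bounded_iff)
  qed
  obtain \<delta> where \<delta>: "gauge_fun \<delta>" "\<forall>p. free_partition p \<and> delta_fine \<delta> p \<longrightarrow> hausdorff_distance \<Psi> (S p) < ennreal \<epsilon>"
    using ex[OF \<epsilon>] by blast
  show thesis
  proof (rule that[OF \<delta>(1)])
    fix p and f :: "'a \<Rightarrow>\<^sub>L real" assume p: "free_partition p" "delta_fine \<delta> p" and f: "norm f \<le> 1"
    have hd: "hausdorff_distance \<Psi> (S p) < ennreal \<epsilon>" using \<delta>(2) p by blast
    have S: "S p \<noteq> {}" "bounded (S p)" "support_fun f (S p) = (\<Sum>(t, I)\<in>p. measure lborel I * support_fun f (\<Gamma> t))"
      unfolding S_def by (rule set_sum_cwk; use cwk p(1) in blast)+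
    have "\<bar>support_fun f \<Psi> - support_fun f (S p)\<bar> \<le> norm f * \<epsilon>"
      using hd ne S(1) bounded S(2) by (intro support_fun_diff_le_hausdorff bdd_above_functional)
    also have "\<dots> \<le> 1 * \<epsilon>" using f \<epsilon> by (intro mult_right_mono) auto
    finally show "\<bar>(\<Sum>(t, I)\<in>p. measure lborel I * support_fun f (\<Gamma> t)) - support_fun f \<Psi>\<bar> \<le> \<epsilon>"
      by (simp add: S(3) abs_minus_commute)
  qed
qed

text \<open>One gauge and one partition \<open>P\<close> serve the whole unit ball, and at the
  finitely many tags of \<open>P\<close> the support functions are bounded by the norms in
  \<open>\<Gamma> t\<close>. The factor \<open>C\<close> of the measure of \<open>E\<close> is
  therefore common to all functionals.\<close>

lemma mcshane_uniformly_integrable: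
  shows "norm f \<le> 1 \<Longrightarrow> (\<lambda>t. support_fun f (\<Gamma> t)) absolutely_integrable_on {0..1}"
    and "0 < \<epsilon> \<Longrightarrow> \<exists>\<eta>>0. \<forall>E f. E \<in> sets lebesgue \<longrightarrow> E \<subseteq> {0..1} \<longrightarrow> measure lebesgue E \<le> \<eta> \<longrightarrow> norm f \<le> 1 \<longrightarrow>
      (LINT t:E|lebesgue. \<bar>support_fun f (\<Gamma> t)\<bar>) \<le> \<epsilon>"
proof -
  have *: "\<exists>C. \<forall>f. norm f \<le> 1 \<longrightarrow> (\<lambda>t. support_fun f (\<Gamma> t)) absolutely_integrable_on {0..1} \<and>
      (\<forall>E. E \<in> sets lebesgue \<longrightarrow> E \<subseteq> {0..1} \<longrightarrow> (LINT t:E|lebesgue. \<bar>support_fun f (\<Gamma> t)\<bar>) \<le> 6 * e + C * measure lebesgue E)"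
    if e: "0 < e" for e
  proof -
    obtain \<delta> y where \<delta>: "gauge_fun \<delta>" and mc: "\<And>p f. free_partition p \<Longrightarrow> delta_fine \<delta> p \<Longrightarrow> norm f \<le> 1 \<Longrightarrow>
      \<bar>(\<Sum>(t, I)\<in>p. measure lborel I * support_fun f (\<Gamma> t)) - y f\<bar> \<le> e"
      by (rule mcshane_support_fun_uniform[OF e]) (rule that; assumption)
    obtain P where P: "P tagged_division_of {0..1}" "delta_fine \<delta> P"
      using gauge_exists_fine_division[OF \<delta>] by metis
    have h: "(\<lambda>t. support_fun f (\<Gamma> t)) integrable_on {a..b}" if "0 \<le> a" "a \<le> b" "b \<le> 1" for f a b
      using support_fun_has_integral[OF cwk prim that] by (auto simp: integrable_on_def)
    have "\<exists>c. \<forall>f. norm f \<le> 1 \<longrightarrow> \<bar>support_fun f (\<Gamma> t)\<bar> \<le> c" if t: "t \<in> {0..1}" for t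
    proof -
      obtain c where c: "\<And>x. x \<in> \<Gamma> t \<Longrightarrow> norm x \<le> c"
        using cwk_bounded[OF cwk[OF t]] by (auto simp: bounded_iff)
      have "\<bar>support_fun f (\<Gamma> t)\<bar> \<le> c" if f: "norm f \<le> 1" for f
      proof -
        obtain x where x: "x \<in> \<Gamma> t" "support_fun f (\<Gamma> t) = blinfun_apply f x"
          using support_fun_attained[OF cwk[OF t]] by metis
        then show ?thesis using blinfun_apply_le_unit[OF f, of x] c[OF x(1)] by simp
      qed
      then show ?thesis by blast
    qed
    then obtain c where c: "\<And>t f. t \<in> {0..1} \<Longrightarrow> norm f \<le> 1 \<Longrightarrow> \<bar>support_fun f (\<Gamma> t)\<bar> \<le> c t"
      by metis
    define C where "C = (\<Sum>(t, J)\<in>P. c t)"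
    show ?thesis
    proof (intro exI[of _ C] allI impI conjI)
      fix f :: "'a \<Rightarrow>\<^sub>L real" assume f: "norm f \<le> 1"
      have mcf: "\<bar>(\<Sum>(t, I)\<in>p. measure lborel I * support_fun f (\<Gamma> t)) - y f\<bar> \<le> e"
        if "free_partition p" "delta_fine \<delta> p" for p
        using that f by (rule mc)
      show "(\<lambda>t. support_fun f (\<Gamma> t)) absolutely_integrable_on {0..1}" by (rule mcshane_real_absolutely_integrable(1)[OF \<delta> e mcf h P])
      fix E assume E: "E \<in> sets lebesgue" "E \<subseteq> {0..1::real}"
      have "(\<Sum>(t, J)\<in>P. \<bar>support_fun f (\<Gamma> t)\<bar>) \<le> C"
        unfolding C_def using tag_in_interval[OF P(1)] by (intro sum_mono) (auto intro!: c f)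
      then have "(\<Sum>(t, J)\<in>P. \<bar>support_fun f (\<Gamma> t)\<bar>) * measure lebesgue E \<le> C * measure lebesgue E"
        by (intro mult_right_mono) auto
      moreover have "(LINT t:E|lebesgue. \<bar>support_fun f (\<Gamma> t)\<bar>) \<le>
          6 * e + (\<Sum>(t, J)\<in>P. \<bar>support_fun f (\<Gamma> t)\<bar>) * measure lebesgue E"
        by (rule mcshane_real_absolutely_integrable(2)[OF \<delta> e mcf h P]) (assumption | rule E)+
      ultimately show "(LINT t:E|lebesgue. \<bar>support_fun f (\<Gamma> t)\<bar>) \<le> 6 * e + C * measure lebesgue E"
        by linarith
    qed
  qed
  show "norm f \<le> 1 \<Longrightarrow> (\<lambda>t. support_fun f (\<Gamma> t)) absolutely_integrable_on {0..1}"
    using *[of 1] by auto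
  assume \<epsilon>: "0 < \<epsilon>"
  then obtain C where C: "\<And>f E. norm f \<le> 1 \<Longrightarrow> E \<in> sets lebesgue \<Longrightarrow> E \<subseteq> {0..1} \<Longrightarrow>
      (LINT t:E|lebesgue. \<bar>support_fun f (\<Gamma> t)\<bar>) \<le> 6 * (\<epsilon> / 12) + C * measure lebesgue E"
    using *[of "\<epsilon> / 12"] by auto
  \<comment> \<open>Half of \<open>\<epsilon>\<close> is spent on
    \<open>6 * (\<epsilon> / 12)\<close>, and this \<open>\<eta>\<close> keeps the measure term
    within the other half.\<close>
  define \<eta> where "\<eta> = \<epsilon> / (2 * (\<bar>C\<bar> + 1))"
  have "0 < \<eta>" using \<epsilon> by (simp add: \<eta>_def add_nonneg_pos)
  moreover have "(LINT t:E|lebesgue. \<bar>support_fun f (\<Gamma> t)\<bar>) \<le> \<epsilon>"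
    if "E \<in> sets lebesgue" "E \<subseteq> {0..1}" "measure lebesgue E \<le> \<eta>" "norm f \<le> 1" for E f
  proof -
    have "C * measure lebesgue E \<le> (\<bar>C\<bar> + 1) * \<eta>"
      using that(3) by (intro mult_mono) auto
    also have "\<dots> = \<epsilon> / 2"
    proof -
      have "\<bar>C\<bar> + 1 \<noteq> 0" by linarith
      then show ?thesis unfolding \<eta>_def by (simp add: field_simps)
    qed
    finally show ?thesis using C[OF that(4,1,2)] by linarith
  qed
  ultimately show "\<exists>\<eta>>0. \<forall>E f. E \<in> sets lebesgue \<longrightarrow> E \<subseteq> {0..1} \<longrightarrow> measure lebesgue E \<le> \<eta> \<longrightarrow> norm f \<le> 1 \<longrightarrow>
      (LINT t:E|lebesgue. \<bar>support_fun f (\<Gamma> t)\<bar>) \<le> \<epsilon>" by blast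
qed

end

section \<open>Pettis integrability of selections\<close>

lemma has_pettis_integralI:
  assumes "\<And>f. (\<lambda>t. support_fun f (\<Gamma> t)) absolutely_integrable_on {0..1}"
    and "\<And>E. E \<in> sets lebesgue \<Longrightarrow> E \<subseteq> {0..1} \<Longrightarrow> M E \<in> cwk \<and>
      (\<forall>f. support_fun f (M E) = (LINT t:E|lebesgue. support_fun f (\<Gamma> t)))"
  shows "has_pettis_integral \<Gamma> M"
  using assms unfolding has_pettis_integral_def
  by (auto simp: integrable_restrict_space set_integrable_def integral_restrict_space set_lebesgue_integral_def)

lemma pettis_integrable_funI:
  fixes g :: "real \<Rightarrow> 'a::real_normed_vector"
  assumes "\<And>f :: 'a \<Rightarrow>\<^sub>L real. (\<lambda>t. blinfun_apply f (g t)) absolutely_integrable_on {0..1}"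
    and "\<And>E. E \<in> sets lebesgue \<Longrightarrow> E \<subseteq> {0..1} \<Longrightarrow>
      \<exists>m. \<forall>f :: 'a \<Rightarrow>\<^sub>L real. blinfun_apply f m = (LINT t:E|lebesgue. blinfun_apply f (g t))"
  shows "pettis_integrable_fun g"
proof -
  have "\<forall>E. \<exists>m. E \<in> sets lebesgue \<and> E \<subseteq> {0..1} \<longrightarrow>
      (\<forall>f :: 'a \<Rightarrow>\<^sub>L real. blinfun_apply f m = (LINT t:E|lebesgue. blinfun_apply f (g t)))"
    proof
    fix E show "\<exists>m. E \<in> sets lebesgue \<and> E \<subseteq> {0..1} \<longrightarrow>
      (\<forall>f :: 'a \<Rightarrow>\<^sub>L real. blinfun_apply f m = (LINT t:E|lebesgue. blinfun_apply f (g t)))"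
    proof (cases "E \<in> sets lebesgue \<and> E \<subseteq> {0..1}")
      case True
      then have "\<exists>m. \<forall>f :: 'a \<Rightarrow>\<^sub>L real. blinfun_apply f m = (LINT t:E|lebesgue. blinfun_apply f (g t))"
        by (intro assms(2)) auto
      then show ?thesis by (rule ex_forward) simp
    next
      case False
      show ?thesis by (rule exI[of _ 0], rule impI, rule notE[OF False])
    qed
  qed
  from choice[OF this] obtain m where "\<forall>E. E \<in> sets lebesgue \<and> E \<subseteq> {0..1} \<longrightarrow>
      (\<forall>f :: 'a \<Rightarrow>\<^sub>L real. blinfun_apply f (m E) = (LINT t:E|lebesgue. blinfun_apply f (g t)))" ..
  then have "has_pettis_integral (\<lambda>t. {g t}) (\<lambda>E. {m E})"
    using assms(1) by (intro has_pettis_integralI) auto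
  then show ?thesis by (auto simp: pettis_integrable_fun_def)
qed

lemma pettis_integral_fun_set_integral:
  fixes g :: "real \<Rightarrow> 'a::real_normed_vector" and f :: "'a \<Rightarrow>\<^sub>L real"
  assumes "has_pettis_integral (\<lambda>t. {g t}) (\<lambda>E. {m E})"
  shows "(\<lambda>t. blinfun_apply f (g t)) absolutely_integrable_on {0..1}"
    and "E \<in> sets lebesgue \<Longrightarrow> E \<subseteq> {0..1} \<Longrightarrow> blinfun_apply f (m E) = (LINT t:E|lebesgue. blinfun_apply f (g t))"
  using pettis_integral_set_integral[OF assms] by auto

text \<open>The sets on which the scalar integrals are represented by a vector form a Dynkin system;
  uniform integrability makes the partial sums over a disjoint sequence Cauchy.\<close>

lemma pettis_integrable_fun_of_intervals:
  fixes g :: "real \<Rightarrow> 'a::banach"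
  assumes int: "\<And>f :: 'a \<Rightarrow>\<^sub>L real. (\<lambda>t. blinfun_apply f (g t)) absolutely_integrable_on {0..1}"
    and ivl: "\<And>a. a \<in> {0..1} \<Longrightarrow> \<exists>m. \<forall>f :: 'a \<Rightarrow>\<^sub>L real. blinfun_apply f m = (LINT t:{0..a}|lebesgue. blinfun_apply f (g t))"
    and ui: "\<And>\<epsilon>. 0 < \<epsilon> \<Longrightarrow> \<exists>\<eta>>0. \<forall>E (f :: 'a \<Rightarrow>\<^sub>L real). E \<in> sets lebesgue \<longrightarrow> E \<subseteq> {0..1} \<longrightarrow> measure lebesgue E \<le> \<eta> \<longrightarrow> norm f \<le> 1 \<longrightarrow>
      (LINT t:E|lebesgue. \<bar>blinfun_apply f (g t)\<bar>) \<le> \<epsilon>"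
  shows "pettis_integrable_fun g"
proof (rule pettis_integrable_funI[OF int])
  \<comment> \<open>Intersecting with the unit interval lets \<open>A\<close> range over all Borel
    sets of the line, where half-lines are a generator stable under intersection.\<close>
  define R where "R A m \<longleftrightarrow> (\<forall>f :: 'a \<Rightarrow>\<^sub>L real. blinfun_apply f m = (LINT t:A \<inter> {0..1}|lebesgue. blinfun_apply f (g t)))" for A m
  have sub: "set_integrable lebesgue E (\<lambda>t. blinfun_apply f (g t))" if "E \<in> sets lebesgue" "E \<subseteq> {0..1}" for E and f :: "'a \<Rightarrow>\<^sub>L real"
    using set_integrable_subset[OF int that] .
  have empty: "R {} 0" by (simp add: R_def set_lebesgue_integral_def)
  have whole: "\<exists>m. R UNIV m" using ivl[of 1] by (auto simp: R_def)
  have R: "\<exists>m. R A m" if "A \<in> sets borel" for A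
  proof -
    have "A \<in> sigma_sets UNIV (range (\<lambda>a::real. {..a}))"
      using that by (simp add: borel_eq_atMost)
    then show ?thesis
    proof (induction A rule: sigma_sets_induct_disjoint[rotated 2, consumes 1, case_names basic empty compl union Int Pow])
      case (basic A)
      then obtain a where a: "A = {..a}" by blast
      show ?case
      proof (cases "a < 0")
        case True
        then have "A \<inter> {0..1} = {} \<inter> {0..1}" by (auto simp: a)
        with empty show ?thesis unfolding R_def by metis
      next
        case False
        then have "A \<inter> {0..1} = {0..min a 1}" by (auto simp: a)
        moreover have "\<exists>m. \<forall>f :: 'a \<Rightarrow>\<^sub>L real. blinfun_apply f m = (LINT t:{0..min a 1}|lebesgue. blinfun_apply f (g t))"
          using False by (intro ivl) auto
        ultimately show ?thesis unfolding R_def by simp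
      qed
    next
      case empty
      show ?case using \<open>R {} 0\<close> by blast
    next
      case (compl A)
      then have A: "A \<in> sets lebesgue" by (simp add: borel_eq_atMost sets_completionI_sets)
      obtain m1 m2 where m: "R UNIV m1" "R A m2" using compl whole by blast
      have "R (UNIV - A) (m1 - m2)"
        unfolding R_def
      proof
        fix f :: "'a \<Rightarrow>\<^sub>L real"
        have "(LINT t:(UNIV - A) \<inter> {0..1} \<union> A \<inter> {0..1}|lebesgue. blinfun_apply f (g t)) =
            (LINT t:(UNIV - A) \<inter> {0..1}|lebesgue. blinfun_apply f (g t)) + (LINT t:A \<inter> {0..1}|lebesgue. blinfun_apply f (g t))"
          using A sets.compl_sets[OF A] by (intro set_integral_Un sub sets.Int) auto
        also have "(UNIV - A) \<inter> {0..1} \<union> A \<inter> {0..1} = UNIV \<inter> {0..1}" by blast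
        finally show "blinfun_apply f (m1 - m2) = (LINT t:(UNIV - A) \<inter> {0..1}|lebesgue. blinfun_apply f (g t))"
          using m by (simp add: R_def blinfun.diff_right)
      qed
      then show ?case by blast
    next
      case (union A)
      define A' where "A' i = A i \<inter> {0..1}" for i
      have A: "A i \<in> sets lebesgue" for i
      proof -
        have "A i \<in> sigma_sets UNIV (range (\<lambda>a::real. {..a}))" using union(2) by blast
        then show ?thesis by (simp add: borel_eq_atMost sets_completionI_sets)
      qed
      have A': "A' i \<in> sets lebesgue" "A' i \<subseteq> {0..1}" for i using A by (auto simp: A'_def)
      have A'd: "disjoint_family A'"
        using union(1) by (auto simp: A'_def disjoint_family_on_def)
      obtain m where m: "\<And>i. R (A i) (m i)" using union(3) by metis
      \<comment> \<open>The integrals over the tails \<open>T n\<close> bound the differences of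
        partial sums; disjointness makes the intersection of the tails empty, so their measures tend
        to 0.\<close>
      define T where "T n = (\<Union>i\<in>{n..}. A' i)" for n :: nat
      have T: "T n \<in> sets lebesgue" "T n \<subseteq> {0..1}" for n
        using A' by (auto simp: T_def)
      have "(\<lambda>n. measure lebesgue (T n)) \<longlonglongrightarrow> measure lebesgue (\<Inter>n. T n)"
      proof (rule Lim_measure_decseq)
        show "decseq T" by (force simp: decseq_def T_def)
        fix n
        have "T n \<in> lmeasurable"
          using T[of n] bounded_subset[of "{0..1}" "T n"] by (intro bounded_set_imp_lmeasurable) auto
        from fmeasurableD2[OF this] show "emeasure lebesgue (T n) \<noteq> \<infinity>"
          by (simp only: infinity_ennreal_def not_False_eq_True)
      qed (use T in auto)
      moreover have "(\<Inter>n. T n) = {}"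
      proof (rule ccontr)
        assume "(\<Inter>n. T n) \<noteq> {}"
        then obtain t where t: "\<And>n. t \<in> T n" by blast
        from t[of 0] obtain i where i: "t \<in> A' i" by (auto simp: T_def)
        from t[of "Suc i"] obtain j where j: "Suc i \<le> j" "t \<in> A' j" by (auto simp: T_def)
        with i A'd show False by (auto simp: disjoint_family_on_def) (metis IntI Suc_n_not_le_n emptyE)
      qed
      ultimately have Tlim: "(\<lambda>n. measure lebesgue (T n)) \<longlonglongrightarrow> 0" by simp
      define s where "s n = (\<Sum>i<n. m i)" for n
      have mi: "blinfun_apply f (m i) = (LINT t:A' i|lebesgue. blinfun_apply f (g t))" for i and f :: "'a \<Rightarrow>\<^sub>L real"
        using m[of i] by (simp add: R_def A'_def)
      have "Cauchy s"
      proof (rule CauchyI')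
        fix \<epsilon> :: real assume "0 < \<epsilon>"
        then have e2: "0 < \<epsilon> / 2" by simp
        from ui[OF this] obtain \<eta> where \<eta>: "0 < \<eta>" "\<forall>E (f :: 'a \<Rightarrow>\<^sub>L real). E \<in> sets lebesgue \<longrightarrow> E \<subseteq> {0..1} \<longrightarrow> measure lebesgue E \<le> \<eta> \<longrightarrow> norm f \<le> 1 \<longrightarrow>
            (LINT t:E|lebesgue. \<bar>blinfun_apply f (g t)\<bar>) \<le> \<epsilon> / 2" by blast
        obtain N where N: "\<And>n. N \<le> n \<Longrightarrow> measure lebesgue (T n) < \<eta>"
          using order_tendstoD(2)[OF Tlim \<eta>(1)] by (auto simp: eventually_sequentially)
        show "\<exists>M. \<forall>p\<ge>M. \<forall>q>p. dist (s p) (s q) < \<epsilon>"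
        proof (intro exI[of _ N] allI impI)
          fix p q :: nat assume pq: "N \<le> p" "p < q"
          have fin: "finite {p..<q}" by simp
          have "norm (\<Sum>i=p..<q. m i) \<le> \<epsilon> / 2"
          proof (rule norm_le_dualI)
            fix f :: "'a \<Rightarrow>\<^sub>L real" assume f: "norm f \<le> 1"
            have "blinfun_apply f (\<Sum>i=p..<q. m i) = (\<Sum>i=p..<q. LINT t:A' i|lebesgue. blinfun_apply f (g t))"
              by (simp add: blinfun.sum_right mi)
            also have "\<dots> = (LINT t:(\<Union>i\<in>{p..<q}. A' i)|lebesgue. blinfun_apply f (g t))"
              using A' A'd sub by (intro set_integral_finite_Union[symmetric]) (auto simp: disjoint_family_on_def)
            also have "\<dots> \<le> (LINT t:(\<Union>i\<in>{p..<q}. A' i)|lebesgue. \<bar>blinfun_apply f (g t)\<bar>)"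
              using set_integral_abs_subset_le(1)[OF int, of "\<Union>i\<in>{p..<q}. A' i" f] A' by (auto simp: UN_subset_iff)
            also have "\<dots> \<le> (LINT t:T p|lebesgue. \<bar>blinfun_apply f (g t)\<bar>)"
              using A' by (intro set_integral_abs_subset_le(2) sub T) (auto simp: T_def)
            also have "\<dots> \<le> \<epsilon> / 2"
              using \<eta>(2) T[of p] N[OF pq(1)] f by (meson less_imp_le)
            finally show "blinfun_apply f (\<Sum>i=p..<q. m i) \<le> \<epsilon> / 2" .
          qed
          moreover have "s q - s p = (\<Sum>i=p..<q. m i)"
            using pq(2) by (simp add: s_def lessThan_atLeast0 sum_diff_nat_ivl)
          ultimately have "dist (s q) (s p) \<le> \<epsilon> / 2" by (simp add: dist_norm)
          then show "dist (s p) (s q) < \<epsilon>"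
            using \<open>0 < \<epsilon>\<close> by (simp add: dist_commute)
        qed
      qed
      then obtain l where l: "s \<longlonglongrightarrow> l" by (auto simp: Cauchy_convergent_iff convergent_def)
      have "R (\<Union>i. A i) l"
        unfolding R_def
      proof
        fix f :: "'a \<Rightarrow>\<^sub>L real"
        have "(\<lambda>n. blinfun_apply f (s n)) \<longlonglongrightarrow> blinfun_apply f l"
          by (intro blinfun.tendsto l tendsto_const)
        moreover have "(\<lambda>i. if i \<in> UNIV then LINT t:A' i|lebesgue. blinfun_apply f (g t) else 0) sums
            (LINT t:(\<Union>i\<in>UNIV. A' i)|lebesgue. blinfun_apply f (g t))"
          by (rule set_integral_sums_subfamily[OF A'(1) A'd A'(2) int])
        then have "(\<lambda>n. blinfun_apply f (s n)) \<longlonglongrightarrow> (LINT t:(\<Union>i. A' i)|lebesgue. blinfun_apply f (g t))"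
          by (simp add: sums_def s_def blinfun.sum_right mi)
        ultimately have "blinfun_apply f l = (LINT t:(\<Union>i. A' i)|lebesgue. blinfun_apply f (g t))"
          by (rule LIMSEQ_unique)
        then show "blinfun_apply f l = (LINT t:(\<Union>i. A i) \<inter> {0..1}|lebesgue. blinfun_apply f (g t))"
          by (simp add: A'_def)
      qed
      then show ?case by blast
    next
      case Int
      show ?case by (auto simp: Int_stable_def)
    next
      case Pow
      show ?case by simp
    qed
  qed
  fix E :: "real set" assume E: "E \<in> sets lebesgue" "E \<subseteq> {0..1}"
  \<comment> \<open>A Lebesgue set is a Borel set up to a null set, which does not affect the
    integrals.\<close>
  obtain C T where CT: "fsigma C" "T \<in> null_sets lebesgue" "C \<union> T = E" "disjnt C T"
    using lebesgue_set_almost_fsigma[OF E(1)] by metis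
  have Cb: "C \<in> sets borel" using CT(1) by (cases rule: fsigma.cases) auto
  obtain m where m: "R C m" using R[OF Cb] by blast
  have C01: "C \<inter> {0..1} = C" using CT(3) E(2) by blast
  have "(LINT t:C|lebesgue. blinfun_apply f (g t)) = (LINT t:E|lebesgue. blinfun_apply f (g t))" for f :: "'a \<Rightarrow>\<^sub>L real"
  proof (rule set_integral_cong_set)
    have "set_integrable lebesgue C (\<lambda>t. blinfun_apply f (g t))" "set_integrable lebesgue E (\<lambda>t. blinfun_apply f (g t))"
      using Cb E CT(3) by (auto intro!: sub)
    then show "set_borel_measurable lebesgue C (\<lambda>t. blinfun_apply f (g t))" "set_borel_measurable lebesgue E (\<lambda>t. blinfun_apply f (g t))"
      by (auto simp: set_borel_measurable_def set_integrable_def)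
    have "AE t in lebesgue. t \<notin> T" using CT(2) by (rule AE_not_in)
    then show "AE t in lebesgue. (t \<in> E) = (t \<in> C)"
      by eventually_elim (use CT(3) in auto)
  qed
  with m C01 show "\<exists>m. \<forall>f :: 'a \<Rightarrow>\<^sub>L real. blinfun_apply f m = (LINT t:E|lebesgue. blinfun_apply f (g t))"
    by (auto simp: R_def)
qed

section \<open>Passing between selections and the multifunction\<close>

lemma selection_le_support_fun:
  fixes f :: "'a::real_normed_vector \<Rightarrow>\<^sub>L real"
  assumes "C \<in> cwk" "x \<in> C"
  shows "\<bar>blinfun_apply f x\<bar> \<le> \<bar>support_fun f C\<bar> + \<bar>support_fun (- f) C\<bar>"
  using le_support_fun[OF assms, of f] le_support_fun[OF assms, of "- f"]
  by (simp add: blinfun.minus_left)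

lemma vH_fun_has_integral:
  fixes g :: "real \<Rightarrow> 'a::real_normed_vector" and f :: "'a \<Rightarrow>\<^sub>L real"
  assumes "has_vH_primitive (\<lambda>t. {g t}) (\<lambda>I. {G I})" "0 \<le> a" "a \<le> b" "b \<le> 1"
  shows "((\<lambda>t. blinfun_apply f (g t)) has_integral blinfun_apply f (G {a..b})) {a..b}"
  using support_fun_has_integral[OF _ assms, of f] by simp

text \<open>A selection is bounded in every functional by the support functions of \<open>f\<close>
  and \<open>- f\<close>, so it inherits their uniform integrability. Its own Henstock primitive
  represents the integrals over the intervals \<open>{0..a}\<close>.\<close>

lemma vH_mcshane_selection_pettis:
  fixes \<Gamma> :: "real \<Rightarrow> 'a::banach set"
  assumes cwk: "\<And>t. t \<in> {0..1} \<Longrightarrow> \<Gamma> t \<in> cwk" and prim: "has_vH_primitive \<Gamma> \<Phi>"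
    and mcs: "mcshane_integrable \<Gamma>" and g: "g \<in> S_vH \<Gamma>"
  shows "pettis_integrable_fun g"
proof -
  obtain G where G: "has_vH_primitive (\<lambda>t. {g t}) (\<lambda>I. {G I})"
    using g by (auto simp: S_vH_def vH_integrable_fun_def)
  have sel: "g t \<in> \<Gamma> t" if "t \<in> {0..1}" for t
    using g that by (auto simp: S_vH_def measurable_selections_def)
  note ui = mcshane_uniformly_integrable[OF cwk prim mcs]
  have hint: "(\<lambda>t. support_fun f (\<Gamma> t)) absolutely_integrable_on {0..1}" for f :: "'a \<Rightarrow>\<^sub>L real"
  proof -
    \<comment> \<open>Rescaling into the unit ball, where integrability is known; the summand 1
      avoids division by zero for \<open>f = 0\<close>.\<close>
    define f' where "f' = (1 / (norm f + 1)) *\<^sub>R f"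
    have pos: "0 < norm f + 1" by (rule add_nonneg_pos) auto
    have "norm f' \<le> 1" using pos by (simp add: f'_def divide_le_eq)
    then have "(\<lambda>t. (norm f + 1) * support_fun f' (\<Gamma> t)) absolutely_integrable_on {0..1}"
      using ui(1) by (intro set_integrable_mult_right) auto
    moreover have "(norm f + 1) * support_fun f' (\<Gamma> t) = support_fun f (\<Gamma> t)" if "t \<in> {0..1}" for t
    proof -
      have "support_fun f' (\<Gamma> t) = 1 / (norm f + 1) * support_fun f (\<Gamma> t)"
        unfolding f'_def by (rule sublinear_scale[OF sublinear_support_fun[OF cwk[OF that]]]) simp
      moreover have "norm f + 1 \<noteq> 0" using pos by simp
      ultimately show ?thesis by simp
    qed
    ultimately show ?thesis
      by (subst set_integrable_cong[OF refl]) auto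
  qed
  have fint: "(\<lambda>t. blinfun_apply f (g t)) absolutely_integrable_on {0..1}" for f :: "'a \<Rightarrow>\<^sub>L real"
  proof (rule absolutely_integrable_integrable_bound[where g = "\<lambda>t. \<bar>support_fun f (\<Gamma> t)\<bar> + \<bar>support_fun (- f) (\<Gamma> t)\<bar>"])
    show "norm (blinfun_apply f (g t)) \<le> \<bar>support_fun f (\<Gamma> t)\<bar> + \<bar>support_fun (- f) (\<Gamma> t)\<bar>" if "t \<in> {0..1}" for t
      using selection_le_support_fun[OF cwk[OF that] sel[OF that], of f] by simp
    show "(\<lambda>t. blinfun_apply f (g t)) integrable_on {0..1}"
      using vH_fun_has_integral[OF G, of 0 1 f] by (auto simp: integrable_on_def)
    show "(\<lambda>t. \<bar>support_fun f (\<Gamma> t)\<bar> + \<bar>support_fun (- f) (\<Gamma> t)\<bar>) integrable_on {0..1}"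
      using hint by (intro integrable_add) (auto simp: absolutely_integrable_on_def)
  qed
  have sub: "set_integrable lebesgue E u" if "u absolutely_integrable_on {0..1}" "E \<in> sets lebesgue" "E \<subseteq> {0..1}"
    for E and u :: "real \<Rightarrow> real"
    using set_integrable_subset[OF that] .
  show ?thesis
  proof (rule pettis_integrable_fun_of_intervals[OF fint])
    fix a :: real assume a: "a \<in> {0..1}"
    have "blinfun_apply f (G {0..a}) = (LINT t:{0..a}|lebesgue. blinfun_apply f (g t))" for f :: "'a \<Rightarrow>\<^sub>L real"
    proof -
      have "(LINT t:{0..a}|lebesgue. blinfun_apply f (g t)) = integral {0..a} (\<lambda>t. blinfun_apply f (g t))"
        using a by (intro set_lebesgue_integral_eq_integral sub[OF fint]) auto
      also have "\<dots> = blinfun_apply f (G {0..a})"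
        using a by (intro integral_unique vH_fun_has_integral[OF G]) auto
      finally show ?thesis by simp
    qed
    then show "\<exists>m. \<forall>f :: 'a \<Rightarrow>\<^sub>L real. blinfun_apply f m = (LINT t:{0..a}|lebesgue. blinfun_apply f (g t))" by blast
  next
    fix \<epsilon> :: real assume "0 < \<epsilon>"
    then have "0 < \<epsilon> / 2" by simp
    then obtain \<eta> where \<eta>: "0 < \<eta>" "\<forall>E (f :: 'a \<Rightarrow>\<^sub>L real). E \<in> sets lebesgue \<longrightarrow> E \<subseteq> {0..1} \<longrightarrow> measure lebesgue E \<le> \<eta> \<longrightarrow> norm f \<le> 1 \<longrightarrow>
      (LINT t:E|lebesgue. \<bar>support_fun f (\<Gamma> t)\<bar>) \<le> \<epsilon> / 2"
      using ui(2) by blast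
    show "\<exists>\<eta>>0. \<forall>E (f :: 'a \<Rightarrow>\<^sub>L real). E \<in> sets lebesgue \<longrightarrow> E \<subseteq> {0..1} \<longrightarrow> measure lebesgue E \<le> \<eta> \<longrightarrow> norm f \<le> 1 \<longrightarrow>
      (LINT t:E|lebesgue. \<bar>blinfun_apply f (g t)\<bar>) \<le> \<epsilon>"
    proof (intro exI[of _ \<eta>] conjI allI impI \<eta>(1))
      fix E :: "real set" and f :: "'a \<Rightarrow>\<^sub>L real"
      assume E: "E \<in> sets lebesgue" "E \<subseteq> {0..1}" "measure lebesgue E \<le> \<eta>" and f: "norm f \<le> 1"
      have "(LINT t:E|lebesgue. \<bar>blinfun_apply f (g t)\<bar>) \<le>
          (LINT t:E|lebesgue. \<bar>support_fun f (\<Gamma> t)\<bar> + \<bar>support_fun (- f) (\<Gamma> t)\<bar>)"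
        using E selection_le_support_fun[OF cwk sel]
        by (intro set_integral_mono set_integral_add set_integrable_abs sub[OF fint] sub[OF hint]) auto
      also have "\<dots> = (LINT t:E|lebesgue. \<bar>support_fun f (\<Gamma> t)\<bar>) + (LINT t:E|lebesgue. \<bar>support_fun (- f) (\<Gamma> t)\<bar>)"
        using E by (intro set_integral_add set_integrable_abs sub[OF hint]) auto
      also have "\<dots> \<le> \<epsilon> / 2 + \<epsilon> / 2"
        using E f \<eta>(2) by (intro add_mono) auto
      finally show "(LINT t:E|lebesgue. \<bar>blinfun_apply f (g t)\<bar>) \<le> \<epsilon>" by simp
    qed
  qed
qed

text \<open>The map sending \<open>f\<close> to the integral of \<open>f (g t)\<close> over
  \<open>E\<close> is linear and lies below the support function of \<open>M E\<close>, hence is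
  evaluation at a point of \<open>M E\<close>. Scalar measurability of \<open>g\<close> is what
  makes these integrals exist.\<close>

lemma pettis_selection_pettis:
  fixes \<Gamma> :: "real \<Rightarrow> 'a::real_normed_vector set"
  assumes cwk: "\<And>t. t \<in> {0..1} \<Longrightarrow> \<Gamma> t \<in> cwk" and M: "has_pettis_integral \<Gamma> M"
    and g: "g \<in> measurable_selections \<Gamma>"
  shows "pettis_integrable_fun g"
proof -
  note P = pettis_integral_set_integral[OF M]
  have sel: "g t \<in> \<Gamma> t" if "t \<in> {0..1}" for t
    using g that by (auto simp: measurable_selections_def)
  have fint: "(\<lambda>t. blinfun_apply f (g t)) absolutely_integrable_on {0..1}" for f :: "'a \<Rightarrow>\<^sub>L real"
  proof (rule set_integrable_bound)
    show "set_integrable lebesgue {0..1} (\<lambda>t. \<bar>support_fun f (\<Gamma> t)\<bar> + \<bar>support_fun (- f) (\<Gamma> t)\<bar>)"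
      by (intro set_integral_add set_integrable_abs P)
    have "(\<lambda>t. blinfun_apply f (g t)) \<in> borel_measurable (lebesgue_on {0..1})"
      using g by (auto simp: measurable_selections_def scalarly_measurable_def)
    then show "set_borel_measurable lebesgue {0..1} (\<lambda>t. blinfun_apply f (g t))"
      by (simp add: set_borel_measurable_def borel_measurable_restrict_space_iff mult.commute)
    show "AE t in lebesgue. t \<in> {0..1} \<longrightarrow> norm (blinfun_apply f (g t)) \<le> norm (\<bar>support_fun f (\<Gamma> t)\<bar> + \<bar>support_fun (- f) (\<Gamma> t)\<bar>)"
      using selection_le_support_fun[OF cwk sel, of _ f] by (intro AE_I2) auto
  qed
  show ?thesis
  proof (rule pettis_integrable_funI[OF fint])
    fix E :: "real set" assume E: "E \<in> sets lebesgue" "E \<subseteq> {0..1}"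
    have fE: "set_integrable lebesgue E (\<lambda>t. blinfun_apply f (g t))" for f :: "'a \<Rightarrow>\<^sub>L real"
      using set_integrable_subset[OF fint E] .
    define \<xi> where "\<xi> f = (LINT t:E|lebesgue. blinfun_apply f (g t))" for f :: "'a \<Rightarrow>\<^sub>L real"
    have "linear \<xi>"
    proof
      show "\<xi> (f + f') = \<xi> f + \<xi> f'" for f f'
        unfolding \<xi>_def blinfun.add_left by (rule set_integral_add(2)[OF fE fE])
      show "\<xi> (c *\<^sub>R f) = c *\<^sub>R \<xi> f" for c f
        unfolding \<xi>_def blinfun.scaleR_left by simp
    qed
    moreover have "\<xi> f \<le> support_fun f (M E)" for f
      unfolding \<xi>_def P(3)[OF E] using E set_integrable_subset[OF P(1) E]
      by (intro set_integral_mono fE le_support_fun[OF cwk sel]) auto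
    ultimately show "\<exists>m. \<forall>f :: 'a \<Rightarrow>\<^sub>L real. blinfun_apply f m = (LINT t:E|lebesgue. blinfun_apply f (g t))"
      using functional_represented[OF P(2)[OF E], of \<xi>] unfolding \<xi>_def by (metis (full_types))
  qed
qed

lemma vH_pettis_selection_imp_pettis:
  fixes \<Gamma> :: "real \<Rightarrow> 'a::real_normed_vector set"
  assumes cwk: "\<And>t. t \<in> {0..1} \<Longrightarrow> \<Gamma> t \<in> cwk" and prim: "has_vH_primitive \<Gamma> \<Phi>"
    and sel: "\<And>t. t \<in> {0..1} \<Longrightarrow> g t \<in> \<Gamma> t" and m: "has_pettis_integral (\<lambda>t. {g t}) (\<lambda>E. {m E})"
  shows "pettis_integrable \<Gamma>"
proof -
  note g = pettis_integral_fun_set_integral[OF m]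
  have \<Phi>: "\<Phi> {0..1} \<in> cwk" by (intro vh_primitive_cwk[OF cwk prim] subintervalsI) auto
  have hHK: "((\<lambda>t. support_fun f (\<Gamma> t)) has_integral support_fun f (\<Phi> {0..1})) {0..1}" for f
    by (rule support_fun_has_integral[OF cwk prim]) auto
  \<comment> \<open>Subtracting the selection makes the integrand non-negative, and a non-negative
    Henstock integrable function is absolutely integrable.\<close>
  define D where "D f t = support_fun f (\<Gamma> t) - blinfun_apply f (g t)" for f and t
  have D0: "0 \<le> D f t" if "t \<in> {0..1}" for t and f :: "'a \<Rightarrow>\<^sub>L real"
    using le_support_fun[OF cwk[OF that] sel[OF that]] by (simp add: D_def)
  have D: "D f absolutely_integrable_on {0..1}" for f :: "'a \<Rightarrow>\<^sub>L real"
  proof (rule nonnegative_absolutely_integrable_1)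
    show "D f integrable_on {0..1}"
      unfolding D_def using hHK[of f] g(1)[of f]
      by (intro integrable_diff) (auto simp: absolutely_integrable_on_def integrable_on_def)
  qed (rule D0)
  have h: "(\<lambda>t. support_fun f (\<Gamma> t)) absolutely_integrable_on {0..1}" for f :: "'a \<Rightarrow>\<^sub>L real"
  proof -
    have "(\<lambda>t. D f t + blinfun_apply f (g t)) absolutely_integrable_on {0..1}"
      by (rule set_integral_add(1)[OF D g(1)])
    then show ?thesis by (simp add: D_def)
  qed
  have "\<exists>C. C \<in> cwk \<and> (\<forall>f. support_fun f C = (LINT t:E|lebesgue. support_fun f (\<Gamma> t)))"
    if E: "E \<in> sets lebesgue" "E \<subseteq> {0..1}" for E
  proof -
    have sub: "set_integrable lebesgue E u" if "u absolutely_integrable_on {0..1}" for u :: "real \<Rightarrow> real"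
      using set_integrable_subset[OF that E] .
    define p where "p f = (LINT t:E|lebesgue. support_fun f (\<Gamma> t))" for f
    \<comment> \<open>The integral of \<open>D f\<close> over \<open>E\<close> is at most that over
      the unit interval, which is \<open>support_fun f (\<Phi> {0..1}) - f (m {0..1})\<close>.
      Adding \<open>f (m E)\<close> gives exactly the support function of this translate.\<close>
    define K where "K = (+) (m E - m {0..1}) ` \<Phi> {0..1}"
    note sl = sublinear_support_fun[OF cwk]
    have "sublinear p"
    proof (rule sublinearI)
      fix f f' :: "'a \<Rightarrow>\<^sub>L real"
      have "p (f + f') \<le> (LINT t:E|lebesgue. support_fun f (\<Gamma> t) + support_fun f' (\<Gamma> t))"
        unfolding p_def using E sublinear_add[OF sl]
        by (intro set_integral_mono set_integral_add sub[OF h]) auto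
      also have "\<dots> = p f + p f'"
        unfolding p_def by (rule set_integral_add(2)[OF sub[OF h] sub[OF h]])
      finally show "p (f + f') \<le> p f + p f'" .
    next
      fix c :: real and f :: "'a \<Rightarrow>\<^sub>L real" assume c: "0 < c"
      have "p (c *\<^sub>R f) \<le> (LINT t:E|lebesgue. c * support_fun f (\<Gamma> t))"
        unfolding p_def
      proof (rule set_integral_mono)
        show "support_fun (c *\<^sub>R f) (\<Gamma> t) \<le> c * support_fun f (\<Gamma> t)" if "t \<in> E" for t
          using sublinear_scale[OF sl, of t c f] that E(2) c by auto
      qed (auto intro!: sub[OF h] set_integrable_mult_right)
      also have "\<dots> = c * p f" by (simp add: p_def)
      finally show "p (c *\<^sub>R f) \<le> c * p f" .
    qed
    moreover have "p f \<le> support_fun f K" for f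
    proof -
      have "p f = (LINT t:E|lebesgue. D f t) + (LINT t:E|lebesgue. blinfun_apply f (g t))"
        unfolding p_def by (subst set_integral_add(2)[symmetric, OF sub[OF D] sub[OF g(1)]]) (simp add: D_def)
      also have "(LINT t:E|lebesgue. D f t) \<le> (LINT t:E|lebesgue. \<bar>D f t\<bar>)"
        using set_integral_abs_subset_le(1)[OF D E] by (rule order_trans[OF abs_ge_self])
      also have "\<dots> \<le> (LINT t:{0..1}|lebesgue. \<bar>D f t\<bar>)"
        by (rule set_integral_abs_subset_le(2)[OF D E])
      also have "\<dots> = (LINT t:{0..1}|lebesgue. D f t)"
        using D0 by (intro set_lebesgue_integral_cong) auto
      also have "\<dots> = (LINT t:{0..1}|lebesgue. support_fun f (\<Gamma> t)) - (LINT t:{0..1}|lebesgue. blinfun_apply f (g t))"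
        unfolding D_def by (rule set_integral_diff(2)[OF h g(1)])
      also have "(LINT t:{0..1}|lebesgue. support_fun f (\<Gamma> t)) = support_fun f (\<Phi> {0..1})"
        using set_lebesgue_integral_eq_integral(2)[OF h[of f]] integral_unique[OF hHK[of f]] by simp
      finally show ?thesis
        unfolding K_def cwk_translation(2)[OF \<Phi>] using g(2)[OF E, of f] g(2)[of "{0..1}" f]
        by (simp add: blinfun.diff_right)
    qed
    ultimately have "sublinear p" "\<And>f. p f \<le> support_fun f ((+) (m E - m {0..1}) ` \<Phi> {0..1})"
      unfolding K_def by blast+
    from cwk_dominated[OF cwk_translation(1)[OF \<Phi>] this]
    have "\<exists>C. C \<in> cwk \<and> (\<forall>f. support_fun f C = p f)" by metis
    then show ?thesis by (auto simp: p_def)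
  qed
  then have "\<forall>E. \<exists>C. E \<in> sets lebesgue \<longrightarrow> E \<subseteq> {0..1} \<longrightarrow>
      C \<in> cwk \<and> (\<forall>f. support_fun f C = (LINT t:E|lebesgue. support_fun f (\<Gamma> t)))"
    by blast
  from choice[OF this] obtain M where "\<forall>E. E \<in> sets lebesgue \<longrightarrow> E \<subseteq> {0..1} \<longrightarrow>
      M E \<in> cwk \<and> (\<forall>f. support_fun f (M E) = (LINT t:E|lebesgue. support_fun f (\<Gamma> t)))" ..
  then have "has_pettis_integral \<Gamma> M"
    using h by (intro has_pettis_integralI) auto
  then show ?thesis by (auto simp: pettis_integrable_def)
qed

section \<open>The five equivalent conditions\<close>

lemma vH_pettis_fun_imp_mcshane:
  fixes g :: "real \<Rightarrow> 'a::real_normed_vector"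
  assumes "vH_integrable_fun g" "pettis_integrable_fun g"
  shows "mcshane_integrable_fun g"
proof -
  obtain G where G: "has_vH_primitive (\<lambda>t. {g t}) (\<lambda>I. {G I})"
    using assms(1) by (auto simp: vH_integrable_fun_def)
  obtain m where m: "has_pettis_integral (\<lambda>t. {g t}) (\<lambda>E. {m E})"
    using assms(2) by (auto simp: pettis_integrable_fun_def)
  have "has_mcshane_integral (\<lambda>t. {g t}) {G {0..1}}"
    by (rule vh_pettis_imp_mcshane[OF singleton_in_cwk G m])
  then show ?thesis by (auto simp: mcshane_integrable_fun_def)
qed

text \<open>The implications proved are (a) to (b), (b) to (a), (b) to (c), (c) to (d), (d) to (b),
  (d) to (e) and (e) to (b). A variationally Henstock selection is assumed to exist so that (b) is
  not vacuous and yields (c).\<close>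

lemma vH_equivalences:
  fixes \<Gamma> :: "real \<Rightarrow> 'a::banach set"
  assumes cwk: "\<And>t. t \<in> {0..1} \<Longrightarrow> \<Gamma> t \<in> cwk" and vH: "vH_integrable \<Gamma>" and ne: "S_vH \<Gamma> \<noteq> {}"
  shows "(S_vH \<Gamma> \<subseteq> S_MS \<Gamma> \<longleftrightarrow> S_vH \<Gamma> \<subseteq> S_P \<Gamma>) \<and>
      (S_vH \<Gamma> \<subseteq> S_P \<Gamma> \<longleftrightarrow> S_P \<Gamma> \<noteq> {}) \<and>
      (S_P \<Gamma> \<noteq> {} \<longleftrightarrow> pettis_integrable \<Gamma>) \<and>
      (pettis_integrable \<Gamma> \<longleftrightarrow> mcshane_integrable \<Gamma>)"
proof -
  obtain \<Phi> where \<Phi>: "has_vH_primitive \<Gamma> \<Phi>" using vH by (auto simp: vH_integrable_def)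
  have ab: "S_vH \<Gamma> \<subseteq> S_P \<Gamma>" if "S_vH \<Gamma> \<subseteq> S_MS \<Gamma>"
  proof
    fix g assume g: "g \<in> S_vH \<Gamma>"
    then obtain G where G: "has_vH_primitive (\<lambda>t. {g t}) (\<lambda>I. {G I})" and sel: "g \<in> measurable_selections \<Gamma>"
      by (auto simp: S_vH_def vH_integrable_fun_def)
    \<comment> \<open>The uniform integrability argument is applied to the multifunction with the
      single selection \<open>g\<close>, so nothing is asked of \<open>\<Gamma>\<close>
      itself.\<close>
    have "mcshane_integrable (\<lambda>t. {g t})"
      using g that by (auto simp: S_MS_def mcshane_integrable_fun_def mcshane_integrable_def)
    moreover have "g \<in> S_vH (\<lambda>t. {g t})"
      using g by (auto simp: S_vH_def measurable_selections_def)
    ultimately have "pettis_integrable_fun g"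
      by (rule vH_mcshane_selection_pettis[OF singleton_in_cwk G])
    with sel show "g \<in> S_P \<Gamma>" by (simp add: S_P_def)
  qed
  have ba: "S_vH \<Gamma> \<subseteq> S_MS \<Gamma>" if "S_vH \<Gamma> \<subseteq> S_P \<Gamma>"
    using that vH_pettis_fun_imp_mcshane unfolding S_vH_def S_MS_def S_P_def by blast
  have bc: "S_P \<Gamma> \<noteq> {}" if "S_vH \<Gamma> \<subseteq> S_P \<Gamma>"
    using that ne by blast
  have cd: "pettis_integrable \<Gamma>" if that': "S_P \<Gamma> \<noteq> {}"
  proof -
    obtain g where "g \<in> S_P \<Gamma>" using that' by blast
    then have sel: "\<And>t. t \<in> {0..1} \<Longrightarrow> g t \<in> \<Gamma> t" and "pettis_integrable_fun g"
      by (auto simp: S_P_def measurable_selections_def)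
    then obtain m where m: "has_pettis_integral (\<lambda>t. {g t}) (\<lambda>E. {m E})"
      by (auto simp: pettis_integrable_fun_def)
    show ?thesis by (rule vH_pettis_selection_imp_pettis[OF cwk \<Phi> sel m])
  qed
  have db: "S_vH \<Gamma> \<subseteq> S_P \<Gamma>" if d: "pettis_integrable \<Gamma>"
  proof
    obtain M where M: "has_pettis_integral \<Gamma> M" using d by (auto simp: pettis_integrable_def)
    fix g assume "g \<in> S_vH \<Gamma>"
    then have g: "g \<in> measurable_selections \<Gamma>" by (simp add: S_vH_def)
    have "pettis_integrable_fun g"
      using pettis_selection_pettis[of \<Gamma> M g] cwk M g by blast
    with g show "g \<in> S_P \<Gamma>" by (simp add: S_P_def)
  qed
  have de: "mcshane_integrable \<Gamma>" if d: "pettis_integrable \<Gamma>"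
  proof -
    obtain M where M: "has_pettis_integral \<Gamma> M" using d by (auto simp: pettis_integrable_def)
    have "has_mcshane_integral \<Gamma> (\<Phi> {0..1})"
      using vh_pettis_imp_mcshane[of \<Gamma> \<Phi> M] cwk \<Phi> M by blast
    then show ?thesis by (auto simp: mcshane_integrable_def)
  qed
  have eb: "S_vH \<Gamma> \<subseteq> S_P \<Gamma>" if e: "mcshane_integrable \<Gamma>"
  proof
    fix g assume g: "g \<in> S_vH \<Gamma>"
    then have "pettis_integrable_fun g"
      using vH_mcshane_selection_pettis[of \<Gamma> \<Phi> g] cwk \<Phi> e by blast
    with g show "g \<in> S_P \<Gamma>" by (simp add: S_P_def S_vH_def)
  qed
  show ?thesis using ab ba bc cd db de eb by blast
qed

section \<open>Lipschitz functions and the Radon--Nikodym property\<close>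

lemma measure_tail_tendsto_zero:
  fixes A :: "nat \<Rightarrow> real set"
  assumes "\<And>i. A i \<in> sets borel"
  shows "(\<lambda>n. measure lborel (((\<Union>i. A i) - (\<Union>i<n. A i)) \<inter> {0..1})) \<longlonglongrightarrow> 0"
proof -
  define T where "T n = ((\<Union>i. A i) - (\<Union>i<n. A i)) \<inter> {0..1}" for n
  have T: "T n \<in> sets borel" for n
    unfolding T_def using assms by (intro sets.Int sets.Diff sets.countable_UN sets.finite_UN) auto
  have "(\<lambda>n. measure lborel (T n)) \<longlonglongrightarrow> measure lborel (\<Inter>n. T n)"
  proof (rule Lim_measure_decseq)
    show "decseq T" unfolding decseq_def T_def by (fastforce intro: order_less_le_trans)
    show "emeasure lborel (T n) \<noteq> \<infinity>" for n
      using emeasure_mono[of "T n" "{0..1}" lborel] by (auto simp: T_def top_unique)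
  qed (use T in auto)
  moreover have "(\<Inter>n. T n) = {}"
    by (auto simp: T_def)
  ultimately show ?thesis by (simp add: T_def)
qed

context
  fixes g :: "real \<Rightarrow> 'a::banach" and L :: real
  assumes lip: "\<And>x y. x \<in> {0..1} \<Longrightarrow> y \<in> {0..1} \<Longrightarrow> norm (g x - g y) \<le> L * \<bar>x - y\<bar>"
begin

private definition J :: "nat \<Rightarrow> nat \<Rightarrow> real set" where
  "J k j = {real j / 2^k..<(real j + 1) / 2^k}"

text \<open>The integral over \<open>A\<close> of the step function whose value on each dyadic
  interval of level \<open>k\<close> is the difference quotient of \<open>g\<close> there. The limit
  in \<open>k\<close> will be the vector measure with distribution function
  \<open>g - g 0\<close>.\<close>

private definition \<nu> :: "nat \<Rightarrow> real set \<Rightarrow> 'a" where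
  "\<nu> k A = (\<Sum>j<2^k. (2^k * measure lborel (A \<inter> J k j)) *\<^sub>R (g ((real j + 1) / 2^k) - g (real j / 2^k)))"

private lemma L: "0 \<le> L"
  using order_trans[OF norm_ge_zero lip[of 1 0]] by simp

private lemma J_props:
  "J k j \<in> sets borel" "measure lborel (J k j) = 1 / 2^k" "emeasure lborel (A \<inter> J k j) \<noteq> \<infinity>"
proof -
  show "J k j \<in> sets borel" by (simp add: J_def)
  have le: "real j / 2^k \<le> (real j + 1) / 2^k" by (simp add: divide_right_mono)
  then show "measure lborel (J k j) = 1 / 2^k"
    by (simp add: J_def diff_divide_distrib[symmetric])
  have "emeasure lborel (A \<inter> J k j) \<le> emeasure lborel (J k j)"
    by (intro emeasure_mono) (auto simp: J_def)
  also have "\<dots> < \<infinity>" using le by (simp add: J_def)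
  finally show "emeasure lborel (A \<inter> J k j) \<noteq> \<infinity>" by simp
qed

private lemma J_endpoints:
  assumes "j < 2^k"
  shows "0 \<le> real j / 2^k" "real j / 2^k \<le> 1" "(real j + 1) / 2^k \<le> 1" "0 \<le> (real j + 1) / 2^k" "J k j \<subseteq> {0..<1}"
proof -
  have "real j + 1 \<le> 2^k"
    using assms by (metis Suc_leI add.commute of_nat_Suc of_nat_le_iff of_nat_numeral of_nat_power)
  then show *: "(real j + 1) / 2^k \<le> 1" by simp
  have "real j / 2^k \<le> (real j + 1) / 2^k" by (simp add: divide_right_mono)
  with * show "real j / 2^k \<le> 1" by linarith
  show "0 \<le> real j / 2^k" "0 \<le> (real j + 1) / 2^k" by auto
  then show "J k j \<subseteq> {0..<1}"
    unfolding J_def using * by (intro subsetI) (simp only: atLeastLessThan_iff, linarith)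
qed

private lemma J_diff_norm:
  assumes "j < 2^k"
  shows "norm (g ((real j + 1) / 2^k) - g (real j / 2^k)) \<le> L / 2^k"
proof -
  have "norm (g ((real j + 1) / 2^k) - g (real j / 2^k)) \<le> L * \<bar>(real j + 1) / 2^k - real j / 2^k\<bar>"
    using J_endpoints[OF assms] by (intro lip) auto
  then show ?thesis by (simp add: diff_divide_distrib[symmetric])
qed

private lemma J_disjoint: "disjoint_family_on (\<lambda>j. A \<inter> J k j) S"
proof -
  have "J k i \<inter> J k j = {}" if "i < j" for i j
  proof -
    have "(real i + 1) / 2^k \<le> real j / 2^k"
      using that by (intro divide_right_mono) auto
    then show ?thesis by (auto simp: J_def)
  qed
  then show ?thesis
    unfolding disjoint_family_on_def by (metis Int_assoc Int_commute Int_empty_left linorder_neqE_nat)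
qed

private lemma \<nu>_norm:
  assumes A: "A \<in> sets borel"
  shows "norm (\<nu> k A) \<le> L * measure lborel (A \<inter> {0..1})"
proof -
  have "norm (\<nu> k A) \<le> (\<Sum>j<2^k. L * measure lborel (A \<inter> J k j))"
    unfolding \<nu>_def
  proof (rule sum_norm_le)
    fix j :: nat assume "j \<in> {..<2^k}"
    then have "norm (g ((real j + 1) / 2^k) - g (real j / 2^k)) \<le> L / 2^k"
      by (intro J_diff_norm) simp
    then have "(2^k * measure lborel (A \<inter> J k j)) * norm (g ((real j + 1) / 2^k) - g (real j / 2^k)) \<le>
        (2^k * measure lborel (A \<inter> J k j)) * (L / 2^k)"
      by (intro mult_left_mono) auto
    then show "norm ((2^k * measure lborel (A \<inter> J k j)) *\<^sub>R (g ((real j + 1) / 2^k) - g (real j / 2^k))) \<le>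
        L * measure lborel (A \<inter> J k j)"
      by (simp add: mult.commute)
  qed
  also have "\<dots> = L * measure lborel (\<Union>j<2^k. A \<inter> J k j)"
    using A J_props(1,3) J_disjoint
    by (subst measure_finite_Union) (auto simp: sum_distrib_left)
  also have "\<dots> \<le> L * measure lborel (A \<inter> {0..1})"
  proof (intro mult_left_mono L measure_mono_fmeasurable)
    have "J k j \<subseteq> {0..1}" if "j < 2^k" for j
      using J_endpoints(5)[OF that] by auto
    then show "(\<Union>j<2^k. A \<inter> J k j) \<subseteq> A \<inter> {0..1}" by blast
    show "(\<Union>j<2^k. A \<inter> J k j) \<in> sets lborel"
      using A J_props(1) by (intro sets.finite_UN sets.Int) simp_all
    have "{0..1::real} \<in> fmeasurable lborel"
      by (simp add: fmeasurable_def)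
    then show "A \<inter> {0..1} \<in> fmeasurable lborel"
      by (rule fmeasurableI2) (use A in auto)
  qed
  finally show ?thesis .
qed

private lemma \<nu>_Un:
  assumes "A \<in> sets borel" "B \<in> sets borel" "A \<inter> B = {}"
  shows "\<nu> k (A \<union> B) = \<nu> k A + \<nu> k B"
proof -
  have "measure lborel ((A \<union> B) \<inter> J k j) = measure lborel (A \<inter> J k j) + measure lborel (B \<inter> J k j)" for j
    unfolding Int_Un_distrib2 using assms J_props(1,3) by (intro measure_Union) auto
  then show ?thesis
    unfolding \<nu>_def sum.distrib[symmetric] by (intro sum.cong) (auto simp: algebra_simps)
qed

private lemma \<nu>_cong: "(\<And>j. j < 2^k \<Longrightarrow> A \<inter> J k j = B \<inter> J k j) \<Longrightarrow> \<nu> k A = \<nu> k B"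
  by (simp add: \<nu>_def)

text \<open>The dyadic intervals to the left of \<open>x\<close> telescope. The one containing
  \<open>x\<close> contributes at most \<open>L / 2^k\<close>, and moving from its left endpoint to
  \<open>x\<close> costs another \<open>L / 2^k\<close>.\<close>

private lemma \<nu>_lessThan:
  assumes x: "x \<in> {0..1}"
  shows "norm (\<nu> k {..<x} - (g x - g 0)) \<le> 2 * L / 2^k"
proof -
  define i where "i = nat \<lfloor>2^k * x\<rfloor>"
  have i_floor: "real i = of_int \<lfloor>2^k * x\<rfloor>" using x by (simp add: i_def)
  have i: "real i \<le> 2^k * x" "2^k * x < real i + 1"
    unfolding i_floor by (auto simp: of_int_floor_le)
  have "2^k * x \<le> 2^k" using x by simp
  with i(1) have "real i \<le> 2^k" by linarith
  then have i_le: "i \<le> 2^k" by (metis of_nat_le_iff of_nat_numeral of_nat_power)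
  define d where "d j = g ((real j + 1) / 2^k) - g (real j / 2^k)" for j
  define c where "c j = 2^k * measure lborel ({..<x} \<inter> J k j)" for j
  \<comment> \<open>The weights that telescope to \<open>g (real i / 2^k) - g 0\<close>. The true
    weights \<open>c\<close> differ from them at most at \<open>j = i\<close>; for
    \<open>x = 1\<close> this index is \<open>2^k\<close>, beyond the range of the sum.\<close>
  define e where "e j = (if j < i then 1 else 0::real)" for j
  have c: "0 \<le> c j" "c j \<le> 1" for j
  proof -
    show "0 \<le> c j" by (simp add: c_def)
    have "measure lborel ({..<x} \<inter> J k j) \<le> measure lborel (J k j)"
      using J_props(1) J_props(3)[of UNIV k j]
      by (intro measure_mono_fmeasurable) (auto simp: fmeasurable_def less_top)
    then show "c j \<le> 1" by (simp add: c_def J_props(2) field_simps)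
  qed
  have ce: "c j = e j" if "j \<noteq> i" for j
  proof (cases "j < i")
    case True
    then have "real j + 1 \<le> 2^k * x" using i(1) by linarith
    then have "(real j + 1) / 2^k \<le> x" by (simp add: field_simps)
    then have "{..<x} \<inter> J k j = J k j" by (auto simp: J_def)
    then show ?thesis using True by (simp add: c_def e_def J_props(2))
  next
    case False
    then have "real i + 1 \<le> real j" using that by linarith
    then have "2^k * x \<le> real j" using i(2) by linarith
    then have "x \<le> real j / 2^k" by (simp add: field_simps)
    then have "{..<x} \<inter> J k j = {}" by (auto simp: J_def)
    then show ?thesis using False by (simp add: c_def e_def)
  qed
  have "(\<Sum>j<2^k. e j *\<^sub>R d j) = (\<Sum>j<i. d j)"
    using i_le by (intro sum.mono_neutral_cong_right) (auto simp: e_def)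
  also have "\<dots> = g (real i / 2^k) - g 0"
    using sum_lessThan_telescope[of "\<lambda>j. g (real j / 2^k)" i] by (simp add: d_def add.commute)
  finally have tel: "(\<Sum>j<2^k. e j *\<^sub>R d j) = g (real i / 2^k) - g 0" .
  have "\<nu> k {..<x} - (g (real i / 2^k) - g 0) = (\<Sum>j<2^k. (c j - e j) *\<^sub>R d j)"
    unfolding tel[symmetric] \<nu>_def c_def[symmetric] d_def[symmetric]
    by (simp add: sum_subtractf scaleR_diff_left)
  also have "norm \<dots> \<le> (\<Sum>j<2^k. if j = i then L / 2^k else 0)"
  proof (rule sum_norm_le)
    fix j :: nat assume j: "j \<in> {..<2^k}"
    show "norm ((c j - e j) *\<^sub>R d j) \<le> (if j = i then L / 2^k else 0)"
    proof (cases "j = i")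
      case True
      have "norm (d j) \<le> L / 2^k" using j J_diff_norm by (simp add: d_def)
      moreover have "\<bar>c j - e j\<bar> \<le> 1" using True c[of j] by (simp add: e_def)
      ultimately have "\<bar>c j - e j\<bar> * norm (d j) \<le> 1 * (L / 2^k)" by (intro mult_mono) auto
      then show ?thesis using True by simp
    qed (simp add: ce)
  qed
  also have "\<dots> \<le> L / 2^k" using L by (simp add: sum.delta)
  finally have 1: "norm (\<nu> k {..<x} - (g (real i / 2^k) - g 0)) \<le> L / 2^k" .
  have ix: "real i / 2^k \<le> x" "x - real i / 2^k \<le> 1 / 2^k"
  proof -
    show "real i / 2^k \<le> x" using i(1) by (simp add: field_simps)
    have "x \<le> (real i + 1) / 2^k" using i(2) by (simp add: field_simps)
    then show "x - real i / 2^k \<le> 1 / 2^k" by (simp add: add_divide_distrib)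
  qed
  have "norm (g (real i / 2^k) - g x) \<le> L * \<bar>real i / 2^k - x\<bar>"
    using x i_le by (intro lip) simp_all
  also have "\<dots> \<le> L * (1 / 2^k)"
    using ix L by (intro mult_left_mono) auto
  finally have 2: "norm (g (real i / 2^k) - g x) \<le> L / 2^k" by simp
  have "\<nu> k {..<x} - (g x - g 0) = (\<nu> k {..<x} - (g (real i / 2^k) - g 0)) + (g (real i / 2^k) - g x)"
    by simp
  also have "norm \<dots> \<le> L / 2^k + L / 2^k"
    using 1 2 by (rule norm_triangle_mono)
  finally show ?thesis by simp
qed

private lemma \<nu>_lessThan_tendsto:
  assumes "x \<in> {0..1}"
  shows "(\<lambda>k. \<nu> k {..<x}) \<longlonglongrightarrow> g x - g 0"
proof -
  have lim: "(\<lambda>k. 2 * L * (1/2)^k) \<longlonglongrightarrow> 0"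
    using tendsto_mult[OF tendsto_const LIMSEQ_power_zero[of "1/2 :: real"], of "2 * L"] by simp
  have bnd: "norm (\<nu> k {..<x} - (g x - g 0)) \<le> 2 * L * (1/2)^k" for k
    using \<nu>_lessThan[OF assms, of k] by (simp add: power_one_over)
  have "(\<lambda>k. \<nu> k {..<x} - (g x - g 0)) \<longlonglongrightarrow> 0"
    by (rule Lim_null_comparison[OF _ lim]) (intro always_eventually allI bnd)
  then show ?thesis by (simp add: LIM_zero_iff)
qed

text \<open>Dynkin system generated by the half-lines. Countable disjoint unions are handled by the
  bound \<open>\<nu>_norm\<close> on the remainder, which does not depend on
  \<open>k\<close>.\<close>

private lemma \<nu>_convergent:
  assumes "A \<in> sets borel"
  shows "convergent (\<lambda>k. \<nu> k A)"
proof -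
  have UNIV_eq: "\<nu> k UNIV = \<nu> k {..<1}" for k
    using J_endpoints(5) by (intro \<nu>_cong) fastforce
  have conv1: "convergent (\<lambda>k. \<nu> k UNIV)"
    unfolding UNIV_eq convergent_def using \<nu>_lessThan_tendsto[of 1] by auto
  have "A \<in> sigma_sets UNIV (range (\<lambda>a::real. {..<a}))"
    using assms by (simp add: borel_Iio)
  then show ?thesis
  proof (induction A rule: sigma_sets_induct_disjoint[rotated 2, consumes 1, case_names basic empty compl union Int Pow])
    case (basic A)
    then obtain a where a: "A = {..<a}" by blast
    define y where "y = max 0 (min a 1)"
    have "\<nu> k A = \<nu> k {..<y}" for k
      using J_endpoints(5)[of _ k] by (intro \<nu>_cong) (fastforce simp: a y_def)
    moreover have "y \<in> {0..1}" by (simp add: y_def)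
    ultimately show ?case
      using \<nu>_lessThan_tendsto[of y] by (auto simp: convergent_def)
  next
    case empty
    have "\<nu> k {} = 0" for k by (simp add: \<nu>_def)
    then show ?case by (simp add: convergent_const)
  next
    case (compl A)
    then have A: "A \<in> sets borel" by (simp add: borel_Iio)
    have "\<nu> k (UNIV - A) = \<nu> k UNIV - \<nu> k A" for k
      using \<nu>_Un[of "UNIV - A" A k] A by (simp add: Un_commute Compl_eq_Diff_UNIV[symmetric])
    then show ?case
      using convergent_diff[OF conv1 compl(2)] by simp
  next
    case (union A)
    have A: "A i \<in> sets borel" for i
    proof -
      have "A i \<in> sigma_sets UNIV (range (\<lambda>a::real. {..<a}))" using union(2) by blast
      then show ?thesis by (simp add: borel_Iio)
    qed
    define U where "U n = (\<Union>i<n. A i)" for n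
    have U: "U n \<in> sets borel" for n unfolding U_def using A by auto
    have UA: "(\<Union>i. A i) \<in> sets borel" using A by auto
    have Usum: "\<nu> k (U n) = (\<Sum>i<n. \<nu> k (A i))" for k n
    proof (induction n)
      case 0
      show ?case by (simp add: U_def \<nu>_def)
    next
      case (Suc n)
      have "U (Suc n) = U n \<union> A n" by (auto simp: U_def less_Suc_eq)
      moreover have "U n \<inter> A n = {}"
        using union(1) by (auto simp: U_def disjoint_family_on_def) (metis IntI emptyE less_irrefl)
      ultimately show ?case using \<nu>_Un[OF U A, of n n k] Suc by simp
    qed
    have Uconv: "convergent (\<lambda>k. \<nu> k (U n))" for n
      unfolding Usum by (intro convergent_sum union(3))
    have "(\<lambda>n. L * measure lborel (((\<Union>i. A i) - U n) \<inter> {0..1})) \<longlonglongrightarrow> L * 0"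
      unfolding U_def by (intro tendsto_mult tendsto_const measure_tail_tendsto_zero A)
    then have tail: "(\<lambda>n. L * measure lborel (((\<Union>i. A i) - U n) \<inter> {0..1})) \<longlonglongrightarrow> 0" by simp
    have diff: "norm (\<nu> k (\<Union>i. A i) - \<nu> k (U n)) \<le> L * measure lborel (((\<Union>i. A i) - U n) \<inter> {0..1})" for k n
    proof -
      have "U n \<union> ((\<Union>i. A i) - U n) = (\<Union>i. A i)" by (auto simp: U_def)
      then have "\<nu> k (\<Union>i. A i) = \<nu> k (U n) + \<nu> k ((\<Union>i. A i) - U n)"
        using \<nu>_Un[OF U, of "(\<Union>i. A i) - U n" n k] UA U by auto
      then show ?thesis using \<nu>_norm[of "(\<Union>i. A i) - U n" k] UA U by auto
    qed
    have "Cauchy (\<lambda>k. \<nu> k (\<Union>i. A i))"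
    proof (rule metric_CauchyI)
      fix \<epsilon> :: real assume "0 < \<epsilon>"
      then have "0 < \<epsilon> / 3" by simp
      from order_tendstoD(2)[OF tail this] obtain n where
        n: "L * measure lborel (((\<Union>i. A i) - U n) \<inter> {0..1}) < \<epsilon> / 3"
        by (auto simp: eventually_sequentially)
      have "Cauchy (\<lambda>k. \<nu> k (U n))" using Uconv by (simp add: Cauchy_convergent_iff)
      then obtain K where K: "\<And>k l. K \<le> k \<Longrightarrow> K \<le> l \<Longrightarrow> dist (\<nu> k (U n)) (\<nu> l (U n)) < \<epsilon> / 3"
        using metric_CauchyD[OF _ \<open>0 < \<epsilon> / 3\<close>] by blast
      show "\<exists>M. \<forall>m\<ge>M. \<forall>n\<ge>M. dist (\<nu> m (\<Union>i. A i)) (\<nu> n (\<Union>i. A i)) < \<epsilon>"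
      proof (intro exI[of _ K] allI impI)
        fix k l assume "K \<le> k" "K \<le> l"
        then have "dist (\<nu> k (U n)) (\<nu> l (U n)) < \<epsilon> / 3" by (rule K)
        moreover have "dist (\<nu> k (\<Union>i. A i)) (\<nu> k (U n)) < \<epsilon> / 3" "dist (\<nu> l (U n)) (\<nu> l (\<Union>i. A i)) < \<epsilon> / 3"
          using diff[of k n] diff[of l n] n by (auto simp: dist_norm norm_minus_commute)
        ultimately show "dist (\<nu> k (\<Union>i. A i)) (\<nu> l (\<Union>i. A i)) < \<epsilon>"
          using dist_triangle[of "\<nu> k (\<Union>i. A i)" "\<nu> l (\<Union>i. A i)" "\<nu> k (U n)"]
            dist_triangle[of "\<nu> k (U n)" "\<nu> l (\<Union>i. A i)" "\<nu> l (U n)"] by linarith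
      qed
    qed
    then show ?case by (simp add: Cauchy_convergent_iff)
  next
    case Int
    have "{..<a} \<inter> {..<b} = {..<min a b}" for a b :: real by auto
    then show ?case by (auto simp: Int_stable_def)
  next
    case Pow
    show ?case by simp
  qed
qed

text \<open>Additivity and the bound by \<open>L\<close> times Lebesgue measure survive the limit;
  the bound later yields countable additivity, finite variation and absolute continuity.\<close>

lemma lipschitz_vector_measure:
  shows "\<exists>m :: real set \<Rightarrow> 'a. (\<forall>A. A \<in> sets borel \<longrightarrow> norm (m A) \<le> L * measure lborel (A \<inter> {0..1})) \<and>
      (\<forall>A B. A \<in> sets borel \<longrightarrow> B \<in> sets borel \<longrightarrow> A \<inter> B = {} \<longrightarrow> m (A \<union> B) = m A + m B) \<and>
      (\<forall>x y. 0 \<le> x \<longrightarrow> x \<le> y \<longrightarrow> y \<le> 1 \<longrightarrow> m {x..<y} = g y - g x)"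
proof -
  define m where "m A = lim (\<lambda>k. \<nu> k A)" for A
  have m: "(\<lambda>k. \<nu> k A) \<longlonglongrightarrow> m A" if "A \<in> sets borel" for A
    using \<nu>_convergent[OF that] by (simp add: m_def convergent_LIMSEQ_iff)
  have bnd: "norm (m A) \<le> L * measure lborel (A \<inter> {0..1})" if "A \<in> sets borel" for A
    using tendsto_norm[OF m[OF that]] \<nu>_norm[OF that] by (intro LIMSEQ_le_const2) auto
  have add: "m (A \<union> B) = m A + m B" if "A \<in> sets borel" "B \<in> sets borel" "A \<inter> B = {}" for A B
  proof -
    have "(\<lambda>k. \<nu> k (A \<union> B)) \<longlonglongrightarrow> m A + m B"
      unfolding \<nu>_Un[OF that] by (intro tendsto_add m that)
    moreover have "(\<lambda>k. \<nu> k (A \<union> B)) \<longlonglongrightarrow> m (A \<union> B)"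
      using that by (intro m) auto
    ultimately show ?thesis by (rule LIMSEQ_unique[rotated])
  qed
  have less: "m {..<x} = g x - g 0" if "x \<in> {0..1}" for x
    by (rule LIMSEQ_unique[OF m \<nu>_lessThan_tendsto[OF that]]) simp
  have ivl: "m {x..<y} = g y - g x" if "0 \<le> x" "x \<le> y" "y \<le> 1" for x y
  proof -
    have "{..<x} \<union> {x..<y} = {..<y}" "{..<x} \<inter> {x..<y} = {}" using that by auto
    then have "m {..<y} = m {..<x} + m {x..<y}"
      using add[of "{..<x}" "{x..<y}"] by simp
    then show ?thesis using less[of x] less[of y] that by (simp add: algebra_simps)
  qed
  show ?thesis
    using bnd add ivl by (intro exI[of _ m] conjI allI impI)
qed

end

text \<open>The domination by \<open>L\<close> times Lebesgue measure verifies every premise of the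
  Radon-Nikodym property on the Borel sets of the unit interval. Half-open intervals are those on
  which the measure is an exact increment of \<open>g\<close>.\<close>

lemma lipschitz_density:
  fixes g :: "real \<Rightarrow> 'a::banach"
  assumes rnp: "radon_nikodym_property TYPE('a)"
    and lip: "\<And>x y. x \<in> {0..1} \<Longrightarrow> y \<in> {0..1} \<Longrightarrow> norm (g x - g y) \<le> L * \<bar>x - y\<bar>"
  shows "\<exists>h. has_bochner_integral_gen (restrict_space lborel {0..1}) (\<lambda>t. indicator {0..1} t *\<^sub>R h t) (g 1 - g 0) \<and>
    (\<forall>x y. 0 \<le> x \<longrightarrow> x \<le> y \<longrightarrow> y \<le> 1 \<longrightarrow>
      has_bochner_integral_gen (restrict_space lborel {0..1}) (\<lambda>t. indicator {x..<y} t *\<^sub>R h t) (g y - g x))"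
proof -
  define M where "M = restrict_space (lborel :: real measure) {0..1}"
  have L0: "0 \<le> L" using order_trans[OF norm_ge_zero lip[of 1 0]] by simp
  from lipschitz_vector_measure[of g L] lip
  obtain m where m:
    "\<And>A. A \<in> sets borel \<Longrightarrow> norm (m A) \<le> L * measure lborel (A \<inter> {0..1})"
    "\<And>A B. A \<in> sets borel \<Longrightarrow> B \<in> sets borel \<Longrightarrow> A \<inter> B = {} \<Longrightarrow> m (A \<union> B) = m A + m B"
    "\<And>x y. 0 \<le> x \<Longrightarrow> x \<le> y \<Longrightarrow> y \<le> 1 \<Longrightarrow> m {x..<y} = g y - g x"
    by blast
  have setsM: "A \<in> sets M \<longleftrightarrow> A \<in> sets borel \<and> A \<subseteq> {0..1}" for A
    by (auto simp: M_def sets_restrict_space_iff)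
  have m_empty: "m {} = 0" using m(1)[of "{}"] by simp
  have m_sum: "m (\<Union>i\<in>I. A i) = (\<Sum>i\<in>I. m (A i))"
    if "finite I" "\<And>i. i \<in> I \<Longrightarrow> A i \<in> sets borel" "disjoint_family_on A I" for I :: "nat set" and A
    using that
  proof (induction I rule: finite_induct)
    case empty
    show ?case by (simp add: m_empty)
  next
    case (insert i I)
    have "A i \<inter> (\<Union>i\<in>I. A i) = {}"
      using insert by (auto simp: disjoint_family_on_def)
    then have "m (A i \<union> (\<Union>i\<in>I. A i)) = m (A i) + m (\<Union>i\<in>I. A i)"
      using insert.prems insert.hyps by (intro m(2)) auto
    then show ?case using insert by (simp add: disjoint_family_on_def)
  qed
  have "finite_measure M"
    by (rule finite_measureI) (simp add: M_def space_restrict_space emeasure_restrict_space)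
  moreover have "vector_measure M m"
    unfolding vector_measure_def
  proof (intro allI impI)
    fix A :: "nat \<Rightarrow> real set" assume A: "range A \<subseteq> sets M \<and> disjoint_family A"
    then have Ab: "A i \<in> sets borel" for i using setsM by blast
    define U where "U n = (\<Union>i<n. A i)" for n
    have "(\<lambda>n. L * measure lborel (((\<Union>i. A i) - U n) \<inter> {0..1})) \<longlonglongrightarrow> L * 0"
      unfolding U_def by (intro tendsto_mult tendsto_const measure_tail_tendsto_zero Ab)
    then have tail: "(\<lambda>n. L * measure lborel (((\<Union>i. A i) - U n) \<inter> {0..1})) \<longlonglongrightarrow> 0" by simp
    have "(\<lambda>n. m (\<Union>i. A i) - m (U n)) \<longlonglongrightarrow> 0"
    proof (rule Lim_null_comparison[OF _ tail])
      show "\<forall>\<^sub>F n in sequentially. norm (m (\<Union>i. A i) - m (U n)) \<le> L * measure lborel (((\<Union>i. A i) - U n) \<inter> {0..1})"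
      proof (intro always_eventually allI)
        fix n
        have "U n \<union> ((\<Union>i. A i) - U n) = (\<Union>i. A i)" by (auto simp: U_def)
        moreover have "U n \<in> sets borel" "(\<Union>i. A i) - U n \<in> sets borel"
          using Ab by (auto simp: U_def)
        ultimately have "m (\<Union>i. A i) = m (U n) + m ((\<Union>i. A i) - U n)" "(\<Union>i. A i) - U n \<in> sets borel"
          using m(2)[of "U n" "(\<Union>i. A i) - U n"] by auto
        then show "norm (m (\<Union>i. A i) - m (U n)) \<le> L * measure lborel (((\<Union>i. A i) - U n) \<inter> {0..1})"
          using m(1)[of "(\<Union>i. A i) - U n"] by simp
      qed
    qed
    then have "(\<lambda>n. m (U n)) \<longlonglongrightarrow> m (\<Union>i. A i)"
      using LIM_zero_cancel[of "\<lambda>n. m (U n)" "m (\<Union>i. A i)" sequentially] tendsto_minus by fastforce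
    moreover have "m (U n) = (\<Sum>i<n. m (A i))" for n
      unfolding U_def using Ab A by (intro m_sum) (auto simp: disjoint_family_on_def)
    ultimately show "(\<lambda>n. m (A n)) sums m (\<Union>n. A n)" by (simp add: sums_def)
  qed
  moreover have "finite_variation M m"
    unfolding finite_variation_def
  proof (intro exI[of _ L] allI impI)
    fix P assume P: "finite P \<and> P \<subseteq> sets M \<and> disjoint P"
    then have Pb: "A \<in> sets borel" "A \<subseteq> {0..1}" if "A \<in> P" for A using that setsM by blast+
    have "(\<Sum>A\<in>P. norm (m A)) \<le> (\<Sum>A\<in>P. L * measure lborel A)"
    proof (rule sum_mono)
      fix A assume "A \<in> P"
      moreover from this have "A \<inter> {0..1} = A" using Pb(2) by blast
      ultimately show "norm (m A) \<le> L * measure lborel A" using m(1)[OF Pb(1), of A] by simp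
    qed
    also have "\<dots> = L * measure lborel (\<Union>A\<in>P. A)"
    proof (subst measure_finite_Union)
      show "disjoint_family_on (\<lambda>A. A) P"
        using P by (auto simp: disjoint_family_on_def disjoint_def)
      show "emeasure lborel A \<noteq> \<infinity>" if "A \<in> P" for A
        using emeasure_mono[OF Pb(2)[OF that], of lborel] by (auto simp: top_unique)
    qed (use P Pb in \<open>auto simp: sum_distrib_left\<close>)
    also have "\<dots> \<le> L * measure lborel {0..1::real}"
      using P Pb by (intro mult_left_mono L0 measure_mono_fmeasurable sets.finite_UN) (auto simp: fmeasurable_def)
    finally show "(\<Sum>A\<in>P. norm (m A)) \<le> L" by simp
  qed
  moreover have "m A = 0" if A: "A \<in> sets M" "emeasure M A = 0" for A
  proof -
    have "A \<in> sets borel" "A \<inter> {0..1} = A" using A(1) setsM by blast+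
    moreover have "emeasure lborel A = 0"
      using A setsM by (simp add: M_def emeasure_restrict_space)
    ultimately show ?thesis using m(1)[of A] by (simp add: measure_def)
  qed
  ultimately obtain h where h: "\<forall>A\<in>sets M. has_bochner_integral_gen M (\<lambda>t. indicator A t *\<^sub>R h t) (m A)"
    using rnp unfolding radon_nikodym_property_def by blast
  show ?thesis
  proof (intro exI[of _ h] conjI allI impI)
    \<comment> \<open>The right endpoint is a null set, hence invisible to \<open>m\<close>.\<close>
    have "m {0..1} = m ({0..<1} \<union> {1})"
      by (rule arg_cong[of _ _ m]) auto
    also have "\<dots> = m {0..<1} + m {1}" by (intro m(2)) auto
    also have "m {1} = 0" using m(1)[of "{1}"] by simp
    finally have "m {0..1} = g 1 - g 0" using m(3)[of 0 1] by simp
    then show "has_bochner_integral_gen (restrict_space lborel {0..1}) (\<lambda>t. indicator {0..1} t *\<^sub>R h t) (g 1 - g 0)"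
      using bspec[OF h, of "{0..1}"] setsM by (simp add: M_def)
    fix x y :: real assume xy: "0 \<le> x" "x \<le> y" "y \<le> 1"
    then have "{x..<y} \<in> sets M" by (auto simp: setsM)
    from bspec[OF h this]
    show "has_bochner_integral_gen (restrict_space lborel {0..1}) (\<lambda>t. indicator {x..<y} t *\<^sub>R h t) (g y - g x)"
      using m(3)[OF xy] by (simp add: M_def)
  qed
qed

section \<open>Differentiation of Lipschitz functions by means of a Bochner density\<close>

lemma borel_measurable_norm_diff_simple:
  fixes u :: "'m \<Rightarrow> 'a::real_normed_vector"
  assumes u: "u \<in> borel_measurable M" and s: "Bochner_Integration.simple_bochner_integrable M s"
  shows "(\<lambda>t. ennreal (norm (u t - s t))) \<in> borel_measurable M"
proof -
  have sf: "simple_function M s"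
    using s by (auto elim: Bochner_Integration.simple_bochner_integrable.cases)
  then have g: "s \<in> M \<rightarrow>\<^sub>M count_space (s ` space M)"
    by (auto simp: simple_function_def measurable_count_space_eq2)
  have "(\<lambda>t. norm (u t - v)) \<in> borel_measurable M" for v
    by (rule measurable_compose[OF u]) (intro borel_measurable_continuous_onI continuous_intros)
  then have f: "(\<lambda>t. ennreal (norm (u t - v))) \<in> borel_measurable M" for v
    by (rule measurable_compose[OF _ measurable_ennreal])
  \<comment> \<open>In a non-separable space the difference of two measurable maps need not be
    measurable. Since \<open>s\<close> has finitely many values, the function is pieced together
    from the maps \<open>norm (u t - v)\<close> with fixed \<open>v\<close>.\<close>
  show ?thesis
    by (rule measurable_compose_countable'[OF f g]) (use sf in \<open>auto simp: simple_function_def intro: countable_finite\<close>)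
qed

text \<open>The functional is applied to the approximating simple functions; the errors grow at most
  by the factor \<open>norm f\<close>.\<close>

lemma has_bochner_integral_gen_functional:
  fixes u :: "'m \<Rightarrow> 'a::real_normed_vector" and f :: "'a \<Rightarrow>\<^sub>L real"
  assumes "has_bochner_integral_gen M u x"
  shows "has_bochner_integral M (\<lambda>t. blinfun_apply f (u t)) (blinfun_apply f x)"
proof -
  obtain s where u: "u \<in> borel_measurable M" and s: "\<And>i. Bochner_Integration.simple_bochner_integrable M (s i)"
    "(\<lambda>i. \<integral>\<^sup>+ t. ennreal (norm (u t - s i t)) \<partial>M) \<longlonglongrightarrow> 0"
    "(\<lambda>i. Bochner_Integration.simple_bochner_integral M (s i)) \<longlonglongrightarrow> x"
    using assms unfolding has_bochner_integral_gen_def by blast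
  show ?thesis
  proof (rule has_bochner_integral.intros)
    show "(\<lambda>t. blinfun_apply f (u t)) \<in> borel_measurable M"
      by (rule measurable_compose[OF u]) (intro borel_measurable_continuous_onI continuous_intros)
    show "Bochner_Integration.simple_bochner_integrable M (\<lambda>t. blinfun_apply f (s i t))" for i
      using s(1)[of i]
      by (auto simp: Bochner_Integration.simple_bochner_integrable_compose2[where p = "\<lambda>x y. blinfun_apply f x", of M "s i" "s i"] blinfun.zero_right)
    have "(\<integral>\<^sup>+ t. ennreal (norm (blinfun_apply f (u t) - blinfun_apply f (s i t))) \<partial>M) \<le>
        ennreal (norm f) * (\<integral>\<^sup>+ t. ennreal (norm (u t - s i t)) \<partial>M)" for i
    proof -
      have "(\<integral>\<^sup>+ t. ennreal (norm (blinfun_apply f (u t) - blinfun_apply f (s i t))) \<partial>M) \<le>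
          (\<integral>\<^sup>+ t. ennreal (norm f) * ennreal (norm (u t - s i t)) \<partial>M)"
        using norm_blinfun[of f]
        by (intro nn_integral_mono) (auto simp: blinfun.diff_right[symmetric] ennreal_mult[symmetric] intro!: ennreal_leI)
      also have "\<dots> = ennreal (norm f) * (\<integral>\<^sup>+ t. ennreal (norm (u t - s i t)) \<partial>M)"
      proof (rule nn_integral_cmult)
        show "(\<lambda>t. ennreal (norm (u t - s i t))) \<in> borel_measurable M"
          by (rule borel_measurable_norm_diff_simple[OF u s(1)])
      qed
      finally show ?thesis .
    qed
    note le = this
    have "(\<lambda>i. ennreal (norm f) * (\<integral>\<^sup>+ t. ennreal (norm (u t - s i t)) \<partial>M)) \<longlonglongrightarrow> ennreal (norm f) * 0"
      by (rule ennreal_tendsto_cmult[OF _ s(2)]) simp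
    then have lim: "(\<lambda>i. ennreal (norm f) * (\<integral>\<^sup>+ t. ennreal (norm (u t - s i t)) \<partial>M)) \<longlonglongrightarrow> 0" by simp
    show "(\<lambda>i. \<integral>\<^sup>+ t. ennreal (norm (blinfun_apply f (u t) - blinfun_apply f (s i t))) \<partial>M) \<longlonglongrightarrow> 0"
      by (rule tendsto_sandwich[OF _ _ tendsto_const lim]) (intro always_eventually allI, (rule zero_le | rule le))+
    have "Bochner_Integration.simple_bochner_integral M (\<lambda>t. blinfun_apply f (s i t)) =
        blinfun_apply f (Bochner_Integration.simple_bochner_integral M (s i))" for i
      by (intro Bochner_Integration.simple_bochner_integral_linear s(1))
        (simp add: blinfun.bounded_linear_right bounded_linear.linear)
    then show "(\<lambda>i. Bochner_Integration.simple_bochner_integral M (\<lambda>t. blinfun_apply f (s i t))) \<longlonglongrightarrow> blinfun_apply f x"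
      using s(3) by (simp add: blinfun.tendsto)
  qed
qed

text \<open>The values of the approximating simple functions form a countable set \<open>V\<close>
  that comes arbitrarily near \<open>u t\<close> for almost every \<open>t\<close>. Almost every
  \<open>t\<close> is a differentiation point of the scalar functions \<open>U v\<close> for all
  \<open>v \<in> V\<close>, and a nearby \<open>v\<close> turns this into differentiability of
  \<open>g\<close> with derivative \<open>h t\<close>.\<close>

lemma rnp_lipschitz_differentiable:
  fixes g :: "real \<Rightarrow> 'a::banach"
  assumes rnp: "radon_nikodym_property TYPE('a)"
    and lip: "\<And>x y. x \<in> {0..1} \<Longrightarrow> y \<in> {0..1} \<Longrightarrow> norm (g x - g y) \<le> L * \<bar>x - y\<bar>"
  obtains N h where "negligible N" "\<And>t \<epsilon>. t \<in> {0..1} \<Longrightarrow> t \<notin> N \<Longrightarrow> 0 < \<epsilon> \<Longrightarrow>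
    \<exists>r>0. \<forall>a b. 0 \<le> a \<and> a \<le> t \<and> t \<le> b \<and> b \<le> 1 \<and> a < b \<and> b - a < r \<longrightarrow> norm (g b - g a - (b - a) *\<^sub>R h t) \<le> \<epsilon> * (b - a)"
proof -
  define M where "M = restrict_space (lborel :: real measure) {0..1}"
  have spaceM: "space M = {0..1}" by (simp add: M_def space_restrict_space)
  have eM: "emeasure M A = emeasure lborel A" if "A \<subseteq> {0..1}" for A
    using that by (simp add: M_def emeasure_restrict_space)
  obtain h where h01: "has_bochner_integral_gen M (\<lambda>t. indicator {0..1} t *\<^sub>R h t) (g 1 - g 0)"
    and h: "\<And>x y. 0 \<le> x \<Longrightarrow> x \<le> y \<Longrightarrow> y \<le> 1 \<Longrightarrow> has_bochner_integral_gen M (\<lambda>t. indicator {x..<y} t *\<^sub>R h t) (g y - g x)"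
    unfolding M_def using lipschitz_density[of g L] rnp lip by blast
  define u where "u t = indicator {0..1::real} t *\<^sub>R h t" for t
  obtain s where u: "u \<in> borel_measurable M" and s: "\<And>i. Bochner_Integration.simple_bochner_integrable M (s i)"
    "(\<lambda>i. \<integral>\<^sup>+ t. ennreal (norm (u t - s i t)) \<partial>M) \<longlonglongrightarrow> 0"
    using h01 unfolding has_bochner_integral_gen_def u_def by blast
  have fin: "finite (s i ` {0..1})" for i
    using s(1)[of i] by (auto elim!: Bochner_Integration.simple_bochner_integrable.cases simp: simple_function_def spaceM)
  define V where "V = (\<Union>i. s i ` {0..1})"
  have V: "countable V" "V \<noteq> {}"
    unfolding V_def using fin by (auto intro: countable_finite)
  define U where "U v t = norm (u t - v)" for v t
  have U_meas: "U v \<in> borel_measurable M" for v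
    unfolding U_def by (rule measurable_compose[OF u]) (intro borel_measurable_continuous_onI continuous_intros)
  have U_int: "integrable M (U v)" for v
  proof (rule integrableI_bounded[OF U_meas])
    obtain i where i: "(\<integral>\<^sup>+ t. ennreal (norm (u t - s i t)) \<partial>M) < 1"
      using order_tendstoD(2)[OF s(2), of 1] by (auto simp: eventually_sequentially)
    obtain C where C: "\<And>x. x \<in> s i ` {0..1} \<Longrightarrow> norm x \<le> C"
      using finite_imp_bounded[OF fin[of i]] by (auto simp: bounded_iff)
    have "(\<integral>\<^sup>+ t. ennreal (norm (U v t)) \<partial>M) \<le> (\<integral>\<^sup>+ t. ennreal (norm (u t - s i t)) + ennreal (C + norm v) \<partial>M)"
    proof (rule nn_integral_mono)
      fix t assume "t \<in> space M"
      then have "norm (s i t) \<le> C" using C by (simp add: spaceM)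
      moreover have "norm (u t - v) \<le> norm (u t - s i t) + norm (s i t - v)"
        using norm_triangle_ineq[of "u t - s i t" "s i t - v"] by simp
      moreover have "norm (s i t - v) \<le> norm (s i t) + norm v" by (rule norm_triangle_ineq4)
      ultimately have "U v t \<le> norm (u t - s i t) + (C + norm v)" "0 \<le> U v t"
        unfolding U_def by (linarith, simp)
      moreover have "0 \<le> C + norm v"
        using \<open>norm (s i t) \<le> C\<close> norm_ge_zero[of "s i t"] norm_ge_zero[of v] by linarith
      ultimately have "norm (U v t) \<le> norm (u t - s i t) + (C + norm v)" "0 \<le> C + norm v"
        by simp_all
      then show "ennreal (norm (U v t)) \<le> ennreal (norm (u t - s i t)) + ennreal (C + norm v)"
        by (simp add: ennreal_leI flip: ennreal_plus)
    qed
    also have "\<dots> = (\<integral>\<^sup>+ t. ennreal (norm (u t - s i t)) \<partial>M) + ennreal (C + norm v) * emeasure M (space M)"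
      by (subst nn_integral_add[OF borel_measurable_norm_diff_simple[OF u s(1)]]) auto
    also have "emeasure M (space M) = 1" by (simp add: spaceM eM)
    also have "(\<integral>\<^sup>+ t. ennreal (norm (u t - s i t)) \<partial>M) + ennreal (C + norm v) * 1 < \<infinity>"
      using i by (auto simp: less_top[symmetric] top_unique)
    finally show "(\<integral>\<^sup>+ t. ennreal (norm (U v t)) \<partial>M) < \<infinity>" .
  qed
  have U_set: "set_integrable lborel {0..1} (U v)" for v
    using U_int[of v] unfolding M_def set_integrable_def by (simp add: integrable_restrict_space)
  then have U_HK: "U v integrable_on {0..1}" for v
    by (rule set_borel_integral_eq_integral)
  \<comment> \<open>Tested against functionals of norm at most 1, the increment of \<open>g\<close>
    minus that of \<open>t *\<^sub>R v\<close> is a scalar integral dominated by the integral of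
    \<open>U v\<close>.\<close>
  have bound: "norm (g b - g a - (b - a) *\<^sub>R v) \<le> integral {a..b} (U v)" if ab: "0 \<le> a" "a \<le> b" "b \<le> 1" for a b v
  proof (rule norm_le_dualI)
    fix f :: "'a \<Rightarrow>\<^sub>L real" assume f: "norm f \<le> 1"
    have 1: "has_bochner_integral M (\<lambda>t. blinfun_apply f (indicator {a..<b} t *\<^sub>R h t)) (blinfun_apply f (g b - g a))"
      by (rule has_bochner_integral_gen_functional[OF h[OF ab]])
    have sub: "{a..<b} \<subseteq> {0..1}" "{a..b} \<subseteq> {0..1}" using ab by auto
    have abM: "{a..<b} \<in> sets M" "{a..b} \<in> sets M"
      using sub by (auto simp: M_def sets_restrict_space_iff)
    have "has_bochner_integral M (indicator {a..<b}) (measure M {a..<b})"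
      using abM(1) by (intro has_bochner_integral_real_indicator) (auto simp: eM[OF sub(1)] ab)
    moreover have "measure M {a..<b} = b - a"
      using ab by (simp add: measure_def eM[OF sub(1)])
    ultimately have 2: "has_bochner_integral M (\<lambda>t. indicator {a..<b} t * blinfun_apply f v) ((b - a) * blinfun_apply f v)"
      by (intro has_bochner_integral_mult_left) auto
    have 3: "integrable M (\<lambda>t. indicator {a..b} t * U v t)"
      using integrable_mult_indicator[OF abM(2) U_int[of v]] by simp
    have "blinfun_apply f (g b - g a - (b - a) *\<^sub>R v) = blinfun_apply f (g b - g a) - (b - a) * blinfun_apply f v"
      by (simp add: blinfun.diff_right blinfun.scaleR_right)
    also have "\<dots> = (LINT t|M. blinfun_apply f (indicator {a..<b} t *\<^sub>R h t) - indicator {a..<b} t * blinfun_apply f v)"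
      by (rule has_bochner_integral_integral_eq[OF has_bochner_integral_diff[OF 1 2], symmetric])
    also have "\<dots> \<le> (LINT t|M. indicator {a..b} t * U v t)"
    proof (rule integral_mono)
      show "integrable M (\<lambda>t. blinfun_apply f (indicator {a..<b} t *\<^sub>R h t) - indicator {a..<b} t * blinfun_apply f v)"
        using has_bochner_integral_diff[OF 1 2] by (rule integrable.intros)
      fix t assume "t \<in> space M"
      then have "u t = h t" by (simp add: u_def spaceM)
      then have "blinfun_apply f (h t) - blinfun_apply f v \<le> U v t"
        using blinfun_apply_le_unit[OF f, of "h t - v"] by (simp add: U_def blinfun.diff_right)
      moreover have "0 \<le> U v t" by (simp add: U_def)
      ultimately show "blinfun_apply f (indicator {a..<b} t *\<^sub>R h t) - indicator {a..<b} t * blinfun_apply f v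
          \<le> indicator {a..b} t * U v t"
        by (auto simp: indicator_def blinfun.zero_right)
    qed (rule 3)
    also have "\<dots> = (LINT t:{a..b}|lborel. U v t)"
      unfolding M_def set_lebesgue_integral_def using sub(2)
      by (subst integral_restrict_space) (auto intro!: Bochner_Integration.integral_cong simp: indicator_def)
    also have "\<dots> = integral {a..b} (U v)"
      using sub(2) by (intro set_borel_integral_eq_integral(2) set_integrable_subset[OF U_set]) auto
    finally show "blinfun_apply f (g b - g a - (b - a) *\<^sub>R v) \<le> integral {a..b} (U v)" .
  qed
  have "\<exists>N. negligible N \<and> (\<forall>t \<eta>. t \<in> {0..1} \<longrightarrow> t \<notin> N \<longrightarrow> 0 < \<eta> \<longrightarrow> (\<exists>r>0. \<forall>a b. 0 \<le> a \<and> a \<le> t \<and> t \<le> b \<and> b \<le> 1 \<and> a < b \<and> b - a < r \<longrightarrow>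
      \<bar>measure lborel {a..b} * U v t - integral {a..b} (U v)\<bar> \<le> \<eta> * (b - a)))" for v
    by (rule henstock_null_derivative_zero[OF henstock_null_integrable[OF U_HK[of v]]]) (simp, blast)
  then obtain Nv where Nv: "\<And>v. negligible (Nv v)" "\<And>v t \<eta>. t \<in> {0..1} \<Longrightarrow> t \<notin> Nv v \<Longrightarrow> 0 < \<eta> \<Longrightarrow>
      \<exists>r>0. \<forall>a b. 0 \<le> a \<and> a \<le> t \<and> t \<le> b \<and> b \<le> 1 \<and> a < b \<and> b - a < r \<longrightarrow>
      \<bar>measure lborel {a..b} * U v t - integral {a..b} (U v)\<bar> \<le> \<eta> * (b - a)"
    by metis
  \<comment> \<open>Points whose density value stays away from \<open>V\<close>. The simple
    functions take values in \<open>V\<close>, so their distance to \<open>u\<close> in mean bounds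
    the measure of \<open>Z n\<close>, and this distance tends to 0.\<close>
  define Z where "Z n = {t \<in> {0..1}. \<forall>v\<in>V. 1 / real (Suc n) \<le> U v t}" for n
  have Z: "negligible (Z n)" for n
  proof -
    have "{t \<in> space M. 1 / real (Suc n) \<le> U v t} \<in> sets M" for v
      using U_meas[of v] by measurable
    then have "(\<Inter>v\<in>V. {t \<in> space M. 1 / real (Suc n) \<le> U v t}) \<in> sets M"
      using V by (intro sets.countable_INT') auto
    also have "(\<Inter>v\<in>V. {t \<in> space M. 1 / real (Suc n) \<le> U v t}) = Z n"
      using V(2) by (auto simp: Z_def spaceM)
    finally have Zs: "Z n \<in> sets M" .
    have "ennreal (1 / real (Suc n)) * emeasure M (Z n) \<le> (\<integral>\<^sup>+ t. ennreal (norm (u t - s i t)) \<partial>M)" for i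
    proof -
      have "ennreal (1 / real (Suc n)) * emeasure M (Z n) = (\<integral>\<^sup>+ t. ennreal (1 / real (Suc n)) * indicator (Z n) t \<partial>M)"
        using Zs by (simp add: nn_integral_cmult_indicator)
      also have "\<dots> \<le> (\<integral>\<^sup>+ t. ennreal (norm (u t - s i t)) \<partial>M)"
      proof (rule nn_integral_mono)
        fix t assume "t \<in> space M"
        then have "s i t \<in> V" unfolding V_def spaceM by blast
        then show "ennreal (1 / real (Suc n)) * indicator (Z n) t \<le> ennreal (norm (u t - s i t))"
          by (auto simp: indicator_def Z_def U_def intro!: ennreal_leI)
      qed
      finally show ?thesis .
    qed
    then have "ennreal (1 / real (Suc n)) * emeasure M (Z n) \<le> 0"
      using s(2) by (intro LIMSEQ_le_const) auto
    then have "emeasure M (Z n) = 0" by (auto simp: ennreal_eq_0_iff)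
    then have "Z n \<in> null_sets lborel"
      using Zs eM[of "Z n"] by (auto simp: null_sets_def M_def sets_restrict_space_iff Z_def)
    then show ?thesis
      by (simp add: negligible_iff_null_sets null_sets_completionI)
  qed
  show thesis
  proof
    show "negligible (\<Union> (Nv ` V) \<union> (\<Union>n. Z n))"
      using V(1) Nv(1) Z by (intro negligible_Un negligible_countable_Union) auto
    fix t \<epsilon> :: real assume t: "t \<in> {0..1}" "t \<notin> \<Union> (Nv ` V) \<union> (\<Union>n. Z n)" and \<epsilon>: "0 < \<epsilon>"
    \<comment> \<open>\<open>U v t\<close> enters twice, once through the integral and once through
      \<open>norm (h t - v)\<close>, and the differentiation error is the remaining third.\<close>
    obtain n where n: "1 / real (Suc n) < \<epsilon> / 3" using \<epsilon> nat_approx_posE[of "\<epsilon> / 3"] by auto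
    have "t \<notin> Z n" using t(2) by blast
    then obtain v where v: "v \<in> V" "U v t < 1 / real (Suc n)" using t(1) by (auto simp: Z_def not_le)
    have "t \<notin> Nv v" using t(2) v(1) by blast
    from Nv(2)[OF t(1) this, of "\<epsilon> / 3"] \<epsilon> obtain r where r: "0 < r"
      "\<forall>a b. 0 \<le> a \<and> a \<le> t \<and> t \<le> b \<and> b \<le> 1 \<and> a < b \<and> b - a < r \<longrightarrow>
      \<bar>measure lborel {a..b} * U v t - integral {a..b} (U v)\<bar> \<le> \<epsilon> / 3 * (b - a)" by auto
    show "\<exists>r>0. \<forall>a b. 0 \<le> a \<and> a \<le> t \<and> t \<le> b \<and> b \<le> 1 \<and> a < b \<and> b - a < r \<longrightarrow> norm (g b - g a - (b - a) *\<^sub>R h t) \<le> \<epsilon> * (b - a)"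
    proof (intro exI[of _ r] conjI allI impI r(1))
      fix a b assume ab: "0 \<le> a \<and> a \<le> t \<and> t \<le> b \<and> b \<le> 1 \<and> a < b \<and> b - a < r"
      have ht: "norm (h t - v) = U v t" using t(1) by (simp add: U_def u_def)
      have "g b - g a - (b - a) *\<^sub>R h t = (g b - g a - (b - a) *\<^sub>R v) - (b - a) *\<^sub>R (h t - v)"
        by (simp add: algebra_simps)
      also have "norm \<dots> \<le> norm (g b - g a - (b - a) *\<^sub>R v) + norm ((b - a) *\<^sub>R (h t - v))"
        by (rule norm_triangle_ineq4)
      also have "norm ((b - a) *\<^sub>R (h t - v)) = (b - a) * U v t" using ab ht by simp
      also have "norm (g b - g a - (b - a) *\<^sub>R v) \<le> integral {a..b} (U v)" using ab by (intro bound) auto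
      also have "integral {a..b} (U v) \<le> (b - a) * U v t + \<epsilon> / 3 * (b - a)"
      proof -
        have "\<bar>(b - a) * U v t - integral {a..b} (U v)\<bar> \<le> \<epsilon> / 3 * (b - a)"
          using r(2)[rule_format, OF ab] ab by simp
        then show ?thesis by linarith
      qed
      also have "(b - a) * U v t + \<epsilon> / 3 * (b - a) + (b - a) * U v t \<le> \<epsilon> * (b - a)"
      proof -
        have "(b - a) * U v t \<le> (b - a) * (\<epsilon> / 3)" using v(2) n ab by (intro mult_left_mono) auto
        moreover have "(b - a) * (\<epsilon> / 3) = \<epsilon> * (b - a) / 3" "\<epsilon> / 3 * (b - a) = \<epsilon> * (b - a) / 3" by simp_all
        ultimately show ?thesis by linarith
      qed
      finally show "norm (g b - g a - (b - a) *\<^sub>R h t) \<le> \<epsilon> * (b - a)" by simp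
    qed
  qed
qed

section \<open>Additive selections and their derivatives\<close>

text \<open>Linear interpolation across the gaps of \<open>E\<close> between the nearest points
  \<open>l x\<close> and \<open>r x\<close>, which exist since \<open>E\<close> is compact and
  contains both endpoints. At a point of \<open>E\<close> the fraction has numerator 0, so even a
  zero denominator gives the value of \<open>F\<close>.\<close>

lemma lipschitz_extension_interval:
  fixes F :: "real \<Rightarrow> 'a::real_normed_vector"
  assumes E: "closed E" "E \<subseteq> {0..1}" "0 \<in> E" "1 \<in> E"
    and lip: "\<And>x y. x \<in> E \<Longrightarrow> y \<in> E \<Longrightarrow> norm (F x - F y) \<le> L * \<bar>x - y\<bar>"
  obtains g where "\<And>x. x \<in> E \<Longrightarrow> g x = F x"
    "\<And>x y. x \<in> {0..1} \<Longrightarrow> y \<in> {0..1} \<Longrightarrow> norm (g x - g y) \<le> L * \<bar>x - y\<bar>"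
proof -
  have L: "0 \<le> L" using order_trans[OF norm_ge_zero lip[OF E(4,3)]] by simp
  have cE: "compact E"
    using compact_Int_closed[of "{0..1::real}" E] E(1,2) by (simp add: Int_absorb1)
  have "\<exists>e. e \<in> E \<and> e \<le> x \<and> (\<forall>y\<in>E. y \<le> x \<longrightarrow> y \<le> e)" if "x \<in> {0..1}" for x
  proof -
    have "compact (E \<inter> {..x})" "E \<inter> {..x} \<noteq> {}"
      using cE E(3) that by (auto intro: compact_Int_closed)
    from compact_attains_sup[OF this] show ?thesis by fastforce
  qed
  then obtain l where l: "\<And>x. x \<in> {0..1} \<Longrightarrow> l x \<in> E" "\<And>x. x \<in> {0..1} \<Longrightarrow> l x \<le> x"
    "\<And>x y. x \<in> {0..1} \<Longrightarrow> y \<in> E \<Longrightarrow> y \<le> x \<Longrightarrow> y \<le> l x" by metis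
  have "\<exists>e. e \<in> E \<and> x \<le> e \<and> (\<forall>y\<in>E. x \<le> y \<longrightarrow> e \<le> y)" if "x \<in> {0..1}" for x
  proof -
    have "compact (E \<inter> {x..})" "E \<inter> {x..} \<noteq> {}"
      using cE E(4) that by (auto intro: compact_Int_closed)
    from compact_attains_inf[OF this] show ?thesis by fastforce
  qed
  then obtain r where r: "\<And>x. x \<in> {0..1} \<Longrightarrow> r x \<in> E" "\<And>x. x \<in> {0..1} \<Longrightarrow> x \<le> r x"
    "\<And>x y. x \<in> {0..1} \<Longrightarrow> y \<in> E \<Longrightarrow> x \<le> y \<Longrightarrow> r x \<le> y" by metis
  define g where "g x = F (l x) + ((x - l x) / (r x - l x)) *\<^sub>R (F (r x) - F (l x))" for x
  have gE: "g x = F x" if "x \<in> E" for x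
  proof -
    have "x \<in> {0..1}" using that E(2) by blast
    then have "l x = x" using l(2,3)[of x] that by (simp add: antisym)
    then show ?thesis by (simp add: g_def)
  qed
  have slope: "norm (c *\<^sub>R (F (r x) - F (l x))) \<le> L * (c * (r x - l x))" if "x \<in> {0..1}" "0 \<le> c" for x c
  proof -
    have "norm (F (r x) - F (l x)) \<le> L * (r x - l x)"
      using lip[OF r(1) l(1), OF that(1) that(1)] l(2)[OF that(1)] r(2)[OF that(1)] by simp
    then have "c * norm (F (r x) - F (l x)) \<le> c * (L * (r x - l x))"
      using that(2) by (rule mult_left_mono)
    then show ?thesis using that(2) by (simp add: mult.left_commute)
  qed
  have left: "norm (g x - F (l x)) \<le> L * (x - l x)" and right: "norm (F (r x) - g x) \<le> L * (r x - x)"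
    if x: "x \<in> {0..1}" for x
  proof -
    have lr: "l x \<le> x" "x \<le> r x" using l(2) r(2) x by auto
    show "norm (g x - F (l x)) \<le> L * (x - l x)"
    proof (cases "r x = l x")
      case True
      then show ?thesis using lr by (simp add: g_def)
    next
      case False
      with slope[OF x, of "(x - l x) / (r x - l x)"] lr show ?thesis by (simp add: g_def)
    qed
    show "norm (F (r x) - g x) \<le> L * (r x - x)"
    proof (cases "r x = l x")
      case True
      then have "r x = x" "l x = x" using lr by auto
      then show ?thesis by (simp add: g_def)
    next
      case False
      have "F (r x) - g x = (1 - (x - l x) / (r x - l x)) *\<^sub>R (F (r x) - F (l x))"
        by (simp add: g_def scaleR_diff_left)
      also have "1 - (x - l x) / (r x - l x) = (r x - x) / (r x - l x)"
        using False by (simp add: field_simps)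
      finally show ?thesis
        using slope[OF x, of "(r x - x) / (r x - l x)"] lr False by simp
    qed
  qed
  \<comment> \<open>Either a point of \<open>E\<close> lies between \<open>x\<close> and
    \<open>y\<close>, and the estimates chain through \<open>r x \<le> l y\<close>, or both lie in
    the same gap, where \<open>g\<close> is affine.\<close>
  have mono: "norm (g y - g x) \<le> L * (y - x)" if xy: "x \<in> {0..1}" "y \<in> {0..1}" "x \<le> y" for x y
  proof (cases "\<exists>e\<in>E. x \<le> e \<and> e \<le> y")
    case True
    then obtain e where e: "e \<in> E" "x \<le> e" "e \<le> y" by blast
    then have ord: "r x \<le> l y" using r(3)[OF xy(1) e(1,2)] l(3)[OF xy(2) e(1,3)] by simp
    have mid: "norm (F (l y) - F (r x)) \<le> L * (l y - r x)"
      using lip[OF l(1)[OF xy(2)] r(1)[OF xy(1)]] ord by simp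
    have "g y - g x = (g y - F (l y)) + (F (l y) - F (r x)) + (F (r x) - g x)" by simp
    also have "norm \<dots> \<le> L * (y - l y) + L * (l y - r x) + L * (r x - x)"
      by (intro norm_triangle_mono left right mid xy)
    also have "\<dots> = L * (y - x)" by (simp add: algebra_simps)
    finally show ?thesis .
  next
    case False
    have leq: "l y = l x"
    proof (rule antisym)
      have "l y < x" using False l(1,2)[OF xy(2)] by (meson not_le)
      then show "l y \<le> l x" using l(3)[OF xy(1) l(1)[OF xy(2)]] by simp
      show "l x \<le> l y" using l(3)[OF xy(2) l(1)[OF xy(1)]] l(2)[OF xy(1)] xy(3) by simp
    qed
    have req: "r y = r x"
    proof (rule antisym)
      have "y < r x" using False r(1,2)[OF xy(1)] by (meson not_le)
      then show "r y \<le> r x" using r(3)[OF xy(2) r(1)[OF xy(1)]] by simp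
      show "r x \<le> r y" using r(3)[OF xy(1) r(1)[OF xy(2)]] r(2)[OF xy(2)] xy(3) by simp
    qed
    have lt: "l x < r x"
      using False l(1,2)[OF xy(1)] r(1,2)[OF xy(1)] xy(3) by (metis antisym_conv2 order_trans)
    have "g y - g x = ((y - l x) / (r x - l x) - (x - l x) / (r x - l x)) *\<^sub>R (F (r x) - F (l x))"
      by (simp add: g_def leq req scaleR_diff_left)
    also have "(y - l x) / (r x - l x) - (x - l x) / (r x - l x) = (y - x) / (r x - l x)"
      by (simp add: diff_divide_distrib[symmetric])
    finally show ?thesis
      using slope[OF xy(1), of "(y - x) / (r x - l x)"] lt xy(3) by simp
  qed
  show thesis
  proof
    show "g x = F x" if "x \<in> E" for x by (rule gE[OF that])
    show "norm (g x - g y) \<le> L * \<bar>x - y\<bar>" if "x \<in> {0..1}" "y \<in> {0..1}" for x y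
    proof (cases "x \<le> y")
      case True
      then show ?thesis using mono[OF that] by (simp add: norm_minus_commute)
    next
      case False
      then show ?thesis using mono[OF that(2,1)] by simp
    qed
  qed
qed

text \<open>Differentiation of the integral of the indicator of \<open>E\<close>: at a point of
  \<open>E\<close> the indicator is 1, so the length minus the integral is the measure of the part
  of the interval outside \<open>E\<close>.\<close>

lemma lebesgue_density_interval:
  fixes E :: "real set"
  assumes E: "closed E"
  obtains N where "negligible N" "\<And>t \<eta>. t \<in> {0..1} \<Longrightarrow> t \<in> E \<Longrightarrow> t \<notin> N \<Longrightarrow> 0 < \<eta> \<Longrightarrow>
    \<exists>r>0. \<forall>a b. 0 \<le> a \<and> a \<le> t \<and> t \<le> b \<and> b \<le> 1 \<and> a < b \<and> b - a < r \<longrightarrow> measure lebesgue ({a..b} - E) \<le> \<eta> * (b - a)"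
proof -
  have fm: "E \<inter> {a..b} \<in> lmeasurable" for a b
    using E by (intro lmeasurable_compact) (metis Int_commute closed_Int_compact compact_Icc inf_commute)
  have "indicat_real E integrable_on {0..1}"
    using fm[of 0 1] by (simp add: integrable_on_indicator)
  from henstock_null_derivative_zero[OF henstock_null_integrable[OF this] abs_ge_zero]
  obtain N where N: "negligible N" "\<And>t \<eta>. t \<in> {0..1} \<Longrightarrow> t \<notin> N \<Longrightarrow> 0 < \<eta> \<Longrightarrow>
      \<exists>r>0. \<forall>a b. 0 \<le> a \<and> a \<le> t \<and> t \<le> b \<and> b \<le> 1 \<and> a < b \<and> b - a < r \<longrightarrow>
      \<bar>measure lborel {a..b} * indicat_real E t - integral {a..b} (indicat_real E)\<bar> \<le> \<eta> * (b - a)"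
    by blast
  show thesis
  proof (rule that[OF N(1)])
    fix t \<eta> :: real assume t: "t \<in> {0..1}" "t \<in> E" "t \<notin> N" and \<eta>: "0 < \<eta>"
    from N(2)[OF t(1,3) \<eta>] obtain r where r: "0 < r"
      "\<And>a b. 0 \<le> a \<and> a \<le> t \<and> t \<le> b \<and> b \<le> 1 \<and> a < b \<and> b - a < r \<Longrightarrow>
      \<bar>measure lborel {a..b} * indicat_real E t - integral {a..b} (indicat_real E)\<bar> \<le> \<eta> * (b - a)" by blast
    show "\<exists>r>0. \<forall>a b. 0 \<le> a \<and> a \<le> t \<and> t \<le> b \<and> b \<le> 1 \<and> a < b \<and> b - a < r \<longrightarrow> measure lebesgue ({a..b} - E) \<le> \<eta> * (b - a)"
    proof (intro exI[of _ r] conjI allI impI r(1))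
      fix a b assume ab: "0 \<le> a \<and> a \<le> t \<and> t \<le> b \<and> b \<le> 1 \<and> a < b \<and> b - a < r"
      have "measure lebesgue ({a..b} - E) = measure lebesgue ({a..b} - E \<inter> {a..b})"
        by (rule arg_cong[of _ _ "measure lebesgue"]) auto
      also have "\<dots> = measure lebesgue {a..b} - measure lebesgue (E \<inter> {a..b})"
        using fm[of a b] by (intro measurable_measure_Diff) auto
      also have "\<dots> = (b - a) - integral {a..b} (indicat_real E)"
        using fm[of a b] ab by (simp add: Equivalence_Lebesgue_Henstock_Integration.integral_indicator)
      also have "\<dots> \<le> \<eta> * (b - a)"
        using r(2)[OF ab] ab t(2) by (simp add: abs_le_iff)
      finally show "measure lebesgue ({a..b} - E) \<le> \<eta> * (b - a)" .
    qed
  qed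
qed

text \<open>At a density point of \<open>E\<close> the gaps of \<open>E\<close> are negligible, so the derivative passes from \<open>g\<close>
  to every \<open>F\<close> that agrees with \<open>g\<close> on \<open>E\<close> and satisfies a Lipschitz estimate at the points of \<open>E\<close>.\<close>

lemma derivative_at_density_point:
  fixes F g :: "real \<Rightarrow> 'a::real_normed_vector"
  assumes E: "closed E" "t \<in> E" "t \<in> {0..1}"
    and eq: "\<And>x. x \<in> E \<Longrightarrow> x \<in> {0..1} \<Longrightarrow> g x = F x"
    and F: "\<And>x y. x \<in> E \<Longrightarrow> x \<in> {0..1} \<Longrightarrow> y \<in> {0..1} \<Longrightarrow> norm (F y - F x) \<le> L * \<bar>y - x\<bar>"
    and g: "\<And>x y. x \<in> E \<Longrightarrow> x \<in> {0..1} \<Longrightarrow> y \<in> {0..1} \<Longrightarrow> norm (g y - g x) \<le> L * \<bar>y - x\<bar>"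
    and L: "0 \<le> L"
    and dens: "\<And>a b. 0 \<le> a \<Longrightarrow> a \<le> t \<Longrightarrow> t \<le> b \<Longrightarrow> b \<le> 1 \<Longrightarrow> a < b \<Longrightarrow> b - a < r \<Longrightarrow>
      measure lebesgue ({a..b} - E) \<le> \<eta> * (b - a)"
    and x: "x \<in> {0..1}" "\<bar>x - t\<bar> < r" and \<eta>: "0 \<le> \<eta>"
  shows "norm (F x - g x) \<le> 2 * L * (\<eta> * \<bar>x - t\<bar>)"
proof -
  have "\<exists>e\<in>E. e \<in> {0..1} \<and> \<bar>x - e\<bar> \<le> \<eta> * \<bar>x - t\<bar>"
  proof (cases "x = t")
    case True
    then show ?thesis using E by auto
  next
    case False
    define a where "a = min x t"
    define b where "b = max x t"
    have ab: "0 \<le> a" "a \<le> t" "t \<le> b" "b \<le> 1" "a < b" "b - a < r" "b - a = \<bar>x - t\<bar>"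
      using x E(3) False by (auto simp: a_def b_def)
    have m: "measure lebesgue ({a..b} - E) \<le> \<eta> * \<bar>x - t\<bar>"
      using dens[OF ab(1-6)] ab(7) by simp
    have comp: "compact (E \<inter> {a..b})" using E(1) by (simp add: closed_Int_compact)
    have ne: "E \<inter> {a..b} \<noteq> {}" using E(2) ab by auto
    \<comment> \<open>No point of \<open>E\<close> lies strictly between \<open>x\<close> and the
      nearest point \<open>e\<close>, so \<open>\<bar>x - e\<bar>\<close> is at most the measure of
      the part outside \<open>E\<close>.\<close>
    obtain e where e: "e \<in> E" "e \<in> {a..b}" and near: "\<And>y. y \<in> E \<inter> {a..b} \<Longrightarrow> dist x e \<le> dist x y"
      using distance_attains_inf[OF compact_imp_closed[OF comp] ne, of x] by auto
    define u where "u = min x e"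
    define v where "v = max x e"
    have uv: "u \<le> v" "v - u = \<bar>x - e\<bar>" by (auto simp: u_def v_def)
    have "{u<..<v} \<subseteq> {a..b} - E"
    proof
      fix s assume s: "s \<in> {u<..<v}"
      have "s \<in> {a..b}" using s e(2) by (auto simp: u_def v_def a_def b_def)
      moreover have "dist x s < dist x e" using s by (auto simp: u_def v_def dist_real_def)
      ultimately show "s \<in> {a..b} - E" using near[of s] by auto
    qed
    then have "measure lebesgue {u<..<v} \<le> measure lebesgue ({a..b} - E)"
      using E(1) by (intro measure_mono_fmeasurable fmeasurable_Diff) auto
    then have "\<bar>x - e\<bar> \<le> \<eta> * \<bar>x - t\<bar>" using m uv by simp
    moreover have "e \<in> {0..1}" using e(2) ab by auto
    ultimately show ?thesis using e(1) by blast
  qed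
  then obtain e where e: "e \<in> E" "e \<in> {0..1}" "\<bar>x - e\<bar> \<le> \<eta> * \<bar>x - t\<bar>" by blast
  have "F x - g x = (F x - F e) - (g x - g e)" using eq[OF e(1,2)] by simp
  also have "norm \<dots> \<le> norm (F x - F e) + norm (g x - g e)" by (rule norm_triangle_ineq4)
  also have "\<dots> \<le> L * \<bar>x - e\<bar> + L * \<bar>x - e\<bar>" using F[OF e(1,2) x(1)] g[OF e(1,2) x(1)] by (rule add_mono)
  also have "\<dots> \<le> L * (\<eta> * \<bar>x - t\<bar>) + L * (\<eta> * \<bar>x - t\<bar>)" using e(3) L by (intro add_mono mult_left_mono) auto
  finally show ?thesis by simp
qed

context
  fixes \<Gamma> :: "real \<Rightarrow> 'a::banach set" and \<Phi>
  assumes cwk: "\<And>t. t \<in> {0..1} \<Longrightarrow> \<Gamma> t \<in> cwk" and prim: "has_vH_primitive \<Gamma> \<Phi>"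
begin

text \<open>Induction on the largest point: \<open>F\<close> is extended by a point of the primitive
  over the last gap, and the constraints over longer intervals follow by adding support functions.
  Inequalities between support functions stand for membership of the increments.\<close>

lemma finite_additive_selection:
  assumes "finite T" "T \<subseteq> {0..1}"
  shows "\<exists>F :: real \<Rightarrow> 'a. F 0 = 0 \<and> (\<forall>s\<in>insert 0 T. \<forall>t\<in>insert 0 T. s \<le> t \<longrightarrow>
    (\<forall>f. blinfun_apply f (F t) - blinfun_apply f (F s) \<le> support_fun f (\<Phi> {0..t}) - support_fun f (\<Phi> {0..s})))"
  using assms
proof (induction T rule: finite_linorder_max_induct)
  case empty
  show ?case by (intro exI[of _ "\<lambda>_. 0"]) auto
next
  case (insert b A)
  have "A \<subseteq> {0..1}" using insert.prems by simp
  from insert.IH[OF this] obtain F :: "real \<Rightarrow> 'a" where F0: "F 0 = 0 \<and>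
    (\<forall>s\<in>insert 0 A. \<forall>t\<in>insert 0 A. s \<le> t \<longrightarrow>
    (\<forall>f. blinfun_apply f (F t) - blinfun_apply f (F s) \<le> support_fun f (\<Phi> {0..t}) - support_fun f (\<Phi> {0..s})))" ..
  then have F: "F 0 = 0" "\<And>s t f. s \<in> insert 0 A \<Longrightarrow> t \<in> insert 0 A \<Longrightarrow> s \<le> t \<Longrightarrow>
    blinfun_apply f (F t) - blinfun_apply f (F s) \<le> support_fun f (\<Phi> {0..t}) - support_fun f (\<Phi> {0..s})"
    by blast+
  show ?case
  proof (cases "b = 0")
    case True
    then have eq: "insert 0 (insert b A) = insert 0 A" by simp
    show ?thesis unfolding eq by (rule exI[of _ F], rule F0)
  next
    case False
    define a where "a = Max (insert 0 A)"
    have "a \<in> insert 0 A"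
      unfolding a_def using insert.hyps(1) by (intro Max_in) auto
    moreover have "s \<le> a" if "s \<in> insert 0 A" for s
      unfolding a_def using insert.hyps(1) that by (intro Max_ge) auto
    ultimately have a: "a \<in> insert 0 A" "\<And>s. s \<in> insert 0 A \<Longrightarrow> s \<le> a" by blast+
    have b01: "b \<in> {0..1}" "A \<subseteq> {0..1}" using insert.prems by auto
    have ab: "0 \<le> a" "a \<le> b" "b \<le> 1"
      using a insert.hyps(2) b01 by auto
    have "\<Phi> {a..b} \<in> cwk" using ab by (intro vh_primitive_cwk[OF cwk prim] subintervalsI)
    note \<Phi>ab = this
    obtain y where y: "y \<in> \<Phi> {a..b}" using cwkD(1)[OF \<Phi>ab] by blast
    define G where "G = F(b := F a + y)"
    have G: "G b = F a + y" "\<And>s. s \<in> insert 0 A \<Longrightarrow> G s = F s"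
      using insert.hyps(2) False by (auto simp: G_def)
    show ?thesis
    proof (intro exI[of _ G] conjI ballI impI allI)
      show "G 0 = 0" using G(2)[of 0] F(1) by simp
      fix s t and f :: "'a \<Rightarrow>\<^sub>L real"
      assume st: "s \<in> insert 0 (insert b A)" "t \<in> insert 0 (insert b A)" "s \<le> t"
      show "blinfun_apply f (G t) - blinfun_apply f (G s) \<le> support_fun f (\<Phi> {0..t}) - support_fun f (\<Phi> {0..s})"
      proof (cases "t = b")
        case t: True
        show ?thesis
        proof (cases "s = b")
          case True
          then show ?thesis using t by simp
        next
          case False
          then have s: "s \<in> insert 0 A" using st(1) by auto
          have "blinfun_apply f (F a) - blinfun_apply f (F s) \<le> support_fun f (\<Phi> {0..a}) - support_fun f (\<Phi> {0..s})"
            by (rule F(2)[OF s a(1) a(2)[OF s]])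
          moreover have "blinfun_apply f y \<le> support_fun f (\<Phi> {0..b}) - support_fun f (\<Phi> {0..a})"
            using le_support_fun[OF \<Phi>ab y, of f] support_fun_primitive_diff[OF cwk prim ab, of f] by simp
          ultimately show ?thesis
            using t G(2)[OF s] by (simp add: G(1) blinfun.add_right)
        qed
      next
        case False
        then have t: "t \<in> insert 0 A" using st(2) by auto
        have "s \<noteq> b"
        proof
          assume "s = b"
          then show False using t st(3) insert.hyps(2) \<open>b \<noteq> 0\<close> b01(1) by auto
        qed
        then have s: "s \<in> insert 0 A" using st(1) by auto
        show ?thesis using F(2)[OF s t st(3), of f] G(2)[OF s] G(2)[OF t] by simp
      qed
    qed
  qed
qed

text \<open>The finitely many constraints on finitely many points are satisfiable, so all of them are by
  Tychonoff's theorem.\<close>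

lemma additive_selection:
  obtains F :: "real \<Rightarrow> 'a" where "\<And>s t. 0 \<le> s \<Longrightarrow> s \<le> t \<Longrightarrow> t \<le> 1 \<Longrightarrow> F t - F s \<in> \<Phi> {s..t}"
proof -
  define X where "X = product_topology (\<lambda>_::real. weak_topology :: 'a topology) {0..1}"
  \<comment> \<open>Normalization by \<open>F 0 = 0\<close> confines \<open>F t\<close> to the
    weakly compact set \<open>\<Phi> {0..t}\<close>, so the candidates form a compact
    product.\<close>
  define S where "S = PiE {0..1::real} (\<lambda>t. \<Phi> {0..t})"
  define H where "H f t = support_fun f (\<Phi> {0..t})" for f t
  define I where "I = {(s, t, f :: 'a \<Rightarrow>\<^sub>L real). 0 \<le> s \<and> s \<le> t \<and> t \<le> (1::real)}"
  define Z where "Z = (\<lambda>(s, t, f). {F \<in> topspace X. blinfun_apply f (F t) - blinfun_apply f (F s) \<le> H f t - H f s})"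
  have \<Phi>t: "\<Phi> {0..t} \<in> cwk" if "t \<in> {0..1}" for t
    using that by (intro vh_primitive_cwk[OF cwk prim] subintervalsI) auto
  have H0: "H f 0 = 0" for f
    using support_fun_primitive_diff[OF cwk prim, of 0 0 f] by (simp add: H_def)
  have comp: "compactin X S"
    unfolding X_def S_def compactin_PiE using cwkD(3)[OF \<Phi>t] by blast
  have closed: "closedin X C" if CZ: "C \<in> Z ` I" for C
  proof -
    obtain s t f where C: "C = Z (s, t, f)" "0 \<le> s" "s \<le> t" "t \<le> 1"
      using CZ by (auto simp: I_def)
    have proj: "continuous_map X weak_topology (\<lambda>F. F x)" if "x \<in> {0..1}" for x
      unfolding X_def using continuous_map_product_projection[OF that, of "\<lambda>_. weak_topology :: 'a topology"] by simp
    have comp: "continuous_map X euclideanreal (\<lambda>F. blinfun_apply f (F x))" if "x \<in> {0..1}" for x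
      using continuous_map_compose[OF proj[OF that] continuous_map_weak_functional[of f]] by (simp add: o_def)
    have "continuous_map X euclideanreal (\<lambda>F. blinfun_apply f (F t) - blinfun_apply f (F s))"
      using C by (intro continuous_map_diff comp) auto
    from closedin_continuous_map_preimage[OF this, of "{..H f t - H f s}"]
    show ?thesis by (simp add: C(1) Z_def)
  qed
  have fip: "S \<inter> \<Inter> \<C> \<noteq> {}" if \<C>: "finite \<C>" "\<C> \<subseteq> Z ` I" for \<C>
  proof -
    obtain A where A: "A \<subseteq> I" "finite A" "\<C> = Z ` A"
      using finite_subset_image[OF \<C>] by blast
    define T where "T = fst ` A \<union> (fst \<circ> snd) ` A"
    have T: "finite T" "T \<subseteq> {0..1}"
      using A(1,2) by (auto simp: T_def I_def)
    obtain F :: "real \<Rightarrow> 'a" where F: "F 0 = 0" "\<And>s t f. s \<in> insert 0 T \<Longrightarrow> t \<in> insert 0 T \<Longrightarrow> s \<le> t \<Longrightarrow>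
      blinfun_apply f (F t) - blinfun_apply f (F s) \<le> H f t - H f s"
      using finite_additive_selection[OF T] unfolding H_def by blast
    \<comment> \<open>Outside the finitely many constrained points the value is arbitrary, but must
      stay in the compact product.\<close>
    define G where "G = (\<lambda>t\<in>{0..1}. if t \<in> T then F t else SOME y. y \<in> \<Phi> {0..t})"
    have GT: "G t = F t" if "t \<in> T" for t
      using that T(2) by (auto simp: G_def)
    have "G \<in> S"
      unfolding S_def
    proof (rule PiE_I)
      fix t :: real assume t: "t \<in> {0..1}"
      show "G t \<in> \<Phi> {0..t}"
      proof (cases "t \<in> T")
        case True
        have "F t \<in> \<Phi> {0..t}"
        proof (rule mem_cwkI[OF \<Phi>t[OF t]])
          show "blinfun_apply f (F t) \<le> support_fun f (\<Phi> {0..t})" for f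
            using F(2)[of 0 t f] t True F(1) H0[of f] by (simp add: H_def blinfun.zero_right)
        qed
        then show ?thesis using GT[OF True] by simp
      next
        case False
        have "(SOME y. y \<in> \<Phi> {0..t}) \<in> \<Phi> {0..t}"
          using cwkD(1)[OF \<Phi>t[OF t]] by (simp add: some_in_eq)
        then show ?thesis using False t by (simp add: G_def)
      qed
    qed (simp only: G_def restrict_apply if_False)
    moreover have "G \<in> Z i" if "i \<in> A" for i
    proof -
      obtain s t f where i: "i = (s, t, f)" by (cases i)
      have st: "s \<in> T" "t \<in> T" using imageI[OF that, of fst] imageI[OF that, of "fst \<circ> snd"] by (simp_all add: T_def i)
      have "s \<le> t" using that A(1) by (auto simp: I_def i)
      then have "blinfun_apply f (G t) - blinfun_apply f (G s) \<le> H f t - H f s"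
        using F(2)[of s t f] st by (simp add: GT)
      moreover have "G \<in> topspace X" using \<open>G \<in> S\<close> by (auto simp: X_def S_def PiE_iff)
      ultimately show ?thesis by (simp add: Z_def i)
    qed
    ultimately have "G \<in> S \<inter> \<Inter> (Z ` A)" by simp
    then show ?thesis unfolding A(3) by (rule ex_in_conv[THEN iffD1, OF exI])
  qed
  have "S \<inter> \<Inter> (Z ` I) \<noteq> {}"
    by (rule comp[unfolded compactin_fip, THEN conjunct2, rule_format]) (use closed fip in auto)
  then obtain F where F: "\<And>i. i \<in> I \<Longrightarrow> F \<in> Z i" by blast
  show thesis
  proof
    fix s t :: real assume st: "0 \<le> s" "s \<le> t" "t \<le> 1"
    show "F t - F s \<in> \<Phi> {s..t}"
    proof (rule mem_cwkI)
      show "\<Phi> {s..t} \<in> cwk" using st by (intro vh_primitive_cwk[OF cwk prim] subintervalsI)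
      fix f :: "'a \<Rightarrow>\<^sub>L real"
      have "F \<in> Z (s, t, f)" using st by (intro F) (simp add: I_def)
      then show "blinfun_apply f (F t - F s) \<le> support_fun f (\<Phi> {s..t})"
        using support_fun_primitive_diff[OF cwk prim st, of f] by (simp add: Z_def H_def blinfun.diff_right)
    qed
  qed
qed

end

text \<open>Differentiability in straddle form: the intervals contain \<open>t\<close> instead of
  starting or ending there, as the tagged intervals of a Perron partition do. It is equivalent to
  differentiability at \<open>t\<close> relative to the unit interval.\<close>

definition interval_derivative :: "(real \<Rightarrow> 'a::real_normed_vector) \<Rightarrow> real \<Rightarrow> 'a \<Rightarrow> bool" where
  "interval_derivative F t y \<longleftrightarrow> (\<forall>\<epsilon>>0. \<exists>r>0. \<forall>a b. 0 \<le> a \<and> a \<le> t \<and> t \<le> b \<and> b \<le> 1 \<and> a < b \<and> b - a < r \<longrightarrow>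
     norm (F b - F a - (b - a) *\<^sub>R y) \<le> \<epsilon> * (b - a))"

text \<open>On \<open>E\<close> the function \<open>F\<close> is \<open>L\<close>-Lipschitz and
  extends to a Lipschitz \<open>g\<close> on the unit interval. At almost every point of
  \<open>E\<close> the derivative of \<open>g\<close> exists and the density of \<open>E\<close> is
  1, so it is also the derivative of \<open>F\<close>.\<close>

lemma lipschitz_points_derivative:
  fixes F :: "real \<Rightarrow> 'a::banach" and L :: real
  assumes rnp: "radon_nikodym_property TYPE('a)" and cont: "continuous_on {0..1} F"
  defines "E \<equiv> {t \<in> {0..1}. \<forall>x\<in>{0..1}. norm (F x - F t) \<le> L * \<bar>x - t\<bar>}"
  shows "\<exists>N. negligible N \<and> (\<forall>t\<in>E. t \<notin> N \<longrightarrow> (\<exists>y. interval_derivative F t y))"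
proof (cases "E = {}")
  case True
  then show ?thesis by (intro exI[of _ "{}"]) auto
next
  case False
  have Esub: "E \<subseteq> {0..1}" by (auto simp: E_def)
  have EL: "norm (F y - F x) \<le> L * \<bar>y - x\<bar>" if "x \<in> E" "y \<in> {0..1}" for x y
    using that by (simp add: E_def)
  have closed: "closed E"
  proof -
    have "closed {t \<in> {0..1}. norm (F x - F t) \<le> L * \<bar>x - t\<bar>}" for x
      by (intro continuous_on_closed_Collect_le continuous_intros cont closed_atLeastAtMost)
    moreover have "E = {0..1} \<inter> (\<Inter>x\<in>{0..1}. {t \<in> {0..1}. norm (F x - F t) \<le> L * \<bar>x - t\<bar>})"
      unfolding E_def by auto
    ultimately show ?thesis by (simp only:) (intro closed_Int closed_INT ballI closed_atLeastAtMost)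
  qed
  obtain s where s: "s \<in> E" using False by blast
  \<comment> \<open>The extension requires both endpoints in the closed set. Adding them keeps the
    constant \<open>L\<close>, because a point \<open>s\<close> of \<open>E\<close> between them
    controls the increment.\<close>
  have ends: "norm (F 1 - F 0) \<le> L"
  proof -
    have "norm (F 1 - F 0) \<le> norm (F 1 - F s) + norm (F s - F 0)" by (rule norm_diff_triangle_ineq[of "F 1" "F s" "F s" "F 0", simplified add.commute, simplified])
    also have "\<dots> \<le> L * (1 - s) + L * s"
      using EL[OF s, of 1] EL[OF s, of 0] s Esub by (intro add_mono) (auto simp: norm_minus_commute)
    finally show ?thesis by (simp add: algebra_simps)
  qed
  have L: "0 \<le> L" using order_trans[OF norm_ge_zero ends] .
  have lip': "norm (F x - F y) \<le> L * \<bar>x - y\<bar>" if E01: "x \<in> E \<union> {0, 1}" "y \<in> E \<union> {0, 1}" for x y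
  proof -
    have xy: "x \<in> {0..1}" "y \<in> {0..1}" using E01 Esub by auto
    consider "x \<in> E" | "y \<in> E" | "x \<in> {0, 1}" "y \<in> {0, 1}" using E01 by blast
    then show ?thesis
    proof cases
      case 1
      from EL[OF 1 xy(2)] show ?thesis by (simp add: norm_minus_commute abs_minus_commute)
    next
      case 2
      from EL[OF 2 xy(1)] show ?thesis .
    next
      case 3
      then show ?thesis using ends by (auto simp: norm_minus_commute)
    qed
  qed
  have "closed (E \<union> {0, 1})" "E \<union> {0, 1} \<subseteq> {0..1}" using closed Esub by auto
  from lipschitz_extension_interval[OF this _ _ lip']
  obtain g where g: "\<And>x. x \<in> E \<union> {0, 1} \<Longrightarrow> g x = F x"
    "\<And>x y. x \<in> {0..1} \<Longrightarrow> y \<in> {0..1} \<Longrightarrow> norm (g x - g y) \<le> L * \<bar>x - y\<bar>" by blast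
  obtain N h where N: "negligible N" and h: "\<And>t \<epsilon>. t \<in> {0..1} \<Longrightarrow> t \<notin> N \<Longrightarrow> 0 < \<epsilon> \<Longrightarrow>
    \<exists>r>0. \<forall>a b. 0 \<le> a \<and> a \<le> t \<and> t \<le> b \<and> b \<le> 1 \<and> a < b \<and> b - a < r \<longrightarrow> norm (g b - g a - (b - a) *\<^sub>R h t) \<le> \<epsilon> * (b - a)"
    using rnp_lipschitz_differentiable[OF rnp g(2)] by blast
  obtain D where D: "negligible D" and dens: "\<And>t \<eta>. t \<in> {0..1} \<Longrightarrow> t \<in> E \<Longrightarrow> t \<notin> D \<Longrightarrow> 0 < \<eta> \<Longrightarrow>
    \<exists>r>0. \<forall>a b. 0 \<le> a \<and> a \<le> t \<and> t \<le> b \<and> b \<le> 1 \<and> a < b \<and> b - a < r \<longrightarrow> measure lebesgue ({a..b} - E) \<le> \<eta> * (b - a)"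
    using lebesgue_density_interval[OF closed] by blast
  have "interval_derivative F t (h t)" if t: "t \<in> E" "t \<notin> N \<union> D" for t
    unfolding interval_derivative_def
  proof (intro allI impI)
    fix \<epsilon> :: real assume \<epsilon>: "0 < \<epsilon>"
    \<comment> \<open>Replacing \<open>g\<close> by \<open>F\<close> at both ends costs
      \<open>2 * L * \<eta>\<close> times the length in total, which is then at most half of
      \<open>\<epsilon>\<close> times the length.\<close>
    define \<eta> where "\<eta> = \<epsilon> / (4 * (L + 1))"
    have \<eta>: "0 < \<eta>" "2 * (L * \<eta>) \<le> \<epsilon> / 2" using \<epsilon> L by (auto simp: \<eta>_def field_simps)
    have t01: "t \<in> {0..1}" using t(1) Esub by blast
    obtain r1 where r1: "0 < r1" "\<forall>a b. 0 \<le> a \<and> a \<le> t \<and> t \<le> b \<and> b \<le> 1 \<and> a < b \<and> b - a < r1 \<longrightarrow>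
        norm (g b - g a - (b - a) *\<^sub>R h t) \<le> (\<epsilon> / 2) * (b - a)"
      using h[OF t01, of "\<epsilon> / 2"] t(2) \<epsilon> by auto
    obtain r2 where r2: "0 < r2" "\<forall>a b. 0 \<le> a \<and> a \<le> t \<and> t \<le> b \<and> b \<le> 1 \<and> a < b \<and> b - a < r2 \<longrightarrow>
        measure lebesgue ({a..b} - E) \<le> \<eta> * (b - a)"
      using dens[OF t01 t(1) _ \<eta>(1)] t(2) by auto
    have near: "norm (F x - g x) \<le> 2 * L * (\<eta> * \<bar>x - t\<bar>)" if "x \<in> {0..1}" "\<bar>x - t\<bar> < r2" for x
    proof (rule derivative_at_density_point[OF closed t(1) t01 _ _ _ L _ that])
      show "g x = F x" if "x \<in> E" for x using g(1) that by simp
      show "norm (F y - F x) \<le> L * \<bar>y - x\<bar>" if "x \<in> E" "y \<in> {0..1}" for x y by (rule EL[OF that])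
      show "norm (g y - g x) \<le> L * \<bar>y - x\<bar>" if "x \<in> {0..1}" "y \<in> {0..1}" for x y by (rule g(2)[OF that(2,1)])
      show "measure lebesgue ({a..b} - E) \<le> \<eta> * (b - a)"
        if "0 \<le> a" "a \<le> t" "t \<le> b" "b \<le> 1" "a < b" "b - a < r2" for a b
        using r2(2) that by blast
    qed (use \<eta>(1) in auto)
    show "\<exists>r>0. \<forall>a b. 0 \<le> a \<and> a \<le> t \<and> t \<le> b \<and> b \<le> 1 \<and> a < b \<and> b - a < r \<longrightarrow>
        norm (F b - F a - (b - a) *\<^sub>R h t) \<le> \<epsilon> * (b - a)"
    proof (intro exI[of _ "min r1 r2"] conjI allI impI)
      show "0 < min r1 r2" using r1 r2 by simp
      fix a b assume ab: "0 \<le> a \<and> a \<le> t \<and> t \<le> b \<and> b \<le> 1 \<and> a < b \<and> b - a < min r1 r2"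
      have nb: "norm (F b - g b) \<le> 2 * L * (\<eta> * (b - t))" using near[of b] ab by simp
      have na: "norm (F a - g a) \<le> 2 * L * (\<eta> * (t - a))" using near[of a] ab by simp
      have ng: "norm (g b - g a - (b - a) *\<^sub>R h t) \<le> (\<epsilon> / 2) * (b - a)" using r1(2) ab by simp
      have "F b - F a - (b - a) *\<^sub>R h t = (F b - g b) - (F a - g a) + (g b - g a - (b - a) *\<^sub>R h t)" by simp
      also have "norm \<dots> \<le> 2 * L * (\<eta> * (b - t)) + 2 * L * (\<eta> * (t - a)) + (\<epsilon> / 2) * (b - a)"
        by (intro norm_triangle_mono norm_triangle_le_diff add_mono nb na ng)
      also have "\<dots> = 2 * (L * \<eta>) * (b - a) + (\<epsilon> / 2) * (b - a)" by (simp add: algebra_simps)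
      also have "\<dots> \<le> (\<epsilon> / 2) * (b - a) + (\<epsilon> / 2) * (b - a)"
        using \<eta>(2) ab by (intro add_mono mult_right_mono) auto
      also have "\<dots> = \<epsilon> * (b - a)" by simp
      finally show "norm (F b - F a - (b - a) *\<^sub>R h t) \<le> \<epsilon> * (b - a)" .
    qed
  qed
  then show ?thesis
    by (intro exI[of _ "N \<union> D"]) (use N D in \<open>auto intro: negligible_Un\<close>)
qed

text \<open>A single fine tagged interval is already a partial division. This gives continuity of
  additive selections at every point, not only almost everywhere.\<close>

lemma henstock_null_small:
  assumes e: "henstock_null e" and \<epsilon>: "0 < \<epsilon>"
  obtains \<delta> where "gauge_fun \<delta>" "\<And>t a b. 0 \<le> a \<Longrightarrow> a \<le> t \<Longrightarrow> t \<le> b \<Longrightarrow> b \<le> 1 \<Longrightarrow> t - \<delta> t < a \<Longrightarrow> b < t + \<delta> t \<Longrightarrow> e t {a..b} < \<epsilon>"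
proof -
  from e \<epsilon> obtain \<delta> where \<delta>: "gauge_fun \<delta>"
    "\<And>p. p tagged_partial_division_of {0..1} \<Longrightarrow> delta_fine \<delta> p \<Longrightarrow> (\<Sum>(t, I)\<in>p. e t I) < \<epsilon>"
    unfolding henstock_null_def by blast
  show thesis
  proof (rule that[OF \<delta>(1)])
    fix t a b :: real assume ab: "0 \<le> a" "a \<le> t" "t \<le> b" "b \<le> 1" "t - \<delta> t < a" "b < t + \<delta> t"
    have "{(t, {a..b})} tagged_partial_division_of {0..1}"
      unfolding tagged_partial_division_of_def
    proof (intro conjI allI impI)
      fix x k assume "(x, k) \<in> {(t, {a..b})}"
      then have "x = t" "k = {a..b}" by auto
      then show "x \<in> k" "k \<subseteq> {0..1}" "\<exists>c d. k = cbox c d"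
        using ab by (auto intro: cbox_interval[symmetric] exI)
    qed auto
    moreover have "delta_fine \<delta> {(t, {a..b})}" using ab by (auto simp: delta_fine_def fine_def)
    ultimately show "e t {a..b} < \<epsilon>" using \<delta>(2) by fastforce
  qed
qed

text \<open>Where \<open>e\<close> is at most the length on short intervals, \<open>F\<close>
  satisfies a Lipschitz estimate at \<open>t\<close> with constant \<open>K t + 1\<close> nearby,
  and boundedness of \<open>F\<close> extends it to distant points. Almost every \<open>t\<close>
  thus lies in some \<open>E n\<close>.\<close>

lemma rnp_derivative_ae:
  fixes F :: "real \<Rightarrow> 'a::banach"
  assumes rnp: "radon_nikodym_property TYPE('a)"
    and e: "henstock_null e" and nonneg: "\<And>t I. 0 \<le> e t I" and K: "\<And>t. t \<in> {0..1} \<Longrightarrow> 0 \<le> K t"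
    and F: "\<And>a b t. 0 \<le> a \<Longrightarrow> a \<le> t \<Longrightarrow> t \<le> b \<Longrightarrow> b \<le> 1 \<Longrightarrow> norm (F b - F a) \<le> K t * (b - a) + e t {a..b}"
  obtains N f where "negligible N" "\<And>t. t \<in> {0..1} \<Longrightarrow> t \<notin> N \<Longrightarrow> interval_derivative F t (f t)"
proof -
  have Fx: "norm (F x - F t) \<le> K t * \<bar>x - t\<bar> + e t {min x t..max x t}" if "x \<in> {0..1}" "t \<in> {0..1}" for x t
  proof (cases "x \<le> t")
    case True
    then show ?thesis using F[of x t t] that by (simp add: norm_minus_commute)
  next
    case False
    then show ?thesis using F[of t t x] that by (simp add: min_def max_def)
  qed
  have cont: "continuous_on {0..1} F"
    unfolding continuous_on_iff
  proof (intro ballI allI impI)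
    fix t \<epsilon> :: real assume t: "t \<in> {0..1}" and \<epsilon>: "0 < \<epsilon>"
    obtain \<delta> where \<delta>: "gauge_fun \<delta>"
      "\<And>t a b. 0 \<le> a \<Longrightarrow> a \<le> t \<Longrightarrow> t \<le> b \<Longrightarrow> b \<le> 1 \<Longrightarrow> t - \<delta> t < a \<Longrightarrow> b < t + \<delta> t \<Longrightarrow> e t {a..b} < \<epsilon> / 2"
      using henstock_null_small[OF e, of "\<epsilon> / 2"] \<epsilon> by auto
    define d where "d = min (\<delta> t) (\<epsilon> / (2 * (K t + 1)))"
    have d: "0 < d" using \<delta>(1) t \<epsilon> K[OF t] by (auto simp: d_def gauge_fun_def)
    have Kd: "K t * d \<le> \<epsilon> / 2"
    proof -
      have "d * (2 * (K t + 1)) \<le> \<epsilon>"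
        using K[OF t] by (simp add: d_def pos_le_divide_eq[symmetric])
      then show ?thesis using d by (simp add: algebra_simps)
    qed
    show "\<exists>d>0. \<forall>x\<in>{0..1}. dist x t < d \<longrightarrow> dist (F x) (F t) < \<epsilon>"
    proof (intro exI[of _ d] conjI ballI impI d)
      fix x assume x: "x \<in> {0..1}" "dist x t < d"
      have "e t {min x t..max x t} < \<epsilon> / 2"
        using x t by (intro \<delta>(2)) (auto simp: d_def dist_real_def)
      moreover have "K t * \<bar>x - t\<bar> \<le> K t * d"
        using K[OF t] x(2) by (intro mult_left_mono) (auto simp: dist_real_def)
      ultimately show "dist (F x) (F t) < \<epsilon>"
        using Fx[OF x(1) t] Kd unfolding dist_norm by linarith
    qed
  qed
  obtain M where "\<forall>y\<in>F ` {0..1}. norm y \<le> M"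
    using compact_imp_bounded[OF compact_continuous_image[OF cont compact_Icc]] unfolding bounded_iff by blast
  then have M: "norm (F x) \<le> M" if "x \<in> {0..1}" for x using that by blast
  define E where "E n = {t \<in> {0..1}. \<forall>x\<in>{0..1}. norm (F x - F t) \<le> real n * \<bar>x - t\<bar>}" for n
  have "\<exists>N. negligible N \<and> (\<forall>t\<in>E n. t \<notin> N \<longrightarrow> (\<exists>y. interval_derivative F t y))" for n
    unfolding E_def by (rule lipschitz_points_derivative[OF rnp cont])
  then obtain N where N: "\<And>n. negligible (N n)"
    "\<And>n t. t \<in> E n \<Longrightarrow> t \<notin> N n \<Longrightarrow> \<exists>y. interval_derivative F t y" by metis
  obtain N0 where N0: "negligible N0" "\<And>t \<eta>. t \<in> {0..1} \<Longrightarrow> t \<notin> N0 \<Longrightarrow> 0 < \<eta> \<Longrightarrow>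
       \<exists>r>0. \<forall>a b. 0 \<le> a \<and> a \<le> t \<and> t \<le> b \<and> b \<le> 1 \<and> a < b \<and> b - a < r \<longrightarrow> e t {a..b} \<le> \<eta> * (b - a)"
    using henstock_null_derivative_zero[OF e nonneg] by blast
  have "\<exists>y. interval_derivative F t y" if t: "t \<in> {0..1}" "t \<notin> N0 \<union> (\<Union>n. N n)" for t
  proof -
    obtain r where r: "0 < r" "\<forall>a b. 0 \<le> a \<and> a \<le> t \<and> t \<le> b \<and> b \<le> 1 \<and> a < b \<and> b - a < r \<longrightarrow> e t {a..b} \<le> 1 * (b - a)"
      using N0(2)[OF t(1), of 1] t(2) by auto
    \<comment> \<open>\<open>K t + 1\<close> serves the points within \<open>r\<close> of
      \<open>t\<close>; at distance at least \<open>r\<close> the increment is at most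
      \<open>2 * M\<close>.\<close>
    obtain n where n: "max (K t + 1) (2 * M / r) \<le> real n" using real_arch_simple by blast
    have "t \<in> E n"
      unfolding E_def
    proof (intro CollectI conjI ballI t(1))
      fix x :: real assume x: "x \<in> {0..1}"
      consider "x = t" | "x \<noteq> t" "\<bar>x - t\<bar> < r" | "r \<le> \<bar>x - t\<bar>" by linarith
      then show "norm (F x - F t) \<le> real n * \<bar>x - t\<bar>"
      proof cases
        case 1
        then show ?thesis by simp
      next
        case 2
        have "e t {min x t..max x t} \<le> 1 * (max x t - min x t)"
          using x t(1) 2 by (intro r(2)[rule_format]) auto
        also have "1 * (max x t - min x t) = \<bar>x - t\<bar>" by auto
        finally have "norm (F x - F t) \<le> (K t + 1) * \<bar>x - t\<bar>"
          using Fx[OF x t(1)] by (simp add: algebra_simps)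
        also have "\<dots> \<le> real n * \<bar>x - t\<bar>" using n by (intro mult_right_mono) auto
        finally show ?thesis .
      next
        case 3
        have "norm (F x - F t) \<le> 2 * M"
          using norm_triangle_ineq4[of "F x" "F t"] M[OF x] M[OF t(1)] by linarith
        also have "\<dots> = 2 * M / r * r" using r(1) by simp
        also have "\<dots> \<le> real n * \<bar>x - t\<bar>" using n r(1) 3 by (intro mult_mono) auto
        finally show ?thesis .
      qed
    qed
    then show ?thesis using N(2) t(2) by blast
  qed
  then obtain f where f: "\<And>t. t \<in> {0..1} \<Longrightarrow> t \<notin> N0 \<union> (\<Union>n. N n) \<Longrightarrow> interval_derivative F t (f t)" by metis
  show thesis
    by (rule that[of "N0 \<union> (\<Union>n. N n)" f]) (use N0(1) N(1) f in \<open>auto intro!: negligible_Un negligible_countable_Union\<close>)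
qed

text \<open>Non-overlapping intervals whose union is an interval share an endpoint, unless one of
  them is degenerate and lies inside the other; then its increment is zero.\<close>

lemma additive_interval_fun_increment: "additive_interval_fun (\<lambda>I. {F (Sup I) - F (Inf I)})"
  unfolding additive_interval_fun_def
proof (intro ballI impI)
  fix I J :: "real set" assume IJ: "I \<in> subintervals" "J \<in> subintervals" "interior I \<inter> interior J = {} \<and> I \<union> J \<in> subintervals"
  obtain a b where I: "I = {a..b}" "a \<le> b" using IJ(1) by (auto simp: subintervals_def)
  obtain c d where J: "J = {c..d}" "c \<le> d" using IJ(2) by (auto simp: subintervals_def)
  obtain u v where U: "I \<union> J = {u..v}" "u \<le> v" using IJ(3) by (auto simp: subintervals_def)
  have gap: "\<not> (x < y \<and> (\<forall>z. x < z \<and> z < y \<longrightarrow> z \<notin> I \<union> J) \<and> x \<in> I \<union> J \<and> y \<in> I \<union> J)" for x y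
  proof
    assume *: "x < y \<and> (\<forall>z. x < z \<and> z < y \<longrightarrow> z \<notin> I \<union> J) \<and> x \<in> I \<union> J \<and> y \<in> I \<union> J"
    then have "(x + y) / 2 \<in> I \<union> J" unfolding U(1) by auto
    moreover have "x < (x + y) / 2" "(x + y) / 2 < y" using * by auto
    ultimately show False using * by blast
  qed
  have touch: "F (Sup (I \<union> J)) - F (Inf (I \<union> J)) = (F (Sup I) - F (Inf I)) + (F (Sup J) - F (Inf J))"
  proof -
    have "max a c \<ge> min b d"
    proof (rule ccontr)
      assume "\<not> max a c \<ge> min b d"
      then have "(max a c + min b d) / 2 \<in> interior I \<inter> interior J"
        by (auto simp: I J interior_atLeastAtMost_real min_def max_def field_simps split: if_splits)
      then show False using IJ(3) by blast
    qed
    \<comment> \<open>The last two cases are the degenerate ones: a one-point interval has empty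
      interior and may sit strictly inside the other interval.\<close>
    then consider "b \<le> c" | "d \<le> a" | "a = b" "c < a" "a < d" | "c = d" "a < c" "c < b"
      using I(2) J(2) by linarith
    then show ?thesis
    proof cases
      case 1
      have "b = c" using gap[of b c] 1 I J by force
      then have "I \<union> J = {a..d}" using I J by auto
      then show ?thesis using I J \<open>b = c\<close> by simp
    next
      case 2
      have "d = a" using gap[of d a] 2 I J by force
      then have "I \<union> J = {c..b}" using I J by auto
      then show ?thesis using I J \<open>d = a\<close> by simp
    next
      case 3
      then have "I \<union> J = {c..d}" using I J by auto
      then show ?thesis using I J 3 by simp
    next
      case 4
      then have "I \<union> J = {a..b}" using I J by auto
      then show ?thesis using I J 4 by simp
    qed
  qed
  show "{F (Sup (I \<union> J)) - F (Inf (I \<union> J))} = {F (Sup I) - F (Inf I)} + {F (Sup J) - F (Inf J)}"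
    unfolding touch by (simp add: set_plus_def)
qed

text \<open>Off \<open>N\<close> the straddle estimate bounds the error by a multiple of the length.
  On \<open>N\<close> the error is at most \<open>K t\<close> times the length plus
  \<open>e\<close>, and the first part has small sums because a function supported on a null set has
  integral 0, whatever its size.\<close>

lemma vH_primitive_of_derivative:
  fixes F f :: "real \<Rightarrow> 'a::real_normed_vector"
  assumes N: "negligible N" "\<And>t. t \<in> {0..1} \<Longrightarrow> t \<notin> N \<Longrightarrow> interval_derivative F t (f t)"
    and e: "henstock_null e" and nonneg: "\<And>t I. 0 \<le> e t I"
    and F: "\<And>a b t. 0 \<le> a \<Longrightarrow> a \<le> t \<Longrightarrow> t \<le> b \<Longrightarrow> b \<le> 1 \<Longrightarrow> norm (F b - F a - (b - a) *\<^sub>R f t) \<le> K t * (b - a) + e t {a..b}"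
  shows "has_vH_primitive (\<lambda>t. {f t}) (\<lambda>I. {F (Sup I) - F (Inf I)})"
  unfolding has_vH_primitive_def
proof (intro conjI ballI allI impI additive_interval_fun_increment singleton_in_cwk)
  fix \<epsilon> :: real assume \<epsilon>: "0 < \<epsilon>"
  define h where "h t = (if t \<in> N then K t else 0)" for t
  have h0: "(h has_integral 0) {0..1}"
    by (rule has_integral_negligible[OF N(1)]) (simp add: h_def)
  obtain \<delta>1 where \<delta>1: "gauge_fun \<delta>1" "\<And>p. p tagged_division_of {0..1} \<Longrightarrow> delta_fine \<delta>1 p \<Longrightarrow>
      \<bar>(\<Sum>(t, I)\<in>p. measure lborel I * h t) - 0\<bar> < \<epsilon> / 4"
    using has_integral_gauge_fun[OF h0, of "\<epsilon> / 4"] \<epsilon> by auto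
  obtain \<delta>2 where \<delta>2: "gauge_fun \<delta>2"
    "\<And>p. p tagged_partial_division_of {0..1} \<Longrightarrow> delta_fine \<delta>2 p \<Longrightarrow> (\<Sum>(t, I)\<in>p. e t I) < \<epsilon> / 4"
    using e \<epsilon> unfolding henstock_null_def by (metis zero_less_divide_iff zero_less_numeral)
  have "\<exists>r>0. \<forall>a b. 0 \<le> a \<and> a \<le> t \<and> t \<le> b \<and> b \<le> 1 \<and> a < b \<and> b - a < r \<longrightarrow>
     norm (F b - F a - (b - a) *\<^sub>R f t) \<le> \<epsilon> / 4 * (b - a)" if "t \<in> {0..1} - N" for t
    by (rule N(2)[unfolded interval_derivative_def, THEN spec, THEN mp]) (use that \<epsilon> in auto)
  then obtain r where r: "\<And>t. t \<in> {0..1} - N \<Longrightarrow> 0 < r t" "\<And>t. t \<in> {0..1} - N \<Longrightarrow> \<forall>a b. 0 \<le> a \<and> a \<le> t \<and> t \<le> b \<and> b \<le> 1 \<and> a < b \<and> b - a < r t \<longrightarrow>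
     norm (F b - F a - (b - a) *\<^sub>R f t) \<le> \<epsilon> / 4 * (b - a)" by metis
  \<comment> \<open>The factor 1/2 makes a fine interval around \<open>t\<close>, of length below
    \<open>2 * \<delta>3 t\<close>, shorter than \<open>r t\<close>.\<close>
  define \<delta>3 where "\<delta>3 t = (if t \<in> N then 1 else r t / 2)" for t
  define \<delta> where "\<delta> t = min (\<delta>3 t) (min (\<delta>1 t) (\<delta>2 t))" for t
  have "gauge_fun \<delta>3" using r(1) by (auto simp: gauge_fun_def \<delta>3_def)
  then have "gauge_fun \<delta>" unfolding \<delta>_def by (intro gauge_fun_min \<delta>1 \<delta>2)
  moreover have "(\<Sum>(t, I)\<in>p. hausdorff_distance {F (Sup I) - F (Inf I)} ((*\<^sub>R) (measure lborel I) ` {f t})) < ennreal \<epsilon>"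
    if p: "p tagged_division_of {0..1}" "delta_fine \<delta> p" for p
  proof -
    define T where "T t I = norm (F (Sup I) - F (Inf I) - measure lborel I *\<^sub>R f t)" for t I
    have fine: "delta_fine \<delta>1 p" "delta_fine \<delta>2 p"
      by (rule delta_fine_mono[OF p(2)]; simp add: \<delta>_def)+
    have part: "p tagged_partial_division_of {0..1}" using p(1) by (simp add: tagged_division_of_def)
    have term_le: "T t I \<le> \<epsilon> / 4 * measure lborel I + measure lborel I * h t + e t I" if tI: "(t, I) \<in> p" for t I
    proof -
      obtain a b where I: "I = {a..b}" and ab: "0 \<le> a" "a \<le> t" "t \<le> b" "b \<le> 1"
        using tagged_partial_division_subintervals[OF part tI] .
      have t: "t \<in> {0..1}" using ab by simp
      have T: "T t I = norm (F b - F a - (b - a) *\<^sub>R f t)" using ab by (simp add: T_def I)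
      show ?thesis
      proof (cases "t \<in> N")
        case True
        have "0 \<le> \<epsilon> / 4 * (b - a)" using ab \<epsilon> by simp
        moreover have "measure lborel I * h t = K t * (b - a)" "measure lborel I = b - a"
          using True ab by (simp_all add: I h_def)
        ultimately show ?thesis unfolding T using F[OF ab] by (simp only: I)
      next
        case False
        have "T t I \<le> \<epsilon> / 4 * (b - a)"
        proof (cases "a < b")
          case True
          have "I \<subseteq> {t - \<delta> t <..< t + \<delta> t}" using p(2) tI by (auto simp: delta_fine_def fine_def)
          moreover have "a \<in> I" "b \<in> I" using True by (auto simp: I)
          ultimately have "t - \<delta> t < a" "b < t + \<delta> t" by auto
          then have "b - a < r t" using False by (simp add: \<delta>_def \<delta>3_def)
          then show ?thesis unfolding T using r(2)[of t] t False ab True by simp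
        next
          case False
          then have "a = b" using ab by simp
          then show ?thesis by (simp add: T)
        qed
        then show ?thesis using False ab nonneg[of t I] by (simp add: I h_def)
      qed
    qed
    have "(\<Sum>(t, I)\<in>p. T t I) \<le> (\<Sum>(t, I)\<in>p. \<epsilon> / 4 * measure lborel I + measure lborel I * h t + e t I)"
      using term_le by (intro sum_mono) auto
    also have "\<dots> = \<epsilon> / 4 * (\<Sum>(t, I)\<in>p. measure lborel I) + (\<Sum>(t, I)\<in>p. measure lborel I * h t) + (\<Sum>(t, I)\<in>p. e t I)"
      by (simp add: split_def sum.distrib sum_distrib_left)
    also have "(\<Sum>(t, I)\<in>p. measure lborel I) = 1"
      using additive_content_tagged_division[of p 0 "1::real"] p(1) by (simp add: cbox_interval)
    also have "(\<Sum>(t, I)\<in>p. measure lborel I * h t) < \<epsilon> / 4"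
      using \<delta>1(2)[OF p(1) fine(1)] by linarith
    also have "(\<Sum>(t, I)\<in>p. e t I) < \<epsilon> / 4"
      by (rule \<delta>2(2)[OF part fine(2)])
    finally have "(\<Sum>(t, I)\<in>p. T t I) < \<epsilon>" using \<epsilon> by simp
    moreover have "(\<Sum>(t, I)\<in>p. hausdorff_distance {F (Sup I) - F (Inf I)} ((*\<^sub>R) (measure lborel I) ` {f t})) =
        ennreal (\<Sum>(t, I)\<in>p. T t I)"
      by (simp add: hausdorff_distance_singletons T_def dist_norm split_def)
    ultimately show ?thesis using \<epsilon> by (simp add: ennreal_less_iff sum_nonneg T_def split_def)
  qed
  ultimately show "\<exists>\<delta>. gauge_fun \<delta> \<and> (\<forall>p. p tagged_division_of {0..1} \<and> delta_fine \<delta> p \<longrightarrow>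
      (\<Sum>(t, I)\<in>p. hausdorff_distance {F (Sup I) - F (Inf I)} ((*\<^sub>R) (measure lborel I) ` {f t})) < ennreal \<epsilon>)"
    by blast
qed

text \<open>The margin \<open>\<eta>\<close> turns the distance, which is an infimum over the scaled
  set, into a strict bound and hence an actual point of \<open>\<Gamma> t\<close>.\<close>

lemma additive_selection_increment:
  fixes \<Gamma> :: "real \<Rightarrow> 'a::real_normed_vector set"
  assumes cwk: "\<And>t. t \<in> {0..1} \<Longrightarrow> \<Gamma> t \<in> cwk" and prim: "has_vH_primitive \<Gamma> \<Phi>"
    and z: "z \<in> \<Phi> {a..b}" and ab: "0 \<le> a" "a \<le> t" "t \<le> b" "b \<le> 1" and \<eta>: "0 < \<eta>"
  obtains y where "y \<in> \<Gamma> t" "norm (z - (b - a) *\<^sub>R y) < vh_error \<Gamma> \<Phi> t {a..b} + \<eta>"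
proof -
  have t: "t \<in> {0..1}" using ab by simp
  have "{a..b} \<in> subintervals" using ab by (intro subintervalsI) auto
  then have "hausdorff_distance (\<Phi> {a..b}) ((*\<^sub>R) (measure lborel {a..b}) ` \<Gamma> t) = ennreal (vh_error \<Gamma> \<Phi> t {a..b})"
    by (intro vh_error_eq vh_primitive_cwk[OF cwk prim] cwk t)
  also have "\<dots> < ennreal (vh_error \<Gamma> \<Phi> t {a..b} + \<eta>)"
    using \<eta> vh_error_nonneg[of \<Gamma> \<Phi> t "{a..b}"] by (simp add: ennreal_less_iff)
  finally obtain w where "w \<in> (*\<^sub>R) (measure lborel {a..b}) ` \<Gamma> t" "dist z w < vh_error \<Gamma> \<Phi> t {a..b} + \<eta>"
    by (rule hausdorff_distance_lessD[OF _ z cwk_scaleR(1)[OF cwk[OF t]]])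
  then show thesis using that ab by (auto simp: dist_norm)
qed

text \<open>Closeness of the increments of \<open>F\<close> to the scaled sets supplies the bound
  with \<open>K\<close> and \<open>e\<close> that differentiation needs, and shows that the
  difference quotients approach \<open>\<Gamma> t\<close>. As \<open>\<Gamma> t\<close> is closed,
  the derivative belongs to it.\<close>

lemma rnp_imp_vH_selection:
  fixes \<Gamma> :: "real \<Rightarrow> 'a::banach set"
  assumes cwk: "\<And>t. t \<in> {0..1} \<Longrightarrow> \<Gamma> t \<in> cwk" and vH: "vH_integrable \<Gamma>"
    and rnp: "radon_nikodym_property TYPE('a)"
  shows "S_vH \<Gamma> \<noteq> {}"
proof -
  obtain \<Phi> where prim: "has_vH_primitive \<Gamma> \<Phi>" using vH by (auto simp: vH_integrable_def)
  obtain F where F: "\<And>s t. 0 \<le> s \<Longrightarrow> s \<le> t \<Longrightarrow> t \<le> 1 \<Longrightarrow> F t - F s \<in> \<Phi> {s..t}"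
    using additive_selection[OF cwk prim] by blast
  define e where "e = vh_error \<Gamma> \<Phi>"
  have e: "henstock_null e" "\<And>t I. 0 \<le> e t I"
    unfolding e_def by (rule henstock_null_vh_error[OF cwk prim]; assumption) (rule vh_error_nonneg)
  have inc: "\<exists>y\<in>\<Gamma> t. norm (F b - F a - (b - a) *\<^sub>R y) < e t {a..b} + \<eta>"
    if "0 \<le> a" "a \<le> t" "t \<le> b" "b \<le> 1" "0 < \<eta>" for a b t \<eta>
    using additive_selection_increment[OF cwk prim F that] that unfolding e_def by (metis order_trans)
  have "\<exists>k. 0 \<le> k \<and> (\<forall>y\<in>\<Gamma> t. norm y \<le> k)" if "t \<in> {0..1}" for t
    using cwk_bounded[OF cwk[OF that]] by (meson bounded_pos less_imp_le)
  then obtain K where K: "\<And>t. t \<in> {0..1} \<Longrightarrow> 0 \<le> K t" "\<And>t y. t \<in> {0..1} \<Longrightarrow> y \<in> \<Gamma> t \<Longrightarrow> norm y \<le> K t"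
    by metis
  have FK: "norm (F b - F a) \<le> K t * (b - a) + e t {a..b}" if ab: "0 \<le> a" "a \<le> t" "t \<le> b" "b \<le> 1" for a b t
  proof (rule field_le_epsilon)
    fix \<eta> :: real assume "0 < \<eta>"
    from inc[OF ab this] obtain y where y: "y \<in> \<Gamma> t" "norm (F b - F a - (b - a) *\<^sub>R y) < e t {a..b} + \<eta>" by blast
    have "norm ((b - a) *\<^sub>R y) \<le> K t * (b - a)"
      using K(2)[of t y] y(1) ab by (simp add: mult.commute[of "b - a"] mult_right_mono)
    then show "norm (F b - F a) \<le> K t * (b - a) + e t {a..b} + \<eta>"
      using norm_triangle_sub[of "F b - F a" "(b - a) *\<^sub>R y"] y(2) by linarith
  qed
  obtain N1 f1 where N1: "negligible N1" "\<And>t. t \<in> {0..1} \<Longrightarrow> t \<notin> N1 \<Longrightarrow> interval_derivative F t (f1 t)"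
    using rnp_derivative_ae[OF rnp e K(1) FK] by blast
  obtain N2 where N2: "negligible N2" "\<And>t \<eta>. t \<in> {0..1} \<Longrightarrow> t \<notin> N2 \<Longrightarrow> 0 < \<eta> \<Longrightarrow>
       \<exists>r>0. \<forall>a b. 0 \<le> a \<and> a \<le> t \<and> t \<le> b \<and> b \<le> 1 \<and> a < b \<and> b - a < r \<longrightarrow> e t {a..b} \<le> \<eta> * (b - a)"
    using henstock_null_derivative_zero[OF e] by blast
  have mem: "f1 t \<in> \<Gamma> t" if t: "t \<in> {0..1}" "t \<notin> N1 \<union> N2" for t
  proof -
    have "\<exists>y\<in>\<Gamma> t. dist y (f1 t) < \<epsilon>" if \<epsilon>: "0 < \<epsilon>" for \<epsilon>
    proof -
      define \<eta> where "\<eta> = \<epsilon> / 4"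
      have \<eta>: "0 < \<eta>" using \<epsilon> by (simp add: \<eta>_def)
      obtain r1 where r1: "0 < r1" "\<forall>a b. 0 \<le> a \<and> a \<le> t \<and> t \<le> b \<and> b \<le> 1 \<and> a < b \<and> b - a < r1 \<longrightarrow>
          norm (F b - F a - (b - a) *\<^sub>R f1 t) \<le> \<eta> * (b - a)"
        using N1(2)[OF t(1)] t(2) \<eta> unfolding interval_derivative_def by auto
      obtain r2 where r2: "0 < r2" "\<forall>a b. 0 \<le> a \<and> a \<le> t \<and> t \<le> b \<and> b \<le> 1 \<and> a < b \<and> b - a < r2 \<longrightarrow> e t {a..b} \<le> \<eta> * (b - a)"
        using N2(2)[OF t(1) _ \<eta>] t(2) by auto
      \<comment> \<open>With \<open>d \<le> 1 / 2\<close>, one of the intervals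
        \<open>{t..t + d}\<close> and \<open>{t - d..t}\<close> lies in the unit interval.\<close>
      define d where "d = min 1 (min r1 r2) / 2"
      have d: "0 < d" "d < r1" "d < r2" "d \<le> 1 / 2" using r1(1) r2(1) by (auto simp: d_def)
      obtain a b where ab: "0 \<le> a" "a \<le> t" "t \<le> b" "b \<le> 1" "a < b" "b - a = d"
      proof (cases "t \<le> 1 / 2")
        case True
        then show ?thesis using that[of t "t + d"] d t(1) by auto
      next
        case False
        then show ?thesis using that[of "t - d" t] d t(1) by auto
      qed
      have "0 < \<eta> * (b - a)" using \<eta> ab by simp
      from inc[OF ab(1-4) this] obtain y where y: "y \<in> \<Gamma> t" "norm (F b - F a - (b - a) *\<^sub>R y) < e t {a..b} + \<eta> * (b - a)" by blast
      have "e t {a..b} \<le> \<eta> * (b - a)" using r2(2)[rule_format, of a b] ab d by simp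
      moreover have "norm (F b - F a - (b - a) *\<^sub>R f1 t) \<le> \<eta> * (b - a)" using r1(2)[rule_format, of a b] ab d by simp
      moreover have "(b - a) * dist y (f1 t) \<le> norm (F b - F a - (b - a) *\<^sub>R y) + norm (F b - F a - (b - a) *\<^sub>R f1 t)"
      proof -
        have "(b - a) * dist y (f1 t) = norm ((b - a) *\<^sub>R (f1 t - y))"
          using ab by (simp add: dist_norm norm_minus_commute)
        also have "(b - a) *\<^sub>R (f1 t - y) = (F b - F a - (b - a) *\<^sub>R y) - (F b - F a - (b - a) *\<^sub>R f1 t)"
          by (simp add: scaleR_diff_right)
        also have "norm \<dots> \<le> norm (F b - F a - (b - a) *\<^sub>R y) + norm (F b - F a - (b - a) *\<^sub>R f1 t)"
          by (rule norm_triangle_ineq4)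
        finally show ?thesis .
      qed
      ultimately have "(b - a) * dist y (f1 t) < 3 * (\<eta> * (b - a))" using y(2) by linarith
      also have "\<dots> = (b - a) * (3 * \<eta>)" by simp
      finally have "dist y (f1 t) < 3 * \<eta>" using ab by simp
      then show ?thesis using y(1) \<eta>_def \<epsilon> by (intro bexI[of _ y]) auto
    qed
    then show ?thesis using closed_approachable[OF cwk_closed[OF cwk[OF t(1)]]] by blast
  qed
  \<comment> \<open>On the exceptional null set any point of \<open>\<Gamma> t\<close> will do; the
    primitive is insensitive to this choice.\<close>
  define f where "f t = (if t \<in> N1 \<union> N2 then SOME y. y \<in> \<Gamma> t else f1 t)" for t
  have sel: "f t \<in> \<Gamma> t" if "t \<in> {0..1}" for t
    using mem[OF that] cwkD(1)[OF cwk[OF that]] by (simp add: f_def some_in_eq)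
  have "has_vH_primitive (\<lambda>t. {f t}) (\<lambda>I. {F (Sup I) - F (Inf I)})"
  proof (rule vH_primitive_of_derivative[OF _ _ e])
    show "negligible (N1 \<union> N2)" using N1 N2 by (intro negligible_Un)
    show "interval_derivative F t (f t)" if "t \<in> {0..1}" "t \<notin> N1 \<union> N2" for t
      using N1(2) that by (simp add: f_def)
    \<comment> \<open>The factor 2 collects the bound for the increment of \<open>F\<close> and the
      one for \<open>f t\<close>.\<close>
    show "norm (F b - F a - (b - a) *\<^sub>R f t) \<le> (2 * K t) * (b - a) + e t {a..b}"
      if ab: "0 \<le> a" "a \<le> t" "t \<le> b" "b \<le> 1" for a b t
    proof -
      have "norm ((b - a) *\<^sub>R f t) \<le> K t * (b - a)"
        using K(2)[of t "f t"] sel[of t] ab by (simp add: mult.commute[of "b - a"] mult_right_mono)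
      then show ?thesis
        using norm_triangle_ineq4[of "F b - F a" "(b - a) *\<^sub>R f t"] FK[OF ab] by (simp add: algebra_simps)
    qed
  qed
  note prim_f = this
  have "scalarly_measurable f"
    unfolding scalarly_measurable_def
  proof
    fix x' :: "'a \<Rightarrow>\<^sub>L real"
    \<comment> \<open>Scalar measurability comes from Henstock integrability of the real functions
      \<open>x' (f t)\<close>.\<close>
    have "(\<lambda>t. blinfun_apply x' (f t)) integrable_on {0..1}"
      using vH_fun_has_integral[OF prim_f, of 0 1 x'] by auto
    then show "(\<lambda>t. blinfun_apply x' (f t)) \<in> borel_measurable (lebesgue_on {0..1})"
      by (rule integrable_imp_measurable)
  qed
  then have "f \<in> S_vH \<Gamma>"
    using sel prim_f by (auto simp: S_vH_def measurable_selections_def vH_integrable_fun_def)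
  then show ?thesis by blast
qed

theorem theorem4p3:
  fixes \<Gamma> :: "real \<Rightarrow> 'a::banach set"
  assumes "\<And>t. t \<in> {0..1} \<Longrightarrow> \<Gamma> t \<in> cwk"
    and "vH_integrable \<Gamma>"
  shows "(radon_nikodym_property TYPE('a) \<longrightarrow> S_vH \<Gamma> \<noteq> {}) \<and>
    (S_vH \<Gamma> \<noteq> {} \<longrightarrow>
      (S_vH \<Gamma> \<subseteq> S_MS \<Gamma> \<longleftrightarrow> S_vH \<Gamma> \<subseteq> S_P \<Gamma>) \<and>
      (S_vH \<Gamma> \<subseteq> S_P \<Gamma> \<longleftrightarrow> S_P \<Gamma> \<noteq> {}) \<and>
      (S_P \<Gamma> \<noteq> {} \<longleftrightarrow> pettis_integrable \<Gamma>) \<and>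
      (pettis_integrable \<Gamma> \<longleftrightarrow> mcshane_integrable \<Gamma>))"
  using rnp_imp_vH_selection[OF assms] vH_equivalences[OF assms] by blast

end
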